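(* Let $(S,d_S)$ be a Polish metric space and $\Lambda>0$. Let $(X_{t,T})$ be an $S$-valued locally stationary process with auxiliary process $(X_t(u):t\in\mathbb Z,u\in[0,1])$, admitting the representations described in the context, with $\delta_0(m)\to0$ as $m\to\infty$ for both processes. Suppose: (i) $\sup_{T\in\mathbb N}\sup_\lambda\sup_{k\ge0}\sum_{j=0}^\infty\sup_t\nu^W_{t,t-k,T}(j,\lambda)<\infty$ for $W\in\{X,X(\cdot)\}$, where $\nu^W_{t,t-k,T}(j,\lambda)=\sup_{m\ge1}\|P_{t-j}(\mathfrak h(W_{m,t,T},W_{m,t-k,T},\lambda))\|_{\mathbb R,2}$; (ii) for some $\epsilon>0$, $\sup_T\sup_{k\ge0}\sum_{j=0}^\infty j\sup_t\|P_{t-j}(\mathfrak h(X_{t,T},X_{t-k,T},\lambda))\|_{\mathbb R,6+\epsilon}<\infty$; (iii) $h:S\times S\times[0,\Lambda]\to\mathbb R$ is nonnegative, globally bounded, symmetric in its first two arguments, monotone in its third argument, with $|h(x,y,\lambda)-h(x',y,\lambda)|\le L_1d_S(x,x')$ and $|h(x,y,\lambda)-h(x,y,\lambda')|\le L_2(x,y)|\lambda-\lambda'|$, where $\sup_{T}\sup_{1\le t,s\le T}\mathbb E L_2^2(X_{t,T},X_{s,T})<\infty$ and $\sup_{u,v\in[0,1]}\sup_{t,s}\mathbb E L_2^2(X_t(u),X_s(v))<\infty$. Let $\mathbb G=\{\mathbb G(u,v,\lambda):u,v\in[0,1],\lambda\in[0,\Lambda]\}$ be the zero-mean Gaussian process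 with covariance $$\begin{aligned}\mathrm{Cov}(\mathbb G(u_1,v_1,\lambda_1),\mathbb G(u_2,v_2,\lambda_2))&=\int_0^{\min(u_1,u_2)}\sigma_\eta(v_1,\lambda_1,v_2,\lambda_2)d\eta+\int_0^{\min(u_1,v_2)}\sigma_\eta(v_1,\lambda_1,u_2,\lambda_2)d\eta\\&\quad+\int_0^{\min(v_1,u_2)}\sigma_\eta(u_1,\lambda_1,v_2,\lambda_2)d\eta+\int_0^{\min(v_1,v_2)}\sigma_\eta(u_1,\lambda_1,u_2,\lambda_2)d\eta,\end{aligned}$$ $$\sigma_\eta(z,\lambda_1,z',\lambda_2)=\sum_{k\in\mathbb Z}\mathrm{Cov}\Big(\int_0^z\mathbb E_{X_0'(w)}[\mathfrak h(X_0(\eta),X_0'(w),\lambda_1)]dw,\int_0^{z'}\mathbb E_{X_0'(w)}[\mathfrak h(X_k(\eta),X_0'(w),\lambda_2)]dw\Big),$$ with $(X'_t(u))$ an independent copy of $(X_t(u))$. Then $\mathbb G$ can be represented (in law) as $$\mathbb G(u,v,\lambda)=\sum_{\ell=1}^\infty\int_0^u\tilde g_\ell(\eta,v,\lambda)\,d\mathbb B_\ell(\eta)+\sum_{\ell=1}^\infty\int_0^v\tilde g_\ell(\eta,u,\lambda)\,d\mathbb B_\ell(\eta),$$ where $\{\mathbb B_\ell\}_{\ell\in\mathbb N}$ is a sequence of independent standard Brownian motions and the sequence of functions $\{\tilde g_\ell\}$ is such that $$\sigma_\eta(u_1,\lambda_1,u_2,\lambda_2)=\sum_{\ell=1}^\infty\tilde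 g_\ell(\eta,u_1,\lambda_1)\,\tilde g_\ell(\eta,u_2,\lambda_2).$$
   Context: Local stationarity: $(X_{t,T})$ is a triangular array (sample $t=1,\dots,T$, extended by $X_{t,T}=X_{1,T}$ for $t\le0$ and $X_{t,T}=X_{T,T}$ for $t\ge T$) of $S$-valued random variables, and it is locally stationary if there is an $S$-valued process $(X_t(u):t\in\mathbb Z,u\in[0,1])$ (the auxiliary process), stationary in $t$ for each fixed $u$, such that $\mathbb E[d_S(X_{t,T},X_t(t/T))\wedge1]=O(T^{-1})$ and $\mathbb E[d_S(X_t(u),X_t(v))\wedge1]=O(|u-v|)$, uniformly in $t=1,\dots,T$ and $u,v\in[0,1]$. Representations: $X_{t,T}=F(t,T,\mathfrak g_t)$ and $X_t(u)=\ddot F(u,\mathfrak g_t)$, where $\mathfrak g_t=(\varepsilon_t,\varepsilon_{t-1},\dots)$ for an iid sequence $(\varepsilon_t)_{t\in\mathbb Z}$ of random elements of a measurable space $\mathfrak G$, and $F:\mathbb Z\times\mathbb N\times\mathfrak G^\infty\to S$, $\ddot F:[0,1]\times\mathfrak G^\infty\to S$ are measurable. Coupling: let $(\varepsilon'_t)$ be an independent copy of $(\varepsilon_t)$. $X_{m,t,T}$ and $X_{m,t}(u)$ are obtained from $X_{t,T}$, $X_t(u)$ by replacing $\mathfrak g_t$ by $(\varepsilon_t,\dots,\varepsilon_{t-m+1},\varepsilon'_{t-m},\varepsilon'_{t-m-1},\dots)$. $\delta_0(m)$ is the supremum of $\mathbb E[d_S(X_{t,T},X_{m,t,T})\wedge1]$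 over $t,T$ (respectively of $\mathbb E[d_S(X_t(u),X_{m,t}(u))\wedge1]$ over $t,u$). For $W=X(\cdot)$ in (i), the same quantities are formed from the auxiliary process, $\|P_{t-j}(\mathfrak h(X_{m,t}(u),X_{m,t-k}(v),\lambda))\|_{\mathbb R,2}$, uniformly over $u,v\in[0,1]$ in place of $T$. $\mathcal G_t=\sigma(\varepsilon_s:s\le t)$, $P_j(Y)=\mathbb E[Y|\mathcal G_j]-\mathbb E[Y|\mathcal G_{j-1}]$, $\|Y\|_{\mathbb R,p}=(\mathbb E|Y|^p)^{1/p}$. $\mathfrak h$ is the demeaned kernel: $\mathfrak h(Y,Z,\lambda)=h(Y,Z,\lambda)-\mathbb E h(Y,Z,\lambda)$ for $S$-valued random variables $Y,Z$. $\mathbb E_{X'_0(w)}$ denotes expectation with respect to $X'_0(w)$ only. *)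

theory Defs
  imports "HOL-Probability.Probability"
begin

section \<open>Stochastic processes\<close>

text \<open>The law of the process \<open>(Y i : i \<in> I)\<close> on the product \<open>\<sigma>\<close>-algebra over the index set; it
  determines, and is determined by, the finite-dimensional distributions.\<close>

definition process_law ::
    "'w measure \<Rightarrow> 'i set \<Rightarrow> 's measure \<Rightarrow> ('i \<Rightarrow> 'w \<Rightarrow> 's) \<Rightarrow> ('i \<Rightarrow> 's) measure" where
  "process_law M I N Y = distr M (\<Pi>\<^sub>M i\<in>I. N) (\<lambda>\<omega>. \<lambda>i\<in>I. Y i \<omega>)"

definition iid_sequence :: "'w measure \<Rightarrow> 'g measure \<Rightarrow> (int \<Rightarrow> 'w \<Rightarrow> 'g) \<Rightarrow> bool" where
  "iid_sequence M E \<epsilon> \<longleftrightarrow>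
     prob_space.indep_vars M (\<lambda>_. E) \<epsilon> UNIV \<and> (\<forall>t. distr M E (\<epsilon> t) = distr M E (\<epsilon> 0))"

definition independent_copy ::
    "'w measure \<Rightarrow> 'g measure \<Rightarrow> (int \<Rightarrow> 'w \<Rightarrow> 'g) \<Rightarrow> (int \<Rightarrow> 'w \<Rightarrow> 'g) \<Rightarrow> bool" where
  "independent_copy M E \<epsilon> \<epsilon>' \<longleftrightarrow>
     (\<forall>t. \<epsilon>' t \<in> measurable M E) \<and>
     process_law M UNIV E \<epsilon>' = process_law M UNIV E \<epsilon> \<and>
     prob_space.indep_var M (\<Pi>\<^sub>M t\<in>UNIV. E) (\<lambda>\<omega> t. \<epsilon> t \<omega>) (\<Pi>\<^sub>M t\<in>UNIV. E) (\<lambda>\<omega> t. \<epsilon>' t \<omega>)"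

definition covariance :: "'w measure \<Rightarrow> ('w \<Rightarrow> real) \<Rightarrow> ('w \<Rightarrow> real) \<Rightarrow> real" where
  "covariance M Y Z =
     (\<integral>\<omega>. (Y \<omega> - integral\<^sup>L M Y) * (Z \<omega> - integral\<^sup>L M Z) \<partial>M)"

definition Lp_norm :: "'w measure \<Rightarrow> real \<Rightarrow> ('w \<Rightarrow> real) \<Rightarrow> real" where
  "Lp_norm M p Y = (\<integral>\<omega>. \<bar>Y \<omega>\<bar> powr p \<partial>M) powr (1 / p)"

text \<open>Point masses count as Gaussian, as the covariances may degenerate.\<close>

definition gaussian_rv :: "'w measure \<Rightarrow> ('w \<Rightarrow> real) \<Rightarrow> bool" where
  "gaussian_rv M Y \<longleftrightarrow> Y \<in> borel_measurable M \<and>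
     (\<exists>\<mu> s. (s > 0 \<and> distributed M lborel Y (normal_density \<mu> s)) \<or> (AE \<omega> in M. Y \<omega> = \<mu>))"

definition zero_mean_gaussian_process ::
    "'w measure \<Rightarrow> 'i set \<Rightarrow> ('i \<Rightarrow> 'w \<Rightarrow> real) \<Rightarrow> ('i \<Rightarrow> 'i \<Rightarrow> real) \<Rightarrow> bool" where
  "zero_mean_gaussian_process M I Y K \<longleftrightarrow>
     (\<forall>J c. finite J \<and> J \<subseteq> I \<longrightarrow> gaussian_rv M (\<lambda>\<omega>. \<Sum>i\<in>J. c i * Y i \<omega>)) \<and>
     (\<forall>i\<in>I. integral\<^sup>L M (Y i) = 0) \<and>
     (\<forall>i\<in>I. \<forall>j\<in>I. covariance M (Y i) (Y j) = K i j)"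


section \<open>Brownian motion and Wiener integrals\<close>

definition standard_brownian_motion ::
    "'w measure \<Rightarrow> real set \<Rightarrow> (real \<Rightarrow> 'w \<Rightarrow> real) \<Rightarrow> bool" where
  "standard_brownian_motion M I B \<longleftrightarrow>
     (\<forall>t\<in>I. B t \<in> borel_measurable M) \<and>
     (AE \<omega> in M. B 0 \<omega> = 0) \<and>
     (\<forall>n \<tau>. (\<forall>i\<le>n. \<tau> i \<in> I) \<and> (\<forall>i<n. \<tau> i < \<tau> (Suc i)) \<longrightarrow>
        prob_space.indep_vars M (\<lambda>_. borel) (\<lambda>i \<omega>. B (\<tau> (Suc i)) \<omega> - B (\<tau> i) \<omega>) {..<n::nat}) \<and>
     (\<forall>s\<in>I. \<forall>t\<in>I. s < t \<longrightarrow>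
        distributed M lborel (\<lambda>\<omega>. B t \<omega> - B s \<omega>) (normal_density 0 (sqrt (t - s)))) \<and>
     (AE \<omega> in M. continuous_on I (\<lambda>t. B t \<omega>))"

definition independent_brownian_motions ::
    "'w measure \<Rightarrow> real set \<Rightarrow> (nat \<Rightarrow> real \<Rightarrow> 'w \<Rightarrow> real) \<Rightarrow> bool" where
  "independent_brownian_motions M I B \<longleftrightarrow>
     (\<forall>l. standard_brownian_motion M I (B l)) \<and>
     prob_space.indep_vars M (\<lambda>_. \<Pi>\<^sub>M t\<in>I. borel) (\<lambda>l \<omega>. \<lambda>t\<in>I. B l t \<omega>) UNIV"

text \<open>\<open>L\<^sup>2\<close> convergence is stated with \<open>nn_integral\<close>, so that it cannot hold by non-integrability.\<close>

definition L2_tendsto :: "'w measure \<Rightarrow> (nat \<Rightarrow> 'w \<Rightarrow> real) \<Rightarrow> ('w \<Rightarrow> real) \<Rightarrow> bool" where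
  "L2_tendsto M Z Y \<longleftrightarrow> Y \<in> borel_measurable M \<and>
     (\<lambda>n. \<integral>\<^sup>+\<omega>. ennreal ((Y \<omega> - Z n \<omega>)\<^sup>2) \<partial>M) \<longlonglongrightarrow> 0"

definition step_function :: "nat \<Rightarrow> (nat \<Rightarrow> real) \<Rightarrow> (nat \<Rightarrow> real) \<Rightarrow> real \<Rightarrow> real" where
  "step_function n s c x = (\<Sum>i<n. c i * indicator {s i<..s (Suc i)} x)"

definition step_integral ::
    "(real \<Rightarrow> 'w \<Rightarrow> real) \<Rightarrow> nat \<Rightarrow> (nat \<Rightarrow> real) \<Rightarrow> (nat \<Rightarrow> real) \<Rightarrow> 'w \<Rightarrow> real" where
  "step_integral B n s c \<omega> = (\<Sum>i<n. c i * (B (s (Suc i)) \<omega> - B (s i) \<omega>))"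

text \<open>\<open>has_wiener_integral M B f a b Y\<close> means that \<open>Y\<close> is (a version of) \<open>\<integral>\<^sub>a\<^sup>b f dB\<close>, for deterministic
  square-integrable \<open>f\<close>. By the Ito isometry the limit does not depend on the approximating
  sequence of step functions.\<close>

definition has_wiener_integral ::
    "'w measure \<Rightarrow> (real \<Rightarrow> 'w \<Rightarrow> real) \<Rightarrow> (real \<Rightarrow> real) \<Rightarrow> real \<Rightarrow> real \<Rightarrow> ('w \<Rightarrow> real) \<Rightarrow> bool" where
  "has_wiener_integral M B f a b Y \<longleftrightarrow>
     set_borel_measurable lborel {a..b} f \<and>
     set_integrable lborel {a..b} (\<lambda>x. (f x)\<^sup>2) \<and>
     (\<exists>n s c.
        (\<forall>p. \<forall>i<n p. a \<le> s p i \<and> s p i \<le> s p (Suc i) \<and> s p (Suc i) \<le> b) \<and>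
        (\<lambda>p. \<integral>\<^sup>+x\<in>{a..b}. ennreal ((f x - step_function (n p) (s p) (c p) x)\<^sup>2) \<partial>lborel)
          \<longlonglongrightarrow> 0 \<and>
        L2_tendsto M (\<lambda>p. step_integral B (n p) (s p) (c p)) Y)"


section \<open>Locally stationary processes and coupling\<close>

text \<open>\<open>X t T\<close> is \<open>X\<^bsub>t,T\<^esub>\<close> and \<open>Xa t u\<close> is the auxiliary process \<open>X\<^sub>t(u)\<close>.\<close>

definition locally_stationary ::
    "'w measure \<Rightarrow> (int \<Rightarrow> nat \<Rightarrow> 'w \<Rightarrow> 's::polish_space) \<Rightarrow> (int \<Rightarrow> real \<Rightarrow> 'w \<Rightarrow> 's) \<Rightarrow> bool" where
  "locally_stationary M X Xa \<longleftrightarrow>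
     (\<forall>T\<ge>1. \<forall>t. X t T \<in> borel_measurable M) \<and>
     (\<forall>T\<ge>1. \<forall>t\<le>0. X t T = X 1 T) \<and>
     (\<forall>T\<ge>1. \<forall>t\<ge>int T. X t T = X (int T) T) \<and>
     (\<forall>t. \<forall>u\<in>{0..1}. Xa t u \<in> borel_measurable M) \<and>
     (\<forall>u\<in>{0..1}. \<forall>s. process_law M UNIV borel (\<lambda>t. Xa (t + s) u)
                    = process_law M UNIV borel (\<lambda>t. Xa t u)) \<and>
     (\<exists>C. \<forall>T\<ge>1. \<forall>t\<in>{1..int T}.
        (\<integral>\<omega>. min (dist (X t T \<omega>) (Xa t (real_of_int t / real T) \<omega>)) 1 \<partial>M) \<le> C / real T) \<and>
     (\<exists>C. \<forall>t\<ge>1. \<forall>u\<in>{0..1}. \<forall>v\<in>{0..1}.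
        (\<integral>\<omega>. min (dist (Xa t u \<omega>) (Xa t v \<omega>)) 1 \<partial>M) \<le> C * \<bar>u - v\<bar>)"

definition past :: "(int \<Rightarrow> 'w \<Rightarrow> 'g) \<Rightarrow> int \<Rightarrow> 'w \<Rightarrow> nat \<Rightarrow> 'g" where
  "past \<epsilon> t \<omega> = (\<lambda>i. \<epsilon> (t - int i) \<omega>)"

definition coupled_past ::
    "(int \<Rightarrow> 'w \<Rightarrow> 'g) \<Rightarrow> (int \<Rightarrow> 'w \<Rightarrow> 'g) \<Rightarrow> nat \<Rightarrow> int \<Rightarrow> 'w \<Rightarrow> nat \<Rightarrow> 'g" where
  "coupled_past \<epsilon> \<epsilon>' m t \<omega> = (\<lambda>i. if i < m then \<epsilon> (t - int i) \<omega> else \<epsilon>' (t - int i) \<omega>)"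

text \<open>The representation \<open>X\<^bsub>t,T\<^esub> = F(t,T,\<dots>)\<close> concerns \<open>1 \<le> t \<le> T\<close> only: for \<open>t \<le> 0\<close> it would
  contradict the extension \<open>X\<^bsub>t,T\<^esub> = X\<^bsub>1,T\<^esub>\<close>, except for degenerate processes.\<close>

definition has_representations ::
    "'w measure \<Rightarrow> 'g measure \<Rightarrow> (int \<Rightarrow> 'w \<Rightarrow> 'g) \<Rightarrow>
     (int \<Rightarrow> nat \<Rightarrow> (nat \<Rightarrow> 'g) \<Rightarrow> 's::polish_space) \<Rightarrow> (real \<Rightarrow> (nat \<Rightarrow> 'g) \<Rightarrow> 's) \<Rightarrow>
     (int \<Rightarrow> nat \<Rightarrow> 'w \<Rightarrow> 's) \<Rightarrow> (int \<Rightarrow> real \<Rightarrow> 'w \<Rightarrow> 's) \<Rightarrow> bool" where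
  "has_representations M E \<epsilon> F Fa X Xa \<longleftrightarrow>
     (\<forall>T\<ge>1. \<forall>t. F t T \<in> borel_measurable (\<Pi>\<^sub>M i\<in>UNIV. E)) \<and>
     (\<lambda>(u, x). Fa u x) \<in> borel_measurable (restrict_space borel {0..1} \<Otimes>\<^sub>M (\<Pi>\<^sub>M i\<in>UNIV. E)) \<and>
     (\<forall>T\<ge>1. \<forall>t\<in>{1..int T}. AE \<omega> in M. X t T \<omega> = F t T (past \<epsilon> t \<omega>)) \<and>
     (\<forall>t. \<forall>u\<in>{0..1}. AE \<omega> in M. Xa t u \<omega> = Fa u (past \<epsilon> t \<omega>))"

definition clip_time :: "nat \<Rightarrow> int \<Rightarrow> int" where
  "clip_time T t = max 1 (min t (int T))"

definition coupled_array ::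
    "(int \<Rightarrow> 'w \<Rightarrow> 'g) \<Rightarrow> (int \<Rightarrow> 'w \<Rightarrow> 'g) \<Rightarrow> (int \<Rightarrow> nat \<Rightarrow> (nat \<Rightarrow> 'g) \<Rightarrow> 's) \<Rightarrow>
     nat \<Rightarrow> int \<Rightarrow> nat \<Rightarrow> 'w \<Rightarrow> 's" where
  "coupled_array \<epsilon> \<epsilon>' F m t T \<omega> = F (clip_time T t) T (coupled_past \<epsilon> \<epsilon>' m (clip_time T t) \<omega>)"

definition coupled_aux ::
    "(int \<Rightarrow> 'w \<Rightarrow> 'g) \<Rightarrow> (int \<Rightarrow> 'w \<Rightarrow> 'g) \<Rightarrow> (real \<Rightarrow> (nat \<Rightarrow> 'g) \<Rightarrow> 's) \<Rightarrow>
     nat \<Rightarrow> int \<Rightarrow> real \<Rightarrow> 'w \<Rightarrow> 's" where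
  "coupled_aux \<epsilon> \<epsilon>' Fa m t u \<omega> = Fa u (coupled_past \<epsilon> \<epsilon>' m t \<omega>)"

definition delta0_array ::
    "'w measure \<Rightarrow> (int \<Rightarrow> 'w \<Rightarrow> 'g) \<Rightarrow> (int \<Rightarrow> 'w \<Rightarrow> 'g) \<Rightarrow>
     (int \<Rightarrow> nat \<Rightarrow> (nat \<Rightarrow> 'g) \<Rightarrow> 's::polish_space) \<Rightarrow> (int \<Rightarrow> nat \<Rightarrow> 'w \<Rightarrow> 's) \<Rightarrow> nat \<Rightarrow> ennreal" where
  "delta0_array M \<epsilon> \<epsilon>' F X m =
     (SUP T\<in>{1..}. SUP t\<in>{1..int T}.
        \<integral>\<^sup>+\<omega>. ennreal (min (dist (X t T \<omega>) (coupled_array \<epsilon> \<epsilon>' F m t T \<omega>)) 1) \<partial>M)"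

definition delta0_aux ::
    "'w measure \<Rightarrow> (int \<Rightarrow> 'w \<Rightarrow> 'g) \<Rightarrow> (int \<Rightarrow> 'w \<Rightarrow> 'g) \<Rightarrow>
     (real \<Rightarrow> (nat \<Rightarrow> 'g) \<Rightarrow> 's::polish_space) \<Rightarrow> (int \<Rightarrow> real \<Rightarrow> 'w \<Rightarrow> 's) \<Rightarrow> nat \<Rightarrow> ennreal" where
  "delta0_aux M \<epsilon> \<epsilon>' Fa Xa m =
     (SUP t. SUP u\<in>{0..1}.
        \<integral>\<^sup>+\<omega>. ennreal (min (dist (Xa t u \<omega>) (coupled_aux \<epsilon> \<epsilon>' Fa m t u \<omega>)) 1) \<partial>M)"


section \<open>Projections and the dependence measures\<close>

definition innovation_filtration ::
    "'w measure \<Rightarrow> 'g measure \<Rightarrow> (int \<Rightarrow> 'w \<Rightarrow> 'g) \<Rightarrow> int \<Rightarrow> 'w measure" where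
  "innovation_filtration M E \<epsilon> t =
     sigma (space M) (\<Union>s\<in>{..t}. {\<epsilon> s -` A \<inter> space M | A. A \<in> sets E})"

definition projection ::
    "'w measure \<Rightarrow> 'g measure \<Rightarrow> (int \<Rightarrow> 'w \<Rightarrow> 'g) \<Rightarrow> int \<Rightarrow> ('w \<Rightarrow> real) \<Rightarrow> 'w \<Rightarrow> real" where
  "projection M E \<epsilon> j Y \<omega> =
     real_cond_exp M (innovation_filtration M E \<epsilon> j) Y \<omega>
     - real_cond_exp M (innovation_filtration M E \<epsilon> (j - 1)) Y \<omega>"

definition demeaned ::
    "'w measure \<Rightarrow> ('s \<Rightarrow> 's \<Rightarrow> real \<Rightarrow> real) \<Rightarrow> ('w \<Rightarrow> 's) \<Rightarrow> ('w \<Rightarrow> 's) \<Rightarrow> real \<Rightarrow> 'w \<Rightarrow> real" where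
  "demeaned M h Y Z r \<omega> = h (Y \<omega>) (Z \<omega>) r - (\<integral>\<omega>'. h (Y \<omega>') (Z \<omega>') r \<partial>M)"

text \<open>In the next two definitions \<open>r\<close> is the value of \<open>\<lambda>\<close>. For the array, the supremum over \<open>t\<close>
  in the summability conditions will range over \<open>1 \<le> t \<le> T\<close>; only \<open>t - k\<close> may be non-positive.\<close>

definition nu_array ::
    "'w measure \<Rightarrow> 'g measure \<Rightarrow> (int \<Rightarrow> 'w \<Rightarrow> 'g) \<Rightarrow> (int \<Rightarrow> 'w \<Rightarrow> 'g) \<Rightarrow>
     (int \<Rightarrow> nat \<Rightarrow> (nat \<Rightarrow> 'g) \<Rightarrow> 's) \<Rightarrow> ('s \<Rightarrow> 's \<Rightarrow> real \<Rightarrow> real) \<Rightarrow>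
     int \<Rightarrow> nat \<Rightarrow> nat \<Rightarrow> nat \<Rightarrow> real \<Rightarrow> ennreal" where
  "nu_array M E \<epsilon> \<epsilon>' F h t k T j r =
     (SUP m\<in>{1..}. ennreal (Lp_norm M 2 (projection M E \<epsilon> (t - int j)
        (demeaned M h (coupled_array \<epsilon> \<epsilon>' F m t T) (coupled_array \<epsilon> \<epsilon>' F m (t - int k) T) r))))"

definition nu_aux ::
    "'w measure \<Rightarrow> 'g measure \<Rightarrow> (int \<Rightarrow> 'w \<Rightarrow> 'g) \<Rightarrow> (int \<Rightarrow> 'w \<Rightarrow> 'g) \<Rightarrow>
     (real \<Rightarrow> (nat \<Rightarrow> 'g) \<Rightarrow> 's) \<Rightarrow> ('s \<Rightarrow> 's \<Rightarrow> real \<Rightarrow> real) \<Rightarrow>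
     int \<Rightarrow> nat \<Rightarrow> real \<Rightarrow> real \<Rightarrow> nat \<Rightarrow> real \<Rightarrow> ennreal" where
  "nu_aux M E \<epsilon> \<epsilon>' Fa h t k u v j r =
     (SUP m\<in>{1..}. ennreal (Lp_norm M 2 (projection M E \<epsilon> (t - int j)
        (demeaned M h (coupled_aux \<epsilon> \<epsilon>' Fa m t u) (coupled_aux \<epsilon> \<epsilon>' Fa m (t - int k) v) r))))"


section \<open>The limiting covariance\<close>

text \<open>\<open>partial_mean M Xa h k \<eta> w r\<close> is \<open>\<E>\<^bsub>X'\<^sub>0(w)\<^esub>[\<hh>(X\<^sub>k(\<eta>), X'\<^sub>0(w), r)]\<close>. The independent copy is realised
  on \<open>M \<Otimes>\<^sub>M M\<close>, with \<open>X\<close> depending on the first and \<open>X'\<close> on the second coordinate.\<close>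

definition partial_mean ::
    "'w measure \<Rightarrow> (int \<Rightarrow> real \<Rightarrow> 'w \<Rightarrow> 's) \<Rightarrow> ('s \<Rightarrow> 's \<Rightarrow> real \<Rightarrow> real) \<Rightarrow>
     int \<Rightarrow> real \<Rightarrow> real \<Rightarrow> real \<Rightarrow> 'w \<Rightarrow> real" where
  "partial_mean M Xa h k \<eta> w r \<omega> =
     (\<integral>\<omega>'. demeaned (M \<Otimes>\<^sub>M M) h (Xa k \<eta> \<circ> fst) (Xa 0 w \<circ> snd) r (\<omega>, \<omega>') \<partial>M)"

definition long_run_cov ::
    "'w measure \<Rightarrow> (int \<Rightarrow> real \<Rightarrow> 'w \<Rightarrow> 's) \<Rightarrow> ('s \<Rightarrow> 's \<Rightarrow> real \<Rightarrow> real) \<Rightarrow>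
     real \<Rightarrow> real \<Rightarrow> real \<Rightarrow> real \<Rightarrow> real \<Rightarrow> real" where
  "long_run_cov M Xa h \<eta> z r z' r' =
     (\<Sum>\<^sub>\<infinity>k\<in>UNIV. covariance M
        (\<lambda>\<omega>. LBINT w:{0..z}. partial_mean M Xa h 0 \<eta> w r \<omega>)
        (\<lambda>\<omega>. LBINT w:{0..z'}. partial_mean M Xa h k \<eta> w r' \<omega>))"

definition limit_cov ::
    "'w measure \<Rightarrow> (int \<Rightarrow> real \<Rightarrow> 'w \<Rightarrow> 's) \<Rightarrow> ('s \<Rightarrow> 's \<Rightarrow> real \<Rightarrow> real) \<Rightarrow>
     real \<times> real \<times> real \<Rightarrow> real \<times> real \<times> real \<Rightarrow> real" where
  "limit_cov M Xa h = (\<lambda>(u\<^sub>1, v\<^sub>1, r\<^sub>1) (u\<^sub>2, v\<^sub>2, r\<^sub>2).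
       (LBINT \<eta>:{0..min u\<^sub>1 u\<^sub>2}. long_run_cov M Xa h \<eta> v\<^sub>1 r\<^sub>1 v\<^sub>2 r\<^sub>2)
     + (LBINT \<eta>:{0..min u\<^sub>1 v\<^sub>2}. long_run_cov M Xa h \<eta> v\<^sub>1 r\<^sub>1 u\<^sub>2 r\<^sub>2)
     + (LBINT \<eta>:{0..min v\<^sub>1 u\<^sub>2}. long_run_cov M Xa h \<eta> u\<^sub>1 r\<^sub>1 v\<^sub>2 r\<^sub>2)
     + (LBINT \<eta>:{0..min v\<^sub>1 v\<^sub>2}. long_run_cov M Xa h \<eta> u\<^sub>1 r\<^sub>1 u\<^sub>2 r\<^sub>2))"

end

theory Submission
  imports Defs
begin

text \<open>Why the theorem holds. Write \<open>\<sigma>\<^sub>\<eta>(x, y)\<close> for the long-run covariance, where \<open>x\<close> and \<open>y\<close> are pairs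
\<open>(z, \<lambda>)\<close>. Suppose that \<open>\<sigma>\<^sub>\<eta>(x, y) = \<Sum>\<^sub>l g\<^sub>l(\<eta>, x) g\<^sub>l(\<eta>, y)\<close> with bounded functions \<open>g\<^sub>l\<close> that are measurable
in \<open>\<eta>\<close>. By the Ito isometry, the Wiener integrals of \<open>g\<^sub>l(\<cdot>, x)\<close> over \<open>[0, a]\<close> against independent Brownian
motions sum up in \<open>L\<^sup>2\<close> to centered, jointly Gaussian variables \<open>S(a, x)\<close> such that the covariance of \<open>S(a, x)\<close>
and \<open>S(a', x')\<close> is the integral of \<open>\<sigma>\<^sub>\<eta>(x, x')\<close> over \<open>[0, min(a, a')]\<close> (\<open>wiener_series_representation\<close>). Expanding
\<open>S(u, (v, \<lambda>)) + S(v, (u, \<lambda>))\<close> gives the four integrals in the covariance of \<open>G\<close>, and two centered Gaussian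
families with the same covariance have the same law (\<open>gaussian_process_law_eq\<close>).

It remains to factor \<open>\<sigma>\<^sub>\<eta>\<close>. Let \<open>f\<^sub>x\<close> be the observable of the auxiliary process whose long-run covariance
is sought, seen as a function of the past innovations, and let \<open>D\<^sub>j f\<close> be the projection \<open>P\<^sub>0\<close> of the value of \<open>f\<close>
at time \<open>j\<close>. As martingale differences are orthogonal, the covariance of \<open>f\<^sub>x\<close> at time \<open>0\<close> and \<open>f\<^sub>y\<close> at
time \<open>k\<close> is the sum of the inner products of \<open>D\<^sub>i f\<^sub>x\<close> and \<open>D\<^sub>l f\<^sub>y\<close> over the diagonal \<open>l - i = k\<close>
(\<open>covariance_telescope\<close>). Summing over \<open>k\<close> turns \<open>\<sigma>\<^sub>\<eta>(x, y)\<close> into the sum over all \<open>i\<close> and \<open>l\<close>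
(\<open>infsum_antidiagonals\<close>). These inner products form a positive semidefinite kernel on the pairs \<open>(i, x)\<close>, which is
continuous in \<open>x\<close>. Gaussian elimination along a fixed dense sequence of pairs factors it as
\<open>\<Sum>\<^sub>q c\<^sub>q(i, x) c\<^sub>q(l, y)\<close>, where \<open>c\<^sub>q\<close> is an algebraic function of finitely many entries and therefore measurable in
\<open>\<eta>\<close> (\<open>cholesky_sums\<close>). Then \<open>g\<^sub>q(x) = \<Sum>\<^sub>i c\<^sub>q(i, x)\<close> is the required factor (\<open>innovation_factorization\<close>).

All these rearrangements rest on \<open>\<Sum>\<^sub>j \<parallel>D\<^sub>j f\<^sub>x\<parallel> \<le> C\<close>, uniformly in \<open>\<eta>\<close> and \<open>x\<close> (\<open>innovation_sd_sum_le\<close>), and this is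
what the summability condition on the auxiliary process provides. That condition is about
\<open>P\<^sub>-\<^sub>j(h(X\<^sub>0(\<eta>), X\<^sub>-\<^sub>k(w), \<lambda>))\<close>, whereas \<open>f\<^sub>x\<close> averages \<open>h\<close> over an independent copy of \<open>X\<^sub>0(w)\<close>; but for
\<open>k \<longlonglongrightarrow> \<infinity>\<close> the two arguments of \<open>h\<close> become independent, so that the bound passes to the average
(\<open>lagged_product_limit\<close>, \<open>innovation_mean_kernel_sum_le\<close>).\<close>

section \<open>Square-integrable functions\<close>

text \<open>A quadratic polynomial without sign change has a nonpositive discriminant. The Cauchy-Schwarz inequalities for
integrals and for positive semidefinite kernels are both obtained from this.\<close>

lemma discriminant_le:
  fixes a b c :: real
  assumes "\<And>t. 0 \<le> a + 2 * t * b + t\<^sup>2 * c"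
  shows "b\<^sup>2 \<le> a * c"
proof (cases "c = 0")
  case True
  have "b = 0"
  proof (rule ccontr)
    assume b: "b \<noteq> 0"
    have "0 \<le> a + 2 * (- (a + 1) / (2 * b)) * b" using assms[of "- (a + 1) / (2 * b)"] True by simp
    also have "\<dots> = -1" using b by (simp add: field_simps)
    finally show False by simp
  qed
  then show ?thesis using True by simp
next
  case False
  have "0 \<le> a" using assms[of 0] by simp
  have c: "0 < c"
  proof (rule ccontr)
    assume "\<not> 0 < c"
    with False have c: "c < 0" by simp
    define t where "t = (2 * \<bar>b\<bar> + a + 1) / \<bar>c\<bar> + 1"
    have t1: "t \<ge> 1" using \<open>0 \<le> a\<close> by (simp add: t_def)
    have t2: "t * (- c) \<ge> 2 * \<bar>b\<bar> + a + 1"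
      using c by (simp add: t_def field_simps)
    have "t * (t * (- c)) \<ge> t * (2 * \<bar>b\<bar> + a + 1)" using t1 t2 by (intro mult_left_mono) auto
    moreover have "t * (2 * \<bar>b\<bar>) \<ge> 2 * t * b" using t1 by (simp add: mult_left_mono)
    moreover have "t * (a + 1) \<ge> a + 1" using t1 \<open>0 \<le> a\<close> mult_right_mono[of 1 t "a + 1"] by simp
    ultimately have "a + 2 * t * b + t\<^sup>2 * c < 0"
      by (simp add: power2_eq_square algebra_simps)
    with assms[of t] show False by simp
  qed
  have "0 \<le> a + 2 * (- b / c) * b + (- b / c)\<^sup>2 * c" by (rule assms)
  also have "\<dots> = a - b\<^sup>2 / c" using c by (simp add: field_simps power2_eq_square)
  finally show ?thesis using c by (simp add: field_simps)
qed

definition sq_integrable :: "'a measure \<Rightarrow> ('a \<Rightarrow> real) \<Rightarrow> bool" where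
  "sq_integrable M f \<longleftrightarrow> f \<in> borel_measurable M \<and> integrable M (\<lambda>x. (f x)\<^sup>2)"

lemma sq_integrable_measurable: "sq_integrable M f \<Longrightarrow> f \<in> borel_measurable M"
  by (simp add: sq_integrable_def)

lemma sq_integrable_mult:
  assumes "sq_integrable M f" "sq_integrable M g"
  shows "integrable M (\<lambda>x. f x * g x)"
proof (rule Bochner_Integration.integrable_bound)
  show "integrable M (\<lambda>x. (f x)\<^sup>2 + (g x)\<^sup>2)"
    using assms by (auto simp: sq_integrable_def)
  show "(\<lambda>x. f x * g x) \<in> borel_measurable M" using assms by (auto simp: sq_integrable_def)
  have "\<bar>x * y\<bar> \<le> x\<^sup>2 + y\<^sup>2" for x y :: real
  proof -
    have "0 \<le> \<bar>x\<bar> * \<bar>y\<bar>" by simp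
    moreover have "2 * (\<bar>x\<bar> * \<bar>y\<bar>) \<le> x\<^sup>2 + y\<^sup>2" using sum_squares_bound[of "\<bar>x\<bar>" "\<bar>y\<bar>"] by (simp add: mult.assoc)
    ultimately show ?thesis unfolding abs_mult by linarith
  qed
  then show "AE x in M. norm (f x * g x) \<le> norm ((f x)\<^sup>2 + (g x)\<^sup>2)"
    by (intro AE_I2) (metis abs_ge_self order_trans real_norm_def)
qed

lemma sq_integrable_cmult: "sq_integrable M f \<Longrightarrow> sq_integrable M (\<lambda>x. c * f x)"
  by (auto simp: sq_integrable_def power_mult_distrib)

lemma sq_integrable_add:
  assumes "sq_integrable M f" "sq_integrable M g"
  shows "sq_integrable M (\<lambda>x. f x + g x)"
proof -
  have "integrable M (\<lambda>x. (f x)\<^sup>2 + (g x)\<^sup>2 + 2 * (f x * g x))"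
    using assms sq_integrable_mult[OF assms] by (auto simp: sq_integrable_def)
  then show ?thesis using assms by (auto simp: sq_integrable_def power2_sum algebra_simps)
qed

lemma sq_integrable_diff:
  assumes "sq_integrable M f" "sq_integrable M g"
  shows "sq_integrable M (\<lambda>x. f x - g x)"
  using sq_integrable_add[OF assms(1) sq_integrable_cmult[OF assms(2), of "-1"]] by simp

lemma sq_integrable_zero: "sq_integrable M (\<lambda>x. 0)"
  by (simp add: sq_integrable_def)

lemma sq_integrable_sum:
  "(\<And>i. i \<in> A \<Longrightarrow> sq_integrable M (f i)) \<Longrightarrow> sq_integrable M (\<lambda>x. \<Sum>i\<in>A. f i x)"
  by (induction A rule: infinite_finite_induct) (auto intro: sq_integrable_add sq_integrable_zero)

lemma sq_integrable_bounded:
  assumes "finite_measure M" "f \<in> borel_measurable M" "\<And>x. x \<in> space M \<Longrightarrow> \<bar>f x\<bar> \<le> C"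
  shows "sq_integrable M f"
proof -
  interpret finite_measure M by fact
  have "\<bar>(f x)\<^sup>2\<bar> \<le> C\<^sup>2" if "x \<in> space M" for x
    using power_mono[OF assms(3)[OF that], of 2] by simp
  then show ?thesis using assms(2)
    by (auto simp: sq_integrable_def intro!: integrable_const_bound[where B="C\<^sup>2"])
qed

lemma (in prob_space) sq_integrable_integrable:
  assumes "sq_integrable M f"
  shows "integrable M f"
  using sq_integrable_mult[OF assms, of "\<lambda>_. 1"] by (simp add: sq_integrable_def)

lemma integral_inner_Cauchy_Schwarz:
  assumes "sq_integrable M f" "sq_integrable M g"
  shows "\<bar>\<integral>x. f x * g x \<partial>M\<bar> \<le> sqrt (\<integral>x. (f x)\<^sup>2 \<partial>M) * sqrt (\<integral>x. (g x)\<^sup>2 \<partial>M)"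
proof -
  have i: "integrable M (\<lambda>x. f x * g x)" "integrable M (\<lambda>x. (f x)\<^sup>2)" "integrable M (\<lambda>x. (g x)\<^sup>2)"
    using assms sq_integrable_mult[OF assms] by (auto simp: sq_integrable_def)
  have "(\<integral>x. f x * g x \<partial>M)\<^sup>2 \<le> (\<integral>x. (f x)\<^sup>2 \<partial>M) * (\<integral>x. (g x)\<^sup>2 \<partial>M)"
  proof (rule discriminant_le)
    fix t :: real
    have "0 \<le> (\<integral>x. (f x + t * g x)\<^sup>2 \<partial>M)" by simp
    also have "(\<lambda>x. (f x + t * g x)\<^sup>2) = (\<lambda>x. (f x)\<^sup>2 + 2 * t * (f x * g x) + t\<^sup>2 * (g x)\<^sup>2)"
      by (auto simp: power2_eq_square algebra_simps)
    also have "(\<integral>x. \<dots> x \<partial>M) = (\<integral>x. (f x)\<^sup>2 \<partial>M) + 2 * t * (\<integral>x. f x * g x \<partial>M) + t\<^sup>2 * (\<integral>x. (g x)\<^sup>2 \<partial>M)"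
      using i by simp
    finally show "0 \<le> (\<integral>x. (f x)\<^sup>2 \<partial>M) + 2 * t * (\<integral>x. f x * g x \<partial>M) + t\<^sup>2 * (\<integral>x. (g x)\<^sup>2 \<partial>M)" .
  qed
  then have "sqrt ((\<integral>x. f x * g x \<partial>M)\<^sup>2) \<le> sqrt ((\<integral>x. (f x)\<^sup>2 \<partial>M) * (\<integral>x. (g x)\<^sup>2 \<partial>M))"
    by (rule real_sqrt_le_mono)
  then show ?thesis by (simp add: real_sqrt_mult)
qed

lemma integral_sq_sum:
  assumes "finite A" "\<And>i. i \<in> A \<Longrightarrow> sq_integrable M (f i)"
  shows "(\<integral>x. (\<Sum>i\<in>A. c i * f i x)\<^sup>2 \<partial>M) = (\<Sum>i\<in>A. \<Sum>j\<in>A. c i * c j * (\<integral>x. f i x * f j x \<partial>M))"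
proof -
  have "(\<integral>x. (\<Sum>i\<in>A. c i * f i x)\<^sup>2 \<partial>M) = (\<integral>x. (\<Sum>i\<in>A. \<Sum>j\<in>A. c i * c j * (f i x * f j x)) \<partial>M)"
    by (intro Bochner_Integration.integral_cong) (auto simp: power2_eq_square sum_product ac_simps)
  also have "\<dots> = (\<Sum>i\<in>A. \<Sum>j\<in>A. (\<integral>x. c i * c j * (f i x * f j x) \<partial>M))"
    using assms
    by (simp add: Bochner_Integration.integral_sum Bochner_Integration.integrable_sum sq_integrable_mult del: integral_mult_right)
  finally show ?thesis by simp
qed

lemma integral_mult_sum:
  assumes "\<And>i. i \<in> A \<Longrightarrow> sq_integrable M (f i)" "\<And>i. i \<in> B \<Longrightarrow> sq_integrable M (g i)"
  shows "(\<integral>x. (\<Sum>i\<in>A. c i * f i x) * (\<Sum>j\<in>B. d j * g j x) \<partial>M)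
     = (\<Sum>i\<in>A. \<Sum>j\<in>B. c i * d j * (\<integral>x. f i x * g j x \<partial>M))"
proof -
  have "(\<integral>x. (\<Sum>i\<in>A. c i * f i x) * (\<Sum>j\<in>B. d j * g j x) \<partial>M) = (\<integral>x. (\<Sum>i\<in>A. \<Sum>j\<in>B. c i * d j * (f i x * g j x)) \<partial>M)"
    by (intro Bochner_Integration.integral_cong) (auto simp: sum_product ac_simps)
  also have "\<dots> = (\<Sum>i\<in>A. \<Sum>j\<in>B. (\<integral>x. c i * d j * (f i x * g j x) \<partial>M))"
    using assms
    by (simp add: Bochner_Integration.integral_sum Bochner_Integration.integrable_sum sq_integrable_mult del: integral_mult_right)
  finally show ?thesis by simp
qed

lemma L2_tendsto_sq_integrable:
  assumes "L2_tendsto M Z Y" "\<And>n. sq_integrable M (Z n)"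
  shows "sq_integrable M Y"
proof -
  have [measurable]: "Y \<in> borel_measurable M" "Z n \<in> borel_measurable M" for n
    using assms by (auto simp: L2_tendsto_def sq_integrable_def)
  have "(\<lambda>n. \<integral>\<^sup>+\<omega>. ennreal ((Y \<omega> - Z n \<omega>)\<^sup>2) \<partial>M) \<longlonglongrightarrow> 0"
    using assms by (simp add: L2_tendsto_def)
  then have "eventually (\<lambda>n. (\<integral>\<^sup>+\<omega>. ennreal ((Y \<omega> - Z n \<omega>)\<^sup>2) \<partial>M) < 1) sequentially"
    by (rule order_tendstoD) simp
  then obtain n where n: "(\<integral>\<^sup>+\<omega>. ennreal ((Y \<omega> - Z n \<omega>)\<^sup>2) \<partial>M) < 1"
    by (auto simp: eventually_sequentially)
  then have "integrable M (\<lambda>x. (Y x - Z n x)\<^sup>2)"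
    by (intro integrableI_nonneg) (auto intro: order_less_trans[OF n])
  then have "sq_integrable M (\<lambda>x. Y x - Z n x)" by (simp add: sq_integrable_def)
  from sq_integrable_add[OF this assms(2)[of n]] show ?thesis by simp
qed

lemma nn_integral_sq:
  assumes "sq_integrable M f"
  shows "(\<integral>\<^sup>+x. ennreal ((f x)\<^sup>2) \<partial>M) = ennreal (\<integral>x. (f x)\<^sup>2 \<partial>M)"
  using assms by (intro nn_integral_eq_integral) (auto simp: sq_integrable_def)

lemma L2_tendsto_iff:
  assumes "sq_integrable M Y" "\<And>n. sq_integrable M (Z n)"
  shows "L2_tendsto M Z Y \<longleftrightarrow> (\<lambda>n. \<integral>x. (Y x - Z n x)\<^sup>2 \<partial>M) \<longlonglongrightarrow> 0"
proof -
  have "(\<integral>\<^sup>+x. ennreal ((Y x - Z n x)\<^sup>2) \<partial>M) = ennreal (\<integral>x. (Y x - Z n x)\<^sup>2 \<partial>M)" for n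
    by (rule nn_integral_sq[OF sq_integrable_diff[OF assms]])
  then show ?thesis using assms
    by (simp add: L2_tendsto_def sq_integrable_def) (simp add: tendsto_ennreal_iff[where x=0, simplified])
qed

text \<open>With the errors \<open>a = Y - Z\<close> and \<open>b = Y' - Z'\<close>, the product \<open>Z Z'\<close> equals \<open>Y Y' - a Y' - b Y + a b\<close>, and the
last three terms are small by the Cauchy-Schwarz inequality.\<close>

lemma L2_tendsto_inner:
  assumes L: "L2_tendsto M Z Y" "L2_tendsto M Z' Y'"
    and sq: "\<And>n. sq_integrable M (Z n)" "\<And>n. sq_integrable M (Z' n)"
  shows "(\<lambda>n. \<integral>x. Z n x * Z' n x \<partial>M) \<longlonglongrightarrow> (\<integral>x. Y x * Y' x \<partial>M)"
proof -
  let ?a = "\<lambda>n x. Y x - Z n x" and ?b = "\<lambda>n x. Y' x - Z' n x"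
  have Y: "sq_integrable M Y" "sq_integrable M Y'"
    using L2_tendsto_sq_integrable L sq by blast+
  have ab: "sq_integrable M (?a n)" "sq_integrable M (?b n)" for n
    by (intro sq_integrable_diff Y sq)+
  have lim: "(\<lambda>n. \<integral>x. (?a n x)\<^sup>2 \<partial>M) \<longlonglongrightarrow> 0" "(\<lambda>n. \<integral>x. (?b n x)\<^sup>2 \<partial>M) \<longlonglongrightarrow> 0"
    using L Y sq by (simp_all add: L2_tendsto_iff)
  have sq0: "(\<lambda>n. sqrt (\<integral>x. (?a n x)\<^sup>2 \<partial>M)) \<longlonglongrightarrow> 0" "(\<lambda>n. sqrt (\<integral>x. (?b n x)\<^sup>2 \<partial>M)) \<longlonglongrightarrow> 0"
    using tendsto_real_sqrt[OF lim(1)] tendsto_real_sqrt[OF lim(2)] by simp_all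
  have 1: "(\<lambda>n. \<integral>x. ?a n x * Y' x \<partial>M) \<longlonglongrightarrow> 0"
    by (rule Lim_null_comparison[OF _ tendsto_mult_left_zero[OF sq0(1), of "sqrt (\<integral>x. (Y' x)\<^sup>2 \<partial>M)"]])
       (use integral_inner_Cauchy_Schwarz[OF ab(1) Y(2)] in auto)
  have 2: "(\<lambda>n. \<integral>x. ?b n x * Y x \<partial>M) \<longlonglongrightarrow> 0"
    by (rule Lim_null_comparison[OF _ tendsto_mult_left_zero[OF sq0(2), of "sqrt (\<integral>x. (Y x)\<^sup>2 \<partial>M)"]])
       (use integral_inner_Cauchy_Schwarz[OF ab(2) Y(1)] in auto)
  have 3: "(\<lambda>n. \<integral>x. ?a n x * ?b n x \<partial>M) \<longlonglongrightarrow> 0"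
    by (rule Lim_null_comparison[OF _ tendsto_mult_zero[OF sq0]])
       (use integral_inner_Cauchy_Schwarz[OF ab(1) ab(2)] in auto)
  have "(\<integral>x. Z n x * Z' n x \<partial>M) = (\<integral>x. Y x * Y' x \<partial>M) - (\<integral>x. ?a n x * Y' x \<partial>M)
      - (\<integral>x. ?b n x * Y x \<partial>M) + (\<integral>x. ?a n x * ?b n x \<partial>M)" for n
  proof -
    have "(\<integral>x. Z n x * Z' n x \<partial>M) = (\<integral>x. Y x * Y' x - ?a n x * Y' x - ?b n x * Y x + ?a n x * ?b n x \<partial>M)"
      by (intro Bochner_Integration.integral_cong) (auto simp: algebra_simps)
    also have "\<dots> = (\<integral>x. Y x * Y' x \<partial>M) - (\<integral>x. ?a n x * Y' x \<partial>M)
      - (\<integral>x. ?b n x * Y x \<partial>M) + (\<integral>x. ?a n x * ?b n x \<partial>M)"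
      using sq_integrable_mult[OF Y] sq_integrable_mult[OF ab(1)[of n] Y(2)]
        sq_integrable_mult[OF ab(2)[of n] Y(1)] sq_integrable_mult[OF ab(1)[of n] ab(2)[of n]] by simp
    finally show ?thesis .
  qed
  then show ?thesis using tendsto_add[OF tendsto_diff[OF tendsto_diff[OF tendsto_const 1] 2] 3]
    by simp
qed

lemma AE_summable_abs:
  fixes f :: "nat \<Rightarrow> 'a \<Rightarrow> real"
  assumes int: "\<And>n. integrable M (f n)" and sum: "summable (\<lambda>n. \<integral>x. \<bar>f n x\<bar> \<partial>M)"
  shows "AE x in M. summable (\<lambda>n. \<bar>f n x\<bar>)"
proof -
  have [measurable]: "f n \<in> borel_measurable M" for n using int by auto
  have "(\<integral>\<^sup>+x. (\<Sum>n. ennreal \<bar>f n x\<bar>) \<partial>M) = (\<Sum>n. \<integral>\<^sup>+x. ennreal \<bar>f n x\<bar> \<partial>M)"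
    by (rule nn_integral_suminf) simp
  also have "\<dots> = (\<Sum>n. ennreal (\<integral>x. \<bar>f n x\<bar> \<partial>M))"
    using int by (subst nn_integral_eq_integral) auto
  also have "\<dots> = ennreal (\<Sum>n. \<integral>x. \<bar>f n x\<bar> \<partial>M)"
    using sum by (intro suminf_ennreal2) auto
  finally have "(\<integral>\<^sup>+x. (\<Sum>n. ennreal \<bar>f n x\<bar>) \<partial>M) \<noteq> \<infinity>" by simp
  then have "AE x in M. (\<Sum>n. ennreal \<bar>f n x\<bar>) \<noteq> \<infinity>"
    by (intro nn_integral_PInf_AE) auto
  then show ?thesis
    by eventually_elim (auto intro!: summable_suminf_not_top)
qed

text \<open>Along a subsequence whose successive squared distances are at most \<open>4\<^sup>-\<^sup>p\<close>, the increments have summable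
\<open>L\<^sup>1\<close> norms, so that the subsequence converges almost surely. Fatou's lemma transfers the Cauchy bounds
to the limit.\<close>

lemma (in prob_space) L2_Cauchy_converges:
  assumes sq: "\<And>n. sq_integrable M (Z n)"
    and Cauchy: "\<And>e. e > 0 \<Longrightarrow> \<exists>K. \<forall>m\<ge>K. \<forall>n\<ge>K. (\<integral>x. (Z m x - Z n x)\<^sup>2 \<partial>M) \<le> e"
  shows "\<exists>Y. L2_tendsto M Z Y"
proof -
  have [measurable]: "Z n \<in> borel_measurable M" for n using sq by (simp add: sq_integrable_def)
  have "\<exists>K. \<forall>m\<ge>K. \<forall>n\<ge>K. (\<integral>x. (Z m x - Z n x)\<^sup>2 \<partial>M) \<le> (1/4)^p" for p :: nat
    by (rule Cauchy) simp
  then obtain K where K: "\<And>p m n. m \<ge> K p \<Longrightarrow> n \<ge> K p \<Longrightarrow> (\<integral>x. (Z m x - Z n x)\<^sup>2 \<partial>M) \<le> (1/4)^p"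
    by metis
  (* Summation makes the subsequence monotone; the summand p makes it unbounded. *)
  define r where "r p = (\<Sum>i\<le>p. K i) + p" for p
  have rK: "K p \<le> r p" "r p \<le> r (Suc p)" "p \<le> r p" for p
    using member_le_sum[of p "{..p}" K] by (auto simp: r_def)
  have sqd: "sq_integrable M (\<lambda>x. Z (r (Suc p)) x - Z (r p) x)" for p
    by (intro sq_integrable_diff sq)
  have "AE x in M. summable (\<lambda>p. \<bar>Z (r (Suc p)) x - Z (r p) x\<bar>)"
  proof (rule AE_summable_abs)
    show int: "integrable M (\<lambda>x. Z (r (Suc p)) x - Z (r p) x)" for p
      using sq_integrable_integrable[OF sqd] .
    have "norm (\<integral>x. \<bar>Z (r (Suc p)) x - Z (r p) x\<bar> \<partial>M) \<le> 2 * (1/2)^p" for p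
    proof -
      (* The inequality of means, with the weight that balances the two terms when y^2 is about 4^-p. *)
      have "\<bar>y\<bar> \<le> 2^p * y\<^sup>2 + (1/2)^p" for y :: real
      proof -
        have "0 \<le> (2^p * \<bar>y\<bar> - 1)\<^sup>2" by simp
        then have "2 * (2^p * \<bar>y\<bar>) \<le> (2^p * \<bar>y\<bar>)\<^sup>2 + 1" by (simp add: power2_diff)
        moreover have "(2^p * \<bar>y\<bar>)\<^sup>2 = 2^p * (2^p * y\<^sup>2)" by (simp add: power2_eq_square)
        moreover have "0 \<le> 2^p * \<bar>y\<bar>" by simp
        ultimately have "2^p * \<bar>y\<bar> \<le> 2^p * (2^p * y\<^sup>2) + 1" by linarith
        also have "\<dots> = 2^p * (2^p * y\<^sup>2 + (1/2)^p)" by (simp add: field_simps)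
        finally show ?thesis by simp
      qed
      then have "(\<integral>x. \<bar>Z (r (Suc p)) x - Z (r p) x\<bar> \<partial>M) \<le> (\<integral>x. 2^p * (Z (r (Suc p)) x - Z (r p) x)\<^sup>2 + (1/2)^p \<partial>M)"
        using int sqd by (intro integral_mono) (auto simp: sq_integrable_def)
      also have "\<dots> = 2^p * (\<integral>x. (Z (r (Suc p)) x - Z (r p) x)\<^sup>2 \<partial>M) + (1/2)^p"
        using sqd[of p] by (simp add: sq_integrable_def prob_space)
      also have "\<dots> \<le> 2^p * (1/4)^p + (1/2)^p"
        using K[of p "r (Suc p)" "r p"] rK[of p] by (intro add_right_mono mult_left_mono) auto
      also have "\<dots> = 2 * (1/2)^p" by (simp add: power_mult_distrib[symmetric])
      finally show ?thesis by simp
    qed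
    then show "summable (\<lambda>p. \<integral>x. \<bar>Z (r (Suc p)) x - Z (r p) x\<bar> \<partial>M)"
      by (rule summable_comparison_test'[where N=0, rotated]) (rule summable_mult summable_geometric | simp)+
  qed
  then have conv: "AE x in M. (\<lambda>p. Z (r p) x) \<longlonglongrightarrow> lim (\<lambda>p. Z (r p) x)"
  proof eventually_elim
    case (elim x)
    then have "summable (\<lambda>p. Z (r (Suc p)) x - Z (r p) x)" by (rule summable_rabs_cancel)
    then have "(\<lambda>n. \<Sum>p<n. Z (r (Suc p)) x - Z (r p) x) \<longlonglongrightarrow> (\<Sum>p. Z (r (Suc p)) x - Z (r p) x)"
      by (rule summable_LIMSEQ)
    then have "(\<lambda>n. Z (r n) x - Z (r 0) x) \<longlonglongrightarrow> (\<Sum>p. Z (r (Suc p)) x - Z (r p) x)"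
      by (simp add: sum_lessThan_telescope[of "\<lambda>p. Z (r p) x"])
    then have "convergent (\<lambda>n. Z (r n) x - Z (r 0) x)" by (auto simp: convergent_def)
    then have "convergent (\<lambda>n. Z (r n) x)" using convergent_diff_const_right_iff by blast
    then show ?case by (simp add: convergent_LIMSEQ_iff)
  qed
  define Y where "Y x = lim (\<lambda>p. Z (r p) x)" for x
  have [measurable]: "Y \<in> borel_measurable M" unfolding Y_def by measurable
  have "(\<lambda>n. \<integral>\<^sup>+x. ennreal ((Y x - Z n x)\<^sup>2) \<partial>M) \<longlonglongrightarrow> 0"
  proof (rule order_tendstoI)
    fix a :: ennreal assume "0 < a"
    then obtain e where e: "e > 0" "ennreal e < a"
      by (metis ennreal_0 ennreal_enn2real_if ennreal_less_zero_iff dense infinity_ennreal_def less_top_ennreal not_less_zero order_less_trans top_neq_ennreal)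
    obtain J where J: "\<And>m n. m \<ge> J \<Longrightarrow> n \<ge> J \<Longrightarrow> (\<integral>x. (Z m x - Z n x)\<^sup>2 \<partial>M) \<le> e"
      using Cauchy[OF e(1)] by blast
    have "(\<integral>\<^sup>+x. ennreal ((Y x - Z n x)\<^sup>2) \<partial>M) \<le> ennreal e" if "n \<ge> J" for n
    proof -
      have "(\<integral>\<^sup>+x. ennreal ((Y x - Z n x)\<^sup>2) \<partial>M) = (\<integral>\<^sup>+x. liminf (\<lambda>p. ennreal ((Z (r p) x - Z n x)\<^sup>2)) \<partial>M)"
      proof (rule nn_integral_cong_AE)
        show "AE x in M. ennreal ((Y x - Z n x)\<^sup>2) = liminf (\<lambda>p. ennreal ((Z (r p) x - Z n x)\<^sup>2))"
          using conv
        proof eventually_elim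
          case (elim x)
          then have "(\<lambda>p. ennreal ((Z (r p) x - Z n x)\<^sup>2)) \<longlonglongrightarrow> ennreal ((Y x - Z n x)\<^sup>2)"
            by (intro tendsto_ennrealI tendsto_intros) (simp add: Y_def)
          from lim_imp_Liminf[OF trivial_limit_sequentially this] show ?case by (rule sym)
        qed
      qed
      also have "\<dots> \<le> liminf (\<lambda>p. \<integral>\<^sup>+x. ennreal ((Z (r p) x - Z n x)\<^sup>2) \<partial>M)"
        by (rule nn_integral_liminf) simp
      also have "\<dots> = liminf (\<lambda>p. ennreal (\<integral>x. (Z (r p) x - Z n x)\<^sup>2 \<partial>M))"
        by (simp add: nn_integral_sq[OF sq_integrable_diff[OF sq sq]])
      also have "\<dots> \<le> limsup (\<lambda>p. ennreal (\<integral>x. (Z (r p) x - Z n x)\<^sup>2 \<partial>M))"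
        by (rule Liminf_le_Limsup) simp
      also have "\<dots> \<le> ennreal e"
      proof (rule Limsup_bounded)
        show "\<forall>\<^sub>F p in sequentially. ennreal (\<integral>x. (Z (r p) x - Z n x)\<^sup>2 \<partial>M) \<le> ennreal e"
          unfolding eventually_sequentially
          by (intro exI[of _ J] allI impI ennreal_leI J that) (use rK(3) order_trans in blast)
      qed
      finally show ?thesis .
    qed
    then show "\<forall>\<^sub>F n in sequentially. (\<integral>\<^sup>+x. ennreal ((Y x - Z n x)\<^sup>2) \<partial>M) < a"
      using e(2) unfolding eventually_sequentially by (meson le_less_trans)
  qed auto
  then have L: "L2_tendsto M Z Y" by (simp add: L2_tendsto_def)
  from exI[of "L2_tendsto M Z" Y, OF L]
  show "\<exists>Y. L2_tendsto M Z Y" .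
qed

section \<open>Square roots of positive semidefinite kernels\<close>

definition psd_kernel :: "'a set \<Rightarrow> ('a \<Rightarrow> 'a \<Rightarrow> real) \<Rightarrow> bool" where
  "psd_kernel A k \<longleftrightarrow> (\<forall>x\<in>A. \<forall>y\<in>A. k x y = k y x) \<and>
     (\<forall>(n::nat) x c. (\<forall>i<n. x i \<in> A) \<longrightarrow> 0 \<le> (\<Sum>i<n. \<Sum>j<n. c i * c j * k (x i) (x j)))"

lemma psd_kernel_sym: "psd_kernel A k \<Longrightarrow> x \<in> A \<Longrightarrow> y \<in> A \<Longrightarrow> k x y = k y x"
  by (simp add: psd_kernel_def)

lemma psd_kernel_sum:
  assumes "psd_kernel A k" "\<And>i. i < (n::nat) \<Longrightarrow> x i \<in> A"
  shows "0 \<le> (\<Sum>i<n. \<Sum>j<n. c i * c j * k (x i) (x j))"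
  using assms by (simp add: psd_kernel_def)

lemma psd_kernel_Cauchy_Schwarz_sum:
  assumes psd: "psd_kernel A k" and x: "\<And>i. i < (n::nat) \<Longrightarrow> x i \<in> A" and d: "d \<in> A"
  shows "(\<Sum>i<n. c i * k (x i) d)\<^sup>2 \<le> (\<Sum>i<n. \<Sum>j<n. c i * c j * k (x i) (x j)) * k d d"
proof (rule discriminant_le)
  fix t :: real
  have "0 \<le> (\<Sum>i<Suc n. \<Sum>j<Suc n. (c(n := t)) i * (c(n := t)) j * k ((x(n := d)) i) ((x(n := d)) j))"
    using x d by (intro psd_kernel_sum[OF psd]) auto
  also have "\<dots> = (\<Sum>i<n. \<Sum>j<n. c i * c j * k (x i) (x j)) + (\<Sum>i<n. c i * t * k (x i) d)
      + (\<Sum>j<n. t * c j * k d (x j)) + t * t * k d d"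
    by (simp add: sum.distrib)
  also have "(\<Sum>j<n. t * c j * k d (x j)) = (\<Sum>i<n. c i * t * k (x i) d)"
    using psd_kernel_sym[OF psd _ d] x by (intro sum.cong) auto
  also have "(\<Sum>i<n. c i * t * k (x i) d) = t * (\<Sum>i<n. c i * k (x i) d)"
    by (simp add: sum_distrib_left ac_simps)
  finally show "0 \<le> (\<Sum>i<n. \<Sum>j<n. c i * c j * k (x i) (x j)) + 2 * t * (\<Sum>i<n. c i * k (x i) d) + t\<^sup>2 * k d d"
    by (simp add: power2_eq_square algebra_simps)
qed

lemma psd_kernel_diag: "psd_kernel A k \<Longrightarrow> x \<in> A \<Longrightarrow> 0 \<le> k x x"
  using psd_kernel_sum[of A k 1 "\<lambda>_. x" "\<lambda>_. 1"] by simp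

lemma psd_kernel_Cauchy_Schwarz:
  assumes "psd_kernel A k" "x \<in> A" "y \<in> A"
  shows "(k x y)\<^sup>2 \<le> k x x * k y y"
  using psd_kernel_Cauchy_Schwarz_sum[OF assms(1), of 1 "\<lambda>_. x" y "\<lambda>_. 1"] assms by simp

text \<open>Gaussian elimination: the residual after \<open>l\<close> steps is the conditional covariance given the first \<open>l\<close>
points of \<open>d\<close>. A vanishing pivot is harmless, since its whole row vanishes and the quotient is \<open>0\<close>.\<close>

primrec cholesky_residual :: "('a \<Rightarrow> 'a \<Rightarrow> real) \<Rightarrow> (nat \<Rightarrow> 'a) \<Rightarrow> nat \<Rightarrow> 'a \<Rightarrow> 'a \<Rightarrow> real" where
  "cholesky_residual k d 0 = k"
| "cholesky_residual k d (Suc l) = (\<lambda>x y. cholesky_residual k d l x y -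
     cholesky_residual k d l x (d l) * cholesky_residual k d l y (d l) / cholesky_residual k d l (d l) (d l))"

definition cholesky :: "('a \<Rightarrow> 'a \<Rightarrow> real) \<Rightarrow> (nat \<Rightarrow> 'a) \<Rightarrow> nat \<Rightarrow> 'a \<Rightarrow> real" where
  "cholesky k d l x = cholesky_residual k d l x (d l) / sqrt (cholesky_residual k d l (d l) (d l))"

text \<open>The Schur complement of a diagonal entry. Its quadratic form is nonnegative by the Cauchy-Schwarz inequality
between the given linear combination and the point \<open>d\<close>.\<close>

lemma psd_kernel_residual_step:
  assumes psd: "psd_kernel A k" and d: "d \<in> A"
  shows "psd_kernel A (\<lambda>x y. k x y - k x d * k y d / k d d)"
  unfolding psd_kernel_def
proof (intro conjI allI impI ballI)
  fix x y assume "x \<in> A" "y \<in> A"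
  then show "k x y - k x d * k y d / k d d = k y x - k y d * k x d / k d d"
    using psd_kernel_sym[OF psd] by simp
next
  fix n :: nat and x c assume x: "\<forall>i<n. x i \<in> A"
  let ?a = "\<Sum>i<n. \<Sum>j<n. c i * c j * k (x i) (x j)" and ?b = "\<Sum>i<n. c i * k (x i) d"
  have "(\<Sum>i<n. \<Sum>j<n. c i * c j * (k (x i) (x j) - k (x i) d * k (x j) d / k d d)) = ?a - ?b\<^sup>2 / k d d"
    by (simp add: algebra_simps sum_subtractf power2_eq_square sum_product sum_divide_distrib)
  moreover have "?b\<^sup>2 / k d d \<le> ?a"
  proof (cases "k d d = 0")
    case True
    then show ?thesis using psd_kernel_sum[OF psd, of n x c] x by simp
  next
    case False
    with psd_kernel_diag[OF psd d] have "0 < k d d" by simp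
    then show ?thesis using psd_kernel_Cauchy_Schwarz_sum[OF psd, of n x d c] x d by (simp add: field_simps)
  qed
  ultimately show "0 \<le> (\<Sum>i<n. \<Sum>j<n. c i * c j * (k (x i) (x j) - k (x i) d * k (x j) d / k d d))"
    by simp
qed

context
  fixes A :: "'a set" and k :: "'a \<Rightarrow> 'a \<Rightarrow> real" and d :: "nat \<Rightarrow> 'a"
  assumes psd: "psd_kernel A k" and d: "\<And>l. d l \<in> A"
begin

lemma psd_cholesky_residual: "psd_kernel A (cholesky_residual k d l)"
proof (induction l)
  case (Suc l)
  from psd_kernel_residual_step[OF Suc d[of l]] show ?case by simp
qed (use psd in simp)

lemma cholesky_residual_Suc:
  "cholesky_residual k d (Suc l) x y = cholesky_residual k d l x y - cholesky k d l x * cholesky k d l y"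
  using psd_kernel_diag[OF psd_cholesky_residual d, of l l] by (simp add: cholesky_def field_simps)

lemma cholesky_residual_eq:
  "cholesky_residual k d n x y = k x y - (\<Sum>l<n. cholesky k d l x * cholesky k d l y)"
proof (induction n)
  case (Suc n) then show ?case unfolding cholesky_residual_Suc by simp
qed simp

text \<open>Step \<open>l\<close> annihilates row and column \<open>d l\<close>, and later steps keep them at zero. If the pivot vanishes, then the
row vanishes already before step \<open>l\<close>, by the Cauchy-Schwarz inequality.\<close>

lemma cholesky_residual_vanishes:
  assumes "x \<in> A" "l < n"
  shows "cholesky_residual k d n x (d l) = 0"
  using assms
proof (induction n arbitrary: x)
  case (Suc n)
  let ?R = "cholesky_residual k d n"
  show ?case
  proof (cases "l = n")
    case True
    have "?R (d n) (d n) = 0 \<Longrightarrow> ?R x (d n) = 0"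
      using psd_kernel_Cauchy_Schwarz[OF psd_cholesky_residual Suc.prems(1) d, of n n] by simp
    then show ?thesis using True by simp
  next
    case False
    then have "?R x (d l) = 0" "?R (d n) (d l) = 0" using Suc d by auto
    moreover have "?R (d l) (d n) = ?R (d n) (d l)"
      by (rule psd_kernel_sym[OF psd_cholesky_residual d d])
    ultimately show ?thesis by simp
  qed
qed simp

text \<open>Elimination decreases the squared distance that the kernel induces, because a sum of squares is subtracted.
A point close to some \<open>d l\<close> therefore has a small residual once \<open>d l\<close> has been eliminated.\<close>

lemma cholesky_residual_quadratic_le:
  "cholesky_residual k d n x x - 2 * cholesky_residual k d n x y + cholesky_residual k d n y y
    \<le> k x x - 2 * k x y + k y y"
proof -
  have 1: "(\<Sum>l<n. cholesky k d l x * cholesky k d l x) - 2 * (\<Sum>l<n. cholesky k d l x * cholesky k d l y)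
      + (\<Sum>l<n. cholesky k d l y * cholesky k d l y) = (\<Sum>l<n. (cholesky k d l x - cholesky k d l y)\<^sup>2)"
    by (simp add: power2_eq_square algebra_simps sum.distrib sum_subtractf sum_distrib_left)
  have 2: "(\<Sum>l<n. (cholesky k d l x - cholesky k d l y)\<^sup>2) \<ge> 0" by (intro sum_nonneg) auto
  have "a - 2 * b + c = s \<Longrightarrow> 0 \<le> s \<Longrightarrow> (p - a) - 2 * (q - b) + (r - c) \<le> p - 2 * q + r"
    for a b c p q r s :: real by simp
  from this[OF 1 2] show ?thesis unfolding cholesky_residual_eq .
qed

text \<open>A factorization of a positive semidefinite kernel on an infinite set into a series of products. On the
diagonal the residual tends to \<open>0\<close> because \<open>d\<close> is dense for the distance induced by \<open>k\<close>; off the diagonal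
the Cauchy-Schwarz inequality applies.\<close>

theorem cholesky_sums:
  assumes dense: "\<And>x e. x \<in> A \<Longrightarrow> e > 0 \<Longrightarrow> \<exists>l. k x x - 2 * k x (d l) + k (d l) (d l) < e"
    and x: "x \<in> A" and y: "y \<in> A"
  shows "(\<lambda>l. cholesky k d l x * cholesky k d l y) sums k x y"
proof -
  have diag: "(\<lambda>n. cholesky_residual k d n x x) \<longlonglongrightarrow> 0" if x: "x \<in> A" for x
  proof (rule order_tendstoI)
    fix a :: real assume "a < 0"
    then show "\<forall>\<^sub>F n in sequentially. a < cholesky_residual k d n x x"
      using psd_kernel_diag[OF psd_cholesky_residual x] by (auto intro: always_eventually less_le_trans)
  next
    fix a :: real assume "0 < a"
    then obtain l where l: "k x x - 2 * k x (d l) + k (d l) (d l) < a" using dense[OF x] by blast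
    have "cholesky_residual k d n x x < a" if "n > l" for n
      using cholesky_residual_quadratic_le[of n x "d l"] l cholesky_residual_vanishes[OF x that]
        cholesky_residual_vanishes[OF d that, of l] by simp
    then show "\<forall>\<^sub>F n in sequentially. cholesky_residual k d n x x < a"
      by (auto intro: eventually_sequentiallyI[of "Suc l"])
  qed
  have "(\<lambda>n. cholesky_residual k d n x y) \<longlonglongrightarrow> 0"
  proof (rule Lim_null_comparison)
    show "\<forall>\<^sub>F n in sequentially. norm (cholesky_residual k d n x y)
        \<le> sqrt (cholesky_residual k d n x x * cholesky_residual k d n y y)"
      using psd_kernel_Cauchy_Schwarz[OF psd_cholesky_residual x y]
      by (intro always_eventually allI) (metis real_norm_def real_sqrt_abs real_sqrt_le_mono)
    show "(\<lambda>n. sqrt (cholesky_residual k d n x x * cholesky_residual k d n y y)) \<longlonglongrightarrow> 0"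
      using tendsto_real_sqrt[OF tendsto_mult_zero[OF diag[OF x] diag[OF y]]] by simp
  qed
  then have "(\<lambda>n. k x y - cholesky_residual k d n x y) \<longlonglongrightarrow> k x y - 0" by (intro tendsto_intros)
  then show ?thesis by (simp add: sums_def cholesky_residual_eq)
qed

end

text \<open>The points of elimination do not depend on the parameter, so that each factor is a rational expression in finitely
many values of the kernel and square roots of pivots. This is why elimination is preferable to a spectral
decomposition, where the eigenfunctions would have to be selected measurably.\<close>

lemma measurable_cholesky:
  assumes k: "\<And>x y. x \<in> A \<Longrightarrow> y \<in> A \<Longrightarrow> (\<lambda>t. k t x y) \<in> borel_measurable M" and d: "\<And>l. d l \<in> A" and x: "x \<in> A"
  shows "(\<lambda>t. cholesky (k t) d l x) \<in> borel_measurable M"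
proof -
  have [measurable]: "(\<lambda>t. cholesky_residual (k t) d l x y) \<in> borel_measurable M" if "x \<in> A" "y \<in> A" for l x y
    using that by (induction l arbitrary: x y) (auto intro!: k borel_measurable_diff borel_measurable_divide borel_measurable_times d)
  show ?thesis using x d unfolding cholesky_def by measurable
qed

section \<open>Laws determined by one-dimensional characteristic functions\<close>

lemma (in finite_measure) integrable_bounded:
  fixes f :: "'a \<Rightarrow> real"
  assumes "f \<in> borel_measurable M" "\<And>x. x \<in> space M \<Longrightarrow> \<bar>f x\<bar> \<le> C"
  shows "integrable M f"
  using assms by (intro integrable_const_bound[where B=C]) auto

lemma (in finite_measure) integrable_trig_weight:
  fixes f w :: "'a \<Rightarrow> real"
  assumes [measurable]: "f \<in> borel_measurable M" "w \<in> borel_measurable M" and w: "\<And>x. \<bar>w x\<bar> \<le> C"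
  shows "integrable M (\<lambda>x. cos (f x) * w x)" "integrable M (\<lambda>x. sin (f x) * w x)"
proof -
  have C: "0 \<le> C" using w[of undefined] by simp
  have "\<bar>cos (f x) * w x\<bar> \<le> 1 * C" "\<bar>sin (f x) * w x\<bar> \<le> 1 * C" for x
    unfolding abs_mult using w[of x] C by (intro mult_mono; simp)+
  then show "integrable M (\<lambda>x. cos (f x) * w x)" "integrable M (\<lambda>x. sin (f x) * w x)"
    by (intro integrable_bounded[where C="1 * C"]; simp)+
qed

text \<open>After normalization the weights are densities of probability measures, and the image measures under \<open>Y\<close> and \<open>Z\<close>
agree by Levy's uniqueness theorem. The weights make it possible to treat several coordinates one at a time.\<close>

lemma weighted_law_eqI:
  fixes Y :: "'a \<Rightarrow> real" and Z :: "'b \<Rightarrow> real"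
  assumes fin: "finite_measure M" "finite_measure N"
    and [measurable]: "Y \<in> borel_measurable M" "Z \<in> borel_measurable N"
      "w \<in> borel_measurable M" "v \<in> borel_measurable N"
    and w: "\<And>x. 0 \<le> w x" "\<And>x. w x \<le> C" and v: "\<And>x. 0 \<le> v x" "\<And>x. v x \<le> C"
    and c: "\<And>s. (\<integral>x. cos (s * Y x) * w x \<partial>M) = (\<integral>x. cos (s * Z x) * v x \<partial>N)"
    and s: "\<And>s. (\<integral>x. sin (s * Y x) * w x \<partial>M) = (\<integral>x. sin (s * Z x) * v x \<partial>N)"
    and [measurable]: "A \<in> sets borel"
  shows "(\<integral>x. indicator A (Y x) * w x \<partial>M) = (\<integral>x. indicator A (Z x) * v x \<partial>N)"
proof -
  interpret M: finite_measure M by fact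
  interpret N: finite_measure N by fact
  have wC: "\<bar>w x\<bar> \<le> C" "\<bar>v y\<bar> \<le> C" for x y using w v by auto
  define m where "m = (\<integral>x. w x \<partial>M)"
  have iw: "integrable M w" and iv: "integrable N v"
    using M.integrable_trig_weight(1)[of "\<lambda>_. 0" w C] N.integrable_trig_weight(1)[of "\<lambda>_. 0" v C] wC by auto
  have m: "m = (\<integral>x. v x \<partial>N)" using c[of 0] by (simp add: m_def)
  have "m \<ge> 0" unfolding m_def using w by simp
  show ?thesis
  proof (cases "m = 0")
    case True
    then have "AE x in M. w x = 0" "AE x in N. v x = 0"
      using iw iv w v m integral_nonneg_eq_0_iff_AE[of M w] integral_nonneg_eq_0_iff_AE[of N v]
      by (auto simp: m_def)
    then have "(\<integral>x. indicator A (Y x) * w x \<partial>M) = (\<integral>x. 0 \<partial>M)"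
      "(\<integral>x. indicator A (Z x) * v x \<partial>N) = (\<integral>x. 0 \<partial>N)"
      by (intro integral_cong_AE; auto)+
    then show ?thesis by simp
  next
    case False
    with \<open>m \<ge> 0\<close> have "m > 0" by simp
    define DM where "DM = distr (density M (\<lambda>x. ennreal (w x / m))) borel Y"
    define DN where "DN = distr (density N (\<lambda>x. ennreal (v x / m))) borel Z"
    have "emeasure (density M (\<lambda>x. ennreal (w x / m))) (space M) = 1"
      using iw \<open>m > 0\<close> w by (subst emeasure_density) (auto simp: nn_integral_eq_integral m_def simp flip: ennreal_1)
    then have pM: "prob_space (density M (\<lambda>x. ennreal (w x / m)))" by (intro prob_spaceI) simp
    have "emeasure (density N (\<lambda>x. ennreal (v x / m))) (space N) = 1"
      using iv \<open>m > 0\<close> v m by (subst emeasure_density) (auto simp: nn_integral_eq_integral simp flip: ennreal_1)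
    then have pN: "prob_space (density N (\<lambda>x. ennreal (v x / m)))" by (intro prob_spaceI) simp
    have rd: "real_distribution DM" "real_distribution DN"
      unfolding DM_def DN_def by (intro prob_space.real_distribution_distr pM pN; simp)+
    have "char DM = char DN"
    proof
      fix t
      have int: "complex_integrable M (\<lambda>x. (w x / m) *\<^sub>R iexp (t * Y x))"
        "complex_integrable N (\<lambda>x. (v x / m) *\<^sub>R iexp (t * Z x))"
        using w v \<open>m > 0\<close>
        by (auto intro!: M.integrable_const_bound[where B="C / m"] N.integrable_const_bound[where B="C / m"] AE_I2
            simp: divide_le_cancel)
      have "char DM t = (\<integral>x. (w x / m) *\<^sub>R iexp (t * Y x) \<partial>M)"
        unfolding char_def DM_def using w \<open>m > 0\<close> by (subst integral_distr) (simp_all add: integral_density)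
      also have "\<dots> = (\<integral>x. (v x / m) *\<^sub>R iexp (t * Z x) \<partial>N)"
      proof (rule complex_eqI)
        show "Re (\<integral>x. (w x / m) *\<^sub>R iexp (t * Y x) \<partial>M) = Re (\<integral>x. (v x / m) *\<^sub>R iexp (t * Z x) \<partial>N)"
          using c[of t] integral_Re[OF int(1)] integral_Re[OF int(2)] by (simp add: Re_exp mult.commute)
        show "Im (\<integral>x. (w x / m) *\<^sub>R iexp (t * Y x) \<partial>M) = Im (\<integral>x. (v x / m) *\<^sub>R iexp (t * Z x) \<partial>N)"
          using s[of t] integral_Im[OF int(1)] integral_Im[OF int(2)] by (simp add: Im_exp mult.commute)
      qed
      also have "\<dots> = char DN t"
        unfolding char_def DN_def using v \<open>m > 0\<close> by (subst integral_distr) (simp_all add: integral_density)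
      finally show "char DM t = char DN t" .
    qed
    then have "DM = DN" using rd by (intro Levy_uniqueness)
    then have eq: "(\<integral>x. indicator A x \<partial>DM) = (\<integral>x. indicator A x \<partial>DN :: real)" by metis
    have "(\<integral>x. indicator A x \<partial>DM :: real) = (\<integral>x. (w x / m) *\<^sub>R (indicator A (Y x)) \<partial>M)"
      unfolding DM_def using w \<open>m > 0\<close> by (subst integral_distr) (simp_all add: integral_density)
    moreover have "(\<integral>x. indicator A x \<partial>DN :: real) = (\<integral>x. (v x / m) *\<^sub>R (indicator A (Z x)) \<partial>N)"
      unfolding DN_def using v \<open>m > 0\<close> by (subst integral_distr) (simp_all add: integral_density)
    ultimately show ?thesis using \<open>m > 0\<close> eq by (simp add: mult.commute)
  qed
qed

text \<open>Products of a wave and a weight \<open>1 + cos\<close> or \<open>1 + sin\<close> are combinations of waves. The weights are shifted by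
\<open>1\<close> to be nonnegative.\<close>

lemma trig_weight_products:
  fixes a b :: real
  shows "cos a * ((1 + cos b) * w) = cos a * w + (cos (a + b) * w + cos (- a + b) * w) / 2"
    "sin a * ((1 + cos b) * w) = sin a * w + (sin (a + b) * w - sin (- a + b) * w) / 2"
    "cos a * ((1 + sin b) * w) = cos a * w + (sin (a + b) * w + sin (- a + b) * w) / 2"
    "sin a * ((1 + sin b) * w) = sin a * w + (cos (- a + b) * w - cos (a + b) * w) / 2"
  by (simp_all add: cos_add sin_add cos_diff sin_diff algebra_simps)

text \<open>Induction on \<open>J\<close>, in which the indicator of the new coordinate is absorbed into the weight. The trigonometric
moments for the new weight follow from \<open>weighted_law_eqI\<close>, applied to the new coordinate with the weights
\<open>(1 + cos) w\<close> and \<open>(1 + sin) w\<close>, by subtracting the result for \<open>w\<close> itself.\<close>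

lemma Cramer_Wold_weighted:
  fixes Y :: "'i \<Rightarrow> 'a \<Rightarrow> real" and Z :: "'i \<Rightarrow> 'b \<Rightarrow> real"
  assumes "finite J"
    and fin: "finite_measure M" "finite_measure N"
    and Y: "\<And>j. j \<in> J \<Longrightarrow> Y j \<in> borel_measurable M" and Z: "\<And>j. j \<in> J \<Longrightarrow> Z j \<in> borel_measurable N"
    and "w \<in> borel_measurable M" "v \<in> borel_measurable N"
    and "\<And>x. 0 \<le> w x" "\<And>x. w x \<le> C" "\<And>x. 0 \<le> v x" "\<And>x. v x \<le> C"
    and "\<And>c. (\<integral>x. cos (\<Sum>j\<in>J. c j * Y j x) * w x \<partial>M) = (\<integral>x. cos (\<Sum>j\<in>J. c j * Z j x) * v x \<partial>N)"
    and "\<And>c. (\<integral>x. sin (\<Sum>j\<in>J. c j * Y j x) * w x \<partial>M) = (\<integral>x. sin (\<Sum>j\<in>J. c j * Z j x) * v x \<partial>N)"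
    and A: "\<And>j. j \<in> J \<Longrightarrow> A j \<in> sets borel"
  shows "(\<integral>x. (\<Prod>j\<in>J. indicator (A j) (Y j x)) * w x \<partial>M) = (\<integral>x. (\<Prod>j\<in>J. indicator (A j) (Z j x)) * v x \<partial>N)"
  using assms
proof (induction J arbitrary: w v rule: finite_induct)
  case empty
  from empty.prems(11)[of undefined] show ?case by simp
next
  case (insert k J)
  interpret M: finite_measure M by fact
  interpret N: finite_measure N by fact
  note [measurable] = insert.prems(5,6)
  have [measurable]: "Y k \<in> borel_measurable M" "Z k \<in> borel_measurable N" "A k \<in> sets borel"
    "\<And>j. j \<in> J \<Longrightarrow> Y j \<in> borel_measurable M" "\<And>j. j \<in> J \<Longrightarrow> Z j \<in> borel_measurable N"
    using insert.prems by auto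
  note w = insert.prems(7,8) and v = insert.prems(9,10)
  have wC: "\<bar>w x\<bar> \<le> C" "\<bar>v y\<bar> \<le> C" for x y using w v by auto
  have C: "0 \<le> C" using wC(1)[of undefined] by simp
  note intM = M.integrable_trig_weight[OF _ _ wC(1)] and intN = N.integrable_trig_weight[OF _ _ wC(2)]
  have cs: "(\<integral>x. cos (s * Y k x + (\<Sum>j\<in>J. c j * Y j x)) * w x \<partial>M) = (\<integral>x. cos (s * Z k x + (\<Sum>j\<in>J. c j * Z j x)) * v x \<partial>N)"
     "(\<integral>x. sin (s * Y k x + (\<Sum>j\<in>J. c j * Y j x)) * w x \<partial>M) = (\<integral>x. sin (s * Z k x + (\<Sum>j\<in>J. c j * Z j x)) * v x \<partial>N)" for c s
  proof -
    have "(\<Sum>j\<in>J. (c(k := s)) j * f j) = (\<Sum>j\<in>J. c j * f j)" for f :: "'i \<Rightarrow> real"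
      using insert.hyps by (intro sum.cong) auto
    then show "(\<integral>x. cos (s * Y k x + (\<Sum>j\<in>J. c j * Y j x)) * w x \<partial>M) = (\<integral>x. cos (s * Z k x + (\<Sum>j\<in>J. c j * Z j x)) * v x \<partial>N)"
     "(\<integral>x. sin (s * Y k x + (\<Sum>j\<in>J. c j * Y j x)) * w x \<partial>M) = (\<integral>x. sin (s * Z k x + (\<Sum>j\<in>J. c j * Z j x)) * v x \<partial>N)"
      using insert.prems(11)[of "c(k := s)"] insert.prems(12)[of "c(k := s)"] insert.hyps by simp_all
  qed
  have cs0: "(\<integral>x. cos (s * Y k x) * w x \<partial>M) = (\<integral>x. cos (s * Z k x) * v x \<partial>N)"
     "(\<integral>x. sin (s * Y k x) * w x \<partial>M) = (\<integral>x. sin (s * Z k x) * v x \<partial>N)" for s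
    using cs[of s "\<lambda>_. 0"] by simp_all
  have csm: "(\<integral>x. cos ((\<Sum>j\<in>J. c j * Y j x) - s * Y k x) * w x \<partial>M) = (\<integral>x. cos ((\<Sum>j\<in>J. c j * Z j x) - s * Z k x) * v x \<partial>N)"
     "(\<integral>x. sin ((\<Sum>j\<in>J. c j * Y j x) - s * Y k x) * w x \<partial>M) = (\<integral>x. sin ((\<Sum>j\<in>J. c j * Z j x) - s * Z k x) * v x \<partial>N)" for c s
    using cs[of "-s" c] by simp_all
  have ind: "\<bar>indicator (A k) y * w x\<bar> \<le> C" "\<bar>indicator (A k) y * v z\<bar> \<le> C" for x y z
    using wC C by (auto simp: indicator_def)
  have plain: "(\<integral>x. indicator (A k) (Y k x) * w x \<partial>M) = (\<integral>x. indicator (A k) (Z k x) * v x \<partial>N)"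
    by (rule weighted_law_eqI[where C=C]) (use fin w v cs0 in auto)
  have plus: "(\<integral>x. indicator (A k) (Y k x) * ((1 + cos (\<Sum>j\<in>J. c j * Y j x)) * w x) \<partial>M)
      = (\<integral>x. indicator (A k) (Z k x) * ((1 + cos (\<Sum>j\<in>J. c j * Z j x)) * v x) \<partial>N)"
    "(\<integral>x. indicator (A k) (Y k x) * ((1 + sin (\<Sum>j\<in>J. c j * Y j x)) * w x) \<partial>M)
      = (\<integral>x. indicator (A k) (Z k x) * ((1 + sin (\<Sum>j\<in>J. c j * Z j x)) * v x) \<partial>N)" for c
  proof -
    have ge: "0 \<le> 1 + cos y" "0 \<le> 1 + sin y" "1 + cos y \<le> 2" "1 + sin y \<le> 2" for y :: real
      using cos_ge_minus_one[of y] sin_ge_minus_one[of y] cos_le_one[of y] sin_le_one[of y] by linarith+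
    have le: "(1 + cos y) * w x \<le> 2 * C" "(1 + sin y) * w x \<le> 2 * C"
      "(1 + cos y) * v z \<le> 2 * C" "(1 + sin y) * v z \<le> 2 * C" for x y z
      using ge[of y] w[of x] v[of z] by (intro mult_mono; simp)+
    show "(\<integral>x. indicator (A k) (Y k x) * ((1 + cos (\<Sum>j\<in>J. c j * Y j x)) * w x) \<partial>M)
      = (\<integral>x. indicator (A k) (Z k x) * ((1 + cos (\<Sum>j\<in>J. c j * Z j x)) * v x) \<partial>N)"
      by (rule weighted_law_eqI[where C="2 * C"])
         (use fin w v ge le in \<open>auto simp: trig_weight_products intM intN cs cs0 csm\<close>)
    show "(\<integral>x. indicator (A k) (Y k x) * ((1 + sin (\<Sum>j\<in>J. c j * Y j x)) * w x) \<partial>M)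
      = (\<integral>x. indicator (A k) (Z k x) * ((1 + sin (\<Sum>j\<in>J. c j * Z j x)) * v x) \<partial>N)"
      by (rule weighted_law_eqI[where C="2 * C"])
         (use fin w v ge le in \<open>auto simp: trig_weight_products intM intN cs cs0 csm\<close>)
  qed
  let ?w = "\<lambda>x. indicator (A k) (Y k x) * w x" and ?v = "\<lambda>x. indicator (A k) (Z k x) * v x"
  have intw: "integrable M ?w" "integrable N ?v"
    using ind by (intro M.integrable_bounded N.integrable_bounded; measurable)+
  note intM' = M.integrable_trig_weight[OF _ _ ind(1)] and intN' = N.integrable_trig_weight[OF _ _ ind(2)]
  have split: "i * ((1 + t) * w) = i * w + t * (i * w)" for i t w :: real by (simp add: algebra_simps)
  have "(\<integral>x. cos (\<Sum>j\<in>J. c j * Y j x) * ?w x \<partial>M) = (\<integral>x. cos (\<Sum>j\<in>J. c j * Z j x) * ?v x \<partial>N)" for c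
    using plus(1)[of c] plain intw by (simp add: split intM' intN')
  moreover have "(\<integral>x. sin (\<Sum>j\<in>J. c j * Y j x) * ?w x \<partial>M) = (\<integral>x. sin (\<Sum>j\<in>J. c j * Z j x) * ?v x \<partial>N)" for c
    using plus(2)[of c] plain intw by (simp add: split intM' intN')
  moreover have "0 \<le> ?w x" "?w x \<le> C" "0 \<le> ?v y" "?v y \<le> C" for x y
    using w v C by (auto simp: indicator_def)
  ultimately have "(\<integral>x. (\<Prod>j\<in>J. indicator (A j) (Y j x)) * ?w x \<partial>M) = (\<integral>x. (\<Prod>j\<in>J. indicator (A j) (Z j x)) * ?v x \<partial>N)"
    by (intro insert.IH) (use insert.prems in auto)
  then show ?case using insert.hyps by (simp add: ac_simps)
qed

text \<open>The real and imaginary parts of the given characteristic functions are the trigonometric moments of all linear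
combinations. They determine the probabilities of boxes, and boxes generate the product \<open>\<sigma>\<close>-algebra.\<close>

theorem Cramer_Wold:
  fixes Y :: "'i \<Rightarrow> 'a \<Rightarrow> real" and Z :: "'i \<Rightarrow> 'b \<Rightarrow> real"
  assumes M: "prob_space M" and N: "prob_space N"
    and Y[measurable]: "\<And>i. i \<in> I \<Longrightarrow> Y i \<in> borel_measurable M" and Z[measurable]: "\<And>i. i \<in> I \<Longrightarrow> Z i \<in> borel_measurable N"
    and eq: "\<And>J c. finite J \<Longrightarrow> J \<subseteq> I \<Longrightarrow>
       char (distr M borel (\<lambda>x. \<Sum>j\<in>J. c j * Y j x)) 1 = char (distr N borel (\<lambda>x. \<Sum>j\<in>J. c j * Z j x)) 1"
  shows "distr M (\<Pi>\<^sub>M i\<in>I. borel) (\<lambda>x. \<lambda>i\<in>I. Y i x) = distr N (\<Pi>\<^sub>M i\<in>I. borel) (\<lambda>x. \<lambda>i\<in>I. Z i x)"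
proof (rule measure_eqI_PiM_infinite)
  interpret M: prob_space M by fact
  interpret N: prob_space N by fact
  show "finite_measure (distr M (\<Pi>\<^sub>M i\<in>I. borel) (\<lambda>x. \<lambda>i\<in>I. Y i x))"
    by (intro M.finite_measure_distr measurable_restrict Y)
  fix A and J assume J: "finite J" "J \<subseteq> I" and A: "\<And>i. i \<in> J \<Longrightarrow> A i \<in> sets (borel :: real measure)"
  have [measurable]: "\<And>j. j \<in> J \<Longrightarrow> Y j \<in> borel_measurable M" "\<And>j. j \<in> J \<Longrightarrow> Z j \<in> borel_measurable N"
    "\<And>j. j \<in> J \<Longrightarrow> A j \<in> sets borel"
    using J A by auto
  have cexp: "Re (char (distr K borel f) 1) = (\<integral>x. cos (f x) \<partial>K)" "Im (char (distr K borel f) 1) = (\<integral>x. sin (f x) \<partial>K)"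
    if "prob_space K" and [measurable]: "f \<in> borel_measurable K" for K :: "'c measure" and f
  proof -
    interpret K: prob_space K by fact
    have int: "complex_integrable K (\<lambda>x. iexp (f x))"
      by (intro K.integrable_const_bound[where B=1]) auto
    show "Re (char (distr K borel f) 1) = (\<integral>x. cos (f x) \<partial>K)" "Im (char (distr K borel f) 1) = (\<integral>x. sin (f x) \<partial>K)"
      using integral_Re[OF int] integral_Im[OF int] by (simp_all add: char_def integral_distr Re_exp Im_exp)
  qed
  have c: "(\<integral>x. cos (\<Sum>j\<in>J. c j * Y j x) \<partial>M) = (\<integral>x. cos (\<Sum>j\<in>J. c j * Z j x) \<partial>N)"
    "(\<integral>x. sin (\<Sum>j\<in>J. c j * Y j x) \<partial>M) = (\<integral>x. sin (\<Sum>j\<in>J. c j * Z j x) \<partial>N)" for c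
    using cexp[OF M, of "\<lambda>x. \<Sum>j\<in>J. c j * Y j x"] cexp[OF N, of "\<lambda>x. \<Sum>j\<in>J. c j * Z j x"] eq[OF J, of c]
    by simp_all
  have eq1: "(\<integral>x. (\<Prod>j\<in>J. indicator (A j) (Y j x)) * 1 \<partial>M) = (\<integral>x. (\<Prod>j\<in>J. indicator (A j) (Z j x)) * (1::real) \<partial>N)"
    by (rule Cramer_Wold_weighted[where C=1]) (use J A c in \<open>auto intro: M.finite_measure_axioms N.finite_measure_axioms\<close>)
  have box: "(\<integral>x. (\<Prod>j\<in>J. indicator (A j) (f j x)) * 1 \<partial>K) = measure K {x\<in>space K. \<forall>j\<in>J. f j x \<in> A j}"
    if [measurable]: "\<And>j. j \<in> J \<Longrightarrow> f j \<in> borel_measurable K" for f :: "'i \<Rightarrow> 'c \<Rightarrow> real" and K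
  proof -
    have "(\<Prod>j\<in>J. indicator (A j) (f j x)) = (indicator {x\<in>space K. \<forall>j\<in>J. f j x \<in> A j} x :: real)" if "x \<in> space K" for x
      using J(1) that by (auto simp: indicator_def prod_zero_iff split: if_splits)
    then have "(\<integral>x. (\<Prod>j\<in>J. indicator (A j) (f j x)) * 1 \<partial>K) = (\<integral>x. indicator {x\<in>space K. \<forall>j\<in>J. f j x \<in> A j} x \<partial>K :: real)"
      by (intro Bochner_Integration.integral_cong) auto
    moreover have "{x\<in>space K. \<forall>j\<in>J. f j x \<in> A j} \<subseteq> space K" by auto
    ultimately show ?thesis by (simp add: Int_absorb2)
  qed
  have eq2: "measure M {x\<in>space M. \<forall>j\<in>J. Y j x \<in> A j} = measure N {x\<in>space N. \<forall>j\<in>J. Z j x \<in> A j}"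
    using eq1 box[of Y M] box[of Z N] by simp
  have em: "emeasure (distr K (\<Pi>\<^sub>M i\<in>I. borel) (\<lambda>x. \<lambda>i\<in>I. f i x)) (prod_emb I (\<lambda>_. borel) J (Pi\<^sub>E J A))
     = emeasure K {x\<in>space K. \<forall>j\<in>J. f j x \<in> A j}"
    if "\<And>j. j \<in> I \<Longrightarrow> f j \<in> borel_measurable K" for f :: "'i \<Rightarrow> 'c \<Rightarrow> real" and K
  proof -
    have "prod_emb I (\<lambda>_. borel) J (Pi\<^sub>E J A) \<in> sets (\<Pi>\<^sub>M i\<in>I. borel)"
      using J A by (intro sets_PiM_I) auto
    moreover have "(\<lambda>x. \<lambda>i\<in>I. f i x) -` prod_emb I (\<lambda>_. borel) J (Pi\<^sub>E J A) \<inter> space K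
        = {x\<in>space K. \<forall>j\<in>J. f j x \<in> A j}"
      using subsetD[OF J(2)] by (auto simp: prod_emb_def PiE_iff)
    ultimately show ?thesis using that by (simp add: emeasure_distr measurable_restrict)
  qed
  show "emeasure (distr M (\<Pi>\<^sub>M i\<in>I. borel) (\<lambda>x. \<lambda>i\<in>I. Y i x)) (prod_emb I (\<lambda>_. borel) J (Pi\<^sub>E J A))
     = emeasure (distr N (\<Pi>\<^sub>M i\<in>I. borel) (\<lambda>x. \<lambda>i\<in>I. Z i x)) (prod_emb I (\<lambda>_. borel) J (Pi\<^sub>E J A))"
    using Y Z eq2 by (simp add: em M.emeasure_eq_measure N.emeasure_eq_measure)
qed simp_all

section \<open>Gaussian spaces\<close>

text \<open>Stated by means of the characteristic function, so that variance \<open>0\<close> is included and the property passes to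
\<open>L\<^sup>2\<close> limits.\<close>

definition centered_gaussian :: "'a measure \<Rightarrow> ('a \<Rightarrow> real) \<Rightarrow> bool" where
  "centered_gaussian M Y \<longleftrightarrow> sq_integrable M Y \<and>
     (\<forall>t. char (distr M borel Y) t = complex_of_real (exp (- (t\<^sup>2 * (\<integral>x. (Y x)\<^sup>2 \<partial>M)) / 2)))"

lemma char_distr:
  assumes "Y \<in> borel_measurable M"
  shows "char (distr M borel Y) t = (\<integral>x. iexp (t * Y x) \<partial>M)"
  unfolding char_def using assms by (subst integral_distr) auto

lemma char_distr_cmult:
  assumes [measurable]: "Y \<in> borel_measurable M"
  shows "char (distr M borel (\<lambda>x. c * Y x)) t = char (distr M borel Y) (t * c)"
  by (simp add: char_distr mult.assoc)

lemma (in prob_space) char_normal: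
  assumes "\<sigma> > 0" "distributed M lborel Y (normal_density 0 \<sigma>)"
  shows "char (distr M borel Y) t = complex_of_real (exp (- (t\<^sup>2 * \<sigma>\<^sup>2) / 2))"
proof -
  have [measurable]: "Y \<in> borel_measurable M" using distributed_measurable[OF assms(2)] by simp
  have "distributed M lborel (\<lambda>x. Y x / \<sigma>) std_normal_density"
    using normal_standard_normal_convert[OF assms(1), of Y 0] assms(2) by simp
  then have "distr M lborel (\<lambda>x. Y x / \<sigma>) = std_normal_distribution"
    by (rule distributed_distr_eq_density)
  moreover have "distr M lborel (\<lambda>x. Y x / \<sigma>) = distr M borel (\<lambda>x. Y x / \<sigma>)"
    by (rule distr_cong) auto
  ultimately have *: "distr M borel (\<lambda>x. Y x / \<sigma>) = std_normal_distribution" by simp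
  have "char (distr M borel (\<lambda>x. \<sigma> * (Y x / \<sigma>))) t = char std_normal_distribution (t * \<sigma>)"
    unfolding *[symmetric] by (rule char_distr_cmult) simp
  then show ?thesis using assms(1) by (simp add: char_std_normal_distribution power_mult_distrib)
qed

lemma (in prob_space) centered_gaussian_normal:
  assumes "\<sigma> > 0" "distributed M lborel Y (normal_density 0 \<sigma>)"
  shows "centered_gaussian M Y" "(\<integral>x. (Y x)\<^sup>2 \<partial>M) = \<sigma>\<^sup>2"
proof -
  have [measurable]: "Y \<in> borel_measurable M" using distributed_measurable[OF assms(2)] by simp
  have "has_bochner_integral lborel (\<lambda>x. normal_density 0 \<sigma> x * x\<^sup>2) (\<sigma>\<^sup>2)"
    using normal_moment_even[OF assms(1), of 0 1] assms(1) by simp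
  then have "integrable lborel (\<lambda>x. normal_density 0 \<sigma> x * x\<^sup>2)" "(\<integral>x. normal_density 0 \<sigma> x * x\<^sup>2 \<partial>lborel) = \<sigma>\<^sup>2"
    by (auto simp: has_bochner_integral_iff)
  moreover have "integrable M (\<lambda>x. (Y x)\<^sup>2) \<longleftrightarrow> integrable lborel (\<lambda>x. normal_density 0 \<sigma> x * x\<^sup>2)"
    by (rule distributed_integrable[OF assms(2), symmetric]) auto
  moreover have "(\<integral>x. normal_density 0 \<sigma> x * x\<^sup>2 \<partial>lborel) = (\<integral>x. (Y x)\<^sup>2 \<partial>M)"
    by (rule distributed_integral[OF assms(2)]) auto
  ultimately show "(\<integral>x. (Y x)\<^sup>2 \<partial>M) = \<sigma>\<^sup>2" "centered_gaussian M Y"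
    using char_normal[OF assms] by (simp_all add: centered_gaussian_def sq_integrable_def)
qed

lemma (in prob_space) centered_gaussian_of_gaussian_rv:
  assumes "gaussian_rv M Y" "expectation Y = 0"
  shows "centered_gaussian M Y"
proof -
  have [measurable]: "Y \<in> borel_measurable M" using assms(1) by (simp add: gaussian_rv_def)
  from assms(1) consider (normal) \<mu> s where "s > 0" "distributed M lborel Y (normal_density \<mu> s)"
    | (const) \<mu> where "AE \<omega> in M. Y \<omega> = \<mu>" by (auto simp: gaussian_rv_def)
  then show ?thesis
  proof cases
    case normal
    then have "\<mu> = 0" using normal_distributed_expectation assms(2) by auto
    with normal show ?thesis using centered_gaussian_normal(1) by simp
  next
    case const
    then have "expectation Y = expectation (\<lambda>_. \<mu>)" by (intro integral_cong_AE) auto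
    then have "\<mu> = 0" using assms(2) by (simp add: prob_space)
    with const have Y0: "AE \<omega> in M. Y \<omega> = 0" by simp
    then have sq: "integrable M (\<lambda>x. (Y x)\<^sup>2) \<longleftrightarrow> integrable M (\<lambda>_. 0::real)" "(\<integral>x. (Y x)\<^sup>2 \<partial>M) = (\<integral>x. 0 \<partial>M)"
      by (intro integrable_cong_AE integral_cong_AE; auto)+
    have "char (distr M borel Y) t = (\<integral>x. 1 \<partial>M)" for t
      unfolding char_distr[OF \<open>Y \<in> borel_measurable M\<close>]
    proof (rule integral_cong_AE)
      show "AE x in M. iexp (t * Y x) = 1" using Y0 by eventually_elim simp
    qed auto
    then have "char (distr M borel Y) t = 1" for t by (simp add: prob_space)
    moreover have "integrable M (\<lambda>x. (Y x)\<^sup>2)" "(\<integral>x. (Y x)\<^sup>2 \<partial>M) = 0" unfolding sq by simp_all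
    ultimately show ?thesis by (simp add: centered_gaussian_def sq_integrable_def)
  qed
qed

lemma (in prob_space) distributed_centered_gaussian:
  assumes Y: "centered_gaussian M Y" and v: "(\<integral>x. (Y x)\<^sup>2 \<partial>M) = \<sigma>\<^sup>2" "\<sigma> > 0"
  shows "distributed M lborel Y (normal_density 0 \<sigma>)"
proof -
  have [measurable]: "Y \<in> borel_measurable M" using Y by (simp add: centered_gaussian_def sq_integrable_def)
  let ?D = "density lborel (normal_density 0 \<sigma>)"
  interpret D: prob_space ?D by (rule prob_space_normal_density) fact
  have "distr ?D lborel (\<lambda>x. x) = ?D" by (simp add: distr_id2)
  then have "distributed ?D lborel (\<lambda>x. x) (normal_density 0 \<sigma>)" by (simp add: distributed_def)
  from D.char_normal[OF v(2) this] have "char (distr ?D borel (\<lambda>x. x)) t = complex_of_real (exp (- (t\<^sup>2 * \<sigma>\<^sup>2) / 2))" for t .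
  moreover have "distr ?D borel (\<lambda>x. x) = ?D" by (simp add: distr_id2)
  ultimately have "char (distr M borel Y) = char ?D" using Y v by (auto simp: centered_gaussian_def fun_eq_iff)
  moreover have "real_distribution ?D" by (intro real_distribution.intro real_distribution_axioms.intro D.prob_space_axioms) simp
  ultimately have "distr M borel Y = ?D" by (intro Levy_uniqueness) auto
  moreover have "distr M lborel Y = distr M borel Y" by (rule distr_cong) auto
  ultimately show ?thesis by (simp add: distributed_def)
qed

lemma norm_iexp_diff_le: "norm (iexp x - iexp y) \<le> \<bar>x - y\<bar>"
proof -
  have "iexp x - iexp y = iexp y * (iexp (x - y) - 1)"
    by (simp add: algebra_simps flip: exp_add)
  then have "norm (iexp x - iexp y) = norm (iexp (x - y) - 1)" by (simp add: norm_mult)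
  also have "\<dots> \<le> \<bar>x - y\<bar>" using iexp_approx1[of "x - y" 0] by simp
  finally show ?thesis .
qed

text \<open>Under \<open>L\<^sup>2\<close> convergence the variances converge, and so do the characteristic functions, because \<open>x \<mapsto> e\<^sup>i\<^sup>t\<^sup>x\<close> is
Lipschitz.\<close>

lemma (in prob_space) centered_gaussian_limit:
  assumes L: "L2_tendsto M Z Y" and Z: "\<And>n. centered_gaussian M (Z n)"
  shows "centered_gaussian M Y"
proof -
  have sqZ: "sq_integrable M (Z n)" for n using Z by (simp add: centered_gaussian_def)
  have sqY: "sq_integrable M Y" by (rule L2_tendsto_sq_integrable[OF L sqZ])
  have sqd: "sq_integrable M (\<lambda>x. Y x - Z n x)" for n by (intro sq_integrable_diff sqY sqZ)
  have [measurable]: "Y \<in> borel_measurable M" "Z n \<in> borel_measurable M" for n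
    using sqY sqZ by (auto simp: sq_integrable_def)
  have var: "(\<lambda>n. \<integral>x. (Z n x)\<^sup>2 \<partial>M) \<longlonglongrightarrow> (\<integral>x. (Y x)\<^sup>2 \<partial>M)"
    using L2_tendsto_inner[OF L L sqZ sqZ] by (simp add: power2_eq_square)
  have lim: "(\<lambda>n. \<integral>x. (Y x - Z n x)\<^sup>2 \<partial>M) \<longlonglongrightarrow> 0" using L sqY sqZ by (simp add: L2_tendsto_iff)
  have "char (distr M borel Y) t = complex_of_real (exp (- (t\<^sup>2 * (\<integral>x. (Y x)\<^sup>2 \<partial>M)) / 2))" for t
  proof (rule LIMSEQ_unique)
    show "(\<lambda>n. char (distr M borel (Z n)) t) \<longlonglongrightarrow> complex_of_real (exp (- (t\<^sup>2 * (\<integral>x. (Y x)\<^sup>2 \<partial>M)) / 2))"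
    proof -
      have "char (distr M borel (Z n)) t = complex_of_real (exp (- (t\<^sup>2 * (\<integral>x. (Z n x)\<^sup>2 \<partial>M)) / 2))" for n
        using Z[of n] unfolding centered_gaussian_def by blast
      then show ?thesis by (simp only:) (intro tendsto_intros var, simp)
    qed
    have "norm (char (distr M borel (Z n)) t - char (distr M borel Y) t) \<le> \<bar>t\<bar> * sqrt (\<integral>x. (Y x - Z n x)\<^sup>2 \<partial>M)" for n
    proof -
      have i: "complex_integrable M (\<lambda>x. iexp (t * Z n x))" "complex_integrable M (\<lambda>x. iexp (t * Y x))"
        by (intro integrable_iexp; simp)+
      have "char (distr M borel (Z n)) t - char (distr M borel Y) t = (\<integral>x. iexp (t * Z n x) - iexp (t * Y x) \<partial>M)"
        by (simp only: char_distr \<open>Y \<in> borel_measurable M\<close> \<open>\<And>n. Z n \<in> borel_measurable M\<close> Bochner_Integration.integral_diff[OF i])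
      also have "norm \<dots> \<le> (\<integral>x. norm (iexp (t * Z n x) - iexp (t * Y x)) \<partial>M)" by (rule integral_norm_bound)
      also have "\<dots> \<le> (\<integral>x. \<bar>t\<bar> * \<bar>Y x - Z n x\<bar> \<partial>M)"
      proof (rule integral_mono)
        show "integrable M (\<lambda>x. norm (iexp (t * Z n x) - iexp (t * Y x)))"
          by (intro integrable_norm Bochner_Integration.integrable_diff i)
        show "integrable M (\<lambda>x. \<bar>t\<bar> * \<bar>Y x - Z n x\<bar>)" using sq_integrable_integrable[OF sqd[of n]] by auto
        show "norm (iexp (t * Z n x) - iexp (t * Y x)) \<le> \<bar>t\<bar> * \<bar>Y x - Z n x\<bar>" for x
          using norm_iexp_diff_le[of "t * Z n x" "t * Y x"] 
          by (simp add: abs_mult[symmetric] right_diff_distrib abs_minus_commute)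
      qed
      also have "\<dots> = \<bar>t\<bar> * (\<integral>x. \<bar>Y x - Z n x\<bar> * 1 \<partial>M)" by simp
      also have "(\<integral>x. \<bar>Y x - Z n x\<bar> * 1 \<partial>M) \<le> sqrt (\<integral>x. (Y x - Z n x)\<^sup>2 \<partial>M) * sqrt (\<integral>x. 1\<^sup>2 \<partial>M)"
        using integral_inner_Cauchy_Schwarz[of M "\<lambda>x. \<bar>Y x - Z n x\<bar>" "\<lambda>_. 1"] sqd[of n]
        by (simp add: sq_integrable_def)
      finally show ?thesis by (simp add: prob_space mult_left_mono)
    qed
    moreover have "(\<lambda>n. \<bar>t\<bar> * sqrt (\<integral>x. (Y x - Z n x)\<^sup>2 \<partial>M)) \<longlonglongrightarrow> 0"
      using tendsto_real_sqrt[OF lim] by (intro tendsto_mult_right_zero) simp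
    ultimately have "(\<lambda>n. char (distr M borel (Z n)) t - char (distr M borel Y) t) \<longlonglongrightarrow> 0"
      by (rule Lim_null_comparison[OF always_eventually[OF allI]])
    then show "(\<lambda>n. char (distr M borel (Z n)) t) \<longlonglongrightarrow> char (distr M borel Y) t" by (simp add: LIM_zero_iff)
  qed
  then show ?thesis using sqY by (simp add: centered_gaussian_def)
qed

text \<open>The closed linear span in \<open>L\<^sup>2\<close>, consisting of functions rather than of equivalence classes.\<close>

definition linear_closure :: "'a measure \<Rightarrow> ('i \<Rightarrow> 'a \<Rightarrow> real) \<Rightarrow> ('a \<Rightarrow> real) set" where
  "linear_closure M X = {Y. sq_integrable M Y \<and>
     (\<forall>e>0. \<exists>F c. finite F \<and> (\<integral>x. (Y x - (\<Sum>i\<in>F. c i * X i x))\<^sup>2 \<partial>M) < e)}"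

lemma linear_closure_approx:
  "Y \<in> linear_closure M X \<Longrightarrow> e > 0 \<Longrightarrow> \<exists>F c. finite F \<and> (\<integral>x. (Y x - (\<Sum>i\<in>F. c i * X i x))\<^sup>2 \<partial>M) < e"
  by (simp add: linear_closure_def)

lemma integral_sq_add_le:
  assumes "sq_integrable M f" "sq_integrable M g"
  shows "(\<integral>x. (f x + g x)\<^sup>2 \<partial>M) \<le> 2 * (\<integral>x. (f x)\<^sup>2 \<partial>M) + 2 * (\<integral>x. (g x)\<^sup>2 \<partial>M)"
proof -
  have "(\<integral>x. (f x + g x)\<^sup>2 \<partial>M) \<le> (\<integral>x. 2 * (f x)\<^sup>2 + 2 * (g x)\<^sup>2 \<partial>M)"
  proof (rule integral_mono)
    show "(f x + g x)\<^sup>2 \<le> 2 * (f x)\<^sup>2 + 2 * (g x)\<^sup>2" for x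
      using sum_squares_bound[of "f x" "g x"] by (simp add: power2_sum)
  qed (use assms sq_integrable_add[OF assms] in \<open>auto simp: sq_integrable_def\<close>)
  then show ?thesis using assms by (simp add: sq_integrable_def)
qed

context
  fixes M :: "'a measure" and X :: "'i \<Rightarrow> 'a \<Rightarrow> real"
  assumes X: "\<And>i. sq_integrable M (X i)"
begin

lemma sq_integrable_lincomb: "sq_integrable M (\<lambda>x. \<Sum>i\<in>F. c i * X i x)"
  by (intro sq_integrable_sum sq_integrable_cmult X)

lemma linear_closure_lincomb:
  assumes "finite F"
  shows "(\<lambda>x. \<Sum>i\<in>F. c i * X i x) \<in> linear_closure M X"
  unfolding linear_closure_def
proof (intro CollectI conjI allI impI)
  fix e :: real assume "e > 0"
  then show "\<exists>F' c'. finite F' \<and> (\<integral>x. ((\<Sum>i\<in>F. c i * X i x) - (\<Sum>i\<in>F'. c' i * X i x))\<^sup>2 \<partial>M) < e"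
    using assms by (intro exI[of _ F] exI[of _ c]) simp
qed (rule sq_integrable_lincomb)

lemma linear_closure_base: "X i \<in> linear_closure M X"
  using linear_closure_lincomb[of "{i}" "\<lambda>_. 1"] by simp

lemma linear_closure_add:
  assumes "Y \<in> linear_closure M X" "Z \<in> linear_closure M X"
  shows "(\<lambda>x. Y x + Z x) \<in> linear_closure M X"
  unfolding linear_closure_def
proof (intro CollectI conjI allI impI)
  have sq: "sq_integrable M Y" "sq_integrable M Z" using assms by (auto simp: linear_closure_def)
  show "sq_integrable M (\<lambda>x. Y x + Z x)" by (intro sq_integrable_add sq)
  fix e :: real assume "e > 0"
  then have "e / 4 > 0" by simp
  obtain F c where F1: "finite F" "(\<integral>x. (Y x - (\<Sum>i\<in>F. c i * X i x))\<^sup>2 \<partial>M) < e / 4"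
    using linear_closure_approx[OF assms(1) \<open>e / 4 > 0\<close>] by blast
  obtain F' c' where F2: "finite F'" "(\<integral>x. (Z x - (\<Sum>i\<in>F'. c' i * X i x))\<^sup>2 \<partial>M) < e / 4"
    using linear_closure_approx[OF assms(2) \<open>e / 4 > 0\<close>] by blast
  note F = F1 F2
  define d where "d i = (if i \<in> F then c i else 0) + (if i \<in> F' then c' i else 0)" for i
  have "(\<Sum>i\<in>F \<union> F'. d i * X i x) = (\<Sum>i\<in>F. c i * X i x) + (\<Sum>i\<in>F'. c' i * X i x)" for x
  proof -
    have "(\<Sum>i\<in>F \<union> F'. d i * X i x) = (\<Sum>i\<in>F \<union> F'. if i \<in> F then c i * X i x else 0) + (\<Sum>i\<in>F \<union> F'. if i \<in> F' then c' i * X i x else 0)"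
      unfolding sum.distrib[symmetric] by (intro sum.cong) (auto simp: d_def distrib_right)
    also have "\<dots> = (\<Sum>i\<in>(F \<union> F') \<inter> F. c i * X i x) + (\<Sum>i\<in>(F \<union> F') \<inter> F'. c' i * X i x)"
      using F by (subst (1 2) sum.inter_restrict) auto
    finally show ?thesis by (simp add: Int_absorb1 Int_commute[of "F \<union> F'"])
  qed
  then have "(\<integral>x. (Y x + Z x - (\<Sum>i\<in>F \<union> F'. d i * X i x))\<^sup>2 \<partial>M)
     = (\<integral>x. ((Y x - (\<Sum>i\<in>F. c i * X i x)) + (Z x - (\<Sum>i\<in>F'. c' i * X i x)))\<^sup>2 \<partial>M)"
    by (simp add: algebra_simps)
  also have "\<dots> \<le> 2 * (\<integral>x. (Y x - (\<Sum>i\<in>F. c i * X i x))\<^sup>2 \<partial>M) + 2 * (\<integral>x. (Z x - (\<Sum>i\<in>F'. c' i * X i x))\<^sup>2 \<partial>M)"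
    by (intro integral_sq_add_le sq_integrable_diff sq sq_integrable_lincomb)
  also have "\<dots> < e" using F by simp
  finally show "\<exists>F c. finite F \<and> (\<integral>x. (Y x + Z x - (\<Sum>i\<in>F. c i * X i x))\<^sup>2 \<partial>M) < e"
    using F by (intro exI[of _ "F \<union> F'"] exI[of _ d]) simp
qed

lemma linear_closure_cmult:
  assumes "Y \<in> linear_closure M X"
  shows "(\<lambda>x. a * Y x) \<in> linear_closure M X"
  unfolding linear_closure_def
proof (intro CollectI conjI allI impI)
  show "sq_integrable M (\<lambda>x. a * Y x)" using assms by (auto simp: linear_closure_def intro: sq_integrable_cmult)
  fix e :: real assume "e > 0"
  then have "e / (a\<^sup>2 + 1) > 0" by (simp add: add_nonneg_pos)
  then obtain F c where F: "finite F" "(\<integral>x. (Y x - (\<Sum>i\<in>F. c i * X i x))\<^sup>2 \<partial>M) < e / (a\<^sup>2 + 1)"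
    using linear_closure_approx[OF assms] by blast
  have "(\<lambda>x. (a * Y x - (\<Sum>i\<in>F. (a * c i) * X i x))\<^sup>2) = (\<lambda>x. a\<^sup>2 * (Y x - (\<Sum>i\<in>F. c i * X i x))\<^sup>2)"
    by (simp add: power_mult_distrib[symmetric] right_diff_distrib sum_distrib_left mult.assoc)
  then have "(\<integral>x. (a * Y x - (\<Sum>i\<in>F. (a * c i) * X i x))\<^sup>2 \<partial>M) = a\<^sup>2 * (\<integral>x. (Y x - (\<Sum>i\<in>F. c i * X i x))\<^sup>2 \<partial>M)"
    by simp
  also have "\<dots> \<le> (a\<^sup>2 + 1) * (\<integral>x. (Y x - (\<Sum>i\<in>F. c i * X i x))\<^sup>2 \<partial>M)" by (intro mult_right_mono) auto
  also have "\<dots> < (a\<^sup>2 + 1) * (e / (a\<^sup>2 + 1))" using F by (intro mult_strict_left_mono) (auto simp: add_nonneg_pos)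
  also have "\<dots> = e" by (simp add: add_nonneg_eq_0_iff)
  finally show "\<exists>F c. finite F \<and> (\<integral>x. (a * Y x - (\<Sum>i\<in>F. c i * X i x))\<^sup>2 \<partial>M) < e"
    using F by (intro exI[of _ F] exI[of _ "\<lambda>i. a * c i"]) simp
qed

lemma linear_closure_sum:
  assumes "\<And>j. j \<in> A \<Longrightarrow> Y j \<in> linear_closure M X"
  shows "(\<lambda>x. \<Sum>j\<in>A. c j * Y j x) \<in> linear_closure M X"
  using assms
proof (induction A rule: infinite_finite_induct)
  case (insert j A)
  then show ?case using linear_closure_add[OF linear_closure_cmult[of "Y j" "c j"]] by simp
qed (use linear_closure_lincomb[of "{}"] in simp_all)

lemma linear_closure_diff:
  "Y \<in> linear_closure M X \<Longrightarrow> Z \<in> linear_closure M X \<Longrightarrow> (\<lambda>x. Y x - Z x) \<in> linear_closure M X"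
  using linear_closure_add[of Y "\<lambda>x. -1 * Z x"] linear_closure_cmult[of Z "-1"] by simp

lemma linear_closure_sq: "Y \<in> linear_closure M X \<Longrightarrow> sq_integrable M Y"
  by (simp add: linear_closure_def)

lemma linear_closure_limit:
  assumes L: "L2_tendsto M Z Y" and Z: "\<And>n. Z n \<in> linear_closure M X"
  shows "Y \<in> linear_closure M X"
  unfolding linear_closure_def
proof (intro CollectI conjI allI impI)
  note sqZ = linear_closure_sq[OF Z]
  show sqY: "sq_integrable M Y" by (rule L2_tendsto_sq_integrable[OF L sqZ])
  fix e :: real assume "e > 0"
  then have e: "e / 4 > 0" by simp
  have "(\<lambda>n. \<integral>x. (Y x - Z n x)\<^sup>2 \<partial>M) \<longlonglongrightarrow> 0" using L sqY sqZ by (simp add: L2_tendsto_iff)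
  then have "\<forall>\<^sub>F n in sequentially. (\<integral>x. (Y x - Z n x)\<^sup>2 \<partial>M) < e / 4" by (rule order_tendstoD) fact
  then obtain n where n: "(\<integral>x. (Y x - Z n x)\<^sup>2 \<partial>M) < e / 4" by (auto simp: eventually_sequentially)
  obtain F c where F: "finite F" "(\<integral>x. (Z n x - (\<Sum>i\<in>F. c i * X i x))\<^sup>2 \<partial>M) < e / 4"
    using linear_closure_approx[OF Z e] by blast
  have "(\<integral>x. (Y x - (\<Sum>i\<in>F. c i * X i x))\<^sup>2 \<partial>M)
     = (\<integral>x. ((Y x - Z n x) + (Z n x - (\<Sum>i\<in>F. c i * X i x)))\<^sup>2 \<partial>M)" by simp
  also have "\<dots> \<le> 2 * (\<integral>x. (Y x - Z n x)\<^sup>2 \<partial>M) + 2 * (\<integral>x. (Z n x - (\<Sum>i\<in>F. c i * X i x))\<^sup>2 \<partial>M)"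
    by (intro integral_sq_add_le sq_integrable_diff sqY sqZ sq_integrable_lincomb)
  also have "\<dots> < e" using F n by simp
  finally show "\<exists>F c. finite F \<and> (\<integral>x. (Y x - (\<Sum>i\<in>F. c i * X i x))\<^sup>2 \<partial>M) < e"
    using F by blast
qed

lemma linear_closure_centered_gaussian:
  assumes M: "prob_space M" and g: "\<And>F c. finite F \<Longrightarrow> centered_gaussian M (\<lambda>x. \<Sum>i\<in>F. c i * X i x)"
    and Y: "Y \<in> linear_closure M X"
  shows "centered_gaussian M Y"
proof -
  interpret prob_space M by fact
  have "\<exists>F c. finite F \<and> (\<integral>x. (Y x - (\<Sum>i\<in>F. c i * X i x))\<^sup>2 \<partial>M) < 1 / real (Suc n)" for n
    using Y by (simp add: linear_closure_def)
  then obtain F c where F: "\<And>n. finite (F n)" "\<And>n. (\<integral>x. (Y x - (\<Sum>i\<in>F n. c n i * X i x))\<^sup>2 \<partial>M) < 1 / real (Suc n)"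
    by metis
  have "(\<lambda>n. \<integral>x. (Y x - (\<Sum>i\<in>F n. c n i * X i x))\<^sup>2 \<partial>M) \<longlonglongrightarrow> 0"
    by (rule Lim_null_comparison[OF always_eventually LIMSEQ_Suc[OF lim_1_over_n]])
       (use F(2) less_imp_le in auto)
  then have "L2_tendsto M (\<lambda>n x. \<Sum>i\<in>F n. c n i * X i x) Y"
    using linear_closure_sq[OF Y] sq_integrable_lincomb by (subst L2_tendsto_iff) auto
  then show ?thesis by (rule centered_gaussian_limit) (rule g[OF F(1)])
qed

end

lemma indep_vars_PiM_coordinates:
  assumes "\<And>i. i \<in> I \<Longrightarrow> prob_space (M i)" "I \<noteq> {}"
  shows "prob_space.indep_vars (Pi\<^sub>M I M) M (\<lambda>i \<omega>. \<omega> i) I"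
proof -
  interpret prob_space "Pi\<^sub>M I M" by (rule prob_space_PiM) fact
  have "distr (Pi\<^sub>M I M) (Pi\<^sub>M I M) (\<lambda>x. \<lambda>i\<in>I. x i) = distr (Pi\<^sub>M I M) (Pi\<^sub>M I M) (\<lambda>x. x)"
    by (rule distr_cong) (auto simp: space_PiM PiE_def extensional_restrict)
  also have "\<dots> = Pi\<^sub>M I M" by (rule distr_id)
  also have "\<dots> = Pi\<^sub>M I (\<lambda>i. distr (Pi\<^sub>M I M) (M i) (\<lambda>\<omega>. \<omega> i))"
    by (intro PiM_cong) (auto simp: distr_PiM_component assms)
  finally show ?thesis by (subst indep_vars_iff_distr_eq_PiM') (use assms in auto)
qed

lemma (in prob_space) centered_gaussian_indep_sum:
  assumes "finite F" "indep_vars (\<lambda>_. borel) X F" and g: "\<And>i. i \<in> F \<Longrightarrow> centered_gaussian M (X i)"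
  shows "char (distr M borel (\<lambda>x. \<Sum>i\<in>F. c i * X i x)) t
    = complex_of_real (exp (- (t\<^sup>2 * (\<Sum>i\<in>F. (c i)\<^sup>2 * (\<integral>x. (X i x)\<^sup>2 \<partial>M))) / 2))"
proof -
  have X: "i \<in> F \<Longrightarrow> X i \<in> borel_measurable M" for i using g by (simp add: centered_gaussian_def sq_integrable_def)
  have "indep_vars (\<lambda>_. borel) (\<lambda>i x. c i * X i x) F"
    by (rule indep_vars_compose2[OF assms(2)]) simp
  then have "char (distr M borel (\<lambda>x. \<Sum>i\<in>F. c i * X i x)) t = (\<Prod>i\<in>F. char (distr M borel (\<lambda>x. c i * X i x)) t)"
    by (rule char_distr_sum)
  also have "\<dots> = (\<Prod>i\<in>F. complex_of_real (exp (- (t\<^sup>2 * ((c i)\<^sup>2 * (\<integral>x. (X i x)\<^sup>2 \<partial>M))) / 2)))"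
    using g X by (intro prod.cong) (auto simp: char_distr_cmult centered_gaussian_def power_mult_distrib mult.assoc)
  also have "\<dots> = complex_of_real (exp (\<Sum>i\<in>F. (- (t\<^sup>2 * ((c i)\<^sup>2 * (\<integral>x. (X i x)\<^sup>2 \<partial>M))) / 2)))"
    by (simp add: exp_sum[OF assms(1)])
  also have "(\<Sum>i\<in>F. (- (t\<^sup>2 * ((c i)\<^sup>2 * (\<integral>x. (X i x)\<^sup>2 \<partial>M))) / 2)) = - (t\<^sup>2 * (\<Sum>i\<in>F. (c i)\<^sup>2 * (\<integral>x. (X i x)\<^sup>2 \<partial>M))) / 2"
    by (simp add: sum_distrib_left sum_negf sum_divide_distrib)
  finally show ?thesis .
qed

lemma integral_sq_orthogonal_sum:
  assumes "finite F" "\<And>i. i \<in> F \<Longrightarrow> sq_integrable M (X i)"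
    "\<And>i j. i \<in> F \<Longrightarrow> j \<in> F \<Longrightarrow> i \<noteq> j \<Longrightarrow> (\<integral>x. X i x * X j x \<partial>M) = 0"
  shows "(\<integral>x. (\<Sum>i\<in>F. c i * X i x)\<^sup>2 \<partial>M) = (\<Sum>i\<in>F. (c i)\<^sup>2 * (\<integral>x. (X i x)\<^sup>2 \<partial>M))"
proof -
  have "(\<integral>x. (\<Sum>i\<in>F. c i * X i x)\<^sup>2 \<partial>M) = (\<Sum>i\<in>F. \<Sum>j\<in>F. c i * c j * (\<integral>x. X i x * X j x \<partial>M))"
    by (rule integral_sq_sum[OF assms(1,2)])
  also have "\<dots> = (\<Sum>i\<in>F. \<Sum>j\<in>F. if j = i then (c i)\<^sup>2 * (\<integral>x. (X i x)\<^sup>2 \<partial>M) else 0)"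
    using assms(3) by (intro sum.cong refl) (auto simp: power2_eq_square)
  also have "\<dots> = (\<Sum>i\<in>F. (c i)\<^sup>2 * (\<integral>x. (X i x)\<^sup>2 \<partial>M))" using assms(1) by simp
  finally show ?thesis .
qed

text \<open>The linear combinations of the \<open>Y j\<close> have the same variances as those of independent variables with the same
marginals. By \<open>Cramer_Wold\<close>, the joint law is the product of the marginals.\<close>

theorem (in prob_space) orthogonal_jointly_gaussian_indep:
  fixes Y :: "'i \<Rightarrow> 'a \<Rightarrow> real"
  assumes J: "finite J"
    and g: "\<And>c. centered_gaussian M (\<lambda>x. \<Sum>j\<in>J. c j * Y j x)"
    and orth: "\<And>i j. i \<in> J \<Longrightarrow> j \<in> J \<Longrightarrow> i \<noteq> j \<Longrightarrow> (\<integral>x. Y i x * Y j x \<partial>M) = 0"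
  shows "indep_vars (\<lambda>_. borel) Y J"
proof (cases "J = {}")
  case True then show ?thesis by (simp add: indep_vars_def indep_sets_def)
next
  case False
  have gY: "centered_gaussian M (Y j)" if "j \<in> J" for j
  proof -
    have "(\<Sum>i\<in>J. (if i = j then 1 else 0) * Y i x) = Y j x" for x
      using that J by (simp add: if_distrib[of "\<lambda>y. y * Y _ x"] sum.delta cong: if_cong)
    with g[of "\<lambda>i. if i = j then 1 else 0"] show ?thesis by simp
  qed
  then have sq: "sq_integrable M (Y j)" if "j \<in> J" for j using that by (simp add: centered_gaussian_def)
  then have Ym: "j \<in> J \<Longrightarrow> Y j \<in> borel_measurable M" for j by (simp add: sq_integrable_def)
  let ?D = "\<lambda>j. distr M borel (Y j)"
  let ?Q = "Pi\<^sub>M J ?D"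
  have pD: "j \<in> J \<Longrightarrow> prob_space (?D j)" for j by (intro prob_space_distr Ym)
  interpret Q: prob_space ?Q by (rule prob_space_PiM) (rule pD)
  have comp: "distr ?Q borel (\<lambda>z. z j) = ?D j" if "j \<in> J" for j
  proof -
    have "distr ?Q borel (\<lambda>z. z j) = distr ?Q (?D j) (\<lambda>z. z j)" by (rule distr_cong) auto
    also have "\<dots> = ?D j" using pD that by (intro distr_PiM_component)
    finally show ?thesis .
  qed
  have zm: "(\<lambda>z. z j) \<in> borel_measurable ?Q" if "j \<in> J" for j
    using measurable_component_singleton[OF that, of ?D] by simp
  have gz: "centered_gaussian ?Q (\<lambda>z. z j)" and vz: "(\<integral>z. (z j)\<^sup>2 \<partial>?Q) = (\<integral>x. (Y j x)\<^sup>2 \<partial>M)" if "j \<in> J" for j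
  proof -
    have "(\<integral>z. (z j)\<^sup>2 \<partial>?Q) = (\<integral>y. y\<^sup>2 \<partial>distr ?Q borel (\<lambda>z. z j))" using zm[OF that] by (simp add: integral_distr)
    also have "\<dots> = (\<integral>x. (Y j x)\<^sup>2 \<partial>M)" unfolding comp[OF that] using Ym[OF that] by (simp add: integral_distr)
    finally show v: "(\<integral>z. (z j)\<^sup>2 \<partial>?Q) = (\<integral>x. (Y j x)\<^sup>2 \<partial>M)" .
    have "integrable ?Q (\<lambda>z. (z j)\<^sup>2) \<longleftrightarrow> integrable (distr ?Q borel (\<lambda>z. z j)) (\<lambda>y. y\<^sup>2)"
      using zm[OF that] by (simp add: integrable_distr_eq)
    also have "\<dots> \<longleftrightarrow> integrable M (\<lambda>x. (Y j x)\<^sup>2)" unfolding comp[OF that] using Ym[OF that] by (simp add: integrable_distr_eq)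
    finally show "centered_gaussian ?Q (\<lambda>z. z j)"
      using gY[OF that] zm[OF that] v comp[OF that] by (simp add: centered_gaussian_def sq_integrable_def)
  qed
  have "Q.indep_vars ?D (\<lambda>j z. z j) J" by (rule indep_vars_PiM_coordinates[OF pD False])
  then have ind: "Q.indep_vars (\<lambda>_. borel) (\<lambda>j z. z j) J"
    using Q.indep_vars_compose2[of ?D "\<lambda>j z. z j" J "\<lambda>_ y. y" "\<lambda>_. borel"] by simp
  have "distr M (\<Pi>\<^sub>M j\<in>J. borel) (\<lambda>x. \<lambda>j\<in>J. Y j x) = distr ?Q (\<Pi>\<^sub>M j\<in>J. borel) (\<lambda>z. \<lambda>j\<in>J. z j)"
  proof (rule Cramer_Wold)
    fix K and c :: "'i \<Rightarrow> real" assume K: "finite K" "K \<subseteq> J"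
    let ?c = "\<lambda>j. if j \<in> K then c j else (0::real)"
    have c: "(\<Sum>j\<in>J. ?c j * f j) = (\<Sum>j\<in>K. c j * f j)"
      for f :: "'i \<Rightarrow> real"
      using K J by (intro sum.mono_neutral_cong_right) auto
    have "char (distr M borel (\<lambda>x. \<Sum>j\<in>J. ?c j * Y j x)) 1 = char (distr ?Q borel (\<lambda>z. \<Sum>j\<in>J. ?c j * z j)) 1"
      using g[of ?c] Q.centered_gaussian_indep_sum[OF J ind gz, where c="?c" and t=1] integral_sq_orthogonal_sum[OF J sq orth, where c="?c"]
      by (simp add: centered_gaussian_def vz)
    then show "char (distr M borel (\<lambda>x. \<Sum>j\<in>K. c j * Y j x)) 1 = char (distr ?Q borel (\<lambda>z. \<Sum>j\<in>K. c j * z j)) 1"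
      by (simp only: c)
  qed (auto intro: Ym zm prob_space_axioms Q.prob_space_axioms)
  also have "\<dots> = distr ?Q ?Q (\<lambda>z. z)"
    by (rule distr_cong) (auto simp: space_PiM PiE_def extensional_restrict intro!: sets_PiM_cong)
  also have "\<dots> = ?Q" by (rule distr_id)
  finally show ?thesis by (subst indep_vars_iff_distr_eq_PiM'[OF False]) (auto intro: Ym)
qed

definition white_noise :: "('i \<Rightarrow> real) measure" where
  "white_noise = (\<Pi>\<^sub>M i\<in>UNIV. std_normal_distribution)"

lemma prob_space_std_normal: "prob_space std_normal_distribution"
  using real_dist_normal_dist by (simp add: real_distribution_def)

lemma prob_space_white_noise: "prob_space white_noise"
  unfolding white_noise_def by (intro prob_space_PiM prob_space_std_normal)

lemma sets_white_noise: "sets white_noise = sets (\<Pi>\<^sub>M i\<in>UNIV. borel)"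
  unfolding white_noise_def by (intro sets_PiM_cong) auto

lemma measurable_white_noise_coordinate [measurable]: "(\<lambda>\<omega>. \<omega> i) \<in> borel_measurable white_noise"
  by (subst measurable_cong_sets[OF sets_white_noise refl]) simp

lemma distr_white_noise_coordinate: "distr white_noise borel (\<lambda>\<omega>. \<omega> i) = std_normal_distribution"
proof -
  have "distr white_noise borel (\<lambda>\<omega>. \<omega> i) = distr white_noise std_normal_distribution (\<lambda>\<omega>. \<omega> i)"
    by (rule distr_cong) auto
  also have "\<dots> = std_normal_distribution" unfolding white_noise_def
    by (rule distr_PiM_component[of UNIV "\<lambda>_. std_normal_distribution"]) (auto intro: prob_space_std_normal)
  finally show ?thesis .
qed

lemma white_noise_coordinate:
  shows "centered_gaussian white_noise (\<lambda>\<omega>. \<omega> i)" "(\<integral>\<omega>. (\<omega> i)\<^sup>2 \<partial>white_noise) = 1"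
    "sq_integrable white_noise (\<lambda>\<omega>. \<omega> i)" "(\<integral>\<omega>. \<omega> i \<partial>white_noise) = 0"
proof -
  interpret prob_space white_noise by (rule prob_space_white_noise)
  have "distributed white_noise lborel (\<lambda>\<omega>. \<omega> i) std_normal_density"
    using distr_white_noise_coordinate[of i] by (simp add: distributed_def cong: distr_cong)
  from centered_gaussian_normal[OF _ this] normal_distributed_expectation[OF _ this]
  show "centered_gaussian white_noise (\<lambda>\<omega>. \<omega> i)" "(\<integral>\<omega>. (\<omega> i)\<^sup>2 \<partial>white_noise) = 1"
    "sq_integrable white_noise (\<lambda>\<omega>. \<omega> i)" "(\<integral>\<omega>. \<omega> i \<partial>white_noise) = 0"
    by (simp_all add: centered_gaussian_def)
qed

lemma indep_white_noise: "prob_space.indep_vars white_noise (\<lambda>_. borel) (\<lambda>i \<omega>. \<omega> i) UNIV"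
proof -
  interpret prob_space white_noise by (rule prob_space_white_noise)
  have "indep_vars (\<lambda>_. std_normal_distribution) (\<lambda>i \<omega>. \<omega> i) UNIV"
    unfolding white_noise_def by (rule indep_vars_PiM_coordinates) (auto intro: prob_space_std_normal)
  from indep_vars_compose2[OF this, of "\<lambda>_ y. y" "\<lambda>_. borel"] show ?thesis by simp
qed

lemma white_noise_orthogonal:
  assumes "i \<noteq> j"
  shows "(\<integral>\<omega>. \<omega> i * \<omega> j \<partial>white_noise) = 0"
proof -
  interpret prob_space white_noise by (rule prob_space_white_noise)
  have "(\<integral>\<omega>. (\<Prod>k\<in>{i, j}. \<omega> k) \<partial>white_noise) = (\<Prod>k\<in>{i, j}. \<integral>\<omega>. \<omega> k \<partial>white_noise)"
    by (intro indep_vars_lebesgue_integral indep_vars_subset[OF indep_white_noise] sq_integrable_integrable white_noise_coordinate) auto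
  then show ?thesis using assms by (simp add: white_noise_coordinate)
qed

lemma white_noise_lincomb:
  assumes "finite F"
  shows "centered_gaussian white_noise (\<lambda>\<omega>. \<Sum>i\<in>F. c i * \<omega> i)"
    "(\<integral>\<omega>. (\<Sum>i\<in>F. c i * \<omega> i)\<^sup>2 \<partial>white_noise) = (\<Sum>i\<in>F. (c i)\<^sup>2)"
proof -
  interpret prob_space white_noise by (rule prob_space_white_noise)
  show v: "(\<integral>\<omega>. (\<Sum>i\<in>F. c i * \<omega> i)\<^sup>2 \<partial>white_noise) = (\<Sum>i\<in>F. (c i)\<^sup>2)"
    by (subst integral_sq_orthogonal_sum) (auto simp: assms white_noise_coordinate white_noise_orthogonal)
  show "centered_gaussian white_noise (\<lambda>\<omega>. \<Sum>i\<in>F. c i * \<omega> i)"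
    using centered_gaussian_indep_sum[OF assms indep_vars_subset[OF indep_white_noise] white_noise_coordinate(1), of c]
    by (simp add: centered_gaussian_def v white_noise_coordinate sq_integrable_lincomb)
qed

text \<open>All Gaussian variables below are constructed inside this space: linear combinations stay in it, so that joint
Gaussianity is automatic and only covariances have to be computed.\<close>

abbreviation gaussian_space :: "(('i \<Rightarrow> real) \<Rightarrow> real) set" where
  "gaussian_space \<equiv> linear_closure white_noise (\<lambda>i \<omega>. \<omega> i)"

lemma gaussian_space_centered_gaussian: "Y \<in> gaussian_space \<Longrightarrow> centered_gaussian white_noise Y"
  by (rule linear_closure_centered_gaussian[OF white_noise_coordinate(3) prob_space_white_noise white_noise_lincomb(1)])

lemma gaussian_space_sq: "Y \<in> gaussian_space \<Longrightarrow> sq_integrable white_noise Y"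
  by (rule linear_closure_sq[OF white_noise_coordinate(3)])

section \<open>Brownian motion\<close>

lemma integrable_indicator_Ioc: "integrable lborel (indicator {a<..b::real} :: real \<Rightarrow> real)"
proof (rule integrable_real_indicator)
  show "emeasure lborel {a<..b} < \<infinity>" by (cases "a \<le> b") simp_all
qed simp

lemma sq_integrable_indicator_Ioc: "sq_integrable lborel (indicator {a<..b::real})"
proof -
  have "integrable lborel (indicator {a<..b} :: real \<Rightarrow> real)"
    by (rule integrable_indicator_Ioc)
  moreover have "(\<lambda>x. (indicator {a<..b} x)\<^sup>2 :: real) = indicator {a<..b}" by (auto simp: indicator_def)
  ultimately show ?thesis by (simp add: sq_integrable_def)
qed

lemma integral_indicator_Ioc_min:
  fixes x y :: real
  assumes "0 \<le> x" "0 \<le> y"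
  shows "(\<integral>z. indicator {0<..x} z * indicator {0<..y} z \<partial>lborel) = min x y"
proof -
  have "(\<integral>z. indicator {0<..x} z * indicator {0<..y} z \<partial>lborel) = (\<integral>z. indicator {0<..min x y} z \<partial>lborel :: real)"
    by (intro Bochner_Integration.integral_cong) (auto simp: indicator_def)
  then show ?thesis using assms by simp
qed

lemma psd_kernel_min: "psd_kernel {0..1::real} min"
  unfolding psd_kernel_def
proof (intro conjI allI impI ballI)
  fix n :: nat and x c :: "nat \<Rightarrow> real" assume x: "\<forall>i<n. x i \<in> {0..1}"
  have "0 \<le> (\<integral>z. (\<Sum>i<n. c i * indicator {0<..x i} z)\<^sup>2 \<partial>lborel)" by simp
  also have "\<dots> = (\<Sum>i<n. \<Sum>j<n. c i * c j * (\<integral>z. indicator {0<..x i} z * indicator {0<..x j} z \<partial>lborel))"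
    by (rule integral_sq_sum) (auto intro: sq_integrable_indicator_Ioc)
  also have "\<dots> = (\<Sum>i<n. \<Sum>j<n. c i * c j * min (x i) (x j))"
    using x by (intro sum.cong refl) (simp add: integral_indicator_Ioc_min)
  finally show "0 \<le> (\<Sum>i<n. \<Sum>j<n. c i * c j * min (x i) (x j))" .
qed (simp add: min.commute)

lemma dense_sequence:
  fixes A :: "'a::{metric_space, second_countable_topology} set"
  assumes "A \<noteq> {}"
  obtains d :: "nat \<Rightarrow> 'a" where "\<And>l. d l \<in> A" "\<And>x e. x \<in> A \<Longrightarrow> e > 0 \<Longrightarrow> \<exists>l. dist (d l) x < e"
proof -
  obtain T where T: "countable T" "T \<subseteq> A" "A \<subseteq> closure T" using separable by blast
  then have ne: "T \<noteq> {}" using assms by auto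
  show ?thesis
  proof
    show "from_nat_into T l \<in> A" for l using from_nat_into[OF ne] T by blast
    fix x and e :: real assume "x \<in> A" "e > 0"
    then obtain y where "y \<in> T" "dist y x < e" using T(3) closure_approachable[of x T] by blast
    then show "\<exists>l. dist (from_nat_into T l) x < e" using from_nat_into_surj[OF T(1)] by metis
  qed
qed

lemma white_noise_series:
  fixes a :: "nat \<Rightarrow> real"
  assumes "summable (\<lambda>l. (a l)\<^sup>2)"
  shows "\<exists>Y. L2_tendsto white_noise (\<lambda>n \<omega>. \<Sum>l<n. a l * \<omega> l) Y"
proof -
  interpret prob_space "white_noise :: (nat \<Rightarrow> real) measure" by (rule prob_space_white_noise)
  show ?thesis
  proof (rule L2_Cauchy_converges)
    show "sq_integrable white_noise (\<lambda>\<omega>. \<Sum>l<n. a l * \<omega> l)" for n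
      by (rule sq_integrable_lincomb) (rule white_noise_coordinate)
    fix e :: real assume "e > 0"
    then obtain K where K: "\<And>m n. m \<ge> K \<Longrightarrow> norm (\<Sum>l=m..<n. (a l)\<^sup>2) < e"
      using assms unfolding summable_Cauchy by blast
    have *: "(\<integral>\<omega>. ((\<Sum>l<m. a l * \<omega> l) - (\<Sum>l<n. a l * \<omega> l))\<^sup>2 \<partial>white_noise) \<le> e" if "m \<ge> n" "n \<ge> K" for m n
    proof -
      have "(\<Sum>l<m. a l * \<omega> l) - (\<Sum>l<n. a l * \<omega> l) = (\<Sum>l=n..<m. a l * \<omega> l)" for \<omega> :: "nat \<Rightarrow> real"
        using that by (simp add: lessThan_atLeast0 sum_diff_nat_ivl)
      then show ?thesis using K[of n m] that by (simp add: white_noise_lincomb(2))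
    qed
    show "\<exists>K. \<forall>m\<ge>K. \<forall>n\<ge>K. (\<integral>\<omega>. ((\<Sum>l<m. a l * \<omega> l) - (\<Sum>l<n. a l * \<omega> l))\<^sup>2 \<partial>white_noise) \<le> e"
    proof (intro exI[of _ K] allI impI)
      fix m n assume "K \<le> m" "K \<le> n"
      then show "(\<integral>\<omega>. ((\<Sum>l<m. a l * \<omega> l) - (\<Sum>l<n. a l * \<omega> l))\<^sup>2 \<partial>white_noise) \<le> e"
        using *[of n m] *[of m n] by (cases "n \<le> m") (auto simp: power2_commute)
    qed
  qed
qed

text \<open>The series \<open>\<Sum>\<^sub>l a\<^sub>l(t) \<omega>\<^sub>l\<close> has covariance \<open>\<Sum>\<^sub>l a\<^sub>l(s) a\<^sub>l(t)\<close>. The Cholesky factors of \<open>min\<close> thus take the part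
that the Schauder functions have in the construction by Levy and Ciesielski.\<close>

lemma gaussian_process_min_exists:
  "\<exists>W :: real \<Rightarrow> (nat \<Rightarrow> real) \<Rightarrow> real. \<forall>t\<in>{0..1}. W t \<in> gaussian_space \<and> (\<forall>s\<in>{0..1}. (\<integral>\<omega>. W s \<omega> * W t \<omega> \<partial>white_noise) = min s t)"
proof -
  have "{0..1::real} \<noteq> {}" by simp
  then obtain d where d: "\<And>l::nat. d l \<in> {0..1::real}" and dense: "\<And>x e. x \<in> {0..1} \<Longrightarrow> e > 0 \<Longrightarrow> \<exists>l. dist (d l) x < e"
    using dense_sequence by blast
  define a where "a = cholesky min d"
  have sums: "(\<lambda>l. a l s * a l t) sums min s t" if "s \<in> {0..1}" "t \<in> {0..1}" for s t
    unfolding a_def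
  proof (rule cholesky_sums[OF psd_kernel_min d _ that])
    fix x e :: real assume "x \<in> {0..1}" "e > 0"
    then obtain l where "dist (d l) x < e" using dense by blast
    then show "\<exists>l. min x x - 2 * min x (d l) + min (d l) (d l) < e"
      by (intro exI[of _ l]) (auto simp: dist_real_def min_def)
  qed
  have "\<exists>Y. L2_tendsto white_noise (\<lambda>n \<omega>. \<Sum>l<n. a l t * \<omega> l) Y" if "t \<in> {0..1}" for t
    using sums[OF that that] by (intro white_noise_series) (simp add: sums_iff power2_eq_square)
  then obtain W where W: "\<And>t. t \<in> {0..1} \<Longrightarrow> L2_tendsto white_noise (\<lambda>n \<omega>. \<Sum>l<n. a l t * \<omega> l) (W t)"
    by metis
  have sq: "sq_integrable white_noise (\<lambda>\<omega>. \<Sum>l<n. a l t * \<omega> l)" for n t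
    by (rule sq_integrable_lincomb) (rule white_noise_coordinate)
  show ?thesis
  proof (intro exI[of _ W] ballI conjI)
    fix t :: real assume t: "t \<in> {0..1}"
    show "W t \<in> gaussian_space"
      by (rule linear_closure_limit[OF white_noise_coordinate(3) W[OF t]])
         (rule linear_closure_lincomb, auto intro: white_noise_coordinate)
    fix s :: real assume s: "s \<in> {0..1}"
    have "(\<integral>\<omega>. (\<Sum>l<n. a l s * \<omega> l) * (\<Sum>l<n. a l t * \<omega> l) \<partial>white_noise) = (\<Sum>l<n. a l s * a l t)" for n
    proof -
      have "(\<integral>\<omega>. (\<Sum>l<n. a l s * \<omega> l) * (\<Sum>l<n. a l t * \<omega> l) \<partial>white_noise)
        = (\<Sum>l<n. \<Sum>m<n. a l s * a m t * (\<integral>\<omega>. \<omega> l * \<omega> m \<partial>white_noise))"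
        by (rule integral_mult_sum) (rule white_noise_coordinate)+
      also have "\<dots> = (\<Sum>l<n. \<Sum>m<n. if m = l then a l s * a l t else 0)"
        by (intro sum.cong refl) (auto simp: white_noise_orthogonal white_noise_coordinate(2)[unfolded power2_eq_square])
      finally show ?thesis by simp
    qed
    moreover have "(\<lambda>n. \<integral>\<omega>. (\<Sum>l<n. a l s * \<omega> l) * (\<Sum>l<n. a l t * \<omega> l) \<partial>white_noise) \<longlonglongrightarrow> (\<integral>\<omega>. W s \<omega> * W t \<omega> \<partial>white_noise)"
      by (rule L2_tendsto_inner[OF W[OF s] W[OF t] sq sq])
    ultimately show "(\<integral>\<omega>. W s \<omega> * W t \<omega> \<partial>white_noise) = min s t"
      using sums[OF s t] LIMSEQ_unique unfolding sums_def by simp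
  qed
qed

definition dyadic_floor :: "nat \<Rightarrow> real \<Rightarrow> real" where
  "dyadic_floor n t = real_of_int \<lfloor>2 ^ n * t\<rfloor> / 2 ^ n"

lemma dyadic_floor_bounds: "dyadic_floor n t \<le> t" "t < dyadic_floor n t + 1 / 2 ^ n"
proof -
  have "real_of_int \<lfloor>2 ^ n * t\<rfloor> \<le> 2 ^ n * t" "2 ^ n * t < real_of_int \<lfloor>2 ^ n * t\<rfloor> + 1" by linarith+
  then show "dyadic_floor n t \<le> t" "t < dyadic_floor n t + 1 / 2 ^ n"
    by (simp_all add: dyadic_floor_def field_simps)
qed

lemma dyadic_floor_mem:
  assumes "t \<in> {0..1}"
  shows "dyadic_floor n t \<in> {0..1}"
proof -
  have "0 \<le> dyadic_floor n t" using assms by (simp add: dyadic_floor_def)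
  then show ?thesis using dyadic_floor_bounds(1)[of n t] assms by simp
qed

lemma dyadic_floor_tendsto: "(\<lambda>n. dyadic_floor n t) \<longlonglongrightarrow> t"
proof (rule tendsto_sandwich)
  show "\<forall>\<^sub>F n in sequentially. t - (1/2) ^ n \<le> dyadic_floor n t"
    using dyadic_floor_bounds(2)[where t=t] by (intro always_eventually) (auto simp: power_one_over algebra_simps less_imp_le)
  show "\<forall>\<^sub>F n in sequentially. dyadic_floor n t \<le> t" using dyadic_floor_bounds by simp
  have "(\<lambda>n. t - (1/2) ^ n) \<longlonglongrightarrow> t - 0" by (intro tendsto_intros LIMSEQ_realpow_zero) auto
  then show "(\<lambda>n. t - (1/2) ^ n) \<longlonglongrightarrow> t" by simp
qed auto

text \<open>From one level to the next, the dyadic approximation of \<open>t\<close> moves by at most one step of the finer grid, so that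
\<open>w\<close> converges along these approximations, uniformly in \<open>t\<close>. The limit is continuous because the approximations
of two points at distance below \<open>2\<^sup>-\<^sup>n\<close> are equal or adjacent at level \<open>n\<close>.\<close>

lemma dyadic_chaining:
  fixes w :: "real \<Rightarrow> real" and R :: "nat \<Rightarrow> real"
  assumes incr: "\<And>n k. k < 2 ^ n \<Longrightarrow> \<bar>w (real (Suc k) / 2 ^ n) - w (real k / 2 ^ n)\<bar> \<le> R n"
    and R: "summable R"
  shows "t \<in> {0..1} \<Longrightarrow> convergent (\<lambda>n. w (dyadic_floor n t))"
    and "continuous_on {0..1} (\<lambda>t. lim (\<lambda>n. w (dyadic_floor n t)))"
proof -
  have R0: "0 \<le> R n" for n using incr[of 0 n] by (simp add: order_trans[OF abs_ge_zero])
  have adjacent: "\<bar>w (real_of_int j / 2 ^ n) - w (real_of_int i / 2 ^ n)\<bar> \<le> R n"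
    if "0 \<le> i" "i \<le> j" "j \<le> i + 1" "j \<le> 2 ^ n" for i j :: int and n
  proof (cases "j = i")
    case False
    then have j: "j = i + 1" using that by simp
    have i: "real_of_int i = real (nat i)" "real_of_int j = real (Suc (nat i))" using that j by simp_all
    have "nat i < 2 ^ n" using that j by (simp add: nat_less_iff)
    then show ?thesis using incr[of "nat i" n] unfolding i by simp
  qed (use R0 in simp)
  have fl: "0 \<le> \<lfloor>2 ^ n * t\<rfloor>" "\<lfloor>2 ^ n * t\<rfloor> \<le> 2 ^ n" if "t \<in> {0..1}" for n and t :: real
  proof -
    have "2 ^ n * t \<le> 2 ^ n * 1" using that by (intro mult_left_mono) auto
    then have "2 ^ n * t < 2 ^ n + 1" by linarith
    then show "\<lfloor>2 ^ n * t\<rfloor> \<le> 2 ^ n" by (simp add: floor_le_iff)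
    show "0 \<le> \<lfloor>2 ^ n * t\<rfloor>" using that by simp
  qed
  have step: "\<bar>w (dyadic_floor (Suc n) t) - w (dyadic_floor n t)\<bar> \<le> R (Suc n)" if t: "t \<in> {0..1}" for n t
  proof -
    have e: "dyadic_floor n t = real_of_int (2 * \<lfloor>2 ^ n * t\<rfloor>) / 2 ^ Suc n" by (simp add: dyadic_floor_def)
    have "2 * \<lfloor>2 ^ n * t\<rfloor> \<le> \<lfloor>2 ^ Suc n * t\<rfloor>" "\<lfloor>2 ^ Suc n * t\<rfloor> \<le> 2 * \<lfloor>2 ^ n * t\<rfloor> + 1"
      by (simp_all add: le_floor_iff floor_le_iff) linarith+
    then show ?thesis unfolding e unfolding dyadic_floor_def using fl[OF t, of n] fl[OF t, of "Suc n"]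
      by (intro adjacent) auto
  qed
  have conv: "summable (\<lambda>n. w (dyadic_floor (Suc n) t) - w (dyadic_floor n t))" if "t \<in> {0..1}" for t
    by (rule summable_comparison_test'[of "\<lambda>n. R (Suc n)" 0]) (use step[OF that] R in \<open>auto simp: summable_Suc_iff\<close>)
  have tele: "(\<Sum>i<n. w (dyadic_floor (Suc i) t) - w (dyadic_floor i t)) = w (dyadic_floor n t) - w (dyadic_floor 0 t)" for n t
    by (rule sum_lessThan_telescope[of "\<lambda>i. w (dyadic_floor i t)"])
  show conv': "convergent (\<lambda>n. w (dyadic_floor n t))" if "t \<in> {0..1}" for t
  proof -
    have "convergent (\<lambda>n. w (dyadic_floor n t) - w (dyadic_floor 0 t))"
      using conv[OF that] unfolding summable_iff_convergent tele .
    then show ?thesis using convergent_diff_const_right_iff by blast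
  qed
  define L where "L t = lim (\<lambda>n. w (dyadic_floor n t))" for t
  have L: "(\<lambda>n. w (dyadic_floor n t)) \<longlonglongrightarrow> L t" if "t \<in> {0..1}" for t
    unfolding L_def using conv'[OF that] by (simp add: convergent_LIMSEQ_iff)
  have dist_L: "\<bar>L t - w (dyadic_floor n t)\<bar> \<le> (\<Sum>m. R (m + n))" if t: "t \<in> {0..1}" for t n
  proof (rule tendsto_upperbound)
    show "(\<lambda>k. \<bar>w (dyadic_floor k t) - w (dyadic_floor n t)\<bar>) \<longlonglongrightarrow> \<bar>L t - w (dyadic_floor n t)\<bar>"
      by (intro tendsto_intros L t)
    have Rn: "summable (\<lambda>m. R (m + n))" using R by (simp add: summable_iff_shift)
    have bound: "\<bar>w (dyadic_floor (n + p) t) - w (dyadic_floor n t)\<bar> \<le> (\<Sum>m<Suc p. R (m + n))" for p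
    proof (induction p)
      case (Suc p)
      then show ?case using step[OF t, of "n + p"] by (simp add: add.commute)
    qed (use R0 in simp)
    have "\<bar>w (dyadic_floor k t) - w (dyadic_floor n t)\<bar> \<le> (\<Sum>m. R (m + n))" if "k \<ge> n" for k
    proof -
      obtain p where "k = n + p" using \<open>k \<ge> n\<close> le_Suc_ex by blast
      then show ?thesis using bound[of p] sum_le_suminf[OF Rn, of "{..<Suc p}"] R0 by simp
    qed
    then show "\<forall>\<^sub>F k in sequentially. \<bar>w (dyadic_floor k t) - w (dyadic_floor n t)\<bar> \<le> (\<Sum>m. R (m + n))"
      by (rule eventually_sequentiallyI)
  qed simp
  have "continuous_on {0..1} L"
    unfolding continuous_on_iff
  proof (intro ballI allI impI)
    fix t e :: real assume t: "t \<in> {0..1}" and e: "0 < e"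
    have "(\<lambda>n. (\<Sum>m. R (m + n))) \<longlonglongrightarrow> 0" by (rule suminf_exist_split2[OF R])
    moreover have "R \<longlonglongrightarrow> 0" by (rule summable_LIMSEQ_zero[OF R])
    ultimately have "(\<lambda>n. 2 * (\<Sum>m. R (m + n)) + R n) \<longlonglongrightarrow> 2 * 0 + 0" by (intro tendsto_intros)
    then have "\<forall>\<^sub>F n in sequentially. 2 * (\<Sum>m. R (m + n)) + R n < e" using e by (intro order_tendstoD) auto
    then obtain n where n: "2 * (\<Sum>m. R (m + n)) + R n < e" by (auto simp: eventually_sequentially)
    show "\<exists>d>0. \<forall>s\<in>{0..1}. dist s t < d \<longrightarrow> dist (L s) (L t) < e"
    proof (intro exI[of _ "1 / 2 ^ n"] conjI ballI impI)
      fix s :: real assume s: "s \<in> {0..1}" and d: "dist s t < 1 / 2 ^ n"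
      have d': "\<bar>2 ^ n * s - 2 ^ n * t\<bar> < 1"
      proof -
        have "2 ^ n * s - 2 ^ n * t = 2 ^ n * (s - t)" by (simp add: algebra_simps)
        then have "\<bar>2 ^ n * s - 2 ^ n * t\<bar> = 2 ^ n * \<bar>s - t\<bar>" by (simp add: abs_mult)
        then show ?thesis using d by (simp add: dist_real_def field_simps)
      qed
      have "\<bar>w (dyadic_floor n s) - w (dyadic_floor n t)\<bar> \<le> R n"
      proof (cases "\<lfloor>2 ^ n * t\<rfloor> \<le> \<lfloor>2 ^ n * s\<rfloor>")
        case True
        moreover have "\<lfloor>2 ^ n * s\<rfloor> \<le> \<lfloor>2 ^ n * t\<rfloor> + 1" using d' by linarith
        ultimately show ?thesis unfolding dyadic_floor_def using fl[OF s] fl[OF t] by (intro adjacent) auto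
      next
        case False
        moreover have "\<lfloor>2 ^ n * t\<rfloor> \<le> \<lfloor>2 ^ n * s\<rfloor> + 1" using d' by linarith
        ultimately have "\<bar>w (dyadic_floor n t) - w (dyadic_floor n s)\<bar> \<le> R n"
          unfolding dyadic_floor_def using fl[OF s] fl[OF t] by (intro adjacent) auto
        then show ?thesis by (simp add: abs_minus_commute)
      qed
      then show "dist (L s) (L t) < e"
        using dist_L[OF s, of n] dist_L[OF t, of n] n unfolding dist_real_def by linarith
    qed simp
  qed
  then show "continuous_on {0..1} (\<lambda>t. lim (\<lambda>n. w (dyadic_floor n t)))" by (simp add: L_def[abs_def])
qed

lemma (in prob_space) centered_gaussian_fourth_moment:
  assumes g: "centered_gaussian M Y" and v: "(\<integral>x. (Y x)\<^sup>2 \<partial>M) = \<sigma>\<^sup>2" "\<sigma> > 0"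
  shows "integrable M (\<lambda>x. (Y x) ^ 4)" "(\<integral>x. (Y x) ^ 4 \<partial>M) = 3 * \<sigma> ^ 4"
proof -
  note D = distributed_centered_gaussian[OF g v]
  have "has_bochner_integral lborel (\<lambda>x. normal_density 0 \<sigma> x * x ^ 4) (3 * \<sigma> ^ 4)"
    using normal_moment_even[OF v(2), of 0 2] v(2)
    by (simp add: fact_numeral power_divide flip: power_mult)
  then have "integrable lborel (\<lambda>x. normal_density 0 \<sigma> x * x ^ 4)" "(\<integral>x. normal_density 0 \<sigma> x * x ^ 4 \<partial>lborel) = 3 * \<sigma> ^ 4"
    by (auto simp: has_bochner_integral_iff)
  moreover have "integrable M (\<lambda>x. (Y x) ^ 4) \<longleftrightarrow> integrable lborel (\<lambda>x. normal_density 0 \<sigma> x * x ^ 4)"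
    by (rule distributed_integrable[OF D, symmetric]) auto
  moreover have "(\<integral>x. normal_density 0 \<sigma> x * x ^ 4 \<partial>lborel) = (\<integral>x. (Y x) ^ 4 \<partial>M)"
    by (rule distributed_integral[OF D]) auto
  ultimately show "integrable M (\<lambda>x. (Y x) ^ 4)" "(\<integral>x. (Y x) ^ 4 \<partial>M) = 3 * \<sigma> ^ 4" by simp_all
qed

text \<open>Bounds the maximum of finitely many increments by \<open>a\<close> plus a sum whose expectation is explicit.\<close>

lemma le_add_fourth_power:
  fixes x a :: real
  assumes "a > 0"
  shows "\<bar>x\<bar> \<le> a + x ^ 4 / a ^ 3"
proof (cases "\<bar>x\<bar> \<le> a")
  case True
  have "0 \<le> x ^ 4 / a ^ 3" using assms by (simp add: zero_le_even_power)
  with True show ?thesis by linarith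
next
  case False
  then have "a ^ 3 \<le> \<bar>x\<bar> ^ 3" using assms by (intro power_mono) auto
  then have "\<bar>x\<bar> * a ^ 3 \<le> \<bar>x\<bar> * \<bar>x\<bar> ^ 3" by (intro mult_left_mono) auto
  also have "\<dots> = x ^ 4" by (simp add: power_even_abs flip: power_Suc)
  finally have "\<bar>x\<bar> \<le> x ^ 4 / a ^ 3" using assms by (simp add: field_simps)
  then show ?thesis using assms by linarith
qed

text \<open>Kolmogorov's continuity argument. The fourth moments of the \<open>2\<^sup>n\<close> increments at level \<open>n\<close> add up to \<open>3 \<cdot> 2\<^sup>-\<^sup>n\<close>, so
that all increments at level \<open>n\<close> are bounded by a random \<open>R n\<close> which is almost surely summable. The limit along
dyadic approximations is then continuous, and by Fatou's lemma it is a modification of the process \<open>W\<close>.\<close>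

theorem brownian_motion_exists:
  "\<exists>b :: real \<Rightarrow> (nat \<Rightarrow> real) \<Rightarrow> real.
     (\<forall>t\<in>{0..1}. b t \<in> gaussian_space) \<and>
     (\<forall>s\<in>{0..1}. \<forall>t\<in>{0..1}. (\<integral>\<omega>. b s \<omega> * b t \<omega> \<partial>white_noise) = min s t) \<and>
     (AE \<omega> in white_noise. continuous_on {0..1} (\<lambda>t. b t \<omega>))"
proof -
  interpret prob_space "white_noise :: (nat \<Rightarrow> real) measure" by (rule prob_space_white_noise)
  obtain W :: "real \<Rightarrow> (nat \<Rightarrow> real) \<Rightarrow> real" where
    W': "\<forall>t\<in>{0..1}. W t \<in> gaussian_space \<and> (\<forall>s\<in>{0..1}. (\<integral>\<omega>. W s \<omega> * W t \<omega> \<partial>white_noise) = min s t)"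
    using gaussian_process_min_exists ..
  have W: "\<And>t. t \<in> {0..1} \<Longrightarrow> W t \<in> gaussian_space"
    and cov: "\<And>s t. s \<in> {0..1} \<Longrightarrow> t \<in> {0..1} \<Longrightarrow> (\<integral>\<omega>. W s \<omega> * W t \<omega> \<partial>white_noise) = min s t"
    using W' by simp_all
  have sq: "t \<in> {0..1} \<Longrightarrow> sq_integrable white_noise (W t)" for t
    using linear_closure_sq[OF white_noise_coordinate(3) W] by simp
  have Wm[measurable]: "t \<in> {0..1} \<Longrightarrow> W t \<in> borel_measurable white_noise" for t
    using sq by (simp add: sq_integrable_def)
  have var: "(\<integral>\<omega>. (W t \<omega> - W s \<omega>)\<^sup>2 \<partial>white_noise) = t - s" if "s \<in> {0..1}" "t \<in> {0..1}" "s \<le> t" for s t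
  proof -
    have "(\<integral>\<omega>. (W t \<omega> - W s \<omega>)\<^sup>2 \<partial>white_noise) = (\<integral>\<omega>. W t \<omega> * W t \<omega> - 2 * (W s \<omega> * W t \<omega>) + W s \<omega> * W s \<omega> \<partial>white_noise)"
      by (intro Bochner_Integration.integral_cong) (auto simp: power2_eq_square algebra_simps)
    also have "\<dots> = (\<integral>\<omega>. W t \<omega> * W t \<omega> \<partial>white_noise) - 2 * (\<integral>\<omega>. W s \<omega> * W t \<omega> \<partial>white_noise) + (\<integral>\<omega>. W s \<omega> * W s \<omega> \<partial>white_noise)"
      using sq_integrable_mult[OF sq sq, of t t] sq_integrable_mult[OF sq sq, of s t]
        sq_integrable_mult[OF sq sq, of s s] that by simp
    finally show ?thesis using that by (simp add: cov)
  qed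
  have grid: "k \<le> 2 ^ n \<Longrightarrow> real k / 2 ^ n \<in> {0..1}" for k n
    by (simp add: divide_le_eq)
  let ?\<Delta> = "\<lambda>n k \<omega>. W (real (Suc k) / 2 ^ n) \<omega> - W (real k / 2 ^ n) \<omega>"
  (* Any q < 1 with 2 q^3 > 1 makes both q^n and the expected fourth powers 2^-n / q^(3 n) summable. *)
  define q :: real where "q = 9 / 10"
  define R where "R n \<omega> = q ^ n + (\<Sum>k<2^n. (?\<Delta> n k \<omega>) ^ 4) / (q ^ n) ^ 3" for n \<omega>
  have q: "q > 0" by (simp add: q_def)
  have fourth: "integrable white_noise (\<lambda>\<omega>. (?\<Delta> n k \<omega>) ^ 4)" "(\<integral>\<omega>. (?\<Delta> n k \<omega>) ^ 4 \<partial>white_noise) = 3 * (1/4) ^ n"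
    if k: "k < 2 ^ n" for n k
  proof -
    have g: "centered_gaussian white_noise (?\<Delta> n k)"
      using grid[of k n] grid[of "Suc k" n] k
      by (intro gaussian_space_centered_gaussian linear_closure_diff white_noise_coordinate(3) W) auto
    have v: "(\<integral>\<omega>. (?\<Delta> n k \<omega>)\<^sup>2 \<partial>white_noise) = (sqrt ((1/2) ^ n))\<^sup>2"
      using var[of "real k / 2 ^ n" "real (Suc k) / 2 ^ n"] grid[of k n] grid[of "Suc k" n] k
      by (simp add: divide_right_mono power_one_over diff_divide_distrib[symmetric])
    have "(sqrt ((1/2) ^ n)) ^ 4 = ((sqrt ((1/2 :: real) ^ n))\<^sup>2)\<^sup>2" by (simp only: power_mult[symmetric]) simp
    also have "\<dots> = ((1/2) ^ n) * ((1/2) ^ n)" by (simp only: real_sqrt_pow2 power2_eq_square) simp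
    also have "\<dots> = (1/4) ^ n" by (simp only: power_mult_distrib[symmetric]) simp
    finally have e: "(sqrt ((1/2) ^ n)) ^ 4 = (1/4 :: real) ^ n" .
    show "integrable white_noise (\<lambda>\<omega>. (?\<Delta> n k \<omega>) ^ 4)" "(\<integral>\<omega>. (?\<Delta> n k \<omega>) ^ 4 \<partial>white_noise) = 3 * (1/4) ^ n"
      using centered_gaussian_fourth_moment[OF g v] unfolding e by simp_all
  qed
  have R0: "0 \<le> R n \<omega>" for n \<omega>
    unfolding R_def using q by (intro add_nonneg_nonneg divide_nonneg_pos sum_nonneg) (auto simp: zero_le_even_power)
  have Rint: "integrable white_noise (R n)" for n
    unfolding R_def by (intro Bochner_Integration.integrable_add integrable_divide Bochner_Integration.integrable_sum fourth) auto
  have "(\<integral>\<omega>. \<bar>R n \<omega>\<bar> \<partial>white_noise) = q ^ n + 3 * (1 / (2 * q ^ 3)) ^ n" for n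
  proof -
    have "(\<integral>\<omega>. \<bar>R n \<omega>\<bar> \<partial>white_noise) = (\<integral>\<omega>. R n \<omega> \<partial>white_noise)" using R0 by simp
    also have "\<dots> = q ^ n + (\<Sum>k<2^n. (\<integral>\<omega>. (?\<Delta> n k \<omega>) ^ 4 \<partial>white_noise)) / (q ^ n) ^ 3"
    proof -
      have iS: "integrable white_noise (\<lambda>\<omega>. (\<Sum>k<2^n. (?\<Delta> n k \<omega>) ^ 4) / (q ^ n) ^ 3)"
        by (intro integrable_divide Bochner_Integration.integrable_sum fourth(1)) simp
      have S: "(\<integral>\<omega>. (\<Sum>k<2^n. (?\<Delta> n k \<omega>) ^ 4) \<partial>white_noise) = (\<Sum>k<2^n. (\<integral>\<omega>. (?\<Delta> n k \<omega>) ^ 4 \<partial>white_noise))"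
        by (intro Bochner_Integration.integral_sum fourth(1)) simp
      have "(\<integral>\<omega>. R n \<omega> \<partial>white_noise) = (\<integral>\<omega>. q ^ n \<partial>(white_noise :: (nat \<Rightarrow> real) measure)) + (\<integral>\<omega>. (\<Sum>k<2^n. (?\<Delta> n k \<omega>) ^ 4) / (q ^ n) ^ 3 \<partial>white_noise)"
        unfolding R_def by (rule Bochner_Integration.integral_add[OF _ iS]) simp
      then show ?thesis by (simp only: integral_divide_zero S lebesgue_integral_const prob_space) simp
    qed
    also have "(\<Sum>k<2^n. (\<integral>\<omega>. (?\<Delta> n k \<omega>) ^ 4 \<partial>white_noise)) = (\<Sum>k<(2::nat)^n. 3 * (1/4) ^ n)"
      by (intro sum.cong refl fourth(2)) simp
    also have "\<dots> = 2 ^ n * (3 * (1/4) ^ n)" by simp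
    also have "(q ^ n) ^ 3 = (q ^ 3) ^ n" by (simp only: power_mult[symmetric] mult.commute)
    also have "2 ^ n * (3 * (1/4) ^ n) / (q ^ 3) ^ n = 3 * ((2 * (1/4) / q ^ 3) ^ n)"
      unfolding power_mult_distrib power_divide by simp
    finally show ?thesis by simp
  qed
  moreover have "summable (\<lambda>n. q ^ n + 3 * (1 / (2 * q ^ 3)) ^ n)"
    by (intro summable_add summable_mult summable_geometric) (auto simp: q_def power3_eq_cube)
  ultimately have "AE \<omega> in white_noise. summable (\<lambda>n. \<bar>R n \<omega>\<bar>)" by (intro AE_summable_abs Rint) simp
  then have good: "AE \<omega> in white_noise. summable (\<lambda>n. R n \<omega>)" using R0 by simp
  have incr: "\<bar>?\<Delta> n k \<omega>\<bar> \<le> R n \<omega>" if "k < 2 ^ n" for n k \<omega>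
  proof -
    have "\<bar>?\<Delta> n k \<omega>\<bar> \<le> q ^ n + (?\<Delta> n k \<omega>) ^ 4 / (q ^ n) ^ 3" using q by (intro le_add_fourth_power) simp
    also have "(?\<Delta> n k \<omega>) ^ 4 \<le> (\<Sum>k<2^n. (?\<Delta> n k \<omega>) ^ 4)"
      using that by (intro member_le_sum) (auto simp: zero_le_even_power)
    finally show ?thesis using q by (simp add: R_def divide_right_mono)
  qed
  define b where "b t \<omega> = lim (\<lambda>n. W (dyadic_floor n t) \<omega>)" for t \<omega>
  have bm: "b t \<in> borel_measurable white_noise" if "t \<in> {0..1}" for t
    unfolding b_def using dyadic_floor_mem[OF that] by measurable
  have bW: "AE \<omega> in white_noise. b t \<omega> = W t \<omega>" if t: "t \<in> {0..1}" for t
  proof -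
    have [measurable]: "b t \<in> borel_measurable white_noise" "W t \<in> borel_measurable white_noise"
      "\<And>n. W (dyadic_floor n t) \<in> borel_measurable white_noise"
      using bm[OF t] Wm[OF t] Wm[OF dyadic_floor_mem[OF t]] by auto
    have "(\<integral>\<^sup>+\<omega>. ennreal ((W t \<omega> - b t \<omega>)\<^sup>2) \<partial>white_noise) = (\<integral>\<^sup>+\<omega>. liminf (\<lambda>n. ennreal ((W t \<omega> - W (dyadic_floor n t) \<omega>)\<^sup>2)) \<partial>white_noise)"
    proof (rule nn_integral_cong_AE)
      show "AE \<omega> in white_noise. ennreal ((W t \<omega> - b t \<omega>)\<^sup>2) = liminf (\<lambda>n. ennreal ((W t \<omega> - W (dyadic_floor n t) \<omega>)\<^sup>2))"
        using good
      proof eventually_elim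
        case (elim \<omega>)
        have "(\<lambda>n. W (dyadic_floor n t) \<omega>) \<longlonglongrightarrow> b t \<omega>"
          using dyadic_chaining(1)[of "\<lambda>t. W t \<omega>" "\<lambda>n. R n \<omega>", OF incr elim t] by (simp add: b_def convergent_LIMSEQ_iff)
        then have "(\<lambda>n. ennreal ((W t \<omega> - W (dyadic_floor n t) \<omega>)\<^sup>2)) \<longlonglongrightarrow> ennreal ((W t \<omega> - b t \<omega>)\<^sup>2)"
          by (intro tendsto_ennrealI tendsto_intros)
        from lim_imp_Liminf[OF trivial_limit_sequentially this] show ?case by (rule sym)
      qed
    qed
    also have "\<dots> \<le> liminf (\<lambda>n. \<integral>\<^sup>+\<omega>. ennreal ((W t \<omega> - W (dyadic_floor n t) \<omega>)\<^sup>2) \<partial>white_noise)"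
      by (rule nn_integral_liminf) measurable
    also have "\<dots> = liminf (\<lambda>n. ennreal (t - dyadic_floor n t))"
      using var[OF dyadic_floor_mem[OF t] t dyadic_floor_bounds(1)]
      by (simp add: nn_integral_sq[OF sq_integrable_diff[OF sq[OF t] sq[OF dyadic_floor_mem[OF t]]]])
    also have "\<dots> = 0"
    proof -
      have "(\<lambda>n. ennreal (t - dyadic_floor n t)) \<longlonglongrightarrow> ennreal (t - t)"
        by (intro tendsto_ennrealI tendsto_intros dyadic_floor_tendsto)
      from lim_imp_Liminf[OF trivial_limit_sequentially this] show ?thesis by simp
    qed
    finally have "(\<integral>\<^sup>+\<omega>. ennreal ((W t \<omega> - b t \<omega>)\<^sup>2) \<partial>white_noise) = 0" by simp
    then have "AE \<omega> in white_noise. ennreal ((W t \<omega> - b t \<omega>)\<^sup>2) = 0" by (subst (asm) nn_integral_0_iff_AE) auto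
    then show ?thesis by eventually_elim (auto simp: ennreal_eq_0_iff)
  qed
  show ?thesis
  proof (intro exI[of _ b] conjI ballI)
    show "b t \<in> gaussian_space" if t: "t \<in> {0..1}" for t
    proof (rule linear_closure_limit[OF white_noise_coordinate(3)])
      have "(\<integral>\<^sup>+\<omega>. ennreal ((b t \<omega> - W t \<omega>)\<^sup>2) \<partial>white_noise) = (\<integral>\<^sup>+\<omega>. 0 \<partial>(white_noise :: (nat \<Rightarrow> real) measure))"
        using bW[OF t] by (intro nn_integral_cong_AE) (auto elim!: AE_mp)
      then show "L2_tendsto white_noise (\<lambda>n. W t) (b t)"
        using bm[OF t] by (simp add: L2_tendsto_def)
    qed (rule W[OF t])
    show "(\<integral>\<omega>. b s \<omega> * b t \<omega> \<partial>white_noise) = min s t" if s: "s \<in> {0..1}" and t: "t \<in> {0..1}" for s t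
    proof -
      have "(\<integral>\<omega>. b s \<omega> * b t \<omega> \<partial>white_noise) = (\<integral>\<omega>. W s \<omega> * W t \<omega> \<partial>white_noise)"
        using bW[OF s] bW[OF t] bm[OF s] bm[OF t] Wm[OF s] Wm[OF t] by (intro integral_cong_AE) auto
      then show ?thesis using cov[OF s t] by simp
    qed
    show "AE \<omega> in white_noise. continuous_on {0..1} (\<lambda>t. b t \<omega>)"
      using good
    proof eventually_elim
      case (elim \<omega>)
      show ?case unfolding b_def
        by (rule dyadic_chaining(2)[of "\<lambda>t. W t \<omega>" "\<lambda>n. R n \<omega>", OF incr elim])
    qed
  qed
qed

lemma (in prob_space) centered_gaussian_expectation:
  assumes "centered_gaussian M Y"
  shows "expectation Y = 0"
proof -
  have sq: "sq_integrable M Y" using assms by (simp add: centered_gaussian_def)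
  have [measurable]: "Y \<in> borel_measurable M" using sq by (simp add: sq_integrable_def)
  define v where "v = (\<integral>x. (Y x)\<^sup>2 \<partial>M)"
  have "0 \<le> v" by (simp add: v_def)
  show ?thesis
  proof (cases "v = 0")
    case True
    then have "AE x in M. (Y x)\<^sup>2 = 0"
      using sq by (simp add: v_def sq_integrable_def integral_nonneg_eq_0_iff_AE)
    then have "expectation Y = (\<integral>x. 0 \<partial>M)" by (intro integral_cong_AE) auto
    then show ?thesis by simp
  next
    case False
    then have "sqrt v > 0" "v = (sqrt v)\<^sup>2" using \<open>0 \<le> v\<close> by simp_all
    then show ?thesis
      using distributed_centered_gaussian[OF assms, of "sqrt v"] normal_distributed_expectation[of "sqrt v" Y 0]
      by (simp add: v_def)
  qed
qed

text \<open>The rows of a doubly indexed white noise are independent white noises. One Brownian motion is built from each.\<close>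

definition noise_row :: "nat \<Rightarrow> (nat \<times> nat \<Rightarrow> real) \<Rightarrow> nat \<Rightarrow> real" where
  "noise_row l \<omega> = (\<lambda>k. \<omega> (l, k))"

lemma distr_noise_row: "distr white_noise white_noise (noise_row l) = white_noise"
proof -
  have "distr (\<Pi>\<^sub>M i\<in>UNIV. std_normal_distribution) (\<Pi>\<^sub>M i\<in>UNIV. std_normal_distribution)
      (\<lambda>\<omega>. \<lambda>n\<in>UNIV. \<omega> (l, n)) = (\<Pi>\<^sub>M i\<in>(UNIV :: nat set). std_normal_distribution)"
    by (rule distr_PiM_reindex) (auto intro: prob_space_std_normal injI)
  then show ?thesis by (simp add: white_noise_def noise_row_def[abs_def] restrict_def)
qed

lemma measurable_noise_row [measurable]: "noise_row l \<in> measurable white_noise white_noise"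
proof -
  have "noise_row l \<in> measurable white_noise (\<Pi>\<^sub>M i\<in>UNIV. borel)"
    unfolding noise_row_def[abs_def] by (rule measurable_abs_UNIV) simp
  then show ?thesis using measurable_cong_sets[OF refl sets_white_noise] by blast
qed

lemma noise_row_integral:
  assumes "f \<in> borel_measurable white_noise"
  shows "(\<integral>\<omega>. f (noise_row l \<omega>) \<partial>white_noise) = (\<integral>\<omega>. f \<omega> \<partial>white_noise :: real)"
    "integrable white_noise (\<lambda>\<omega>. f (noise_row l \<omega>)) \<longleftrightarrow> integrable white_noise f"
  using integral_distr[of "noise_row l" white_noise white_noise f] integrable_distr_eq[of "noise_row l" white_noise white_noise f] assms
  by (simp_all add: distr_noise_row)

lemma gaussian_space_noise_row:
  assumes Y: "Y \<in> gaussian_space"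
  shows "(\<lambda>\<omega>. Y (noise_row l \<omega>)) \<in> gaussian_space"
proof -
  have sq: "sq_integrable white_noise Y" using Y by (simp add: linear_closure_def)
  then have [measurable]: "Y \<in> borel_measurable white_noise" by (simp add: sq_integrable_def)
  have "sq_integrable white_noise (\<lambda>\<omega>. Y (noise_row l \<omega>))"
    using sq noise_row_integral(2)[of "\<lambda>\<omega>. (Y \<omega>)\<^sup>2" l] by (simp add: sq_integrable_def)
  moreover have "\<exists>F c. finite F \<and> (\<integral>\<omega>. (Y (noise_row l \<omega>) - (\<Sum>i\<in>F. c i * \<omega> i))\<^sup>2 \<partial>white_noise) < e" if e: "e > 0" for e
  proof -
    obtain F c where F: "finite F" "(\<integral>\<omega>. (Y \<omega> - (\<Sum>i\<in>F. c i * \<omega> i))\<^sup>2 \<partial>white_noise) < e"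
      using linear_closure_approx[OF Y e] by blast
    have "(\<Sum>i\<in>Pair l ` F. c (snd i) * \<omega> i) = (\<Sum>k\<in>F. c k * noise_row l \<omega> k)" for \<omega>
      by (subst sum.reindex) (auto simp: noise_row_def inj_on_def)
    then have "(\<integral>\<omega>. (Y (noise_row l \<omega>) - (\<Sum>i\<in>Pair l ` F. c (snd i) * \<omega> i))\<^sup>2 \<partial>white_noise)
       = (\<integral>\<omega>. (Y \<omega> - (\<Sum>i\<in>F. c i * \<omega> i))\<^sup>2 \<partial>white_noise)"
      using noise_row_integral(1)[of "\<lambda>\<omega>. (Y \<omega> - (\<Sum>i\<in>F. c i * \<omega> i))\<^sup>2" l] by simp
    then show ?thesis using F by (intro exI[of _ "Pair l ` F"] exI[of _ "\<lambda>i. c (snd i)"]) simp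
  qed
  ultimately show ?thesis by (simp add: linear_closure_def)
qed

lemma indep_noise_rows:
  "prob_space.indep_vars (white_noise :: (nat \<times> nat \<Rightarrow> real) measure) (\<lambda>_. \<Pi>\<^sub>M k\<in>UNIV. borel) noise_row UNIV"
proof -
  interpret prob_space "white_noise :: (nat \<times> nat \<Rightarrow> real) measure" by (rule prob_space_white_noise)
  have "indep_vars (\<lambda>l. \<Pi>\<^sub>M i\<in>{l} \<times> UNIV. borel) (\<lambda>l \<omega>. \<lambda>i\<in>{l} \<times> (UNIV::nat set). \<omega> i) (UNIV::nat set)"
    by (rule indep_vars_restrict[OF indep_white_noise]) (auto simp: disjoint_family_on_def)
  then have "indep_vars (\<lambda>_. \<Pi>\<^sub>M k\<in>UNIV. borel) (\<lambda>l \<omega>. noise_row l (\<lambda>i\<in>{l} \<times> UNIV. \<omega> i)) UNIV"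
  proof (rule indep_vars_compose2)
    fix l :: nat
    show "noise_row l \<in> measurable (\<Pi>\<^sub>M i\<in>{l} \<times> UNIV. borel) (\<Pi>\<^sub>M k\<in>UNIV. borel)"
      unfolding noise_row_def[abs_def] by (rule measurable_abs_UNIV) (auto intro!: measurable_component_singleton)
  qed
  then show ?thesis by (simp add: noise_row_def[abs_def])
qed

lemma strict_steps_mono:
  fixes \<tau> :: "nat \<Rightarrow> real"
  assumes "\<And>i. i < n \<Longrightarrow> \<tau> i < \<tau> (Suc i)" "i \<le> j" "j \<le> n"
  shows "\<tau> i \<le> \<tau> j"
  using assms(2,3)
proof (induction j rule: dec_induct)
  case (step k)
  then show ?case using assms(1)[of k] by simp
qed simp

text \<open>Increments over disjoint intervals are orthogonal, as their covariance is a mixed second difference of \<open>min\<close>.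
Being jointly Gaussian, they are independent.\<close>

lemma standard_brownian_motion_gaussian:
  fixes b :: "real \<Rightarrow> ('i \<Rightarrow> real) \<Rightarrow> real"
  assumes b: "\<And>t. t \<in> {0..1} \<Longrightarrow> b t \<in> gaussian_space"
    and cov: "\<And>s t. s \<in> {0..1} \<Longrightarrow> t \<in> {0..1} \<Longrightarrow> (\<integral>\<omega>. b s \<omega> * b t \<omega> \<partial>white_noise) = min s t"
    and cont: "AE \<omega> in white_noise. continuous_on {0..1} (\<lambda>t. b t \<omega>)"
  shows "standard_brownian_motion white_noise {0..1} b"
proof -
  interpret prob_space "white_noise :: ('i \<Rightarrow> real) measure" by (rule prob_space_white_noise)
  have sq: "sq_integrable white_noise (b t)" if "t \<in> {0..1}" for t
    using linear_closure_sq[OF white_noise_coordinate(3) b[OF that]] .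
  have m: "b t \<in> borel_measurable white_noise" if "t \<in> {0..1}" for t using sq[OF that] by (simp add: sq_integrable_def)
  have incr: "(\<integral>\<omega>. (b t1 \<omega> - b t0 \<omega>) * (b s1 \<omega> - b s0 \<omega>) \<partial>white_noise)
      = min t1 s1 - min t1 s0 - min t0 s1 + min t0 s0"
    if "t0 \<in> {0..1}" "t1 \<in> {0..1}" "s0 \<in> {0..1}" "s1 \<in> {0..1}" for t0 t1 s0 s1
  proof -
    have "(\<integral>\<omega>. (b t1 \<omega> - b t0 \<omega>) * (b s1 \<omega> - b s0 \<omega>) \<partial>white_noise)
      = (\<integral>\<omega>. b t1 \<omega> * b s1 \<omega> - b t1 \<omega> * b s0 \<omega> - b t0 \<omega> * b s1 \<omega> + b t0 \<omega> * b s0 \<omega> \<partial>white_noise)"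
      by (simp add: algebra_simps)
    also have "\<dots> = min t1 s1 - min t1 s0 - min t0 s1 + min t0 s0"
      using that by (simp add: sq_integrable_mult[OF sq sq] cov)
    finally show ?thesis .
  qed
  have incr_gauss: "(\<lambda>\<omega>. b t \<omega> - b s \<omega>) \<in> gaussian_space" if "s \<in> {0..1}" "t \<in> {0..1}" for s t
    using that by (intro linear_closure_diff white_noise_coordinate(3) b)
  show ?thesis
    unfolding standard_brownian_motion_def
  proof (intro conjI allI ballI impI)
    show "b t \<in> borel_measurable white_noise" if "t \<in> {0..1}" for t by (rule m[OF that])
    have [measurable]: "b 0 \<in> borel_measurable white_noise" by (rule m) simp
    have "(\<integral>\<omega>. (b 0 \<omega>)\<^sup>2 \<partial>white_noise) = 0" using cov[of 0 0] by (simp add: power2_eq_square)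
    then have "AE \<omega> in white_noise. (b 0 \<omega>)\<^sup>2 = 0"
      using sq[of 0] by (simp add: sq_integrable_def integral_nonneg_eq_0_iff_AE)
    then show "AE \<omega> in white_noise. b 0 \<omega> = 0" by eventually_elim simp
    show "AE \<omega> in white_noise. continuous_on {0..1} (\<lambda>t. b t \<omega>)" by (rule cont)
  next
    fix s t :: real assume st: "s \<in> {0..1}" "t \<in> {0..1}" "s < t"
    have "(\<integral>\<omega>. (b t \<omega> - b s \<omega>)\<^sup>2 \<partial>white_noise) = (sqrt (t - s))\<^sup>2"
      using incr[of s t s t] st by (simp add: power2_eq_square)
    then show "distributed white_noise lborel (\<lambda>\<omega>. b t \<omega> - b s \<omega>) (normal_density 0 (sqrt (t - s)))"
      using st by (intro distributed_centered_gaussian gaussian_space_centered_gaussian incr_gauss) auto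
  next
    fix n :: nat and \<tau> :: "nat \<Rightarrow> real" assume \<tau>: "(\<forall>i\<le>n. \<tau> i \<in> {0..1}) \<and> (\<forall>i<n. \<tau> i < \<tau> (Suc i))"
    show "indep_vars (\<lambda>_. borel) (\<lambda>i \<omega>. b (\<tau> (Suc i)) \<omega> - b (\<tau> i) \<omega>) {..<n}"
    proof (rule orthogonal_jointly_gaussian_indep)
      show "centered_gaussian white_noise (\<lambda>x. \<Sum>j<n. c j * (b (\<tau> (Suc j)) x - b (\<tau> j) x))" for c
        using \<tau> by (intro gaussian_space_centered_gaussian linear_closure_sum white_noise_coordinate(3) incr_gauss) auto
      fix i j assume ij: "i \<in> {..<n}" "j \<in> {..<n}" "i \<noteq> j"
      have ord: "\<tau> (Suc i) \<le> \<tau> j" if "i < j" "j \<le> n" for i j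
        using strict_steps_mono[of n \<tau> "Suc i" j] \<tau> that by simp
      have lt: "\<tau> i < \<tau> (Suc i)" "\<tau> j < \<tau> (Suc j)" using \<tau> ij by auto
      have "\<tau> (Suc i) \<le> \<tau> j \<or> \<tau> (Suc j) \<le> \<tau> i"
        using ord[of i j] ord[of j i] ij by (cases "i < j") auto
      then show "(\<integral>\<omega>. (b (\<tau> (Suc i)) \<omega> - b (\<tau> i) \<omega>) * (b (\<tau> (Suc j)) \<omega> - b (\<tau> j) \<omega>) \<partial>white_noise) = 0"
        using incr[of "\<tau> i" "\<tau> (Suc i)" "\<tau> j" "\<tau> (Suc j)"] \<tau> ij lt by (auto simp: min_def)
    qed simp
  qed
qed

theorem independent_brownian_motions_exist:
  "\<exists>B :: nat \<Rightarrow> real \<Rightarrow> (nat \<times> nat \<Rightarrow> real) \<Rightarrow> real.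
     independent_brownian_motions white_noise {0..1} B \<and>
     (\<forall>l. \<forall>t\<in>{0..1}. B l t \<in> gaussian_space) \<and>
     (\<forall>l m. \<forall>s\<in>{0..1}. \<forall>t\<in>{0..1}. (\<integral>\<omega>. B l s \<omega> * B m t \<omega> \<partial>white_noise) = (if l = m then min s t else 0))"
proof -
  let ?N = "white_noise :: (nat \<times> nat \<Rightarrow> real) measure"
  interpret prob_space ?N by (rule prob_space_white_noise)
  obtain b :: "real \<Rightarrow> (nat \<Rightarrow> real) \<Rightarrow> real" where
    b': "(\<forall>t\<in>{0..1}. b t \<in> gaussian_space) \<and>
     (\<forall>s\<in>{0..1}. \<forall>t\<in>{0..1}. (\<integral>\<omega>. b s \<omega> * b t \<omega> \<partial>white_noise) = min s t) \<and>
     (AE \<omega> in white_noise. continuous_on {0..1} (\<lambda>t. b t \<omega>))"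
    using brownian_motion_exists ..
  then have b: "\<And>t. t \<in> {0..1} \<Longrightarrow> b t \<in> gaussian_space"
    and cov: "\<And>s t. s \<in> {0..1} \<Longrightarrow> t \<in> {0..1} \<Longrightarrow> (\<integral>\<omega>. b s \<omega> * b t \<omega> \<partial>white_noise) = min s t"
    and cont: "AE \<omega> in white_noise. continuous_on {0..1} (\<lambda>t. b t \<omega>)" by auto
  have sqb: "sq_integrable white_noise (b t)" if "t \<in> {0..1}" for t
    using linear_closure_sq[OF white_noise_coordinate(3) b[OF that]] .
  have bm: "b t \<in> borel_measurable white_noise" if "t \<in> {0..1}" for t using sqb[OF that] by (simp add: sq_integrable_def)
  have bm': "b t \<in> borel_measurable (\<Pi>\<^sub>M k\<in>UNIV. borel)" if "t \<in> {0..1}" for t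
    using bm[OF that] measurable_cong_sets[OF sets_white_noise refl] by blast
  define B where "B l t \<omega> = b t (noise_row l \<omega>)" for l t \<omega>
  have BG: "B l t \<in> gaussian_space" if "t \<in> {0..1}" for l t
    unfolding B_def[abs_def] by (rule gaussian_space_noise_row[OF b[OF that]])
  have Bcov: "(\<integral>\<omega>. B l s \<omega> * B m t \<omega> \<partial>?N) = (if l = m then min s t else 0)" if st: "s \<in> {0..1}" "t \<in> {0..1}" for l m s t
  proof (cases "l = m")
    case True
    have "(\<lambda>\<omega>. b s \<omega> * b t \<omega>) \<in> borel_measurable white_noise" using bm st by simp
    from noise_row_integral(1)[OF this, of l] show ?thesis using True cov[OF st] by (simp add: B_def)
  next
    case False
    define c where "c k = (if k = l then b s else b t)" for k
    have "indep_vars (\<lambda>_. borel) (\<lambda>k \<omega>. c k (noise_row k \<omega>)) {l, m}"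
      by (rule indep_vars_compose2[OF indep_vars_subset[OF indep_noise_rows]]) (use bm' st in \<open>auto simp: c_def\<close>)
    moreover have "integrable ?N (\<lambda>\<omega>. c k (noise_row k \<omega>))" for k
      using st sq_integrable_integrable[OF linear_closure_sq[OF white_noise_coordinate(3) BG]]
      by (simp add: c_def B_def[abs_def])
    ultimately have "(\<integral>\<omega>. (\<Prod>k\<in>{l, m}. c k (noise_row k \<omega>)) \<partial>?N) = (\<Prod>k\<in>{l, m}. \<integral>\<omega>. c k (noise_row k \<omega>) \<partial>?N)"
      by (intro indep_vars_lebesgue_integral) auto
    moreover have "(\<integral>\<omega>. b s (noise_row l \<omega>) \<partial>?N) = 0"
      using centered_gaussian_expectation[OF gaussian_space_centered_gaussian[OF BG[OF st(1), of l]]] by (simp add: B_def[abs_def])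
    ultimately show ?thesis using False by (simp add: c_def B_def)
  qed
  have "standard_brownian_motion ?N {0..1} (B l)" for l
  proof (rule standard_brownian_motion_gaussian)
    have "AE \<omega> in distr white_noise white_noise (noise_row l). continuous_on {0..1} (\<lambda>t. b t \<omega>)"
      unfolding distr_noise_row by (rule cont)
    then show "AE \<omega> in ?N. continuous_on {0..1} (\<lambda>t. B l t \<omega>)"
      unfolding B_def by (rule AE_distrD[OF measurable_noise_row])
  qed (use BG Bcov in auto)
  moreover have "indep_vars (\<lambda>_. \<Pi>\<^sub>M t\<in>{0..1}. borel) (\<lambda>l \<omega>. \<lambda>t\<in>{0..1}. B l t \<omega>) UNIV"
    unfolding B_def
  proof (rule indep_vars_compose2[OF indep_noise_rows, of "\<lambda>l z. \<lambda>t\<in>{0..1}. b t z"])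
    show "(\<lambda>z. \<lambda>t\<in>{0..1}. b t z) \<in> measurable (\<Pi>\<^sub>M k\<in>UNIV. borel) (\<Pi>\<^sub>M t\<in>{0..1}. borel)"
      by (rule measurable_restrict) (rule bm')
  qed
  ultimately have "independent_brownian_motions ?N {0..1} B" by (simp add: independent_brownian_motions_def)
  then show ?thesis using BG Bcov by blast
qed

section \<open>Wiener integrals of bounded functions\<close>

text \<open>Indexed by all real numbers, since \<open>linear_closure\<close> uses a whole type as index set. The clamping keeps the interval
inside \<open>{0<..a}\<close>.\<close>

definition interval_indicators :: "real \<Rightarrow> real \<Rightarrow> real \<Rightarrow> real" where
  "interval_indicators a x = indicator {0<..max 0 (min a x)}"

lemma sq_integrable_interval_indicators: "sq_integrable lborel (interval_indicators a x)"
  unfolding interval_indicators_def by (rule sq_integrable_indicator_Ioc)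

lemma L2_tendsto_dominated:
  fixes f :: "'a \<Rightarrow> real"
  assumes [measurable]: "f \<in> borel_measurable M" "\<And>n. s n \<in> borel_measurable M"
    and g: "integrable M g"
    and lim: "\<And>x. x \<in> space M \<Longrightarrow> (\<lambda>n. s n x) \<longlonglongrightarrow> f x" and dom: "\<And>n x. x \<in> space M \<Longrightarrow> (f x - s n x)\<^sup>2 \<le> g x"
  shows "L2_tendsto M s f"
proof -
  have int: "integrable M (\<lambda>x. (f x - s n x)\<^sup>2)" for n
  proof (rule Bochner_Integration.integrable_bound[OF g])
    show "AE x in M. norm ((f x - s n x)\<^sup>2) \<le> norm (g x)"
      using order_trans[OF dom abs_ge_self] by (intro AE_I2) simp
  qed measurable
  have "(\<lambda>n. \<integral>x. (f x - s n x)\<^sup>2 \<partial>M) \<longlonglongrightarrow> (\<integral>x. 0 \<partial>M)"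
  proof (rule integral_dominated_convergence[where w=g])
    show "AE x in M. (\<lambda>n. (f x - s n x)\<^sup>2) \<longlonglongrightarrow> 0"
    proof (rule AE_I2)
      fix x assume "x \<in> space M"
      then have "(\<lambda>n. (f x - s n x)\<^sup>2) \<longlonglongrightarrow> (f x - f x)\<^sup>2" by (intro tendsto_intros lim)
      then show "(\<lambda>n. (f x - s n x)\<^sup>2) \<longlonglongrightarrow> 0" by simp
    qed
  qed (use g dom in auto)
  then have "(\<lambda>n. ennreal (\<integral>x. (f x - s n x)\<^sup>2 \<partial>M)) \<longlonglongrightarrow> ennreal 0" by (intro tendsto_ennrealI) simp
  then show ?thesis by (simp add: L2_tendsto_def nn_integral_eq_integral[OF int])
qed

text \<open>The sets whose indicators lie in the closure form a Dynkin system that contains the half-lines.\<close>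

lemma indicator_in_closure:
  fixes A :: "real set"
  assumes "A \<in> sets borel" "0 \<le> a"
  shows "(\<lambda>x. indicator {0<..a} x * indicator A x) \<in> linear_closure lborel (interval_indicators a)"
proof -
  let ?J = "\<lambda>A x. indicator {0<..a} x * indicator A x :: real"
  note X = sq_integrable_interval_indicators
  (* The clamping covers the case x < 0, where both sides vanish, and the case x > a. *)
  have base: "?J {..x} = interval_indicators a x" for x
    by (auto simp: interval_indicators_def indicator_def fun_eq_iff)
  have "Int_stable (range (atMost :: real \<Rightarrow> _))" by (auto simp: Int_stable_def)
  moreover have "range (atMost :: real \<Rightarrow> _) \<subseteq> Pow UNIV" by simp
  moreover have "A \<in> sigma_sets UNIV (range atMost)"
    using assms(1) by (simp add: borel_eq_atMost)
  ultimately show ?thesis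
  proof (induction A rule: sigma_sets_induct_disjoint)
    case (basic A)
    then show ?case using base linear_closure_base[OF X] by auto
  next
    case empty
    then show ?case using linear_closure_lincomb[OF X, of "{}"] by simp
  next
    case (compl A)
    have "(\<lambda>x. ?J {..a} x - ?J A x) = ?J (UNIV - A)" by (auto simp: indicator_def)
    moreover have "?J {..a} \<in> linear_closure lborel (interval_indicators a)"
      unfolding base by (rule linear_closure_base[OF X])
    ultimately show ?case using linear_closure_diff[OF X _ compl(2)] by metis
  next
    case (union A)
    have [measurable]: "A i \<in> sets borel" for i using union(2) by (auto simp: borel_eq_atMost)
    show ?case
    proof (rule linear_closure_limit[OF X])
      have disj: "(\<lambda>i. indicator (A i) x) sums (indicator (\<Union>i. A i) x :: real)" for x
        by (rule indicator_sums) (use union(1) in \<open>auto simp: disjoint_family_on_def\<close>)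
      show "L2_tendsto lborel (\<lambda>n x. \<Sum>i<n. 1 * ?J (A i) x) (?J (\<Union>i. A i))"
      proof (rule L2_tendsto_dominated)
        show "integrable lborel (indicator {0<..a} :: real \<Rightarrow> real)"
          by (rule integrable_indicator_Ioc)
        show "(\<lambda>n. \<Sum>i<n. 1 * ?J (A i) x) \<longlonglongrightarrow> ?J (\<Union>i. A i) x" for x
          using sums_mult[OF disj, of "indicator {0<..a} x" x] by (simp add: sums_def)
        show "(?J (\<Union>i. A i) x - (\<Sum>i<n. 1 * ?J (A i) x))\<^sup>2 \<le> indicator {0<..a} x" for n x
        proof -
          have "(\<Sum>i<n. indicator (A i) x) \<le> (indicator (\<Union>i. A i) x :: real)"
            using sum_le_suminf[of "\<lambda>i. indicator (A i) x :: real" "{..<n}"] disj[of x] by (simp add: sums_iff)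
          moreover have "0 \<le> (\<Sum>i<n. indicator (A i) x :: real)" by (intro sum_nonneg) simp
          moreover have "indicator (\<Union>i. A i) x \<le> (1::real)" by (simp add: indicator_def)
          ultimately have "\<bar>indicator (\<Union>i. A i) x - (\<Sum>i<n. indicator (A i) x :: real)\<bar> \<le> 1" by linarith
          then have "(indicator (\<Union>i. A i) x - (\<Sum>i<n. indicator (A i) x :: real))\<^sup>2 \<le> 1"
            by (simp add: abs_square_le_1)
          then show ?thesis by (simp add: indicator_def[of "{0<..a}"] sum_distrib_left[symmetric])
        qed
      qed measurable
      show "(\<lambda>x. \<Sum>i<n. 1 * ?J (A i) x) \<in> linear_closure lborel (interval_indicators a)" for n
        by (rule linear_closure_sum[OF X]) (rule union(3))
    qed
  qed
qed

text \<open>The function is approximated uniformly by \<open>\<lfloor>(n + 1) f\<rfloor> / (n + 1)\<close>, which takes finitely many values.\<close>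

lemma bounded_in_closure:
  fixes f :: "real \<Rightarrow> real"
  assumes [measurable]: "f \<in> borel_measurable borel" and C: "\<And>x. \<bar>f x\<bar> \<le> real C" and a: "0 \<le> a"
  shows "(\<lambda>x. indicator {0<..a} x * f x) \<in> linear_closure lborel (interval_indicators a)"
proof -
  note X = sq_integrable_interval_indicators
  define A where "A n k = {x. \<lfloor>real (Suc n) * f x\<rfloor> = k}" for n and k :: int
  have [measurable]: "A n k \<in> sets borel" for n k unfolding A_def by measurable
  let ?K = "\<lambda>n. {- int (Suc n * C) - 1..int (Suc n * C)}"
  define s where "s n x = (\<Sum>k\<in>?K n. (real_of_int k / real (Suc n)) * (indicator {0<..a} x * indicator (A n k) x))" for n x
  have s: "s n x = indicator {0<..a} x * (real_of_int \<lfloor>real (Suc n) * f x\<rfloor> / real (Suc n))" for n x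
  proof -
    have "\<bar>real (Suc n) * f x\<bar> \<le> real (Suc n) * real C" using C[of x] by (simp add: abs_mult mult_left_mono del: of_nat_Suc)
    then have "\<bar>real (Suc n) * f x\<bar> \<le> real (Suc n * C)" by (simp only: of_nat_mult)
    then have "\<lfloor>real (Suc n) * f x\<rfloor> \<le> int (Suc n * C)" "- int (Suc n * C) - 1 \<le> \<lfloor>real (Suc n) * f x\<rfloor>"
      unfolding floor_le_iff le_floor_iff of_int_diff of_int_minus of_int_of_nat_eq of_int_1 by linarith+
    then have "\<lfloor>real (Suc n) * f x\<rfloor> \<in> ?K n" by simp
    then have "(\<Sum>k\<in>?K n. (real_of_int k / real (Suc n)) * (indicator {0<..a} x * (if k = \<lfloor>real (Suc n) * f x\<rfloor> then 1 else 0)))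
       = indicator {0<..a} x * (real_of_int \<lfloor>real (Suc n) * f x\<rfloor> / real (Suc n))"
      by (simp add: if_distrib[of "\<lambda>y. _ * y"] sum.delta' cong: if_cong del: of_nat_Suc)
    moreover have "indicator (A n k) x = (if k = \<lfloor>real (Suc n) * f x\<rfloor> then 1 else 0 :: real)" for k
      by (auto simp: A_def)
    ultimately show ?thesis by (simp only: s_def)
  qed
  have near: "\<bar>f x - real_of_int \<lfloor>real (Suc n) * f x\<rfloor> / real (Suc n)\<bar> \<le> 1 / real (Suc n)" for n x
  proof -
    have "\<bar>real (Suc n) * f x - real_of_int \<lfloor>real (Suc n) * f x\<rfloor>\<bar> \<le> 1" by linarith
    moreover have "f x - real_of_int \<lfloor>real (Suc n) * f x\<rfloor> / real (Suc n) = (real (Suc n) * f x - real_of_int \<lfloor>real (Suc n) * f x\<rfloor>) / real (Suc n)"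
      by (simp add: field_simps del: of_nat_Suc)
    ultimately show ?thesis by (simp add: divide_right_mono del: of_nat_Suc)
  qed
  show ?thesis
  proof (rule linear_closure_limit[OF X])
    show "L2_tendsto lborel s (\<lambda>x. indicator {0<..a} x * f x)"
    proof (rule L2_tendsto_dominated)
      show "integrable lborel (indicator {0<..a} :: real \<Rightarrow> real)"
        by (rule integrable_indicator_Ioc)
      show "s n \<in> borel_measurable lborel" for n unfolding s_def by measurable
      show "(\<lambda>n. s n x) \<longlonglongrightarrow> indicator {0<..a} x * f x" for x
      proof -
        have "(\<lambda>n. real_of_int \<lfloor>real (Suc n) * f x\<rfloor> / real (Suc n) - f x) \<longlonglongrightarrow> 0"
          by (rule Lim_null_comparison[OF always_eventually[OF allI] LIMSEQ_Suc[OF lim_1_over_n]])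
             (use near in \<open>simp add: abs_minus_commute del: of_nat_Suc\<close>)
        then show ?thesis unfolding s by (intro tendsto_intros) (simp add: LIM_zero_iff)
      qed
      show "(indicator {0<..a} x * f x - s n x)\<^sup>2 \<le> indicator {0<..a} x" for n x
      proof -
        have "\<bar>f x - real_of_int \<lfloor>real (Suc n) * f x\<rfloor> / real (Suc n)\<bar> \<le> 1"
          by (rule order_trans[OF near]) simp
        then have "(f x - real_of_int \<lfloor>real (Suc n) * f x\<rfloor> / real (Suc n))\<^sup>2 \<le> 1" by (simp only: abs_square_le_1)
        then show ?thesis unfolding s by (simp add: indicator_def del: of_nat_Suc)
      qed
      show "(\<lambda>x. indicator {0<..a} x * f x) \<in> borel_measurable lborel"
        using borel_measurable_times[of "indicator {0<..a}" lborel f] assms(1) by simp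
    qed
    show "s n \<in> linear_closure lborel (interval_indicators a)" for n
      unfolding s_def[abs_def] by (intro linear_closure_sum[OF X] indicator_in_closure a) simp
  qed
qed

text \<open>Rewrites a combination of the overlapping intervals \<open>{0<..x j}\<close> as a step function on consecutive cells: the value
on a cell is the sum of the coefficients of the intervals that contain it.\<close>

lemma summation_by_parts_tail:
  fixes c :: "nat \<Rightarrow> real"
  shows "(\<Sum>i<m. (\<Sum>j=i..<m. c j) * (\<phi> (Suc i) - \<phi> i)) = (\<Sum>j<m. c j * (\<phi> (Suc j) - \<phi> 0))"
proof (induction m)
  case (Suc m)
  have "(\<Sum>i<Suc m. (\<Sum>j=i..<Suc m. c j) * (\<phi> (Suc i) - \<phi> i))
     = (\<Sum>i<m. (\<Sum>j=i..<m. c j) * (\<phi> (Suc i) - \<phi> i)) + c m * (\<Sum>i<Suc m. \<phi> (Suc i) - \<phi> i)"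
    by (simp add: distrib_right sum.distrib sum_distrib_left distrib_left)
  also have "(\<Sum>i<Suc m. \<phi> (Suc i) - \<phi> i) = \<phi> (Suc m) - \<phi> 0"
    by (rule sum_lessThan_telescope)
  finally show ?case using Suc by simp
qed simp

context
  fixes m :: nat and x :: "nat \<Rightarrow> real" and s :: "nat \<Rightarrow> real" and c :: "nat \<Rightarrow> real"
  assumes x: "\<And>i. i < m \<Longrightarrow> 0 \<le> x i" "\<And>i j. i \<le> j \<Longrightarrow> j < m \<Longrightarrow> x i \<le> x j"
  defines "s \<equiv> (\<lambda>i. case i of 0 \<Rightarrow> 0 | Suc k \<Rightarrow> x k)"
begin

lemma partition_mono: "i < m \<Longrightarrow> 0 \<le> s i \<and> s i \<le> s (Suc i)"
  using x by (cases i) (auto simp: s_def)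

lemma step_function_partition:
  "step_function m s (\<lambda>i. \<Sum>j=i..<m. c j) y = (\<Sum>j<m. c j * indicator {0<..x j} y)"
proof -
  have "step_function m s (\<lambda>i. \<Sum>j=i..<m. c j) y
     = (\<Sum>i<m. (\<Sum>j=i..<m. c j) * (indicator {0<..s (Suc i)} y - indicator {0<..s i} y))"
    unfolding step_function_def using partition_mono
    by (intro sum.cong refl arg_cong2[where f="(*)"]) (fastforce simp: indicator_def)
  also have "\<dots> = (\<Sum>j<m. c j * (indicator {0<..s (Suc j)} y - indicator {0<..s 0} y))"
    by (rule summation_by_parts_tail)
  finally show ?thesis by (simp add: s_def)
qed

lemma step_integral_partition:
  "step_integral B m s (\<lambda>i. \<Sum>j=i..<m. c j) \<omega> = (\<Sum>j<m. c j * (B (x j) \<omega> - B 0 \<omega>))"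
  unfolding step_integral_def
  using summation_by_parts_tail[where m=m and c=c and \<phi>="\<lambda>i. B (s i) \<omega>"] by (simp add: s_def)

end

lemma closure_partition_approx:
  assumes Y: "Y \<in> linear_closure lborel (interval_indicators a)" and a: "0 \<le> a" and e: "e > 0"
  shows "\<exists>(m::nat) x c. (\<forall>i<m. x i \<in> {0..a}) \<and> (\<forall>i j. i \<le> j \<longrightarrow> j < m \<longrightarrow> x i \<le> x j) \<and>
     (\<integral>y. (Y y - (\<Sum>i<m. c i * indicator {0<..x i} y))\<^sup>2 \<partial>lborel) < e"
proof -
  obtain F c where F: "finite F" "(\<integral>y. (Y y - (\<Sum>i\<in>F. c i * interval_indicators a i y))\<^sup>2 \<partial>lborel) < e"
    using linear_closure_approx[OF Y e] by blast
  let ?xs = "sorted_list_of_set F"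
  define x where "x i = max 0 (min a (?xs ! i))" for i
  have bij: "bij_betw ((!) ?xs) {..<card F} F"
    using F by (intro bij_betw_nth) auto
  have "(\<Sum>i\<in>F. c i * interval_indicators a i y) = (\<Sum>i<card F. c (?xs ! i) * indicator {0<..x i} y)" for y
    unfolding x_def interval_indicators_def by (rule sum.reindex_bij_betw[OF bij, symmetric])
  moreover have "x i \<le> x j" if "i \<le> j" "j < card F" for i j
    using sorted_nth_mono[of ?xs i j] that F by (auto simp: x_def)
  moreover have "x i \<in> {0..a}" for i using a by (auto simp: x_def)
  ultimately show ?thesis using F by (intro exI[of _ "card F"] exI[of _ x] exI[of _ "\<lambda>i. c (?xs ! i)"]) auto
qed

text \<open>Describes the Wiener integral by intervals that start at \<open>0\<close>, because their inner products are just minima. The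
value \<open>B 0\<close> is subtracted since it vanishes only almost surely.\<close>

definition wiener_approx ::
  "(real \<Rightarrow> ('i \<Rightarrow> real) \<Rightarrow> real) \<Rightarrow> (real \<Rightarrow> real) \<Rightarrow> real \<Rightarrow> (('i \<Rightarrow> real) \<Rightarrow> real) \<Rightarrow> bool" where
  "wiener_approx B f a Y \<longleftrightarrow> (\<exists>(m :: nat \<Rightarrow> nat) x c. (\<forall>p. \<forall>i<m p. x p i \<in> {0..a}) \<and>
     L2_tendsto lborel (\<lambda>p y. \<Sum>i<m p. c p i * indicator {0<..x p i} y) (\<lambda>y. indicator {0<..a} y * f y) \<and>
     L2_tendsto white_noise (\<lambda>p \<omega>. \<Sum>i<m p. c p i * (B (x p i) \<omega> - B 0 \<omega>)) Y)"

lemma indicator_step_inner: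
  fixes m m' :: nat and x x' c c' :: "nat \<Rightarrow> real"
  assumes x: "\<And>i. i < m \<Longrightarrow> 0 \<le> x i" and x': "\<And>i. i < m' \<Longrightarrow> 0 \<le> x' i"
  shows "(\<integral>y. (\<Sum>i<m. c i * indicator {0<..x i} y) * (\<Sum>i<m'. c' i * indicator {0<..x' i} y) \<partial>lborel)
     = (\<Sum>i<m. \<Sum>j<m'. c i * c' j * min (x i) (x' j))"
proof -
  have "(\<integral>y. (\<Sum>i<m. c i * indicator {0<..x i} y) * (\<Sum>i<m'. c' i * indicator {0<..x' i} y) \<partial>lborel)
     = (\<Sum>i<m. \<Sum>j<m'. c i * c' j * (\<integral>y. indicator {0<..x i} y * indicator {0<..x' j} y \<partial>lborel))"
    by (rule integral_mult_sum[where f="\<lambda>i. indicator {0<..x i}" and g="\<lambda>i. indicator {0<..x' i}"])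
       (rule sq_integrable_indicator_Ioc)+
  also have "\<dots> = (\<Sum>i<m. \<Sum>j<m'. c i * c' j * min (x i) (x' j))"
    using x x' by (intro sum.cong refl) (simp add: integral_indicator_Ioc_min)
  finally show ?thesis .
qed

lemma wiener_approxE:
  assumes "wiener_approx B f a Y"
  obtains m :: "nat \<Rightarrow> nat" and x c where "\<And>p i. i < m p \<Longrightarrow> x p i \<in> {0..a}"
     "L2_tendsto lborel (\<lambda>p y. \<Sum>i<m p. c p i * indicator {0<..x p i} y) (\<lambda>y. indicator {0<..a} y * f y)"
     "L2_tendsto white_noise (\<lambda>p \<omega>. \<Sum>i<m p. c p i * (B (x p i) \<omega> - B 0 \<omega>)) Y"
  using assms unfolding wiener_approx_def by (elim exE conjE) (rule that, simp_all)

lemma brownian_step_inner: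
  fixes m m' :: nat
  assumes B: "\<And>t. t \<in> {0..1} \<Longrightarrow> B t \<in> gaussian_space" and B': "\<And>t. t \<in> {0..1} \<Longrightarrow> B' t \<in> gaussian_space"
    and cov: "\<And>s t. s \<in> {0..1} \<Longrightarrow> t \<in> {0..1} \<Longrightarrow> (\<integral>\<omega>. B s \<omega> * B' t \<omega> \<partial>white_noise) = \<kappa> * min s t"
    and x: "\<And>i. i < m \<Longrightarrow> x i \<in> {0..1}" and x': "\<And>i. i < m' \<Longrightarrow> x' i \<in> {0..1}"
  shows "(\<integral>\<omega>. (\<Sum>i<m. c i * (B (x i) \<omega> - B 0 \<omega>)) * (\<Sum>i<m'. c' i * (B' (x' i) \<omega> - B' 0 \<omega>)) \<partial>white_noise)
     = \<kappa> * (\<Sum>i<m. \<Sum>j<m'. c i * c' j * min (x i) (x' j))"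
proof -
  have sq: "t \<in> {0..1} \<Longrightarrow> sq_integrable white_noise (B t)" "t \<in> {0..1} \<Longrightarrow> sq_integrable white_noise (B' t)" for t
    using gaussian_space_sq[OF B] gaussian_space_sq[OF B'] by blast+
  have incr: "(\<integral>\<omega>. (B s \<omega> - B 0 \<omega>) * (B' t \<omega> - B' 0 \<omega>) \<partial>white_noise) = \<kappa> * min s t"
    if "s \<in> {0..1}" "t \<in> {0..1}" for s t
  proof -
    have "(\<integral>\<omega>. (B s \<omega> - B 0 \<omega>) * (B' t \<omega> - B' 0 \<omega>) \<partial>white_noise)
      = (\<integral>\<omega>. B s \<omega> * B' t \<omega> - B s \<omega> * B' 0 \<omega> - B 0 \<omega> * B' t \<omega> + B 0 \<omega> * B' 0 \<omega> \<partial>white_noise)"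
      by (simp add: algebra_simps)
    also have "\<dots> = \<kappa> * min s t"
      using that by (simp add: sq_integrable_mult[OF sq(1) sq(2)] cov)
    finally show ?thesis .
  qed
  have "(\<integral>\<omega>. (\<Sum>i<m. c i * (B (x i) \<omega> - B 0 \<omega>)) * (\<Sum>i<m'. c' i * (B' (x' i) \<omega> - B' 0 \<omega>)) \<partial>white_noise)
     = (\<Sum>i<m. \<Sum>j<m'. c i * c' j * (\<integral>\<omega>. (B (x i) \<omega> - B 0 \<omega>) * (B' (x' j) \<omega> - B' 0 \<omega>) \<partial>white_noise))"
    using x x' by (intro integral_mult_sum sq_integrable_diff sq) auto
  also have "\<dots> = (\<Sum>i<m. \<Sum>j<m'. c i * c' j * (\<kappa> * min (x i) (x' j)))"
    using x x' by (intro sum.cong refl) (simp add: incr)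
  finally show ?thesis by (simp add: sum_distrib_left ac_simps)
qed

text \<open>For combinations of intervals starting at \<open>0\<close>, both sides are the same double sum of minima. The factor \<open>\<kappa>\<close> is
\<open>1\<close> for equal and \<open>0\<close> for independent Brownian motions, so that the orthogonality of integrals against
different Brownian motions is included.\<close>

theorem wiener_integral_isometry:
  assumes B: "\<And>t. t \<in> {0..1} \<Longrightarrow> B t \<in> gaussian_space" and B': "\<And>t. t \<in> {0..1} \<Longrightarrow> B' t \<in> gaussian_space"
    and cov: "\<And>s t. s \<in> {0..1} \<Longrightarrow> t \<in> {0..1} \<Longrightarrow> (\<integral>\<omega>. B s \<omega> * B' t \<omega> \<partial>white_noise) = \<kappa> * min s t"
    and Y: "wiener_approx B f a Y" and Y': "wiener_approx B' f' a' Y'" and a: "a \<le> 1" "a' \<le> 1"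
  shows "(\<integral>\<omega>. Y \<omega> * Y' \<omega> \<partial>white_noise) = \<kappa> * (\<integral>y. (indicator {0<..a} y * f y) * (indicator {0<..a'} y * f' y) \<partial>lborel)"
proof -
  from Y obtain m :: "nat \<Rightarrow> nat" and x c where x: "\<And>p i. i < m p \<Longrightarrow> x p i \<in> {0..a}" and
     L: "L2_tendsto lborel (\<lambda>p y. \<Sum>i<m p. c p i * indicator {0<..x p i} y) (\<lambda>y. indicator {0<..a} y * f y)"
     "L2_tendsto white_noise (\<lambda>p \<omega>. \<Sum>i<m p. c p i * (B (x p i) \<omega> - B 0 \<omega>)) Y"
    by (rule wiener_approxE) (rule that)
  from Y' obtain m' :: "nat \<Rightarrow> nat" and x' c' where x': "\<And>p i. i < m' p \<Longrightarrow> x' p i \<in> {0..a'}" and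
     L': "L2_tendsto lborel (\<lambda>p y. \<Sum>i<m' p. c' p i * indicator {0<..x' p i} y) (\<lambda>y. indicator {0<..a'} y * f' y)"
     "L2_tendsto white_noise (\<lambda>p \<omega>. \<Sum>i<m' p. c' p i * (B' (x' p i) \<omega> - B' 0 \<omega>)) Y'"
    by (rule wiener_approxE) (rule that)
  have sqB: "t \<in> {0..1} \<Longrightarrow> sq_integrable white_noise (B t)" "t \<in> {0..1} \<Longrightarrow> sq_integrable white_noise (B' t)" for t
    using gaussian_space_sq[OF B] gaussian_space_sq[OF B'] by blast+
  have sq: "sq_integrable white_noise (\<lambda>\<omega>. \<Sum>i<m p. c p i * (B (x p i) \<omega> - B 0 \<omega>))"
    "sq_integrable white_noise (\<lambda>\<omega>. \<Sum>i<m' p. c' p i * (B' (x' p i) \<omega> - B' 0 \<omega>))" for p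
    using x x' a by (intro sq_integrable_sum sq_integrable_cmult sq_integrable_diff sqB; force)+
  have sql: "sq_integrable lborel (\<lambda>y. \<Sum>i<k. d i * indicator {0<..z i} y)" for k :: nat and d z :: "nat \<Rightarrow> real"
    by (intro sq_integrable_sum sq_integrable_cmult sq_integrable_indicator_Ioc)
  have eq: "(\<integral>\<omega>. (\<Sum>i<m p. c p i * (B (x p i) \<omega> - B 0 \<omega>)) * (\<Sum>i<m' p. c' p i * (B' (x' p i) \<omega> - B' 0 \<omega>)) \<partial>white_noise)
     = \<kappa> * (\<integral>y. (\<Sum>i<m p. c p i * indicator {0<..x p i} y) * (\<Sum>i<m' p. c' p i * indicator {0<..x' p i} y) \<partial>lborel)" for p
  proof -
    have x1: "\<And>i. i < m p \<Longrightarrow> x p i \<in> {0..1}" "\<And>i. i < m' p \<Longrightarrow> x' p i \<in> {0..1}"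
      using x x' a by force+
    then have x0: "\<And>i. i < m p \<Longrightarrow> 0 \<le> x p i" "\<And>i. i < m' p \<Longrightarrow> 0 \<le> x' p i" by auto
    show ?thesis
      using brownian_step_inner[OF B B' cov x1] indicator_step_inner[OF x0] by simp
  qed
  show ?thesis
  proof (rule LIMSEQ_unique[OF L2_tendsto_inner[OF L(2) L'(2) sq]])
    show "(\<lambda>n. \<integral>\<omega>. (\<Sum>i<m n. c n i * (B (x n i) \<omega> - B 0 \<omega>)) * (\<Sum>i<m' n. c' n i * (B' (x' n i) \<omega> - B' 0 \<omega>)) \<partial>white_noise)
       \<longlonglongrightarrow> \<kappa> * (\<integral>y. (indicator {0<..a} y * f y) * (indicator {0<..a'} y * f' y) \<partial>lborel)"
      unfolding eq by (intro tendsto_mult_left L2_tendsto_inner L(1) L'(1) sql)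
  qed
qed

text \<open>Step functions that converge to \<open>f\<close> have integrals that are Cauchy in \<open>L\<^sup>2\<close>, by the isometry.\<close>

theorem wiener_integral_exists:
  fixes B :: "real \<Rightarrow> ('i \<Rightarrow> real) \<Rightarrow> real" and f :: "real \<Rightarrow> real"
  assumes B: "\<And>t. t \<in> {0..1} \<Longrightarrow> B t \<in> gaussian_space"
    and cov: "\<And>s t. s \<in> {0..1} \<Longrightarrow> t \<in> {0..1} \<Longrightarrow> (\<integral>\<omega>. B s \<omega> * B t \<omega> \<partial>white_noise) = min s t"
    and f[measurable]: "f \<in> borel_measurable borel" and C: "\<And>x. \<bar>f x\<bar> \<le> C" and a: "0 \<le> a" "a \<le> 1"
  shows "\<exists>Y. has_wiener_integral white_noise B f 0 a Y \<and> Y \<in> gaussian_space \<and> wiener_approx B f a Y"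
proof -
  interpret prob_space "white_noise :: ('i \<Rightarrow> real) measure" by (rule prob_space_white_noise)
  define g where "g y = indicator {0<..a} y * f y" for y
  obtain K :: nat where "C \<le> real K" using real_arch_simple by blast
  then have K: "\<bar>f x\<bar> \<le> real K" for x using C[of x] by simp
  have g: "g \<in> linear_closure lborel (interval_indicators a)"
    unfolding g_def[abs_def] by (rule bounded_in_closure[OF f K a(1)])
  then have sqg: "sq_integrable lborel g" by (simp add: linear_closure_def)
  have ex: "\<forall>p::nat. \<exists>(m::nat) x c. (\<forall>i<m. x i \<in> {0..a}) \<and> (\<forall>i j. i \<le> j \<longrightarrow> j < m \<longrightarrow> x i \<le> x j) \<and>
     (\<integral>y. (g y - (\<Sum>i<m. c i * indicator {0<..x i} y))\<^sup>2 \<partial>lborel) < 1 / real (Suc p)"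
    by (intro allI closure_partition_approx[OF g a(1)]) simp
  then obtain m :: "nat \<Rightarrow> nat" and x c where mxc: "\<forall>p. (\<forall>i<m p. x p i \<in> {0..a}) \<and> (\<forall>i j. i \<le> j \<longrightarrow> j < m p \<longrightarrow> x p i \<le> x p j) \<and>
     (\<integral>y. (g y - (\<Sum>i<m p. c p i * indicator {0<..x p i} y))\<^sup>2 \<partial>lborel) < 1 / real (Suc p)"
    using ex unfolding choice_iff by (elim exE)
  have x: "\<And>p i. i < m p \<Longrightarrow> x p i \<in> {0..a}" and mono: "\<And>p i j. i \<le> j \<Longrightarrow> j < m p \<Longrightarrow> x p i \<le> x p j"
    and near: "\<And>p. (\<integral>y. (g y - (\<Sum>i<m p. c p i * indicator {0<..x p i} y))\<^sup>2 \<partial>lborel) < 1 / real (Suc p)"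
    using mxc by blast+
  define T where "T p y = (\<Sum>i<m p. c p i * indicator {0<..x p i} y)" for p y
  define Z where "Z p \<omega> = (\<Sum>i<m p. c p i * (B (x p i) \<omega> - B 0 \<omega>))" for p \<omega>
  have sqT: "sq_integrable lborel (T p)" for p
    unfolding T_def by (intro sq_integrable_sum sq_integrable_cmult sq_integrable_indicator_Ioc)
  have ZG: "Z p \<in> gaussian_space" for p
    unfolding Z_def using x a by (intro linear_closure_sum linear_closure_diff white_noise_coordinate(3) B) force+
  note sqZ = linear_closure_sq[OF white_noise_coordinate(3) ZG]
  have "(\<lambda>p. \<integral>y. (g y - T p y)\<^sup>2 \<partial>lborel) \<longlonglongrightarrow> 0"
    by (rule Lim_null_comparison[OF always_eventually[OF allI] LIMSEQ_Suc[OF lim_1_over_n]])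
       (use near less_imp_le in \<open>auto simp: T_def\<close>)
  then have LT: "L2_tendsto lborel T g" using sqg sqT by (simp add: L2_tendsto_iff)
  have inner: "(\<integral>\<omega>. Z p \<omega> * Z q \<omega> \<partial>white_noise) = (\<integral>y. T p y * T q y \<partial>lborel)" for p q
  proof -
    have x1: "\<And>p i. i < m p \<Longrightarrow> x p i \<in> {0..1}" using x a by force
    then have x0: "\<And>p i. i < m p \<Longrightarrow> 0 \<le> x p i" by auto
    have c1: "\<And>s t. s \<in> {0..1} \<Longrightarrow> t \<in> {0..1} \<Longrightarrow> (\<integral>\<omega>. B s \<omega> * B t \<omega> \<partial>white_noise) = 1 * min s t"
      using cov by simp
    show ?thesis unfolding Z_def T_def
      using brownian_step_inner[OF B B c1 x1 x1] indicator_step_inner[OF x0 x0] by simp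
  qed
  have sqdiff: "(\<integral>x. (u x - v x)\<^sup>2 \<partial>M) = (\<integral>x. u x * u x \<partial>M) - 2 * (\<integral>x. u x * v x \<partial>M) + (\<integral>x. v x * v x \<partial>M)"
    if "sq_integrable M u" "sq_integrable M v" for M :: "'z measure" and u v
  proof -
    have "(\<integral>x. (u x - v x)\<^sup>2 \<partial>M) = (\<integral>x. u x * u x - 2 * (u x * v x) + v x * v x \<partial>M)"
      by (intro Bochner_Integration.integral_cong) (auto simp: power2_eq_square algebra_simps)
    then show ?thesis using sq_integrable_mult[OF that(1,1)] sq_integrable_mult[OF that] sq_integrable_mult[OF that(2,2)] by simp
  qed
  have dist: "(\<integral>\<omega>. (Z p \<omega> - Z q \<omega>)\<^sup>2 \<partial>white_noise) = (\<integral>y. (T p y - T q y)\<^sup>2 \<partial>lborel)" for p q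
    by (simp add: sqdiff[OF sqZ sqZ] sqdiff[OF sqT sqT] inner)
  have "\<exists>Y. L2_tendsto white_noise Z Y"
  proof (rule L2_Cauchy_converges[OF sqZ])
    fix e :: real assume "e > 0"
    then obtain N :: nat where N: "N > 0" "1 / real N < e / 4" using ex_inverse_of_nat_less[of "e / 4"] by (auto simp: inverse_eq_divide)
    show "\<exists>K. \<forall>p\<ge>K. \<forall>q\<ge>K. (\<integral>\<omega>. (Z p \<omega> - Z q \<omega>)\<^sup>2 \<partial>white_noise) \<le> e"
    proof (intro exI[of _ N] allI impI)
      fix p q assume pq: "N \<le> p" "N \<le> q"
      have small: "(\<integral>y. (g y - T r y)\<^sup>2 \<partial>lborel) < e / 4" if "N \<le> r" for r
      proof -
        have "1 / real (Suc r) \<le> 1 / real N" using N that by (intro divide_left_mono) auto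
        then show ?thesis using near[of r] N by (simp add: T_def)
      qed
      have "(\<integral>y. (T p y - T q y)\<^sup>2 \<partial>lborel) = (\<integral>y. ((g y - T q y) + -1 * (g y - T p y))\<^sup>2 \<partial>lborel)" by simp
      also have "\<dots> \<le> 2 * (\<integral>y. (g y - T q y)\<^sup>2 \<partial>lborel) + 2 * (\<integral>y. (-1 * (g y - T p y))\<^sup>2 \<partial>lborel)"
        by (intro integral_sq_add_le sq_integrable_cmult sq_integrable_diff sqg sqT)
      also have "\<dots> = 2 * (\<integral>y. (g y - T q y)\<^sup>2 \<partial>lborel) + 2 * (\<integral>y. (g y - T p y)\<^sup>2 \<partial>lborel)"
        by (simp add: power2_commute)
      also have "\<dots> \<le> e" using small[OF pq(1)] small[OF pq(2)] by simp
      finally show "(\<integral>\<omega>. (Z p \<omega> - Z q \<omega>)\<^sup>2 \<partial>white_noise) \<le> e" by (simp add: dist)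
    qed
  qed
  then obtain Y where Y: "L2_tendsto white_noise Z Y" ..
  have YG: "Y \<in> gaussian_space" by (rule linear_closure_limit[OF white_noise_coordinate(3) Y ZG])
  have wa: "wiener_approx B f a Y"
    unfolding wiener_approx_def
    by (intro exI[of _ m] exI[of _ x] exI[of _ c] conjI allI impI)
       (use x LT Y in \<open>auto simp: T_def[abs_def] Z_def[abs_def] g_def[abs_def]\<close>)
  (* The cells of the partition formed by 0 and the points x p i. *)
  define s where "s p = (\<lambda>i. case i of 0 \<Rightarrow> 0 | Suc k \<Rightarrow> x p k)" for p
  define d where "d p = (\<lambda>i. \<Sum>j=i..<m p. c p j)" for p
  have x0: "\<And>p i. i < m p \<Longrightarrow> 0 \<le> x p i" using x by auto
  have sT: "step_function (m p) (s p) (d p) y = T p y" for p y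
    unfolding s_def d_def T_def by (rule step_function_partition[OF x0 mono])
  have sZ: "step_integral B (m p) (s p) (d p) = Z p" for p
    unfolding s_def d_def Z_def by (rule ext) (rule step_integral_partition[OF x0 mono])
  have part: "0 \<le> s p i \<and> s p i \<le> s p (Suc i) \<and> s p (Suc i) \<le> a" if "i < m p" for p i
    using partition_mono[of "m p" "x p" i, OF x0 mono that] x[OF that] by (simp add: s_def)
  have f2: "(f y)\<^sup>2 \<le> (real K)\<^sup>2" for y using power_mono[OF K[of y], of 2] by simp
  have "has_wiener_integral white_noise B f 0 a Y"
    unfolding has_wiener_integral_def
  proof (intro conjI)
    have fl: "f \<in> borel_measurable lborel" using f by simp
    have ind: "indicator {0..a} \<in> borel_measurable lborel" by simp
    show "set_borel_measurable lborel {0..a} f" unfolding set_borel_measurable_def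
      using borel_measurable_times[OF ind fl] by simp
    have "integrable lborel (\<lambda>x. indicator {0..a} x * (real K)\<^sup>2)"
      by (intro integrable_mult_left integrable_real_indicator) (auto simp: emeasure_lborel_Icc_eq)
    then show "set_integrable lborel {0..a} (\<lambda>x. (f x)\<^sup>2)"
      unfolding set_integrable_def
    proof (rule Bochner_Integration.integrable_bound)
      show "(\<lambda>x. indicator {0..a} x *\<^sub>R (f x)\<^sup>2) \<in> borel_measurable lborel"
        using borel_measurable_times[OF ind borel_measurable_power[OF fl]] by simp
      show "AE x in lborel. norm (indicator {0..a} x *\<^sub>R (f x)\<^sup>2) \<le> norm (indicator {0..a} x * (real K)\<^sup>2)"
        using f2 by (intro AE_I2) (simp add: indicator_def)
    qed
    show "\<exists>n s c. (\<forall>p. \<forall>i<n p. 0 \<le> s p i \<and> s p i \<le> s p (Suc i) \<and> s p (Suc i) \<le> a) \<and>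
        (\<lambda>p. \<integral>\<^sup>+x\<in>{0..a}. ennreal ((f x - step_function (n p) (s p) (c p) x)\<^sup>2) \<partial>lborel) \<longlonglongrightarrow> 0 \<and>
        L2_tendsto white_noise (\<lambda>p. step_integral B (n p) (s p) (c p)) Y"
    proof (rule exI[of _ m], rule exI[of _ s], rule exI[of _ d], intro conjI allI impI)
      have "(\<integral>\<^sup>+y\<in>{0..a}. ennreal ((f y - T p y)\<^sup>2) \<partial>lborel) = (\<integral>\<^sup>+y. ennreal ((g y - T p y)\<^sup>2) \<partial>lborel)" for p
      proof (rule nn_integral_cong_AE)
        have "AE y in lborel. y \<noteq> (0::real)" by (rule AE_lborel_singleton)
        then show "AE y in lborel. ennreal ((f y - T p y)\<^sup>2) * indicator {0..a} y = ennreal ((g y - T p y)\<^sup>2)"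
        proof eventually_elim
          case (elim y)
          show ?case
          proof (cases "y \<in> {0<..a}")
            case True then show ?thesis by (simp add: g_def)
          next
            case False
            then have "T p y = 0" unfolding T_def using x[of _ p] by (intro sum.neutral) (fastforce simp: indicator_def)
            with False elim show ?thesis by (auto simp: g_def indicator_def)
          qed
        qed
      qed
      then show "(\<lambda>p. \<integral>\<^sup>+x\<in>{0..a}. ennreal ((f x - step_function (m p) (s p) (d p) x)\<^sup>2) \<partial>lborel) \<longlonglongrightarrow> 0"
        using LT by (simp add: sT L2_tendsto_def)
      show "L2_tendsto white_noise (\<lambda>p. step_integral B (m p) (s p) (d p)) Y"
        using Y by (simp add: sZ)
    qed (use part in blast)+
  qed
  with YG wa show ?thesis by blast
qed

section \<open>The transfer operator of an iid past\<close>

text \<open>Sequences are pasts of the innovations, the most recent innovation first. The shift forgets the \<open>n\<close> most recent ones,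
while \<open>comb_seq n e x\<close> puts the first \<open>n\<close> entries of \<open>e\<close> before the past \<open>x\<close>.\<close>

definition shift_seq :: "nat \<Rightarrow> (nat \<Rightarrow> 'a) \<Rightarrow> nat \<Rightarrow> 'a" where
  "shift_seq n x = (\<lambda>i. x (i + n))"

lemma shift_comb_seq: "shift_seq n (comb_seq n e x) = x"
  by (simp add: shift_seq_def comb_seq_add)

lemma shift_comb_seq_le: "n \<le> k \<Longrightarrow> shift_seq n (comb_seq k e x) = comb_seq (k - n) (shift_seq n e) x"
  by (auto simp: shift_seq_def comb_seq_def fun_eq_iff)

lemma comb_comb_seq: "comb_seq m a (comb_seq n e x) = comb_seq (m + n) (comb_seq m a e) x"
  by (auto simp: comb_seq_def fun_eq_iff)

lemma shift_shift_seq: "shift_seq n (shift_seq m x) = shift_seq (m + n) x"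
  by (simp add: shift_seq_def ac_simps)

context sequence_space
begin

sublocale SS: pair_prob_space S S
  by unfold_locales

lemma measurable_shift_seq [measurable]: "shift_seq n \<in> measurable S S"
  unfolding shift_seq_def[abs_def] by (rule measurable_abs_UNIV) simp

definition bounded_measurable :: "((nat \<Rightarrow> 'a) \<Rightarrow> real) \<Rightarrow> bool" where
  "bounded_measurable f \<longleftrightarrow> f \<in> borel_measurable S \<and> (\<exists>C. \<forall>x. \<bar>f x\<bar> \<le> C)"

lemma bounded_measurable_measurable: "bounded_measurable f \<Longrightarrow> f \<in> borel_measurable S"
  by (simp add: bounded_measurable_def)

lemma bounded_measurableE:
  assumes "bounded_measurable f"
  obtains C where "C \<ge> 0" "\<And>x. \<bar>f x\<bar> \<le> C"
proof -
  obtain C where "\<And>x. \<bar>f x\<bar> \<le> C" using assms by (auto simp: bounded_measurable_def)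
  with that[of C] show thesis by (meson abs_ge_zero order_trans)
qed

lemma bounded_measurable_diff:
  assumes "bounded_measurable f" "bounded_measurable g"
  shows "bounded_measurable (\<lambda>x. f x - g x)"
proof -
  from assms obtain C D where "\<And>x. \<bar>f x\<bar> \<le> C" "\<And>x. \<bar>g x\<bar> \<le> D" by (auto simp: bounded_measurable_def)
  then have "\<bar>f x - g x\<bar> \<le> C + D" for x using abs_triangle_ineq4[of "f x" "g x"] by (meson add_mono order_trans)
  then show ?thesis using assms by (auto simp: bounded_measurable_def)
qed

lemma bounded_measurable_mult:
  assumes "bounded_measurable f" "bounded_measurable g"
  shows "bounded_measurable (\<lambda>x. f x * g x)"
proof -
  obtain C where C: "C \<ge> 0" "\<And>x. \<bar>f x\<bar> \<le> C" using bounded_measurableE[OF assms(1)] by metis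
  obtain D where D: "\<And>x. \<bar>g x\<bar> \<le> D" using assms(2) by (auto simp: bounded_measurable_def)
  have "\<bar>f x * g x\<bar> \<le> C * D" for x unfolding abs_mult using C D by (intro mult_mono) auto
  then show ?thesis using assms by (auto simp: bounded_measurable_def)
qed

lemma bounded_measurable_abs: "bounded_measurable f \<Longrightarrow> bounded_measurable (\<lambda>x. \<bar>f x\<bar>)"
  by (auto simp: bounded_measurable_def)

lemma bounded_measurable_const: "bounded_measurable (\<lambda>_. c)"
  by (auto simp: bounded_measurable_def)

lemma bounded_measurable_shift: "bounded_measurable f \<Longrightarrow> bounded_measurable (\<lambda>x. f (shift_seq n x))"
  by (auto simp: bounded_measurable_def intro: measurable_compose[OF measurable_shift_seq])

lemma bounded_measurable_integrable: "bounded_measurable f \<Longrightarrow> integrable S f"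
  by (auto simp: bounded_measurable_def intro: P.integrable_bounded)

lemma bounded_measurable_sq: "bounded_measurable f \<Longrightarrow> sq_integrable S f"
  by (auto simp: bounded_measurable_def intro: sq_integrable_bounded[OF P.finite_measure_axioms])

lemma comb_integrable:
  assumes "G \<in> borel_measurable (S \<Otimes>\<^sub>M S)" "\<And>z. \<bar>G z\<bar> \<le> C"
  shows "integrable (S \<Otimes>\<^sub>M S) (G :: _ \<Rightarrow> real)"
  using assms by (intro SS.integrable_bounded) auto

lemma iterated_integral:
  assumes "G \<in> borel_measurable (S \<Otimes>\<^sub>M S)" "\<And>z. \<bar>G z\<bar> \<le> C"
  shows "(\<integral>z. G z \<partial>(S \<Otimes>\<^sub>M S)) = (\<integral>x. (\<integral>e. G (e, x) \<partial>S) \<partial>S :: real)"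
  using SS.integral_snd[of "\<lambda>e x. G (e, x)"] comb_integrable[OF assms] by simp

lemma integral_comb_seq:
  assumes "f \<in> borel_measurable S"
  shows "(\<integral>z. f (comb_seq n (fst z) (snd z)) \<partial>(S \<Otimes>\<^sub>M S)) = (\<integral>x. f x \<partial>S :: real)"
proof -
  have "(\<integral>x. f x \<partial>S) = (\<integral>x. f x \<partial>distr (S \<Otimes>\<^sub>M S) S (\<lambda>(\<omega>, \<omega>'). comb_seq n \<omega> \<omega>'))"
    by (simp add: PiM_comb_seq)
  also have "\<dots> = (\<integral>z. f (comb_seq n (fst z) (snd z)) \<partial>(S \<Otimes>\<^sub>M S))"
    using assms by (subst integral_distr) (auto simp: split_beta')
  finally show ?thesis by simp
qed

text \<open>The conditional expectation of \<open>f\<close> at time \<open>n\<close> given the past \<open>x\<close> at time \<open>0\<close>.\<close>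

definition transfer :: "nat \<Rightarrow> ((nat \<Rightarrow> 'a) \<Rightarrow> real) \<Rightarrow> (nat \<Rightarrow> 'a) \<Rightarrow> real" where
  "transfer n f x = (\<integral>e. f (comb_seq n e x) \<partial>S)"

lemma bounded_measurable_comb:
  assumes "bounded_measurable f" "x \<in> space S"
  shows "bounded_measurable (\<lambda>e. f (comb_seq n e x))"
proof -
  have [measurable]: "f \<in> borel_measurable S" using assms by (simp add: bounded_measurable_def)
  have "(\<lambda>e. f (comb_seq n e x)) \<in> borel_measurable S"
    using assms(2) by measurable
  then show ?thesis using assms(1) by (auto simp: bounded_measurable_def)
qed

lemma transfer_abs_le:
  assumes "\<And>x. \<bar>f x\<bar> \<le> C"
  shows "\<bar>transfer n f x\<bar> \<le> C"
proof -
  have C: "0 \<le> C" using assms[of undefined] by simp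
  show ?thesis
  proof (cases "integrable S (\<lambda>e. f (comb_seq n e x))")
    case True
    have "\<bar>transfer n f x\<bar> \<le> (\<integral>e. \<bar>f (comb_seq n e x)\<bar> \<partial>S)" unfolding transfer_def by simp
    also have "\<dots> \<le> (\<integral>e. C \<partial>S)" using True assms by (intro integral_mono) auto
    finally show ?thesis by (simp add: P.prob_space)
  next
    case False then show ?thesis using C by (simp add: transfer_def not_integrable_integral_eq)
  qed
qed

lemma bounded_measurable_transfer:
  assumes "bounded_measurable f"
  shows "bounded_measurable (transfer n f)"
proof -
  have [measurable]: "f \<in> borel_measurable S" using assms by (simp add: bounded_measurable_def)
  have "transfer n f \<in> borel_measurable S" unfolding transfer_def[abs_def] by measurable
  moreover obtain C where C: "\<And>x. \<bar>f x\<bar> \<le> C" using assms by (auto simp: bounded_measurable_def)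
  have "\<forall>x. \<bar>transfer n f x\<bar> \<le> C" using transfer_abs_le[of f C, OF C] by blast
  ultimately show ?thesis by (auto simp: bounded_measurable_def)
qed

text \<open>The factor \<open>g\<close> depends on the past \<open>n\<close> steps ago only, so that the \<open>n\<close> latest innovations can be integrated out
in \<open>f\<close> first.\<close>

lemma transfer_adjoint:
  assumes f: "bounded_measurable f" and g: "bounded_measurable g"
  shows "(\<integral>x. f x * g (shift_seq n x) \<partial>S) = (\<integral>x. transfer n f x * g x \<partial>S)"
proof -
  have [measurable]: "f \<in> borel_measurable S" "g \<in> borel_measurable S" using assms by (auto simp: bounded_measurable_def)
  obtain C where C: "\<And>x. \<bar>f x * g (shift_seq n x)\<bar> \<le> C"
    using bounded_measurable_mult[OF f bounded_measurable_shift[OF g]] by (auto simp: bounded_measurable_def)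
  have "(\<integral>x. f x * g (shift_seq n x) \<partial>S) = (\<integral>z. f (comb_seq n (fst z) (snd z)) * g (shift_seq n (comb_seq n (fst z) (snd z))) \<partial>(S \<Otimes>\<^sub>M S))"
    by (rule integral_comb_seq[symmetric]) measurable
  also have "\<dots> = (\<integral>x. (\<integral>e. f (comb_seq n e x) * g (shift_seq n (comb_seq n e x)) \<partial>S) \<partial>S)"
    by (subst iterated_integral[where C=C]) (auto simp: C)
  finally show ?thesis by (simp add: shift_comb_seq transfer_def)
qed

lemma integral_shift_seq:
  assumes "bounded_measurable g"
  shows "(\<integral>x. g (shift_seq n x) \<partial>S) = (\<integral>x. g x \<partial>S)"
  using transfer_adjoint[OF bounded_measurable_const[of 1] assms, of n] by (simp add: transfer_def P.prob_space)

lemma integral_transfer: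
  assumes "bounded_measurable f"
  shows "(\<integral>x. transfer n f x \<partial>S) = (\<integral>x. f x \<partial>S)"
  using transfer_adjoint[OF assms bounded_measurable_const[of 1], of n] by simp

lemma transfer_0: "transfer 0 f x = f x"
  by (simp add: transfer_def comb_seq_0 P.prob_space)

lemma transfer_diff:
  assumes "bounded_measurable f" "bounded_measurable g" "x \<in> space S"
  shows "transfer n (\<lambda>x. f x - g x) x = transfer n f x - transfer n g x"
  unfolding transfer_def
  by (intro Bochner_Integration.integral_diff bounded_measurable_integrable bounded_measurable_comb assms)

lemma transfer_transfer:
  assumes f: "bounded_measurable f" and x: "x \<in> space S"
  shows "transfer n (transfer m f) x = transfer (m + n) f x"
proof -
  have [measurable]: "f \<in> borel_measurable S" using assms by (simp add: bounded_measurable_def)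
  let ?g = "\<lambda>e. f (comb_seq (m + n) e x)"
  have g: "bounded_measurable ?g" by (rule bounded_measurable_comb[OF f x])
  have "transfer n (transfer m f) x = (\<integral>e. transfer m ?g e \<partial>S)"
    by (simp add: transfer_def comb_comb_seq)
  also have "\<dots> = (\<integral>e. ?g e \<partial>S)" by (rule integral_transfer[OF g])
  finally show ?thesis by (simp add: transfer_def)
qed

lemma transfer_L1:
  assumes f: "bounded_measurable f"
  shows "(\<integral>x. \<bar>transfer n f x\<bar> \<partial>S) \<le> (\<integral>x. \<bar>f x\<bar> \<partial>S)"
proof -
  have "(\<integral>x. \<bar>transfer n f x\<bar> \<partial>S) \<le> (\<integral>x. transfer n (\<lambda>x. \<bar>f x\<bar>) x \<partial>S)"
    by (intro integral_mono bounded_measurable_integrable bounded_measurable_abs bounded_measurable_transfer f)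
       (simp add: transfer_def)
  also have "\<dots> = (\<integral>x. \<bar>f x\<bar> \<partial>S)" by (rule integral_transfer[OF bounded_measurable_abs[OF f]])
  finally show ?thesis .
qed

text \<open>The mean change of \<open>f\<close> when all but the \<open>k\<close> latest innovations are replaced by those of an independent past.\<close>

definition coupling_gap :: "nat \<Rightarrow> ((nat \<Rightarrow> 'a) \<Rightarrow> real) \<Rightarrow> real" where
  "coupling_gap k f = (\<integral>z. \<bar>f (comb_seq k (fst z) (snd z)) - f (fst z)\<bar> \<partial>(S \<Otimes>\<^sub>M S))"

lemma coupling_gap_integrable:
  assumes f: "bounded_measurable f"
  shows "integrable (S \<Otimes>\<^sub>M S) (\<lambda>z. \<bar>f (comb_seq k (fst z) (snd z)) - f (fst z)\<bar>)"
proof -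
  have [measurable]: "f \<in> borel_measurable S" using f by (simp add: bounded_measurable_def)
  obtain C where C: "\<And>x. \<bar>f x\<bar> \<le> C" using f by (auto simp: bounded_measurable_def)
  show ?thesis
  proof (rule comb_integrable)
    show "\<bar>\<bar>f (comb_seq k (fst z) (snd z)) - f (fst z)\<bar>\<bar> \<le> C + C" for z
      using C[of "comb_seq k (fst z) (snd z)"] C[of "fst z"] by linarith
  qed measurable
qed

lemma coupling_gap_eq:
  assumes f: "bounded_measurable f"
  shows "coupling_gap k f = (\<integral>x. (\<integral>e. \<bar>f (comb_seq k e x) - f e\<bar> \<partial>S) \<partial>S)"
  unfolding coupling_gap_def
  using SS.integral_snd[of "\<lambda>e x. \<bar>f (comb_seq k e x) - f e\<bar>"] coupling_gap_integrable[OF f, of k]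
  by (simp add: split_beta')

text \<open>Averaging over the \<open>j\<close> latest innovations is a contraction, and it leaves \<open>k - j\<close> of the \<open>k\<close> innovations that are
kept.\<close>

lemma coupling_gap_transfer:
  assumes f: "bounded_measurable f" and j: "j \<le> k"
  shows "coupling_gap (k - j) (transfer j f) \<le> coupling_gap k f"
proof -
  have [measurable]: "f \<in> borel_measurable S" using f by (simp add: bounded_measurable_def)
  obtain C where C: "\<And>x. \<bar>f x\<bar> \<le> C" using f by (auto simp: bounded_measurable_def)
  define \<Psi> where "\<Psi> x e = \<bar>f (comb_seq k e x) - f e\<bar>" for x e
  have \<Psi>b: "bounded_measurable (\<Psi> x)" if "x \<in> space S" for x
    unfolding \<Psi>_def by (intro bounded_measurable_abs bounded_measurable_diff bounded_measurable_comb f that)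
  have inner: "(\<integral>e. \<bar>transfer j f (comb_seq (k - j) e x) - transfer j f e\<bar> \<partial>S) \<le> (\<integral>e. \<Psi> x e \<partial>S)" if x: "x \<in> space S" for x
  proof -
    have pt: "\<bar>transfer j f (comb_seq (k - j) e x) - transfer j f e\<bar> \<le> transfer j (\<Psi> x) e" if e: "e \<in> space S" for e
    proof -
      have "comb_seq (k - j) e x \<in> space S" using e x by (auto simp: space_PiM comb_seq_def PiE_iff)
      then have "transfer j f (comb_seq (k - j) e x) - transfer j f e
        = (\<integral>a. f (comb_seq j a (comb_seq (k - j) e x)) - f (comb_seq j a e) \<partial>S)"
        unfolding transfer_def using e
        by (intro Bochner_Integration.integral_diff[symmetric] bounded_measurable_integrable bounded_measurable_comb f)
      also have "\<bar>\<dots>\<bar> \<le> (\<integral>a. \<bar>f (comb_seq j a (comb_seq (k - j) e x)) - f (comb_seq j a e)\<bar> \<partial>S)" by simp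
      also have "\<dots> = transfer j (\<Psi> x) e" using j by (simp add: transfer_def \<Psi>_def comb_comb_seq)
      finally show ?thesis .
    qed
    have "(\<integral>e. \<bar>transfer j f (comb_seq (k - j) e x) - transfer j f e\<bar> \<partial>S) \<le> (\<integral>e. transfer j (\<Psi> x) e \<partial>S)"
      by (intro integral_mono pt bounded_measurable_integrable bounded_measurable_abs bounded_measurable_diff
          bounded_measurable_comb bounded_measurable_transfer \<Psi>b f x) auto
    also have "\<dots> = (\<integral>e. \<Psi> x e \<partial>S)" by (rule integral_transfer[OF \<Psi>b[OF x]])
    finally show ?thesis .
  qed
  have "coupling_gap (k - j) (transfer j f) = (\<integral>x. (\<integral>e. \<bar>transfer j f (comb_seq (k - j) e x) - transfer j f e\<bar> \<partial>S) \<partial>S)"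
    by (rule coupling_gap_eq[OF bounded_measurable_transfer[OF f]])
  also have "\<dots> \<le> (\<integral>x. (\<integral>e. \<Psi> x e \<partial>S) \<partial>S)"
  proof (rule integral_mono)
    show "integrable S (\<lambda>x. \<integral>e. \<bar>transfer j f (comb_seq (k - j) e x) - transfer j f e\<bar> \<partial>S)"
      using SS.integrable_snd[of "\<lambda>e x. \<bar>transfer j f (comb_seq (k - j) e x) - transfer j f e\<bar>"]
        coupling_gap_integrable[OF bounded_measurable_transfer[OF f, of j], of "k - j"] by (simp add: split_beta')
    show "integrable S (\<lambda>x. \<integral>e. \<Psi> x e \<partial>S)"
      using SS.integrable_snd[of "\<lambda>e x. \<Psi> x e"] coupling_gap_integrable[OF f, of k] by (simp add: split_beta' \<Psi>_def)
  qed (rule inner)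
  also have "\<dots> = coupling_gap k f" unfolding \<Psi>_def by (rule coupling_gap_eq[OF f, symmetric])
  finally show ?thesis .
qed

lemma transfer_mixing:
  assumes f: "bounded_measurable f"
  shows "(\<integral>x. \<bar>transfer n f x - (\<integral>e. f e \<partial>S)\<bar> \<partial>S) \<le> coupling_gap n f"
  unfolding coupling_gap_eq[OF f]
proof (rule integral_mono)
  show "integrable S (\<lambda>x. \<bar>transfer n f x - (\<integral>e. f e \<partial>S)\<bar>)"
    by (intro bounded_measurable_integrable bounded_measurable_abs bounded_measurable_diff bounded_measurable_transfer bounded_measurable_const f)
  show "integrable S (\<lambda>x. \<integral>e. \<bar>f (comb_seq n e x) - f e\<bar> \<partial>S)"
    using SS.integrable_snd[of "\<lambda>e x. \<bar>f (comb_seq n e x) - f e\<bar>"] coupling_gap_integrable[OF f, of n] by (simp add: split_beta')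
  fix x assume x: "x \<in> space S"
  have "transfer n f x - (\<integral>e. f e \<partial>S) = (\<integral>e. f (comb_seq n e x) - f e \<partial>S)"
    unfolding transfer_def
    by (intro Bochner_Integration.integral_diff[symmetric] bounded_measurable_integrable bounded_measurable_comb f x)
  then show "\<bar>transfer n f x - (\<integral>e. f e \<partial>S)\<bar> \<le> (\<integral>e. \<bar>f (comb_seq n e x) - f e\<bar> \<partial>S)" by simp
qed

text \<open>The projection \<open>P\<^sub>0\<close> of \<open>f\<close> at time \<open>n\<close>, as a function of the past at time \<open>0\<close>: it is the difference of the
conditional expectations given the pasts at the times \<open>0\<close> and \<open>-1\<close>.\<close>

definition innovation_part :: "nat \<Rightarrow> ((nat \<Rightarrow> 'a) \<Rightarrow> real) \<Rightarrow> (nat \<Rightarrow> 'a) \<Rightarrow> real" where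
  "innovation_part n f x = transfer n f x - transfer (Suc n) f (shift_seq 1 x)"

definition innovation_cov :: "nat \<Rightarrow> ((nat \<Rightarrow> 'a) \<Rightarrow> real) \<Rightarrow> nat \<Rightarrow> ((nat \<Rightarrow> 'a) \<Rightarrow> real) \<Rightarrow> real" where
  "innovation_cov n f m g = (\<integral>x. innovation_part n f x * innovation_part m g x \<partial>S)"

lemma bounded_measurable_innovation: "bounded_measurable f \<Longrightarrow> bounded_measurable (innovation_part n f)"
  unfolding innovation_part_def[abs_def]
  by (intro bounded_measurable_diff bounded_measurable_transfer bounded_measurable_shift)

text \<open>Martingale differences are orthogonal to the past one step earlier: both terms have the conditional expectation
\<open>transfer (Suc n) f\<close> given that past.\<close>

lemma innovation_orthogonal:
  assumes f: "bounded_measurable f" and g: "bounded_measurable g"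
  shows "(\<integral>x. innovation_part n f x * g (shift_seq 1 x) \<partial>S) = 0"
proof -
  note b = bounded_measurable_mult bounded_measurable_transfer bounded_measurable_shift f g
  have "(\<integral>x. innovation_part n f x * g (shift_seq 1 x) \<partial>S)
     = (\<integral>x. transfer n f x * g (shift_seq 1 x) - transfer (Suc n) f (shift_seq 1 x) * g (shift_seq 1 x) \<partial>S)"
    by (simp add: innovation_part_def left_diff_distrib)
  also have "\<dots> = (\<integral>x. transfer n f x * g (shift_seq 1 x) \<partial>S) - (\<integral>x. transfer (Suc n) f (shift_seq 1 x) * g (shift_seq 1 x) \<partial>S)"
    by (intro Bochner_Integration.integral_diff bounded_measurable_integrable b
        bounded_measurable_mult[OF bounded_measurable_shift[OF bounded_measurable_transfer[OF f]] bounded_measurable_shift[OF g]])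
  also have "(\<integral>x. transfer n f x * g (shift_seq 1 x) \<partial>S) = (\<integral>x. transfer 1 (transfer n f) x * g x \<partial>S)"
    by (intro transfer_adjoint b)
  also have "\<dots> = (\<integral>x. transfer (Suc n) f x * g x \<partial>S)"
    by (intro Bochner_Integration.integral_cong refl) (simp add: transfer_transfer[OF f])
  also have "(\<integral>x. transfer (Suc n) f (shift_seq 1 x) * g (shift_seq 1 x) \<partial>S) = (\<integral>x. transfer (Suc n) f x * g x \<partial>S)"
    by (rule integral_shift_seq[of "\<lambda>x. transfer (Suc n) f x * g x"]) (intro b)
  finally show ?thesis by simp
qed

text \<open>Pythagoras, in the form in which it telescopes: both mixed terms equal the last integral.\<close>

lemma innovation_cov_eq:
  assumes f: "bounded_measurable f" and g: "bounded_measurable g"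
  shows "innovation_cov n f m g = (\<integral>x. transfer n f x * transfer m g x \<partial>S) - (\<integral>x. transfer (Suc n) f x * transfer (Suc m) g x \<partial>S)"
proof -
  note b = bounded_measurable_mult bounded_measurable_transfer bounded_measurable_shift bounded_measurable_innovation f g
  have "innovation_cov n f m g = (\<integral>x. innovation_part n f x * transfer m g x - innovation_part n f x * transfer (Suc m) g (shift_seq 1 x) \<partial>S)"
    by (simp add: innovation_cov_def innovation_part_def[of m] right_diff_distrib)
  also have "\<dots> = (\<integral>x. innovation_part n f x * transfer m g x \<partial>S) - (\<integral>x. innovation_part n f x * transfer (Suc m) g (shift_seq 1 x) \<partial>S)"
    by (intro Bochner_Integration.integral_diff bounded_measurable_integrable b
        bounded_measurable_mult[OF bounded_measurable_innovation[OF f] bounded_measurable_shift[OF bounded_measurable_transfer[OF g]]])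
  also have "(\<integral>x. innovation_part n f x * transfer (Suc m) g (shift_seq 1 x) \<partial>S) = 0"
    by (intro innovation_orthogonal b)
  also have "(\<integral>x. innovation_part n f x * transfer m g x \<partial>S)
     = (\<integral>x. transfer n f x * transfer m g x - transfer m g x * transfer (Suc n) f (shift_seq 1 x) \<partial>S)"
    by (simp add: innovation_part_def algebra_simps)
  also have "\<dots> = (\<integral>x. transfer n f x * transfer m g x \<partial>S) - (\<integral>x. transfer m g x * transfer (Suc n) f (shift_seq 1 x) \<partial>S)"
    by (intro Bochner_Integration.integral_diff bounded_measurable_integrable b
        bounded_measurable_mult[OF bounded_measurable_transfer[OF g] bounded_measurable_shift[OF bounded_measurable_transfer[OF f]]])
  also have "(\<integral>x. transfer m g x * transfer (Suc n) f (shift_seq 1 x) \<partial>S) = (\<integral>x. transfer 1 (transfer m g) x * transfer (Suc n) f x \<partial>S)"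
    by (intro transfer_adjoint b)
  also have "\<dots> = (\<integral>x. transfer (Suc n) f x * transfer (Suc m) g x \<partial>S)"
    by (intro Bochner_Integration.integral_cong refl) (simp add: transfer_transfer[OF g] mult.commute)
  finally show ?thesis by simp
qed

text \<open>Conditioning replaces \<open>f\<close> by \<open>transfer n f\<close>, which is the innovation plus a function of the earlier past, and the
innovation is orthogonal to the latter.\<close>

lemma innovation_cov_diag:
  assumes f: "bounded_measurable f"
  shows "(\<integral>x. innovation_part n f (shift_seq n x) * f x \<partial>S) = innovation_cov n f n f"
proof -
  note b = bounded_measurable_mult bounded_measurable_transfer bounded_measurable_shift bounded_measurable_innovation f
  have "(\<integral>x. innovation_part n f (shift_seq n x) * f x \<partial>S) = (\<integral>x. f x * innovation_part n f (shift_seq n x) \<partial>S)"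
    by (simp add: mult.commute)
  also have "\<dots> = (\<integral>x. transfer n f x * innovation_part n f x \<partial>S)"
    by (intro transfer_adjoint b)
  also have "\<dots> = (\<integral>x. innovation_part n f x * innovation_part n f x + innovation_part n f x * transfer (Suc n) f (shift_seq 1 x) \<partial>S)"
    by (simp add: innovation_part_def algebra_simps)
  also have "\<dots> = innovation_cov n f n f + (\<integral>x. innovation_part n f x * transfer (Suc n) f (shift_seq 1 x) \<partial>S)"
    unfolding innovation_cov_def
    by (intro Bochner_Integration.integral_add bounded_measurable_integrable b
        bounded_measurable_mult[OF bounded_measurable_innovation[OF f] bounded_measurable_shift[OF bounded_measurable_transfer[OF f]]])
  also have "(\<integral>x. innovation_part n f x * transfer (Suc n) f (shift_seq 1 x) \<partial>S) = 0"
    by (intro innovation_orthogonal b)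
  finally show ?thesis by simp
qed

lemma innovation_L1:
  assumes f: "bounded_measurable f"
  shows "(\<integral>x. \<bar>innovation_part n f x\<bar> \<partial>S) \<le> 2 * (\<integral>x. \<bar>f x\<bar> \<partial>S)"
proof -
  have "(\<integral>x. \<bar>innovation_part n f x\<bar> \<partial>S) \<le> (\<integral>x. \<bar>transfer n f x\<bar> + \<bar>transfer (Suc n) f (shift_seq 1 x)\<bar> \<partial>S)"
    by (intro integral_mono bounded_measurable_integrable bounded_measurable_abs bounded_measurable_innovation f
        Bochner_Integration.integrable_add bounded_measurable_transfer bounded_measurable_shift[OF bounded_measurable_transfer])
       (simp add: innovation_part_def)
  also have "\<dots> = (\<integral>x. \<bar>transfer n f x\<bar> \<partial>S) + (\<integral>x. \<bar>transfer (Suc n) f (shift_seq 1 x)\<bar> \<partial>S)"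
    by (intro Bochner_Integration.integral_add bounded_measurable_integrable bounded_measurable_abs
        bounded_measurable_transfer bounded_measurable_shift[OF bounded_measurable_transfer] f)
  also have "(\<integral>x. \<bar>transfer (Suc n) f (shift_seq 1 x)\<bar> \<partial>S) = (\<integral>x. \<bar>transfer (Suc n) f x\<bar> \<partial>S)"
    by (rule integral_shift_seq[of "\<lambda>x. \<bar>transfer (Suc n) f x\<bar>"]) (intro bounded_measurable_abs bounded_measurable_transfer f)
  finally show ?thesis using transfer_L1[OF f, of n] transfer_L1[OF f, of "Suc n"] by simp
qed

lemma innovation_diff:
  assumes "bounded_measurable f" "bounded_measurable g" "x \<in> space S"
  shows "innovation_part n (\<lambda>x. f x - g x) x = innovation_part n f x - innovation_part n g x"
proof -
  have "shift_seq 1 x \<in> space S" using measurable_space[OF measurable_shift_seq assms(3)] .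
  then show ?thesis unfolding innovation_part_def using assms by (simp add: transfer_diff)
qed

lemma innovation_abs_le:
  assumes "\<And>x. \<bar>f x\<bar> \<le> C"
  shows "\<bar>innovation_part n f x\<bar> \<le> 2 * C"
  using transfer_abs_le[of f C n x, OF assms] transfer_abs_le[of f C "Suc n" "shift_seq 1 x", OF assms]
  unfolding innovation_part_def by linarith

text \<open>The partial sums telescope to a difference of inner products. The second one tends to the product of the means, since
the influence of the present on \<open>f\<close> fades away.\<close>

lemma covariance_telescope:
  assumes f: "bounded_measurable f" and g: "bounded_measurable g"
    and gap: "(\<lambda>n. coupling_gap n f) \<longlonglongrightarrow> 0"
  shows "(\<lambda>n. innovation_cov (n + a) f (n + b) g) sums
     ((\<integral>x. transfer a f x * transfer b g x \<partial>S) - (\<integral>x. f x \<partial>S) * (\<integral>x. g x \<partial>S))"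
proof -
  let ?m = "\<integral>x. f x \<partial>S"
  let ?I = "\<lambda>n. \<integral>x. transfer (n + a) f x * transfer (n + b) g x \<partial>S"
  note bm = bounded_measurable_mult bounded_measurable_transfer bounded_measurable_diff bounded_measurable_const
  obtain D where D: "D \<ge> 0" "\<And>x. \<bar>g x\<bar> \<le> D" using bounded_measurableE[OF g] by metis
  have bound: "\<bar>?I n - ?m * (\<integral>x. g x \<partial>S)\<bar> \<le> D * coupling_gap (n + a) f" for n
  proof -
    have "?I n - ?m * (\<integral>x. g x \<partial>S) = ?I n - (\<integral>x. ?m * transfer (n + b) g x \<partial>S)"
      by (simp add: integral_transfer[OF g])
    also have "\<dots> = (\<integral>x. transfer (n + a) f x * transfer (n + b) g x - ?m * transfer (n + b) g x \<partial>S)"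
      by (intro Bochner_Integration.integral_diff[symmetric] bounded_measurable_integrable bm f g)
    also have "\<dots> = (\<integral>x. (transfer (n + a) f x - ?m) * transfer (n + b) g x \<partial>S)" by (simp add: left_diff_distrib)
    also have "\<bar>\<dots>\<bar> \<le> (\<integral>x. \<bar>(transfer (n + a) f x - ?m) * transfer (n + b) g x\<bar> \<partial>S)" by simp
    also have "\<dots> \<le> (\<integral>x. D * \<bar>transfer (n + a) f x - ?m\<bar> \<partial>S)"
    proof (rule integral_mono)
      show "integrable S (\<lambda>x. \<bar>(transfer (n + a) f x - ?m) * transfer (n + b) g x\<bar>)"
        by (intro bounded_measurable_integrable bounded_measurable_abs bm f g)
      show "integrable S (\<lambda>x. D * \<bar>transfer (n + a) f x - ?m\<bar>)"
        by (intro bounded_measurable_integrable bounded_measurable_mult bounded_measurable_const bounded_measurable_abs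
            bounded_measurable_diff bounded_measurable_transfer f)
      show "\<bar>(transfer (n + a) f x - ?m) * transfer (n + b) g x\<bar> \<le> D * \<bar>transfer (n + a) f x - ?m\<bar>" for x
        using mult_left_mono[OF transfer_abs_le[of g D "n + b" x, OF D(2)], of "\<bar>transfer (n + a) f x - ?m\<bar>"]
        by (simp add: abs_mult mult.commute)
    qed
    also have "\<dots> \<le> D * coupling_gap (n + a) f"
      using transfer_mixing[OF f, of "n + a"] D(1) by (simp add: mult_left_mono)
    finally show ?thesis .
  qed
  have "(\<lambda>n. coupling_gap (n + a) f) \<longlonglongrightarrow> 0" using gap by (rule LIMSEQ_ignore_initial_segment)
  then have "(\<lambda>n. D * coupling_gap (n + a) f) \<longlonglongrightarrow> 0" by (rule tendsto_mult_right_zero)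
  then have "(\<lambda>n. ?I n - ?m * (\<integral>x. g x \<partial>S)) \<longlonglongrightarrow> 0"
    by (rule Lim_null_comparison[rotated]) (use bound in simp)
  then have "?I \<longlonglongrightarrow> ?m * (\<integral>x. g x \<partial>S)" by (simp add: LIM_zero_iff)
  then have "(\<lambda>n. ?I 0 - ?I n) \<longlonglongrightarrow> ?I 0 - ?m * (\<integral>x. g x \<partial>S)" by (intro tendsto_intros)
  moreover have "(\<Sum>n<N. innovation_cov (n + a) f (n + b) g) = ?I 0 - ?I N" for N
    by (induction N) (simp_all add: innovation_cov_eq[OF f g])
  ultimately show ?thesis by (simp add: sums_def)
qed

lemma iterated_integral_fst:
  assumes "G \<in> borel_measurable (S \<Otimes>\<^sub>M S)" "\<And>z. \<bar>G z\<bar> \<le> C"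
  shows "(\<integral>z. G z \<partial>(S \<Otimes>\<^sub>M S)) = (\<integral>e. (\<integral>x. G (e, x) \<partial>S) \<partial>S :: real)"
  using SS.integral_fst[of "\<lambda>e x. G (e, x)"] comb_integrable[OF assms] by simp

lemma coupling_gap_shift:
  assumes g: "bounded_measurable g" and n: "n \<le> k"
  shows "coupling_gap k (\<lambda>x. g (shift_seq n x)) = coupling_gap (k - n) g"
proof -
  have "coupling_gap k (\<lambda>x. g (shift_seq n x)) = (\<integral>x. (\<integral>e. \<bar>g (comb_seq (k - n) (shift_seq n e) x) - g (shift_seq n e)\<bar> \<partial>S) \<partial>S)"
    using n by (simp add: coupling_gap_eq[OF bounded_measurable_shift[OF g]] shift_comb_seq_le)
  also have "\<dots> = (\<integral>x. (\<integral>e. \<bar>g (comb_seq (k - n) e x) - g e\<bar> \<partial>S) \<partial>S)"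
  proof (rule Bochner_Integration.integral_cong[OF refl])
    fix x assume x: "x \<in> space S"
    show "(\<integral>e. \<bar>g (comb_seq (k - n) (shift_seq n e) x) - g (shift_seq n e)\<bar> \<partial>S) = (\<integral>e. \<bar>g (comb_seq (k - n) e x) - g e\<bar> \<partial>S)"
      by (rule integral_shift_seq[of "\<lambda>e. \<bar>g (comb_seq (k - n) e x) - g e\<bar>"])
         (intro bounded_measurable_abs bounded_measurable_diff bounded_measurable_comb g x)
  qed
  also have "\<dots> = coupling_gap (k - n) g" by (rule coupling_gap_eq[OF g, symmetric])
  finally show ?thesis .
qed

lemma coupling_gap_diff:
  assumes f: "bounded_measurable f" and g: "bounded_measurable g"
  shows "coupling_gap k (\<lambda>x. f x - g x) \<le> coupling_gap k f + coupling_gap k g"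
proof -
  have "coupling_gap k (\<lambda>x. f x - g x) \<le> (\<integral>z. \<bar>f (comb_seq k (fst z) (snd z)) - f (fst z)\<bar> + \<bar>g (comb_seq k (fst z) (snd z)) - g (fst z)\<bar> \<partial>(S \<Otimes>\<^sub>M S))"
    unfolding coupling_gap_def
    by (intro integral_mono coupling_gap_integrable[OF bounded_measurable_diff[OF f g]]
        Bochner_Integration.integrable_add coupling_gap_integrable f g) simp
  also have "\<dots> = coupling_gap k f + coupling_gap k g"
    unfolding coupling_gap_def by (intro Bochner_Integration.integral_add coupling_gap_integrable f g)
  finally show ?thesis .
qed

lemma coupling_gap_innovation:
  assumes f: "bounded_measurable f" and k: "Suc j \<le> k"
  shows "coupling_gap k (\<lambda>x. innovation_part j f (shift_seq j x)) \<le> 2 * coupling_gap k f"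
proof -
  note b = bounded_measurable_transfer[OF f]
  have "coupling_gap k (\<lambda>x. innovation_part j f (shift_seq j x))
     = coupling_gap k (\<lambda>x. transfer j f (shift_seq j x) - transfer (Suc j) f (shift_seq (Suc j) x))"
    by (simp add: innovation_part_def shift_shift_seq)
  also have "\<dots> \<le> coupling_gap k (\<lambda>x. transfer j f (shift_seq j x)) + coupling_gap k (\<lambda>x. transfer (Suc j) f (shift_seq (Suc j) x))"
    by (intro coupling_gap_diff bounded_measurable_shift b)
  also have "\<dots> = coupling_gap (k - j) (transfer j f) + coupling_gap (k - Suc j) (transfer (Suc j) f)"
    using k by (simp add: coupling_gap_shift[OF b])
  also have "\<dots> \<le> 2 * coupling_gap k f"
    using coupling_gap_transfer[OF f, of j k] coupling_gap_transfer[OF f, of "Suc j" k] k by simp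
  finally show ?thesis .
qed

end

section \<open>Rearranging the long-run covariance\<close>

text \<open>Spelled out, as the name \<open>abs_summable_on\<close> is shared with a measure-theoretic notion.\<close>

abbreviation absolutely_summable_on :: "('a \<Rightarrow> 'b::real_normed_vector) \<Rightarrow> 'a set \<Rightarrow> bool"
    (infix "absolutely'_summable'_on" 50) where
  "f absolutely_summable_on A \<equiv> (\<lambda>x. norm (f x)) summable_on A"

text \<open>Each pair \<open>(i, l)\<close> lies on exactly one of the lines \<open>l - i = k\<close>, which starts at the point \<open>(k\<^sup>-, k\<^sup>+)\<close>.\<close>

lemma infsum_antidiagonals:
  fixes \<beta> :: "nat \<Rightarrow> nat \<Rightarrow> real"
  assumes abs: "(\<lambda>(i, l). \<beta> i l) absolutely_summable_on UNIV"
    and c: "\<And>k :: int. (\<lambda>n. \<beta> (n + nat (- k)) (n + nat k)) sums c k"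
  shows "(\<Sum>\<^sub>\<infinity>k\<in>UNIV. c k) = (\<Sum>\<^sub>\<infinity>(i, l)\<in>UNIV. \<beta> i l)"
proof -
  (* The point with number n on the diagonal k. *)
  let ?\<phi> = "\<lambda>(k :: int, n :: nat). (n + nat (- k), n + nat k)"
  have bij: "bij_betw ?\<phi> (UNIV \<times> UNIV) UNIV"
    by (rule bij_betw_byWitness[where f'="\<lambda>(i, l). (int l - int i, min i l)"]) (auto simp: min_def)
  have "(\<lambda>z. case ?\<phi> z of (i, l) \<Rightarrow> \<beta> i l) absolutely_summable_on (UNIV \<times> UNIV)"
    using abs summable_on_reindex_bij_betw[OF bij, of "\<lambda>z. norm (case z of (i, l) \<Rightarrow> \<beta> i l)"] by simp
  then have s: "(\<lambda>(k, n). \<beta> (n + nat (- k)) (n + nat k)) absolutely_summable_on (UNIV \<times> UNIV)"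
    by (simp add: split_beta')
  have inner: "(\<Sum>\<^sub>\<infinity>n\<in>UNIV. \<beta> (n + nat (- k)) (n + nat k)) = c k" for k
  proof -
    have "(\<lambda>n. \<beta> (n + nat (- k)) (n + nat k)) absolutely_summable_on UNIV"
      using s unfolding Infinite_Sum.abs_summable_on_Sigma_iff by simp
    then have "(\<lambda>n. \<beta> (n + nat (- k)) (n + nat k)) summable_on UNIV"
      by (rule abs_summable_summable)
    then have "(\<lambda>n. \<beta> (n + nat (- k)) (n + nat k)) sums (\<Sum>\<^sub>\<infinity>n\<in>UNIV. \<beta> (n + nat (- k)) (n + nat k))"
      by (intro has_sum_imp_sums has_sum_infsum)
    then show ?thesis using c[of k] sums_unique2 by blast
  qed
  have "(\<Sum>\<^sub>\<infinity>(i, l)\<in>UNIV. \<beta> i l) = (\<Sum>\<^sub>\<infinity>z\<in>UNIV \<times> UNIV. case ?\<phi> z of (i, l) \<Rightarrow> \<beta> i l)"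
    by (rule infsum_reindex_bij_betw[OF bij, symmetric])
  also have "\<dots> = (\<Sum>\<^sub>\<infinity>(k, n)\<in>UNIV \<times> UNIV. \<beta> (n + nat (- k)) (n + nat k))"
    by (simp add: split_beta')
  also have "\<dots> = (\<Sum>\<^sub>\<infinity>k\<in>UNIV. \<Sum>\<^sub>\<infinity>n\<in>UNIV. \<beta> (n + nat (- k)) (n + nat k))"
    by (rule infsum_Sigma'_banach[symmetric]) (rule abs_summable_summable[OF s])
  finally show ?thesis by (simp add: inner)
qed

lemma abs_summable_on_prod:
  fixes A B :: "nat \<Rightarrow> real"
  assumes "summable A" "summable B" "\<And>i. 0 \<le> A i" "\<And>i. 0 \<le> B i"
  shows "(\<lambda>(i, l). A i * B l) absolutely_summable_on UNIV"
proof -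
  have sB: "B absolutely_summable_on UNIV" using assms by (simp add: summable_on_UNIV_nonneg_real_iff)
  have "(\<lambda>(i, l). A i * B l) absolutely_summable_on (UNIV \<times> UNIV)"
    unfolding Infinite_Sum.abs_summable_on_Sigma_iff
  proof (intro conjI ballI)
    show "(\<lambda>l. case (i, l) of (i, l) \<Rightarrow> A i * B l) absolutely_summable_on UNIV" for i
      using summable_on_cmult_right[OF sB, of "\<bar>A i\<bar>"] by (simp add: abs_mult)
    have "(\<Sum>\<^sub>\<infinity>l\<in>UNIV. norm (case (i, l) of (i, l) \<Rightarrow> A i * B l)) = A i * (\<Sum>\<^sub>\<infinity>l\<in>UNIV. B l)" for i
      using assms by (simp add: abs_mult infsum_cmult_right')
    moreover have "(\<lambda>i. A i * (\<Sum>\<^sub>\<infinity>l\<in>UNIV. B l)) summable_on UNIV"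
      using assms by (intro summable_on_cmult_left) (simp add: summable_on_UNIV_nonneg_real_iff)
    ultimately show "(\<lambda>i. \<Sum>\<^sub>\<infinity>l\<in>UNIV. norm (case (i, l) of (i, l) \<Rightarrow> A i * B l)) absolutely_summable_on UNIV"
      using infsum_nonneg[of UNIV B] assms by (simp add: abs_mult)
  qed
  then show ?thesis by simp
qed

lemma sum_abs_mult_le:
  fixes a b :: "nat \<Rightarrow> real"
  assumes "(\<lambda>q. (a q)\<^sup>2) sums A\<^sup>2" "(\<lambda>q. (b q)\<^sup>2) sums B\<^sup>2" "0 \<le> A" "0 \<le> B" "finite F"
  shows "(\<Sum>q\<in>F. \<bar>a q * b q\<bar>) \<le> A * B"
proof -
  have le: "(\<Sum>q\<in>F. (a q)\<^sup>2) \<le> A\<^sup>2" "(\<Sum>q\<in>F. (b q)\<^sup>2) \<le> B\<^sup>2"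
    using sum_le_suminf[of "\<lambda>q. (a q)\<^sup>2" F] sum_le_suminf[of "\<lambda>q. (b q)\<^sup>2" F] assms by (auto simp: sums_iff)
  have "(\<Sum>q\<in>F. \<bar>a q\<bar> * \<bar>b q\<bar>)\<^sup>2 \<le> (\<Sum>q\<in>F. \<bar>a q\<bar>\<^sup>2) * (\<Sum>q\<in>F. \<bar>b q\<bar>\<^sup>2)"
    by (rule Cauchy_Schwarz_ineq_sum)
  also have "\<dots> \<le> A\<^sup>2 * B\<^sup>2" using le by (intro mult_mono) (auto intro: sum_nonneg)
  finally have "(\<Sum>q\<in>F. \<bar>a q\<bar> * \<bar>b q\<bar>)\<^sup>2 \<le> (A * B)\<^sup>2" by (simp add: power_mult_distrib)
  then have "(\<Sum>q\<in>F. \<bar>a q\<bar> * \<bar>b q\<bar>) \<le> A * B" by (rule power2_le_imp_le) (use assms in simp)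
  then show ?thesis by (simp only: abs_mult)
qed

text \<open>By the Cauchy-Schwarz inequality, \<open>\<Sum>\<^sub>q \<bar>a q i * b q l\<bar> \<le> A i * B l\<close>. The triple series therefore converges absolutely
and may be summed in any order.\<close>

lemma sums_products_of_sums:
  fixes a b :: "nat \<Rightarrow> nat \<Rightarrow> real" and A B :: "nat \<Rightarrow> real"
  assumes A: "summable A" "\<And>i. 0 \<le> A i" "\<And>i. (\<lambda>q. (a q i)\<^sup>2) sums (A i)\<^sup>2"
    and B: "summable B" "\<And>i. 0 \<le> B i" "\<And>i. (\<lambda>q. (b q i)\<^sup>2) sums (B i)\<^sup>2"
    and \<beta>: "\<And>i l. (\<lambda>q. a q i * b q l) sums \<beta> i l"
  shows "(\<lambda>q. (\<Sum>i. a q i) * (\<Sum>l. b q l)) sums (\<Sum>\<^sub>\<infinity>(i, l)\<in>UNIV. \<beta> i l)"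
    and "(\<lambda>(i, l). \<beta> i l) absolutely_summable_on UNIV"
proof -
  have AB: "(\<lambda>(i, l). A i * B l) absolutely_summable_on UNIV" by (rule abs_summable_on_prod) fact+
  have ABi: "(\<lambda>(i, l). A i * B l) summable_on UNIV" by (rule abs_summable_summable[OF AB])
  have le: "(\<Sum>q\<in>F. \<bar>a q i * b q l\<bar>) \<le> A i * B l" if "finite F" for F i l
    by (rule sum_abs_mult_le[OF A(3) B(3) A(2) B(2) that])
  have qsum: "(\<lambda>q. a q i * b q l) absolutely_summable_on UNIV" for i l
  proof (rule nonneg_bdd_above_summable_on)
    show "bdd_above (sum (\<lambda>q. norm (a q i * b q l)) ` {F. F \<subseteq> UNIV \<and> finite F})"
      using le by (intro bdd_aboveI2[where M="A i * B l"]) simp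
  qed simp
  have qle: "(\<Sum>\<^sub>\<infinity>q\<in>UNIV. norm (a q i * b q l)) \<le> A i * B l" for i l
    using le by (intro infsum_le_finite_sums qsum) simp
  have all: "(\<lambda>(z, q). a q (fst z) * b q (snd z)) absolutely_summable_on (UNIV \<times> UNIV)"
    unfolding Infinite_Sum.abs_summable_on_Sigma_iff
  proof (intro conjI ballI)
    show "(\<lambda>q. case (z, q) of (z, q) \<Rightarrow> a q (fst z) * b q (snd z)) absolutely_summable_on UNIV" for z
      using qsum[of "fst z" "snd z"] by simp
    show "(\<lambda>z. \<Sum>\<^sub>\<infinity>q\<in>UNIV. norm (case (z, q) of (z, q) \<Rightarrow> a q (fst z) * b q (snd z))) absolutely_summable_on UNIV"
    proof (rule Infinite_Sum.abs_summable_on_comparison_test'[OF ABi])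
      fix z :: "nat \<times> nat"
      have "0 \<le> (\<Sum>\<^sub>\<infinity>q\<in>UNIV. norm (a q (fst z) * b q (snd z)))" by (rule infsum_nonneg) simp
      then show "norm (\<Sum>\<^sub>\<infinity>q\<in>UNIV. norm (case (z, q) of (z, q) \<Rightarrow> a q (fst z) * b q (snd z))) \<le> (case z of (i, l) \<Rightarrow> A i * B l)"
        using qle[of "fst z" "snd z"] by (simp add: split_beta')
    qed
  qed
  have \<beta>': "(\<Sum>\<^sub>\<infinity>q\<in>UNIV. a q i * b q l) = \<beta> i l" for i l
    using has_sum_imp_sums[OF has_sum_infsum[OF abs_summable_summable[OF qsum]]] \<beta> sums_unique2 by blast
  have single: "(\<lambda>i. \<bar>a q i\<bar>) summable_on UNIV" "(\<lambda>i. \<bar>b q i\<bar>) summable_on UNIV" for q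
  proof -
    have "\<bar>a q i\<bar> \<le> A i" for i
    proof (rule power2_le_imp_le)
      have "(\<Sum>p\<in>{q}. (a p i)\<^sup>2) \<le> (\<Sum>p. (a p i)\<^sup>2)" using A(3)[of i] by (intro sum_le_suminf) (auto simp: sums_iff)
      then show "\<bar>a q i\<bar>\<^sup>2 \<le> (A i)\<^sup>2" using A(3)[of i] by (simp add: sums_iff)
    qed (rule A)
    then have "summable (\<lambda>i. \<bar>a q i\<bar>)" by (intro summable_comparison_test'[OF A(1)]) simp
    then show "(\<lambda>i. \<bar>a q i\<bar>) summable_on UNIV" by (simp add: summable_on_UNIV_nonneg_real_iff)
    have "\<bar>b q i\<bar> \<le> B i" for i
    proof (rule power2_le_imp_le)
      have "(\<Sum>p\<in>{q}. (b p i)\<^sup>2) \<le> (\<Sum>p. (b p i)\<^sup>2)" using B(3)[of i] by (intro sum_le_suminf) (auto simp: sums_iff)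
      then show "\<bar>b q i\<bar>\<^sup>2 \<le> (B i)\<^sup>2" using B(3)[of i] by (simp add: sums_iff)
    qed (rule B)
    then have "summable (\<lambda>i. \<bar>b q i\<bar>)" by (intro summable_comparison_test'[OF B(1)]) simp
    then show "(\<lambda>i. \<bar>b q i\<bar>) summable_on UNIV" by (simp add: summable_on_UNIV_nonneg_real_iff)
  qed
  have infsum_a: "(\<Sum>\<^sub>\<infinity>i\<in>UNIV. a q i) = (\<Sum>i. a q i)" "(\<Sum>\<^sub>\<infinity>i\<in>UNIV. b q i) = (\<Sum>i. b q i)" for q
    using single[of q, folded real_norm_def]
    by (blast intro: sums_unique has_sum_imp_sums has_sum_infsum abs_summable_summable)+
  have prod: "(\<Sum>\<^sub>\<infinity>z\<in>UNIV. a q (fst z) * b q (snd z)) = (\<Sum>i. a q i) * (\<Sum>l. b q l)" for q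
  proof -
    have "(\<lambda>(q, z). a q (fst z) * b q (snd z)) absolutely_summable_on (UNIV \<times> UNIV)"
      using all summable_on_swap[of "\<lambda>(z, q). norm (a q (fst z) * b q (snd z))" UNIV UNIV]
      by (simp add: case_prod_unfold)
    then have "(\<lambda>z. a q (fst z) * b q (snd z)) absolutely_summable_on UNIV"
      unfolding Infinite_Sum.abs_summable_on_Sigma_iff by simp
    then have s: "(\<lambda>(i, l). a q i * b q l) summable_on UNIV \<times> UNIV"
      using abs_summable_summable[of "\<lambda>z. a q (fst z) * b q (snd z)" UNIV] by (simp add: case_prod_unfold)
    have "(\<Sum>\<^sub>\<infinity>z\<in>UNIV. a q (fst z) * b q (snd z)) = (\<Sum>\<^sub>\<infinity>(i, l)\<in>UNIV \<times> UNIV. a q i * b q l)"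
      by (simp add: case_prod_unfold)
    also have "\<dots> = (\<Sum>\<^sub>\<infinity>i\<in>UNIV. \<Sum>\<^sub>\<infinity>l\<in>UNIV. a q i * b q l)"
      by (rule infsum_Sigma'_banach[symmetric, OF s])
    also have "\<dots> = (\<Sum>i. a q i) * (\<Sum>l. b q l)"
      by (simp add: infsum_cmult_right' infsum_cmult_left' infsum_a)
    finally show ?thesis .
  qed
  have swapped: "(\<lambda>(q, z). a q (fst z) * b q (snd z)) summable_on (UNIV \<times> UNIV)"
    using abs_summable_summable[OF all] summable_on_swap[of "\<lambda>(z, q). a q (fst z) * b q (snd z)" UNIV UNIV]
    by (simp add: case_prod_unfold)
  have "(\<lambda>q. \<Sum>\<^sub>\<infinity>z\<in>UNIV. a q (fst z) * b q (snd z)) summable_on UNIV"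
    using summable_on_Sigma_banach[of "\<lambda>q z. a q (fst z) * b q (snd z)" UNIV "\<lambda>_. UNIV"] swapped
    by (simp add: case_prod_unfold)
  then have "(\<lambda>q. (\<Sum>i. a q i) * (\<Sum>l. b q l)) sums (\<Sum>\<^sub>\<infinity>q\<in>UNIV. \<Sum>\<^sub>\<infinity>z\<in>UNIV. a q (fst z) * b q (snd z))"
    using has_sum_imp_sums[OF has_sum_infsum] by (simp add: prod)
  also have "(\<Sum>\<^sub>\<infinity>q\<in>UNIV. \<Sum>\<^sub>\<infinity>z\<in>UNIV. a q (fst z) * b q (snd z)) = (\<Sum>\<^sub>\<infinity>z\<in>UNIV. \<Sum>\<^sub>\<infinity>q\<in>UNIV. a q (fst z) * b q (snd z))"
    by (rule infsum_swap_banach[OF swapped])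
  also have "\<dots> = (\<Sum>\<^sub>\<infinity>(i, l)\<in>UNIV. \<beta> i l)" by (simp add: \<beta>' case_prod_unfold)
  finally show "(\<lambda>q. (\<Sum>i. a q i) * (\<Sum>l. b q l)) sums (\<Sum>\<^sub>\<infinity>(i, l)\<in>UNIV. \<beta> i l)" .
  show "(\<lambda>(i, l). \<beta> i l) absolutely_summable_on UNIV"
  proof (rule Infinite_Sum.abs_summable_on_comparison_test'[OF ABi])
    fix z :: "nat \<times> nat"
    have "norm (\<Sum>\<^sub>\<infinity>q\<in>UNIV. a q (fst z) * b q (snd z)) \<le> (\<Sum>\<^sub>\<infinity>q\<in>UNIV. norm (a q (fst z) * b q (snd z)))"
      by (rule norm_infsum_bound[OF qsum])
    then show "norm (case z of (i, l) \<Rightarrow> \<beta> i l) \<le> (case z of (i, l) \<Rightarrow> A i * B l)"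
      using qle[of "fst z" "snd z"] by (simp add: \<beta>' case_prod_unfold)
  qed
qed

section \<open>Innovations and projections\<close>

locale innovations = prob_space M for M :: "'w measure" +
  fixes E :: "'g measure" and \<epsilon> :: "int \<Rightarrow> 'w \<Rightarrow> 'g"
  assumes iid: "iid_sequence M E \<epsilon>"
begin

lemma indep_innovations: "indep_vars (\<lambda>_. E) \<epsilon> UNIV"
  using iid by (simp add: iid_sequence_def)

lemma measurable_innovation [measurable]: "\<epsilon> t \<in> measurable M E"
  using indep_innovations by (auto simp: indep_vars_def)

lemma law_innovation: "distr M E (\<epsilon> t) = distr M E (\<epsilon> 0)"
  using iid by (simp add: iid_sequence_def)

sublocale Q: sequence_space "distr M E (\<epsilon> 0)"
proof -
  interpret P0: prob_space "distr M E (\<epsilon> 0)" by (rule prob_space_distr) simp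
  show "sequence_space (distr M E (\<epsilon> 0))" by unfold_locales
qed

lemma sets_Q: "sets Q.S = sets (\<Pi>\<^sub>M i\<in>UNIV. E)"
  by (intro sets_PiM_cong) auto

lemma measurable_Q1: "measurable Q.S N = measurable (\<Pi>\<^sub>M i\<in>UNIV. E) N"
  by (rule measurable_cong_sets[OF sets_Q refl])

lemma measurable_Q2: "measurable N Q.S = measurable N (\<Pi>\<^sub>M i\<in>UNIV. E)"
  by (rule measurable_cong_sets[OF refl sets_Q])

lemma measurable_past [measurable]: "past \<epsilon> t \<in> measurable M Q.S"
  unfolding measurable_Q2 past_def[abs_def] by (rule measurable_abs_UNIV) simp

lemma law_innovations: "distr M (\<Pi>\<^sub>M i\<in>UNIV. E) (\<lambda>\<omega> t. \<epsilon> t \<omega>) = (\<Pi>\<^sub>M t\<in>UNIV. distr M E (\<epsilon> 0))"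
proof -
  have "distr M (\<Pi>\<^sub>M i\<in>UNIV. E) (\<lambda>\<omega>. \<lambda>t\<in>UNIV. \<epsilon> t \<omega>) = (\<Pi>\<^sub>M t\<in>UNIV. distr M E (\<epsilon> t))"
    using indep_innovations by (subst (asm) indep_vars_iff_distr_eq_PiM) auto
  also have "\<dots> = (\<Pi>\<^sub>M t\<in>UNIV. distr M E (\<epsilon> 0))"
    by (intro PiM_cong refl law_innovation)
  finally show ?thesis by (simp add: restrict_def)
qed

lemma law_past: "distr M Q.S (past \<epsilon> t) = Q.S"
proof -
  let ?\<mu> = "distr M E (\<epsilon> 0)"
  let ?f = "\<lambda>\<omega>. \<lambda>n\<in>UNIV. \<omega> (t - int n)"
  have m: "?f \<in> measurable (\<Pi>\<^sub>M i\<in>UNIV. E) Q.S"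
    unfolding measurable_Q2 by (rule measurable_restrict) simp
  have pE: "prob_space ?\<mu>" by (rule prob_space_distr) simp
  have "Q.S = distr (\<Pi>\<^sub>M t\<in>(UNIV::int set). ?\<mu>) Q.S ?f"
    by (rule distr_PiM_reindex[symmetric]) (auto simp: inj_on_def pE)
  also have "\<dots> = distr (distr M (\<Pi>\<^sub>M i\<in>UNIV. E) (\<lambda>\<omega> t. \<epsilon> t \<omega>)) Q.S ?f"
    by (simp add: law_innovations)
  also have "\<dots> = distr M Q.S (?f \<circ> (\<lambda>\<omega> t. \<epsilon> t \<omega>))"
    by (rule distr_distr[OF m]) (rule measurable_abs_UNIV, simp)
  also have "?f \<circ> (\<lambda>\<omega> t. \<epsilon> t \<omega>) = past \<epsilon> t" by (auto simp: past_def fun_eq_iff)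
  finally show ?thesis by simp
qed

lemma integral_past:
  assumes "f \<in> borel_measurable Q.S"
  shows "(\<integral>\<omega>. f (past \<epsilon> t \<omega>) \<partial>M) = (\<integral>x. f x \<partial>Q.S :: real)"
  using integral_distr[OF measurable_past assms, of t] by (simp add: law_past)

lemma past_shift: "past \<epsilon> (t - int n) \<omega> = shift_seq n (past \<epsilon> t \<omega>)"
  by (simp add: past_def shift_seq_def fun_eq_iff algebra_simps)

lemma space_filtration [simp]: "space (innovation_filtration M E \<epsilon> t) = space M"
  unfolding innovation_filtration_def by (rule space_measure_of) auto

lemma sets_filtration:
  "sets (innovation_filtration M E \<epsilon> t) = sigma_sets (space M) (\<Union>s\<in>{..t}. {\<epsilon> s -` A \<inter> space M | A. A \<in> sets E})"
  unfolding innovation_filtration_def by (rule sets_measure_of) auto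

lemma subalgebra_filtration: "subalgebra M (innovation_filtration M E \<epsilon> t)"
  unfolding subalgebra_def sets_filtration
  by (auto intro!: sets.sigma_sets_subset measurable_sets[OF measurable_innovation])

lemma measurable_past_filtration: "past \<epsilon> t \<in> measurable (innovation_filtration M E \<epsilon> t) Q.S"
  unfolding measurable_Q2 past_def[abs_def]
proof (rule measurable_abs_UNIV)
  fix i :: nat
  show "\<epsilon> (t - int i) \<in> measurable (innovation_filtration M E \<epsilon> t) E"
  proof (rule measurableI)
    fix A assume "A \<in> sets E"
    then have "\<epsilon> (t - int i) -` A \<inter> space M \<in> (\<Union>s\<in>{..t}. {\<epsilon> s -` A \<inter> space M | A. A \<in> sets E})"
      by (intro UN_I[of "t - int i"]) auto
    then show "\<epsilon> (t - int i) -` A \<inter> space (innovation_filtration M E \<epsilon> t) \<in> sets (innovation_filtration M E \<epsilon> t)"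
      by (simp add: sets_filtration sigma_sets.Basic)
  qed (use measurable_space[OF measurable_innovation] in simp)
qed

lemma filtration_set_past:
  assumes "A \<in> sets (innovation_filtration M E \<epsilon> t)"
  shows "\<exists>A'\<in>sets Q.S. A = past \<epsilon> t -` A' \<inter> space M"
proof -
  have "(\<Union>s\<in>{..t}. {\<epsilon> s -` A \<inter> space M | A. A \<in> sets E}) \<subseteq> sets (vimage_algebra (space M) (past \<epsilon> t) Q.S)"
  proof (intro UN_least subsetI)
    fix s B assume s: "s \<in> {..t}" and "B \<in> {\<epsilon> s -` A \<inter> space M | A. A \<in> sets E}"
    then obtain A where A: "A \<in> sets E" "B = \<epsilon> s -` A \<inter> space M" by auto
    let ?A = "(\<lambda>x. x (nat (t - s))) -` A \<inter> space Q.S"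
    have "(\<lambda>x. x (nat (t - s))) \<in> measurable Q.S E" unfolding measurable_Q1 by simp
    then have "?A \<in> sets Q.S" by (rule measurable_sets) (rule A)
    moreover have "past \<epsilon> t \<omega> \<in> ?A \<longleftrightarrow> \<epsilon> s \<omega> \<in> A" if "\<omega> \<in> space M" for \<omega>
      using measurable_space[OF measurable_past that, of t] s by (simp add: past_def)
    then have "B = past \<epsilon> t -` ?A \<inter> space M" unfolding A(2) by blast
    ultimately show "B \<in> sets (vimage_algebra (space M) (past \<epsilon> t) Q.S)" by (metis in_vimage_algebra)
  qed
  then have "sets (innovation_filtration M E \<epsilon> t) \<subseteq> sets (vimage_algebra (space M) (past \<epsilon> t) Q.S)"
    unfolding sets_filtration using sets.sigma_sets_subset[of _ "vimage_algebra (space M) (past \<epsilon> t) Q.S"] by simp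
  moreover have "past \<epsilon> t \<in> space M \<rightarrow> space Q.S" using measurable_space[OF measurable_past] by blast
  ultimately show ?thesis using assms sets_vimage_algebra2[of "past \<epsilon> t" "space M" Q.S] by blast
qed

text \<open>The innovation \<open>V\<close> is measurable with respect to the past at time \<open>t\<close> and orthogonal to the past at time \<open>t - 1\<close>.
Hence \<open>E[V H] = E[V P\<^sub>t(H)]\<close>, and the Cauchy-Schwarz inequality applies.\<close>

theorem integral_innovation_le_projection:
  assumes f: "Q.bounded_measurable f" and [measurable]: "H \<in> borel_measurable M" and H: "\<And>\<omega>. \<bar>H \<omega>\<bar> \<le> C"
  shows "\<bar>\<integral>\<omega>. Q.innovation_part j f (past \<epsilon> t \<omega>) * H \<omega> \<partial>M\<bar>
    \<le> sqrt (Q.innovation_cov j f j f) * Lp_norm M 2 (projection M E \<epsilon> t H)"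
proof -
  let ?G0 = "innovation_filtration M E \<epsilon> t" and ?G1 = "innovation_filtration M E \<epsilon> (t - 1)"
  let ?H0 = "real_cond_exp M ?G0 H" and ?H1 = "real_cond_exp M ?G1 H"
  interpret G0: finite_measure_subalgebra M ?G0 by unfold_locales (rule subalgebra_filtration)
  interpret G1: finite_measure_subalgebra M ?G1 by unfold_locales (rule subalgebra_filtration)
  define V where "V \<omega> = Q.innovation_part j f (past \<epsilon> t \<omega>)" for \<omega>
  have bV: "Q.bounded_measurable (Q.innovation_part j f)" by (rule Q.bounded_measurable_innovation[OF f])
  then obtain D where D: "\<And>x. \<bar>Q.innovation_part j f x\<bar> \<le> D" by (auto simp: Q.bounded_measurable_def)
  have [measurable]: "Q.innovation_part j f \<in> borel_measurable Q.S" using bV by (rule Q.bounded_measurable_measurable)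
  have Vm[measurable]: "V \<in> borel_measurable M" unfolding V_def by measurable
  have VG0: "V \<in> borel_measurable ?G0"
    unfolding V_def[abs_def] by (rule measurable_compose[OF measurable_past_filtration]) simp
  have VD: "\<bar>V \<omega>\<bar> \<le> D" for \<omega> using D by (simp add: V_def)
  have intH: "integrable M H" by (rule integrable_bounded[OF _ H]) simp
  have intV: "integrable M V" by (rule integrable_bounded[OF _ VD]) simp
  have HC: "AE \<omega> in M. - C \<le> H \<omega>" "AE \<omega> in M. H \<omega> \<le> C"
    using H by (auto simp: abs_le_iff intro!: AE_I2) (metis minus_le_iff)
  have b0: "AE \<omega> in M. \<bar>?H0 \<omega>\<bar> \<le> C"
    using G0.real_cond_exp_ge_c[OF intH HC(1)] G0.real_cond_exp_le_c[OF intH HC(2)] by eventually_elim simp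
  have b1: "AE \<omega> in M. \<bar>?H1 \<omega>\<bar> \<le> C"
    using G1.real_cond_exp_ge_c[OF intH HC(1)] G1.real_cond_exp_le_c[OF intH HC(2)] by eventually_elim simp
  have sqV: "sq_integrable M V" by (rule sq_integrable_bounded[OF finite_measure_axioms Vm VD])
  have sqb: "sq_integrable M g" if [measurable]: "g \<in> borel_measurable M" and g: "AE \<omega> in M. \<bar>g \<omega>\<bar> \<le> C" for g
  proof -
    have "AE \<omega> in M. norm ((g \<omega>)\<^sup>2) \<le> C\<^sup>2"
      using g by eventually_elim (use power_mono[of "\<bar>_\<bar>" C 2] in simp)
    then have "integrable M (\<lambda>\<omega>. (g \<omega>)\<^sup>2)" by (intro integrable_const_bound) auto
    then show ?thesis by (simp add: sq_integrable_def)
  qed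
  have sq0: "sq_integrable M ?H0" by (rule sqb[OF _ b0]) simp
  have sq1: "sq_integrable M ?H1" by (rule sqb[OF _ b1]) simp
  have condV: "AE \<omega> in M. real_cond_exp M ?G1 V \<omega> = 0"
  proof (rule G1.real_cond_exp_charact)
    fix A assume "A \<in> sets ?G1"
    then obtain A' where A'[measurable]: "A' \<in> sets Q.S" and A: "A = past \<epsilon> (t - 1) -` A' \<inter> space M"
      using filtration_set_past by blast
    have "(\<integral>\<omega>\<in>A. V \<omega> \<partial>M) = (\<integral>\<omega>. Q.innovation_part j f (past \<epsilon> t \<omega>) * indicator A' (shift_seq 1 (past \<epsilon> t \<omega>)) \<partial>M)"
      unfolding set_lebesgue_integral_def
      using past_shift[of t 1] by (intro Bochner_Integration.integral_cong refl) (auto simp: A V_def indicator_def)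
    also have "\<dots> = (\<integral>x. Q.innovation_part j f x * indicator A' (shift_seq 1 x) \<partial>Q.S)"
      by (rule integral_past) measurable
    also have "\<dots> = 0"
    proof (rule Q.innovation_orthogonal[OF f])
      have "\<bar>indicator A' x :: real\<bar> \<le> 1" for x by (simp add: indicator_def)
      then show "Q.bounded_measurable (indicator A')" unfolding Q.bounded_measurable_def by (intro conjI exI[of _ 1]) auto
    qed
    finally show "(\<integral>\<omega>\<in>A. V \<omega> \<partial>M) = (\<integral>\<omega>\<in>A. 0 \<partial>M)" by simp
  qed (auto intro: intV)
  have "(\<integral>\<omega>. V \<omega> * H \<omega> \<partial>M) = (\<integral>\<omega>. V \<omega> * ?H0 \<omega> \<partial>M)"
    using sq_integrable_mult[OF sqV sq_integrable_bounded[OF finite_measure_axioms _ H]]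
    by (intro G0.real_cond_exp_intg(2)[symmetric]) (auto intro: VG0)
  moreover have "(\<integral>\<omega>. ?H1 \<omega> * V \<omega> \<partial>M) = 0"
  proof -
    have "(\<integral>\<omega>. ?H1 \<omega> * V \<omega> \<partial>M) = (\<integral>\<omega>. ?H1 \<omega> * real_cond_exp M ?G1 V \<omega> \<partial>M)"
      using sq_integrable_mult[OF sq1 sqV] by (intro G1.real_cond_exp_intg(2)[symmetric]) auto
    also have "\<dots> = (\<integral>\<omega>. 0 \<partial>M)" using condV by (intro integral_cong_AE) auto
    finally show ?thesis by simp
  qed
  ultimately have "(\<integral>\<omega>. V \<omega> * H \<omega> \<partial>M) = (\<integral>\<omega>. V \<omega> * ?H0 \<omega> \<partial>M) - (\<integral>\<omega>. V \<omega> * ?H1 \<omega> \<partial>M)"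
    by (simp add: mult.commute)
  also have "\<dots> = (\<integral>\<omega>. V \<omega> * projection M E \<epsilon> t H \<omega> \<partial>M)"
    unfolding projection_def right_diff_distrib
    by (intro Bochner_Integration.integral_diff[symmetric] sq_integrable_mult sqV sq0 sq1)
  also have "\<bar>\<dots>\<bar> \<le> sqrt (\<integral>\<omega>. (V \<omega>)\<^sup>2 \<partial>M) * sqrt (\<integral>\<omega>. (projection M E \<epsilon> t H \<omega>)\<^sup>2 \<partial>M)"
    unfolding projection_def by (intro integral_inner_Cauchy_Schwarz sqV sq_integrable_diff sq0 sq1)
  also have "(\<integral>\<omega>. (V \<omega>)\<^sup>2 \<partial>M) = Q.innovation_cov j f j f"
    unfolding V_def Q.innovation_cov_def power2_eq_square by (rule integral_past) measurable
  also have "sqrt (\<integral>\<omega>. (projection M E \<epsilon> t H \<omega>)\<^sup>2 \<partial>M) = Lp_norm M 2 (projection M E \<epsilon> t H)"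
    by (simp add: Lp_norm_def powr_half_sqrt powr_numeral)
  finally show ?thesis by (simp add: V_def)
qed

end

section \<open>The auxiliary process\<close>

text \<open>Extends the rescaled time from the unit interval to the real line, so that Lipschitz and measurability statements
hold on a whole type.\<close>

definition clip :: "real \<Rightarrow> real" where
  "clip u = max 0 (min 1 u)"

lemma clip_mem: "clip u \<in> {0..1}" "0 \<le> clip u" "clip u \<le> 1"
  by (auto simp: clip_def)

lemma clip_eq: "u \<in> {0..1} \<Longrightarrow> clip u = u"
  by (auto simp: clip_def)

lemma clip_diff_le: "\<bar>clip u - clip v\<bar> \<le> \<bar>u - v\<bar>"
  by (auto simp: clip_def max_def min_def)

abbreviation bdist :: "'s::metric_space \<Rightarrow> 's \<Rightarrow> real" where
  "bdist x y \<equiv> min (dist x y) 1"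

lemma lipschitz_borel:
  fixes f :: "'b::metric_space \<Rightarrow> real"
  assumes "\<And>x y. \<bar>f x - f y\<bar> \<le> K * dist x y"
  shows "f \<in> borel_measurable borel"
proof (rule borel_measurable_continuous_onI)
  have K: "\<bar>f x - f y\<bar> \<le> (\<bar>K\<bar> + 1) * dist x y" for x y
  proof -
    have "K * dist x y \<le> (\<bar>K\<bar> + 1) * dist x y" by (intro mult_right_mono) auto
    then show ?thesis using assms[of x y] by linarith
  qed
  show "continuous_on UNIV f"
    unfolding continuous_on_iff
  proof (intro ballI allI impI)
    fix x and e :: real assume "e > 0"
    show "\<exists>d>0. \<forall>y\<in>UNIV. dist y x < d \<longrightarrow> dist (f y) (f x) < e"
    proof (intro exI[of _ "e / (\<bar>K\<bar> + 1)"] conjI ballI impI)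
      show "0 < e / (\<bar>K\<bar> + 1)" using \<open>e > 0\<close> by (simp add: add_nonneg_pos)
      fix y assume d: "dist y x < e / (\<bar>K\<bar> + 1)"
      have "dist (f y) (f x) \<le> (\<bar>K\<bar> + 1) * dist y x" using K by (simp add: dist_real_def)
      also have "\<dots> < e" using d by (simp add: pos_less_divide_eq mult.commute add_nonneg_pos)
      finally show "dist (f y) (f x) < e" .
    qed
  qed
qed

text \<open>The hypotheses that concern the auxiliary process and the kernel, with names for the constants. The Lipschitz
condition in \<open>u\<close> is stated at time \<open>1\<close>, and the stationarity of the innovations carries it over to the other times.\<close>

locale auxiliary_process = innovations M E \<epsilon>
  for M :: "'w measure" and E :: "'g measure" and \<epsilon> :: "int \<Rightarrow> 'w \<Rightarrow> 'g" +
  fixes \<epsilon>' :: "int \<Rightarrow> 'w \<Rightarrow> 'g" and Fa :: "real \<Rightarrow> (nat \<Rightarrow> 'g) \<Rightarrow> 's::polish_space"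
    and Xa :: "int \<Rightarrow> real \<Rightarrow> 'w \<Rightarrow> 's" and h :: "'s \<Rightarrow> 's \<Rightarrow> real \<Rightarrow> real"
    and \<Lambda> L\<^sub>1 C\<^sub>h C\<^sub>u :: real and L\<^sub>2 :: "'s \<Rightarrow> 's \<Rightarrow> real"
  assumes copy: "independent_copy M E \<epsilon> \<epsilon>'"
    and Fa_measurable: "(\<lambda>(u, x). Fa u x) \<in> borel_measurable (restrict_space borel {0..1} \<Otimes>\<^sub>M (\<Pi>\<^sub>M i\<in>UNIV. E))"
    and Xa_measurable: "\<And>t u. u \<in> {0..1} \<Longrightarrow> Xa t u \<in> borel_measurable M"
    and representation: "\<And>t u. u \<in> {0..1} \<Longrightarrow> AE \<omega> in M. Xa t u \<omega> = Fa u (past \<epsilon> t \<omega>)"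
    and Xa_lipschitz: "\<And>u v. u \<in> {0..1} \<Longrightarrow> v \<in> {0..1} \<Longrightarrow> (\<integral>\<omega>. bdist (Xa 1 u \<omega>) (Xa 1 v \<omega>) \<partial>M) \<le> C\<^sub>u * \<bar>u - v\<bar>"
    and delta0: "(\<lambda>m. delta0_aux M \<epsilon> \<epsilon>' Fa Xa m) \<longlonglongrightarrow> 0"
    and nu_summable: "(SUP u\<in>{0..1}. SUP v\<in>{0..1}. SUP r\<in>{0..\<Lambda>}. SUP k. \<Sum>j. SUP t.
            nu_aux M E \<epsilon> \<epsilon>' Fa h t k u v j r) < \<infinity>"
    and h_nonneg: "\<And>x y r. r \<in> {0..\<Lambda>} \<Longrightarrow> 0 \<le> h x y r"
    and h_le: "\<And>x y r. r \<in> {0..\<Lambda>} \<Longrightarrow> h x y r \<le> C\<^sub>h"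
    and h_symmetric: "\<And>x y r. r \<in> {0..\<Lambda>} \<Longrightarrow> h x y r = h y x r"
    and h_lipschitz: "\<And>x x' y r. r \<in> {0..\<Lambda>} \<Longrightarrow> \<bar>h x y r - h x' y r\<bar> \<le> L\<^sub>1 * dist x x'"
    and h_lipschitz_third: "\<And>x y r r'. r \<in> {0..\<Lambda>} \<Longrightarrow> r' \<in> {0..\<Lambda>} \<Longrightarrow> \<bar>h x y r - h x y r'\<bar> \<le> L\<^sub>2 x y * \<bar>r - r'\<bar>"
    and \<Lambda>_nonneg: "0 \<le> \<Lambda>"
begin

definition rep :: "real \<Rightarrow> (nat \<Rightarrow> 'g) \<Rightarrow> 's" where
  "rep u = Fa (clip u)"

lemma rep_measurable [measurable]: "rep u \<in> borel_measurable Q.S"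
proof -
  have "clip u \<in> space (restrict_space borel {0..1})" using clip_mem by (simp add: space_restrict_space)
  then have "(\<lambda>x. (\<lambda>(u, x). Fa u x) (clip u, x)) \<in> borel_measurable (\<Pi>\<^sub>M i\<in>UNIV. E)"
    by (rule measurable_compose[OF measurable_Pair1' Fa_measurable])
  then show ?thesis by (simp add: rep_def measurable_Q1 cong: measurable_cong_sets)
qed

lemma C_h_nonneg: "0 \<le> C\<^sub>h"
  using h_nonneg[of 0 undefined undefined] h_le[of 0 undefined undefined] \<Lambda>_nonneg by simp

text \<open>A bounded Lipschitz function is Lipschitz for the truncated distance, and the expectations of truncated distances are
what local stationarity and the coupling condition control.\<close>

definition L\<^sub>h :: real where
  "L\<^sub>h = max \<bar>L\<^sub>1\<bar> C\<^sub>h"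

lemma L_h_nonneg: "0 \<le> L\<^sub>h"
  by (simp add: L\<^sub>h_def)

lemma h_abs_le: "r \<in> {0..\<Lambda>} \<Longrightarrow> \<bar>h x y r\<bar> \<le> C\<^sub>h"
  using h_nonneg h_le by (simp add: abs_le_iff order_trans[OF _ C_h_nonneg])

lemma h_bdist:
  assumes r: "r \<in> {0..\<Lambda>}"
  shows "\<bar>h x y r - h x' y r\<bar> \<le> L\<^sub>h * bdist x x'" "\<bar>h x y r - h x y' r\<bar> \<le> L\<^sub>h * bdist y y'"
proof -
  have 1: "\<bar>h x y r - h x' y r\<bar> \<le> L\<^sub>h * bdist x x'" for x x' y
  proof (cases "dist x x' \<le> 1")
    case True
    have "\<bar>h x y r - h x' y r\<bar> \<le> L\<^sub>1 * dist x x'" by (rule h_lipschitz[OF r])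
    also have "\<dots> \<le> L\<^sub>h * dist x x'" by (intro mult_right_mono) (auto simp: L\<^sub>h_def)
    finally show ?thesis using True by simp
  next
    case False
    have "\<bar>h x y r - h x' y r\<bar> \<le> C\<^sub>h"
      using h_nonneg[OF r, of x y] h_le[OF r, of x y] h_nonneg[OF r, of x' y] h_le[OF r, of x' y] by (simp add: abs_le_iff)
    also have "\<dots> \<le> L\<^sub>h" by (simp add: L\<^sub>h_def)
    finally show ?thesis using False by simp
  qed
  show "\<bar>h x y r - h x' y r\<bar> \<le> L\<^sub>h * bdist x x'" by (rule 1)
  show "\<bar>h x y r - h x y' r\<bar> \<le> L\<^sub>h * bdist y y'"
    using 1[of y x y'] by (simp add: h_symmetric[OF r, of x])
qed

lemma h_bdist2:
  assumes r: "r \<in> {0..\<Lambda>}"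
  shows "\<bar>h x y r - h x' y' r\<bar> \<le> L\<^sub>h * (bdist x x' + bdist y y')"
proof -
  have "\<bar>h x y r - h x' y' r\<bar> \<le> \<bar>h x y r - h x' y r\<bar> + \<bar>h x' y r - h x' y' r\<bar>" by simp
  also have "\<dots> \<le> L\<^sub>h * bdist x x' + L\<^sub>h * bdist y y'" by (intro add_mono h_bdist r)
  finally show ?thesis by (simp add: distrib_left)
qed

lemma h_measurable:
  assumes r: "r \<in> {0..\<Lambda>}"
  shows "(\<lambda>p. h (fst p) (snd p) r) \<in> borel_measurable (borel \<Otimes>\<^sub>M borel)"
proof -
  have "\<bar>h (fst p) (snd p) r - h (fst q) (snd q) r\<bar> \<le> (2 * L\<^sub>h) * dist p q" for p q
  proof -
    have "bdist (fst p) (fst q) + bdist (snd p) (snd q) \<le> 2 * dist p q"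
      using dist_fst_le[of p q] dist_snd_le[of p q] by simp
    then have "L\<^sub>h * (bdist (fst p) (fst q) + bdist (snd p) (snd q)) \<le> L\<^sub>h * (2 * dist p q)"
      by (intro mult_left_mono L_h_nonneg)
    then show ?thesis using h_bdist2[OF r, of "fst p" "snd p" "fst q" "snd q"] by simp
  qed
  then have "(\<lambda>p. h (fst p) (snd p) r) \<in> borel_measurable borel" by (rule lipschitz_borel)
  then show ?thesis by (simp add: borel_prod)
qed

lemma h_measurable2:
  assumes r: "r \<in> {0..\<Lambda>}" and [measurable]: "f \<in> borel_measurable N" "g \<in> borel_measurable N"
  shows "(\<lambda>x. h (f x) (g x) r) \<in> borel_measurable N"
  using measurable_compose[OF measurable_Pair[OF assms(2,3)] h_measurable[OF r]] by simp

lemma rep_lipschitz: "(\<integral>e. bdist (rep u e) (rep v e) \<partial>Q.S) \<le> C\<^sub>u * \<bar>clip u - clip v\<bar>"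
proof -
  have "(\<integral>e. bdist (rep u e) (rep v e) \<partial>Q.S) = (\<integral>\<omega>. bdist (rep u (past \<epsilon> 1 \<omega>)) (rep v (past \<epsilon> 1 \<omega>)) \<partial>M)"
    by (rule integral_past[symmetric]) measurable
  also have "\<dots> = (\<integral>\<omega>. bdist (Xa 1 (clip u) \<omega>) (Xa 1 (clip v) \<omega>) \<partial>M)"
  proof (rule integral_cong_AE)
    show "AE \<omega> in M. bdist (rep u (past \<epsilon> 1 \<omega>)) (rep v (past \<epsilon> 1 \<omega>)) = bdist (Xa 1 (clip u) \<omega>) (Xa 1 (clip v) \<omega>)"
      using representation[OF clip_mem(1)[of u], of 1] representation[OF clip_mem(1)[of v], of 1]
      by eventually_elim (simp add: rep_def)
    have [measurable]: "Xa 1 (clip u) \<in> borel_measurable M" "Xa 1 (clip v) \<in> borel_measurable M"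
      using Xa_measurable[OF clip_mem(1)] by auto
    show "(\<lambda>\<omega>. bdist (Xa 1 (clip u) \<omega>) (Xa 1 (clip v) \<omega>)) \<in> borel_measurable M" by measurable
    have [measurable]: "(\<lambda>\<omega>. rep u (past \<epsilon> 1 \<omega>)) \<in> borel_measurable M" "(\<lambda>\<omega>. rep v (past \<epsilon> 1 \<omega>)) \<in> borel_measurable M"
      using measurable_compose[OF measurable_past rep_measurable] by auto
    show "(\<lambda>\<omega>. bdist (rep u (past \<epsilon> 1 \<omega>)) (rep v (past \<epsilon> 1 \<omega>))) \<in> borel_measurable M" by measurable
  qed
  also have "\<dots> \<le> C\<^sub>u * \<bar>clip u - clip v\<bar>" by (rule Xa_lipschitz[OF clip_mem(1) clip_mem(1)])
  finally show ?thesis .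
qed

lemma C_u_nonneg: "0 \<le> C\<^sub>u"
proof -
  have "0 \<le> (\<integral>\<omega>. bdist (Xa 1 0 \<omega>) (Xa 1 1 \<omega>) \<partial>M)" by (rule Bochner_Integration.integral_nonneg) simp
  also have "\<dots> \<le> C\<^sub>u * \<bar>0 - 1\<bar>" by (rule Xa_lipschitz) auto
  finally show ?thesis by simp
qed

lemma rep_lipschitz': "(\<integral>e. bdist (rep u e) (rep v e) \<partial>Q.S) \<le> C\<^sub>u * \<bar>u - v\<bar>"
  using order_trans[OF rep_lipschitz mult_left_mono[OF clip_diff_le C_u_nonneg]] .

lemma bdist_rep_bounded: "Q.bounded_measurable (\<lambda>e. bdist (rep u e) (rep v e))"
proof -
  have "\<bar>bdist (rep u e) (rep v e)\<bar> \<le> 1" for e by simp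
  moreover have "(\<lambda>e. bdist (rep u e) (rep v e)) \<in> borel_measurable Q.S" by measurable
  ultimately show ?thesis unfolding Q.bounded_measurable_def by blast
qed

text \<open>The mean truncated distance of \<open>X\<^sub>0(u)\<close> and its coupled version, realized on a product of two sequence spaces.\<close>

definition rep_gap :: "real \<Rightarrow> nat \<Rightarrow> real" where
  "rep_gap u k = (\<integral>z. bdist (rep u (fst z)) (rep u (comb_seq k (fst z) (snd z))) \<partial>(Q.S \<Otimes>\<^sub>M Q.S))"

lemma measurable_copy [measurable]: "\<epsilon>' t \<in> measurable M E"
  using copy by (simp add: independent_copy_def)

lemma law_two_pasts: "distr M (Q.S \<Otimes>\<^sub>M Q.S) (\<lambda>\<omega>. (past \<epsilon> 0 \<omega>, past \<epsilon>' 0 \<omega>)) = Q.S \<Otimes>\<^sub>M Q.S"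
proof -
  let ?P = "\<Pi>\<^sub>M t\<in>(UNIV :: int set). E"
  let ?f = "\<lambda>z i. z (0 - int i)"
  have f: "?f \<in> measurable ?P Q.S" unfolding measurable_Q2 by (rule measurable_abs_UNIV) simp
  have ind: "indep_var ?P (\<lambda>\<omega> t. \<epsilon> t \<omega>) ?P (\<lambda>\<omega> t. \<epsilon>' t \<omega>)" using copy by (simp add: independent_copy_def)
  have "indep_var Q.S (?f \<circ> (\<lambda>\<omega> t. \<epsilon> t \<omega>)) Q.S (?f \<circ> (\<lambda>\<omega> t. \<epsilon>' t \<omega>))"
    by (rule indep_var_compose[OF ind f f])
  moreover have p: "?f \<circ> (\<lambda>\<omega> t. \<epsilon> t \<omega>) = past \<epsilon> 0" "?f \<circ> (\<lambda>\<omega> t. \<epsilon>' t \<omega>) = past \<epsilon>' 0"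
    by (auto simp: past_def fun_eq_iff)
  ultimately have ind': "indep_var Q.S (past \<epsilon> 0) Q.S (past \<epsilon>' 0)" by simp
  have m: "(\<lambda>\<omega> t. \<epsilon> t \<omega>) \<in> measurable M ?P" "(\<lambda>\<omega> t. \<epsilon>' t \<omega>) \<in> measurable M ?P"
    by (rule measurable_abs_UNIV, simp)+
  have "distr M ?P (\<lambda>\<omega> t. \<epsilon>' t \<omega>) = distr M ?P (\<lambda>\<omega> t. \<epsilon> t \<omega>)"
    using copy by (simp add: independent_copy_def process_law_def restrict_def)
  then have "distr (distr M ?P (\<lambda>\<omega> t. \<epsilon>' t \<omega>)) Q.S ?f = distr (distr M ?P (\<lambda>\<omega> t. \<epsilon> t \<omega>)) Q.S ?f" by simp
  then have "distr M Q.S (past \<epsilon>' 0) = distr M Q.S (past \<epsilon> 0)"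
    by (simp only: distr_distr[OF f m(1)] distr_distr[OF f m(2)] p)
  then show ?thesis using indep_var_distribution_eq[of Q.S "past \<epsilon> 0" Q.S "past \<epsilon>' 0"] ind' law_past[of 0] by simp
qed

lemma coupled_past_comb: "coupled_past \<epsilon> \<epsilon>' m 0 \<omega> = comb_seq m (past \<epsilon> 0 \<omega>) (shift_seq m (past \<epsilon>' 0 \<omega>))"
  by (auto simp: coupled_past_def comb_seq_def past_def shift_seq_def fun_eq_iff)

lemma measurable_coupled_past [measurable]: "coupled_past \<epsilon> \<epsilon>' m t \<in> measurable M Q.S"
  unfolding measurable_Q2 coupled_past_def[abs_def]
proof (rule measurable_abs_UNIV)
  show "(\<lambda>\<omega>. if n < m then \<epsilon> (t - int n) \<omega> else \<epsilon>' (t - int n) \<omega>) \<in> measurable M E" for n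
    by (cases "n < m") simp_all
qed

lemma coupled_aux_measurable: "u \<in> {0..1} \<Longrightarrow> coupled_aux \<epsilon> \<epsilon>' Fa m t u \<in> borel_measurable M"
  using measurable_compose[OF measurable_coupled_past rep_measurable[of u]]
  by (simp add: coupled_aux_def[abs_def] rep_def clip_eq)

lemma coupled_bdist_le:
  assumes u: "u \<in> {0..1}"
  shows "ennreal (\<integral>\<omega>. bdist (Xa t u \<omega>) (coupled_aux \<epsilon> \<epsilon>' Fa m t u \<omega>) \<partial>M) \<le> delta0_aux M \<epsilon> \<epsilon>' Fa Xa m"
proof -
  have [measurable]: "Xa t u \<in> borel_measurable M" "coupled_aux \<epsilon> \<epsilon>' Fa m t u \<in> borel_measurable M"
    using Xa_measurable[OF u] coupled_aux_measurable[OF u] by auto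
  have "ennreal (\<integral>\<omega>. bdist (Xa t u \<omega>) (coupled_aux \<epsilon> \<epsilon>' Fa m t u \<omega>) \<partial>M)
     = (\<integral>\<^sup>+\<omega>. ennreal (bdist (Xa t u \<omega>) (coupled_aux \<epsilon> \<epsilon>' Fa m t u \<omega>)) \<partial>M)"
    by (intro nn_integral_eq_integral[symmetric] integrable_bounded[where C=1]) auto
  also have "\<dots> \<le> delta0_aux M \<epsilon> \<epsilon>' Fa Xa m"
    unfolding delta0_aux_def by (rule SUP_upper2[of t]) (auto intro!: SUP_upper2[of u] u)
  finally show ?thesis .
qed

lemma tendsto_of_ennreal_le:
  fixes a :: "nat \<Rightarrow> real"
  assumes "\<And>n. 0 \<le> a n" "\<And>n. ennreal (a n) \<le> b n" "b \<longlonglongrightarrow> 0"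
  shows "a \<longlonglongrightarrow> 0"
proof -
  have "(\<lambda>n. ennreal (a n)) \<longlonglongrightarrow> 0"
    by (rule tendsto_sandwich[OF _ _ tendsto_const assms(3)]) (use assms in auto)
  then show ?thesis using assms(1) by (simp add: tendsto_ennreal_iff[where x=0, simplified])
qed

lemma coupled_bdist_tendsto:
  assumes u: "u \<in> {0..1}"
  shows "(\<lambda>m. \<integral>\<omega>. bdist (Xa t u \<omega>) (coupled_aux \<epsilon> \<epsilon>' Fa m t u \<omega>) \<partial>M) \<longlonglongrightarrow> 0"
  by (rule tendsto_of_ennreal_le[OF _ coupled_bdist_le[OF u] delta0]) simp

lemma rep_gap_tendsto: "rep_gap u \<longlonglongrightarrow> 0"
proof -
  have "rep_gap u m = (\<integral>\<omega>. bdist (Xa 0 (clip u) \<omega>) (coupled_aux \<epsilon> \<epsilon>' Fa m 0 (clip u) \<omega>) \<partial>M)" for m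
  proof -
    let ?G = "\<lambda>z. bdist (rep u (fst z)) (rep u (comb_seq m (fst z) (snd z)))"
    have mG[measurable]: "?G \<in> borel_measurable (Q.S \<Otimes>\<^sub>M Q.S)" by measurable
    have "(\<integral>\<omega>. bdist (Xa 0 (clip u) \<omega>) (coupled_aux \<epsilon> \<epsilon>' Fa m 0 (clip u) \<omega>) \<partial>M)
      = (\<integral>\<omega>. bdist (rep u (past \<epsilon> 0 \<omega>)) (rep u (comb_seq m (past \<epsilon> 0 \<omega>) (shift_seq m (past \<epsilon>' 0 \<omega>)))) \<partial>M)"
    proof (rule integral_cong_AE)
      show "AE \<omega> in M. bdist (Xa 0 (clip u) \<omega>) (coupled_aux \<epsilon> \<epsilon>' Fa m 0 (clip u) \<omega>)
         = bdist (rep u (past \<epsilon> 0 \<omega>)) (rep u (comb_seq m (past \<epsilon> 0 \<omega>) (shift_seq m (past \<epsilon>' 0 \<omega>))))"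
        using representation[OF clip_mem(1)[of u], of 0]
        by eventually_elim (simp add: coupled_aux_def rep_def coupled_past_comb)
      have [measurable]: "Xa 0 (clip u) \<in> borel_measurable M" "coupled_aux \<epsilon> \<epsilon>' Fa m 0 (clip u) \<in> borel_measurable M"
        using Xa_measurable[OF clip_mem(1)] coupled_aux_measurable[OF clip_mem(1)] by auto
      show "(\<lambda>\<omega>. bdist (Xa 0 (clip u) \<omega>) (coupled_aux \<epsilon> \<epsilon>' Fa m 0 (clip u) \<omega>)) \<in> borel_measurable M" by measurable
      have [measurable]: "(\<lambda>\<omega>. rep u (past \<epsilon> 0 \<omega>)) \<in> borel_measurable M"
        "(\<lambda>\<omega>. rep u (coupled_past \<epsilon> \<epsilon>' m 0 \<omega>)) \<in> borel_measurable M"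
        using measurable_compose[OF measurable_past rep_measurable] measurable_compose[OF measurable_coupled_past rep_measurable] by auto
      show "(\<lambda>\<omega>. bdist (rep u (past \<epsilon> 0 \<omega>)) (rep u (comb_seq m (past \<epsilon> 0 \<omega>) (shift_seq m (past \<epsilon>' 0 \<omega>))))) \<in> borel_measurable M"
        unfolding coupled_past_comb[symmetric] by measurable
    qed
    also have "\<dots> = (\<integral>z. ?G (fst z, shift_seq m (snd z)) \<partial>distr M (Q.S \<Otimes>\<^sub>M Q.S) (\<lambda>\<omega>. (past \<epsilon> 0 \<omega>, past \<epsilon>' 0 \<omega>)))"
    proof (subst integral_distr)
      have "past \<epsilon>' 0 \<in> measurable M Q.S"
        unfolding measurable_Q2 past_def[abs_def] by (rule measurable_abs_UNIV) simp
      then show "(\<lambda>\<omega>. (past \<epsilon> 0 \<omega>, past \<epsilon>' 0 \<omega>)) \<in> measurable M (Q.S \<Otimes>\<^sub>M Q.S)" by simp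
    qed simp_all
    also have "\<dots> = (\<integral>z. ?G (fst z, shift_seq m (snd z)) \<partial>(Q.S \<Otimes>\<^sub>M Q.S))" by (simp add: law_two_pasts)
    also have "\<dots> = (\<integral>e. (\<integral>x. ?G (e, shift_seq m x) \<partial>Q.S) \<partial>Q.S)"
      using Q.SS.integral_fst[of "\<lambda>e x. ?G (e, shift_seq m x)"]
        Q.comb_integrable[of "\<lambda>z. ?G (fst z, shift_seq m (snd z))" 1] by (simp add: split_beta')
    also have "\<dots> = (\<integral>e. (\<integral>x. ?G (e, x) \<partial>Q.S) \<partial>Q.S)"
    proof (rule Bochner_Integration.integral_cong[OF refl])
      fix e assume e: "e \<in> space Q.S"
      have "(\<lambda>x. ?G (e, x)) \<in> borel_measurable Q.S" using measurable_compose[OF measurable_Pair1'[OF e] mG] .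
      moreover have "\<forall>x. \<bar>?G (e, x)\<bar> \<le> 1" by simp
      ultimately have "Q.bounded_measurable (\<lambda>x. ?G (e, x))" unfolding Q.bounded_measurable_def by blast
      then show "(\<integral>x. ?G (e, shift_seq m x) \<partial>Q.S) = (\<integral>x. ?G (e, x) \<partial>Q.S)" by (rule Q.integral_shift_seq)
    qed
    also have "\<dots> = rep_gap u m"
      unfolding rep_gap_def by (rule Q.iterated_integral_fst[OF mG, of 1, symmetric]) simp
    finally show ?thesis by simp
  qed
  then show ?thesis using coupled_bdist_tendsto[OF clip_mem(1)] by presburger
qed

end

context auxiliary_process
begin

section \<open>Averages of the kernel over an independent copy\<close>

text \<open>The average of \<open>h\<close> over a copy of \<open>X\<^sub>0(w)\<close>, without centering. The demeaned average differs from it by a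
constant, to which covariances and innovations are insensitive.\<close>

definition mean_kernel :: "real \<Rightarrow> real \<Rightarrow> 's \<Rightarrow> real" where
  "mean_kernel r w s = (\<integral>e. h s (rep w e) r \<partial>Q.S)"

lemma h_rep_bounded:
  assumes r: "r \<in> {0..\<Lambda>}"
  shows "Q.bounded_measurable (\<lambda>e. h s (rep w e) r)"
  using h_measurable2[OF r, of "\<lambda>_. s" Q.S "rep w"] h_abs_le[OF r] unfolding Q.bounded_measurable_def by auto

lemma mean_kernel_bounds:
  assumes r: "r \<in> {0..\<Lambda>}"
  shows "0 \<le> mean_kernel r w s" "mean_kernel r w s \<le> C\<^sub>h" "\<bar>mean_kernel r w s\<bar> \<le> C\<^sub>h"
proof -
  show 0: "0 \<le> mean_kernel r w s" unfolding mean_kernel_def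
    by (rule Bochner_Integration.integral_nonneg) (rule h_nonneg[OF r])
  have "mean_kernel r w s \<le> (\<integral>e. C\<^sub>h \<partial>Q.S)" unfolding mean_kernel_def
    by (intro integral_mono Q.bounded_measurable_integrable h_rep_bounded r Q.bounded_measurable_const h_le)
  then show "mean_kernel r w s \<le> C\<^sub>h" by (simp add: Q.P.prob_space)
  with 0 show "\<bar>mean_kernel r w s\<bar> \<le> C\<^sub>h" by simp
qed

lemma mean_kernel_bdist:
  assumes r: "r \<in> {0..\<Lambda>}"
  shows "\<bar>mean_kernel r w s - mean_kernel r w s'\<bar> \<le> L\<^sub>h * bdist s s'"
proof -
  have "mean_kernel r w s - mean_kernel r w s' = (\<integral>e. h s (rep w e) r - h s' (rep w e) r \<partial>Q.S)"
    unfolding mean_kernel_def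
    by (intro Bochner_Integration.integral_diff[symmetric] Q.bounded_measurable_integrable h_rep_bounded r)
  also have "\<bar>\<dots>\<bar> \<le> (\<integral>e. \<bar>h s (rep w e) r - h s' (rep w e) r\<bar> \<partial>Q.S)" by simp
  also have "\<dots> \<le> (\<integral>e. L\<^sub>h * bdist s s' \<partial>Q.S)"
    by (intro integral_mono Q.bounded_measurable_integrable Q.bounded_measurable_abs Q.bounded_measurable_diff
        h_rep_bounded r Q.bounded_measurable_const h_bdist)
  finally show ?thesis by (simp add: Q.P.prob_space)
qed

lemma mean_kernel_lipschitz_time:
  assumes r: "r \<in> {0..\<Lambda>}"
  shows "\<bar>mean_kernel r w s - mean_kernel r w' s\<bar> \<le> L\<^sub>h * (C\<^sub>u * \<bar>w - w'\<bar>)"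
proof -
  have "mean_kernel r w s - mean_kernel r w' s = (\<integral>e. h s (rep w e) r - h s (rep w' e) r \<partial>Q.S)"
    unfolding mean_kernel_def
    by (intro Bochner_Integration.integral_diff[symmetric] Q.bounded_measurable_integrable h_rep_bounded r)
  also have "\<bar>\<dots>\<bar> \<le> (\<integral>e. \<bar>h s (rep w e) r - h s (rep w' e) r\<bar> \<partial>Q.S)" by simp
  also have "\<dots> \<le> (\<integral>e. L\<^sub>h * bdist (rep w e) (rep w' e) \<partial>Q.S)"
    by (intro integral_mono Q.bounded_measurable_integrable Q.bounded_measurable_abs Q.bounded_measurable_diff
        h_rep_bounded r Q.bounded_measurable_mult Q.bounded_measurable_const h_bdist bdist_rep_bounded)
  also have "\<dots> \<le> L\<^sub>h * (C\<^sub>u * \<bar>w - w'\<bar>)" by (simp add: mult_left_mono L_h_nonneg rep_lipschitz')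
  finally show ?thesis .
qed

lemma mean_kernel_measurable:
  assumes r: "r \<in> {0..\<Lambda>}"
  shows "(\<lambda>p. mean_kernel r (fst p) (snd p)) \<in> borel_measurable (borel \<Otimes>\<^sub>M borel)"
proof -
  have "\<bar>mean_kernel r (fst p) (snd p) - mean_kernel r (fst q) (snd q)\<bar> \<le> (L\<^sub>h * C\<^sub>u + L\<^sub>h) * dist p q" for p q
  proof -
    have "\<bar>mean_kernel r (fst p) (snd p) - mean_kernel r (fst q) (snd p)\<bar> \<le> L\<^sub>h * (C\<^sub>u * dist p q)"
      using mean_kernel_lipschitz_time[OF r, of "fst p" "snd p" "fst q"] dist_fst_le[of p q]
      by (elim order_trans) (intro mult_left_mono L_h_nonneg C_u_nonneg, simp add: dist_real_def)
    moreover have "\<bar>mean_kernel r (fst q) (snd p) - mean_kernel r (fst q) (snd q)\<bar> \<le> L\<^sub>h * dist p q"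
      using mean_kernel_bdist[OF r, of "fst q" "snd p" "snd q"] dist_snd_le[of p q]
      by (elim order_trans) (intro mult_left_mono L_h_nonneg, simp)
    ultimately show ?thesis by (simp add: algebra_simps)
  qed
  then have "(\<lambda>p. mean_kernel r (fst p) (snd p)) \<in> borel_measurable borel" by (rule lipschitz_borel)
  then show ?thesis by (simp add: borel_prod)
qed

lemma mean_kernel_measurable2:
  assumes r: "r \<in> {0..\<Lambda>}" and [measurable]: "f \<in> borel_measurable N" "g \<in> borel_measurable N"
  shows "(\<lambda>x. mean_kernel r (f x) (g x)) \<in> borel_measurable N"
  using measurable_compose[OF measurable_Pair[OF assms(2,3)] mean_kernel_measurable[OF r]] by simp

definition cumulated_kernel :: "real \<Rightarrow> real \<Rightarrow> 's \<Rightarrow> real" where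
  "cumulated_kernel z r s = (LBINT w:{0..z}. mean_kernel r w s)"

lemma Icc_weight_measurable:
  fixes g :: "real \<Rightarrow> real"
  assumes "g \<in> borel_measurable borel"
  shows "(\<lambda>w. indicator {a..b} w *\<^sub>R g w) \<in> borel_measurable lborel"
  using borel_measurable_times[of "indicator {a..b}" lborel g] assms by simp

lemma set_integrable_bounded_Icc:
  fixes g :: "real \<Rightarrow> real"
  assumes [measurable]: "g \<in> borel_measurable borel" and C: "\<And>w. \<bar>g w\<bar> \<le> C"
  shows "set_integrable lborel {a..b} g"
  unfolding set_integrable_def
proof (rule Bochner_Integration.integrable_bound)
  show "integrable lborel (\<lambda>w. indicator {a..b} w * C)"
    by (intro integrable_mult_left integrable_real_indicator) (auto simp: emeasure_lborel_Icc_eq)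
  have "0 \<le> C" using C[of 0] by simp
  then show "AE w in lborel. norm (indicator {a..b} w *\<^sub>R g w) \<le> norm (indicator {a..b} w * C)"
    using C by (intro AE_I2) (simp add: indicator_def)
qed (rule Icc_weight_measurable[OF assms(1)])

lemma set_integral_bounded_Icc:
  fixes g :: "real \<Rightarrow> real"
  assumes [measurable]: "g \<in> borel_measurable borel" and C: "\<And>w. \<bar>g w\<bar> \<le> C" and ab: "a \<le> b"
  shows "\<bar>LBINT w:{a..b}. g w\<bar> \<le> C * (b - a)"
proof -
  have C0: "0 \<le> C" using C[of 0] by simp
  have "\<bar>LBINT w:{a..b}. g w\<bar> \<le> (\<integral>w. \<bar>indicator {a..b} w *\<^sub>R g w\<bar> \<partial>lborel)"
    unfolding set_lebesgue_integral_def by simp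
  also have "\<dots> \<le> (\<integral>w. C * indicator {a..b} w \<partial>lborel)"
  proof (rule integral_mono)
    show "integrable lborel (\<lambda>w. \<bar>indicator {a..b} w *\<^sub>R g w\<bar>)"
      using set_integrable_bounded_Icc[OF assms(1) C, of a b] unfolding set_integrable_def by (rule integrable_abs)
    show "integrable lborel (\<lambda>w. C * indicator {a..b} w)"
      by (intro integrable_mult_right integrable_real_indicator) (auto simp: emeasure_lborel_Icc_eq)
  qed (use C C0 in \<open>auto simp: indicator_def\<close>)
  finally show ?thesis using ab by simp
qed

lemma mean_kernel_measurable_time: "r \<in> {0..\<Lambda>} \<Longrightarrow> (\<lambda>w. mean_kernel r w s) \<in> borel_measurable borel"
  by (rule mean_kernel_measurable2) auto

lemma mean_kernel_set_integrable: "r \<in> {0..\<Lambda>} \<Longrightarrow> set_integrable lborel {a..b} (\<lambda>w. mean_kernel r w s)"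
  by (rule set_integrable_bounded_Icc[OF mean_kernel_measurable_time mean_kernel_bounds(3)])

lemma cumulated_kernel_abs_le:
  assumes "z \<in> {0..1}" "r \<in> {0..\<Lambda>}"
  shows "\<bar>cumulated_kernel z r s\<bar> \<le> C\<^sub>h"
proof -
  have "\<bar>cumulated_kernel z r s\<bar> \<le> C\<^sub>h * (z - 0)" unfolding cumulated_kernel_def
    using assms by (intro set_integral_bounded_Icc mean_kernel_measurable_time mean_kernel_bounds(3)) auto
  also have "\<dots> \<le> C\<^sub>h" using assms C_h_nonneg by (simp add: mult_left_le)
  finally show ?thesis .
qed

lemma cumulated_kernel_bdist:
  assumes "z \<in> {0..1}" and r: "r \<in> {0..\<Lambda>}"
  shows "\<bar>cumulated_kernel z r s - cumulated_kernel z r s'\<bar> \<le> L\<^sub>h * bdist s s'"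
proof -
  have "cumulated_kernel z r s - cumulated_kernel z r s' = (LBINT w:{0..z}. mean_kernel r w s - mean_kernel r w s')"
    unfolding cumulated_kernel_def by (intro set_integral_diff(2)[symmetric] mean_kernel_set_integrable r)
  also have "\<bar>\<dots>\<bar> \<le> (L\<^sub>h * bdist s s') * (z - 0)"
    using assms by (intro set_integral_bounded_Icc borel_measurable_diff mean_kernel_measurable_time mean_kernel_bdist) auto
  also have "\<dots> \<le> L\<^sub>h * bdist s s'" using assms L_h_nonneg by (simp add: mult_left_le)
  finally show ?thesis .
qed

lemma cumulated_kernel_lipschitz:
  assumes "z \<in> {0..1}" "z' \<in> {0..1}" and r: "r \<in> {0..\<Lambda>}"
  shows "\<bar>cumulated_kernel z r s - cumulated_kernel z' r s\<bar> \<le> C\<^sub>h * \<bar>z - z'\<bar>"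
proof -
  have *: "\<bar>cumulated_kernel b r s - cumulated_kernel a r s\<bar> \<le> C\<^sub>h * (b - a)" if ab: "0 \<le> a" "a \<le> b" for a b
  proof -
    have "cumulated_kernel b r s - cumulated_kernel a r s = (\<integral>w. indicator {0..b} w *\<^sub>R mean_kernel r w s - indicator {0..a} w *\<^sub>R mean_kernel r w s \<partial>lborel)"
      using mean_kernel_set_integrable[OF r, of 0 b s] mean_kernel_set_integrable[OF r, of 0 a s]
      unfolding cumulated_kernel_def set_lebesgue_integral_def set_integrable_def
      by (intro Bochner_Integration.integral_diff[symmetric])
    also have "\<dots> = (LBINT w:{a..b}. mean_kernel r w s)"
      unfolding set_lebesgue_integral_def
    proof (rule integral_cong_AE)
      have "AE w in lborel. w \<noteq> a" by (rule AE_lborel_singleton)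
      then show "AE w in lborel. indicator {0..b} w *\<^sub>R mean_kernel r w s - indicator {0..a} w *\<^sub>R mean_kernel r w s = indicator {a..b} w *\<^sub>R mean_kernel r w s"
        by eventually_elim (use ab in \<open>auto simp: indicator_def\<close>)
    qed (intro borel_measurable_diff Icc_weight_measurable mean_kernel_measurable_time r)+
    also have "\<bar>\<dots>\<bar> \<le> C\<^sub>h * (b - a)"
      by (intro set_integral_bounded_Icc mean_kernel_measurable_time mean_kernel_bounds(3) r ab)
    finally show ?thesis .
  qed
  show ?thesis
  proof (cases "z' \<le> z")
    case True then show ?thesis using *[of z' z] assms by simp
  next
    case False then show ?thesis using *[of z z'] assms by (simp add: abs_minus_commute)
  qed
qed

text \<open>The observable whose long-run covariance is \<open>\<sigma>\<^sub>u\<close>. The index \<open>x\<close> stands for the pair \<open>(z, \<lambda>)\<close>.\<close>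

definition obs :: "real \<Rightarrow> real \<times> real \<Rightarrow> (nat \<Rightarrow> 'g) \<Rightarrow> real" where
  "obs u x e = cumulated_kernel (fst x) (snd x) (rep u e)"

abbreviation "Idx \<equiv> {0..1::real} \<times> {0..\<Lambda>}"

lemma cumulated_kernel_measurable:
  assumes "z \<in> {0..1}" "r \<in> {0..\<Lambda>}"
  shows "cumulated_kernel z r \<in> borel_measurable borel"
proof (rule lipschitz_borel)
  show "\<bar>cumulated_kernel z r s - cumulated_kernel z r s'\<bar> \<le> L\<^sub>h * dist s s'" for s s'
    using order_trans[OF cumulated_kernel_bdist[OF assms, of s s'] mult_left_mono[OF _ L_h_nonneg, of "bdist s s'" "dist s s'"]] by simp
qed

lemma obs_abs_le: "x \<in> Idx \<Longrightarrow> \<bar>obs u x e\<bar> \<le> C\<^sub>h"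
  using cumulated_kernel_abs_le by (auto simp: obs_def)

lemma obs_bounded:
  assumes "x \<in> Idx"
  shows "Q.bounded_measurable (obs u x)"
  using obs_abs_le[OF assms] measurable_compose[OF rep_measurable cumulated_kernel_measurable[of "fst x" "snd x"]] assms
  unfolding Q.bounded_measurable_def obs_def[abs_def] by (auto simp: mem_Times_iff)

lemma obs_gap:
  assumes x: "x \<in> Idx"
  shows "Q.coupling_gap k (obs u x) \<le> L\<^sub>h * rep_gap u k"
proof -
  have "Q.coupling_gap k (obs u x) \<le> (\<integral>z. L\<^sub>h * bdist (rep u (fst z)) (rep u (comb_seq k (fst z) (snd z))) \<partial>(Q.S \<Otimes>\<^sub>M Q.S))"
    unfolding Q.coupling_gap_def
  proof (rule integral_mono)
    show "integrable (Q.S \<Otimes>\<^sub>M Q.S) (\<lambda>z. \<bar>obs u x (comb_seq k (fst z) (snd z)) - obs u x (fst z)\<bar>)"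
      by (rule Q.coupling_gap_integrable[OF obs_bounded[OF x]])
    show "integrable (Q.S \<Otimes>\<^sub>M Q.S) (\<lambda>z. L\<^sub>h * bdist (rep u (fst z)) (rep u (comb_seq k (fst z) (snd z))))"
      by (intro integrable_mult_right Q.comb_integrable[where C=1]) auto
    show "\<bar>obs u x (comb_seq k (fst z) (snd z)) - obs u x (fst z)\<bar> \<le> L\<^sub>h * bdist (rep u (fst z)) (rep u (comb_seq k (fst z) (snd z)))" for z
      using cumulated_kernel_bdist[of "fst x" "snd x" "rep u (fst z)" "rep u (comb_seq k (fst z) (snd z))"] x
      by (auto simp: obs_def abs_minus_commute)
  qed
  then show ?thesis by (simp add: rep_gap_def)
qed

lemma coupling_gap_nonneg: "0 \<le> Q.coupling_gap k f"
  unfolding Q.coupling_gap_def by (rule Bochner_Integration.integral_nonneg) simp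

lemma obs_gap_tendsto:
  assumes x: "x \<in> Idx"
  shows "(\<lambda>k. Q.coupling_gap k (obs u x)) \<longlonglongrightarrow> 0"
proof (rule Lim_null_comparison)
  show "\<forall>\<^sub>F k in sequentially. norm (Q.coupling_gap k (obs u x)) \<le> L\<^sub>h * rep_gap u k"
    using obs_gap[OF x] coupling_gap_nonneg by (intro always_eventually) simp
  show "(\<lambda>k. L\<^sub>h * rep_gap u k) \<longlonglongrightarrow> 0" by (rule tendsto_mult_right_zero[OF rep_gap_tendsto])
qed

section \<open>Summability of the innovations\<close>

definition nu_total :: real where
  "nu_total = enn2real (SUP u\<in>{0..1}. SUP v\<in>{0..1}. SUP r\<in>{0..\<Lambda>}. SUP k. \<Sum>j. SUP t.
            nu_aux M E \<epsilon> \<epsilon>' Fa h t k u v j r)"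

lemma nu_total_nonneg: "0 \<le> nu_total"
  by (simp add: nu_total_def)

definition coupled_product :: "nat \<Rightarrow> nat \<Rightarrow> real \<Rightarrow> real \<Rightarrow> real \<Rightarrow> 'w \<Rightarrow> real" where
  "coupled_product m k u v r = demeaned M h (coupled_aux \<epsilon> \<epsilon>' Fa m 0 u) (coupled_aux \<epsilon> \<epsilon>' Fa m (0 - int k) v) r"

lemma nu_partial_sum_le:
  assumes u: "u \<in> {0..1}" and v: "v \<in> {0..1}" and r: "r \<in> {0..\<Lambda>}" and m: "1 \<le> m"
  shows "(\<Sum>j<J. Lp_norm M 2 (projection M E \<epsilon> (0 - int j) (coupled_product m k u v r))) \<le> nu_total"
proof -
  let ?a = "\<lambda>j. Lp_norm M 2 (projection M E \<epsilon> (0 - int j) (coupled_product m k u v r))"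
  let ?T = "SUP u\<in>{0..1}. SUP v\<in>{0..1}. SUP r\<in>{0..\<Lambda>}. SUP k. \<Sum>j. SUP t. nu_aux M E \<epsilon> \<epsilon>' Fa h t k u v j r"
  have a0: "0 \<le> ?a j" for j by (simp add: Lp_norm_def)
  have "ennreal (\<Sum>j<J. ?a j) = (\<Sum>j<J. ennreal (?a j))" using a0 by simp
  also have "\<dots> \<le> (\<Sum>j<J. SUP t. nu_aux M E \<epsilon> \<epsilon>' Fa h t k u v j r)"
  proof (rule sum_mono)
    fix j
    have "ennreal (?a j) \<le> nu_aux M E \<epsilon> \<epsilon>' Fa h 0 k u v j r"
      unfolding nu_aux_def coupled_product_def by (rule SUP_upper2[of m]) (use m in auto)
    also have "\<dots> \<le> (SUP t. nu_aux M E \<epsilon> \<epsilon>' Fa h t k u v j r)" by (rule SUP_upper) simp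
    finally show "ennreal (?a j) \<le> (SUP t. nu_aux M E \<epsilon> \<epsilon>' Fa h t k u v j r)" .
  qed
  also have "\<dots> \<le> (\<Sum>j. SUP t. nu_aux M E \<epsilon> \<epsilon>' Fa h t k u v j r)" by (rule sum_le_suminf) auto
  also have "\<dots> \<le> ?T"
    by (rule SUP_upper2[OF u], rule SUP_upper2[OF v], rule SUP_upper2[OF r], rule SUP_upper2[of k]) auto
  finally have "ennreal (\<Sum>j<J. ?a j) \<le> ?T" .
  then have "enn2real (ennreal (\<Sum>j<J. ?a j)) \<le> nu_total"
    unfolding nu_total_def by (intro enn2real_mono) (use nu_summable in simp_all)
  moreover have "0 \<le> (\<Sum>j<J. ?a j)" by (intro sum_nonneg a0)
  ultimately show ?thesis by simp
qed

text \<open>The coupled variables converge to the original ones in the mean truncated distance, for which \<open>h\<close> is Lipschitz. The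
centering disappears because innovations have mean zero.\<close>

lemma coupled_product_limit:
  assumes u: "u \<in> {0..1}" and v: "v \<in> {0..1}" and r: "r \<in> {0..\<Lambda>}" and f: "Q.bounded_measurable f"
  shows "(\<lambda>m. \<integral>\<omega>. Q.innovation_part j f (past \<epsilon> (0 - int j) \<omega>) * coupled_product m k u v r \<omega> \<partial>M)
     \<longlonglongrightarrow> (\<integral>e. Q.innovation_part j f (shift_seq j e) * h (rep u e) (rep v (shift_seq k e)) r \<partial>Q.S)"
proof -
  define t where "t = 0 - int k"
  define V where "V \<omega> = Q.innovation_part j f (past \<epsilon> (0 - int j) \<omega>)" for \<omega>
  define X where "X m = coupled_aux \<epsilon> \<epsilon>' Fa m 0 u" for m
  define X' where "X' m = coupled_aux \<epsilon> \<epsilon>' Fa m t v" for m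
  have bV: "Q.bounded_measurable (Q.innovation_part j f)" by (rule Q.bounded_measurable_innovation[OF f])
  obtain D where D: "0 \<le> D" "\<And>x. \<bar>Q.innovation_part j f x\<bar> \<le> D" using Q.bounded_measurableE[OF bV] by metis
  have VD: "\<bar>V \<omega>\<bar> \<le> D" for \<omega> using D by (simp add: V_def)
  have Vm[measurable]: "V \<in> borel_measurable M"
    unfolding V_def[abs_def] by (rule measurable_compose[OF measurable_past Q.bounded_measurable_measurable[OF bV]])
  have [measurable]: "X m \<in> borel_measurable M" "X' m \<in> borel_measurable M" "Xa 0 u \<in> borel_measurable M"
    "Xa t v \<in> borel_measurable M" for m
    unfolding X_def X'_def using coupled_aux_measurable u v Xa_measurable by auto
  note hm = h_measurable2[OF r]
  have V0: "(\<integral>\<omega>. V \<omega> \<partial>M) = 0"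
  proof -
    have "(\<integral>\<omega>. V \<omega> \<partial>M) = (\<integral>x. Q.innovation_part j f x \<partial>Q.S)"
      unfolding V_def by (rule integral_past[OF Q.bounded_measurable_measurable[OF bV]])
    also have "\<dots> = 0" using Q.innovation_orthogonal[OF f Q.bounded_measurable_const[of 1], of j] by simp
    finally show ?thesis .
  qed
  have Vint: "integrable M V" by (rule integrable_bounded[OF Vm VD])
  have Vh: "integrable M (\<lambda>\<omega>. V \<omega> * h (Y \<omega>) (Z \<omega>) r)" if "Y \<in> borel_measurable M" "Z \<in> borel_measurable M" for Y Z
  proof (rule integrable_bounded)
    show "(\<lambda>\<omega>. V \<omega> * h (Y \<omega>) (Z \<omega>) r) \<in> borel_measurable M" using hm[OF that] by measurable
    show "\<bar>V \<omega> * h (Y \<omega>) (Z \<omega>) r\<bar> \<le> D * C\<^sub>h" for \<omega>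
      unfolding abs_mult using VD h_abs_le[OF r] D(1) by (intro mult_mono) auto
  qed
  have dem: "(\<integral>\<omega>. V \<omega> * coupled_product m k u v r \<omega> \<partial>M) = (\<integral>\<omega>. V \<omega> * h (X m \<omega>) (X' m \<omega>) r \<partial>M)" for m
  proof -
    define c where "c = (\<integral>\<omega>. h (X m \<omega>) (X' m \<omega>) r \<partial>M)"
    have "(\<integral>\<omega>. V \<omega> * coupled_product m k u v r \<omega> \<partial>M) = (\<integral>\<omega>. V \<omega> * h (X m \<omega>) (X' m \<omega>) r - c * V \<omega> \<partial>M)"
      unfolding coupled_product_def demeaned_def t_def[symmetric] X_def[symmetric] X'_def[symmetric] c_def by (simp add: algebra_simps)
    also have "\<dots> = (\<integral>\<omega>. V \<omega> * h (X m \<omega>) (X' m \<omega>) r \<partial>M) - (\<integral>\<omega>. c * V \<omega> \<partial>M)"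
      using Vh[of "X m" "X' m"] Vint by (intro Bochner_Integration.integral_diff) auto
    finally show ?thesis by (simp add: V0)
  qed
  have "(\<lambda>m. (\<integral>\<omega>. V \<omega> * h (X m \<omega>) (X' m \<omega>) r \<partial>M) - (\<integral>\<omega>. V \<omega> * h (Xa 0 u \<omega>) (Xa t v \<omega>) r \<partial>M)) \<longlonglongrightarrow> 0"
  proof (rule Lim_null_comparison[OF always_eventually[OF allI]])
    fix m
    let ?b = "\<lambda>\<omega>. bdist (Xa 0 u \<omega>) (X m \<omega>)" and ?b' = "\<lambda>\<omega>. bdist (Xa t v \<omega>) (X' m \<omega>)"
    have bint: "integrable M ?b" "integrable M ?b'" by (rule integrable_bounded[where C=1]; simp)+
    have "(\<integral>\<omega>. V \<omega> * h (X m \<omega>) (X' m \<omega>) r \<partial>M) - (\<integral>\<omega>. V \<omega> * h (Xa 0 u \<omega>) (Xa t v \<omega>) r \<partial>M)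
       = (\<integral>\<omega>. V \<omega> * h (X m \<omega>) (X' m \<omega>) r - V \<omega> * h (Xa 0 u \<omega>) (Xa t v \<omega>) r \<partial>M)"
      by (intro Bochner_Integration.integral_diff[symmetric] Vh) simp_all
    also have "norm \<dots> \<le> (\<integral>\<omega>. norm (V \<omega> * h (X m \<omega>) (X' m \<omega>) r - V \<omega> * h (Xa 0 u \<omega>) (Xa t v \<omega>) r) \<partial>M)"
      by (rule integral_norm_bound)
    also have "\<dots> \<le> (\<integral>\<omega>. (D * L\<^sub>h) * (?b \<omega> + ?b' \<omega>) \<partial>M)"
    proof (rule integral_mono)
      show "integrable M (\<lambda>\<omega>. norm (V \<omega> * h (X m \<omega>) (X' m \<omega>) r - V \<omega> * h (Xa 0 u \<omega>) (Xa t v \<omega>) r))"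
        by (intro integrable_norm Bochner_Integration.integrable_diff Vh) simp_all
      show "integrable M (\<lambda>\<omega>. (D * L\<^sub>h) * (?b \<omega> + ?b' \<omega>))"
        by (intro integrable_mult_right Bochner_Integration.integrable_add bint)
      fix \<omega>
      have "norm (V \<omega> * h (X m \<omega>) (X' m \<omega>) r - V \<omega> * h (Xa 0 u \<omega>) (Xa t v \<omega>) r)
         = \<bar>V \<omega>\<bar> * \<bar>h (Xa 0 u \<omega>) (Xa t v \<omega>) r - h (X m \<omega>) (X' m \<omega>) r\<bar>"
        by (simp add: abs_mult[symmetric] right_diff_distrib abs_minus_commute)
      also have "\<dots> \<le> D * (L\<^sub>h * (?b \<omega> + ?b' \<omega>))"
        by (intro mult_mono VD h_bdist2[OF r] D(1)) simp
      finally show "norm (V \<omega> * h (X m \<omega>) (X' m \<omega>) r - V \<omega> * h (Xa 0 u \<omega>) (Xa t v \<omega>) r) \<le> (D * L\<^sub>h) * (?b \<omega> + ?b' \<omega>)"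
        by (simp add: mult.assoc)
    qed
    also have "\<dots> = (D * L\<^sub>h) * ((\<integral>\<omega>. ?b \<omega> \<partial>M) + (\<integral>\<omega>. ?b' \<omega> \<partial>M))" using bint by simp
    finally show "norm ((\<integral>\<omega>. V \<omega> * h (X m \<omega>) (X' m \<omega>) r \<partial>M) - (\<integral>\<omega>. V \<omega> * h (Xa 0 u \<omega>) (Xa t v \<omega>) r \<partial>M))
       \<le> (D * L\<^sub>h) * ((\<integral>\<omega>. ?b \<omega> \<partial>M) + (\<integral>\<omega>. ?b' \<omega> \<partial>M))" .
  next
    have "(\<lambda>m. (\<integral>\<omega>. bdist (Xa 0 u \<omega>) (X m \<omega>) \<partial>M) + (\<integral>\<omega>. bdist (Xa t v \<omega>) (X' m \<omega>) \<partial>M)) \<longlonglongrightarrow> 0 + 0"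
      unfolding X_def X'_def by (intro tendsto_add coupled_bdist_tendsto u v)
    then show "(\<lambda>m. (D * L\<^sub>h) * ((\<integral>\<omega>. bdist (Xa 0 u \<omega>) (X m \<omega>) \<partial>M) + (\<integral>\<omega>. bdist (Xa t v \<omega>) (X' m \<omega>) \<partial>M))) \<longlonglongrightarrow> 0"
      by (intro tendsto_mult_right_zero) simp
  qed
  then have "(\<lambda>m. \<integral>\<omega>. V \<omega> * h (X m \<omega>) (X' m \<omega>) r \<partial>M) \<longlonglongrightarrow> (\<integral>\<omega>. V \<omega> * h (Xa 0 u \<omega>) (Xa t v \<omega>) r \<partial>M)"
    by (simp add: LIM_zero_iff)
  also have "(\<integral>\<omega>. V \<omega> * h (Xa 0 u \<omega>) (Xa t v \<omega>) r \<partial>M)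
     = (\<integral>\<omega>. Q.innovation_part j f (shift_seq j (past \<epsilon> 0 \<omega>)) * h (rep u (past \<epsilon> 0 \<omega>)) (rep v (shift_seq k (past \<epsilon> 0 \<omega>))) r \<partial>M)"
  proof (rule integral_cong_AE)
    show "AE \<omega> in M. V \<omega> * h (Xa 0 u \<omega>) (Xa t v \<omega>) r
       = Q.innovation_part j f (shift_seq j (past \<epsilon> 0 \<omega>)) * h (rep u (past \<epsilon> 0 \<omega>)) (rep v (shift_seq k (past \<epsilon> 0 \<omega>))) r"
      using representation[OF u, of 0] representation[OF v, of t]
      by eventually_elim (simp only: V_def t_def past_shift rep_def clip_eq[OF u] clip_eq[OF v])
    show "(\<lambda>\<omega>. V \<omega> * h (Xa 0 u \<omega>) (Xa t v \<omega>) r) \<in> borel_measurable M"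
      using hm[of "Xa 0 u" M "Xa t v"] by measurable
    have m1: "(\<lambda>\<omega>. rep u (past \<epsilon> 0 \<omega>)) \<in> borel_measurable M" "(\<lambda>\<omega>. rep v (shift_seq k (past \<epsilon> 0 \<omega>))) \<in> borel_measurable M"
      using measurable_compose[OF measurable_past rep_measurable]
        measurable_compose[OF measurable_compose[OF measurable_past Q.measurable_shift_seq] rep_measurable] by auto
    have "(\<lambda>\<omega>. Q.innovation_part j f (shift_seq j (past \<epsilon> 0 \<omega>))) \<in> borel_measurable M"
      using Vm by (simp only: V_def[abs_def] past_shift)
    then show "(\<lambda>\<omega>. Q.innovation_part j f (shift_seq j (past \<epsilon> 0 \<omega>)) * h (rep u (past \<epsilon> 0 \<omega>)) (rep v (shift_seq k (past \<epsilon> 0 \<omega>))) r) \<in> borel_measurable M"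
      using hm[OF m1] by (rule borel_measurable_times)
  qed
  also have "\<dots> = (\<integral>e. Q.innovation_part j f (shift_seq j e) * h (rep u e) (rep v (shift_seq k e)) r \<partial>Q.S)"
  proof (rule integral_past)
    have "(\<lambda>e. h (rep u e) (rep v (shift_seq k e)) r) \<in> borel_measurable Q.S"
      by (rule hm[OF rep_measurable measurable_compose[OF Q.measurable_shift_seq rep_measurable]])
    with Q.bounded_measurable_measurable[OF Q.bounded_measurable_shift[OF bV]]
    show "(\<lambda>e. Q.innovation_part j f (shift_seq j e) * h (rep u e) (rep v (shift_seq k e)) r) \<in> borel_measurable Q.S"
      by (rule borel_measurable_times)
  qed
  finally show ?thesis unfolding dem V_def[symmetric] .
qed

text \<open>Split the past into its \<open>k\<close> latest innovations and the remote rest. The variable lagged by \<open>k\<close> depends on the rest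
only, whereas \<open>g\<close> and the variable without lag hardly change when the rest is replaced by an independent one.
After this replacement, the two arguments of \<open>h\<close> are independent.\<close>

lemma lagged_product_limit:
  assumes r: "r \<in> {0..\<Lambda>}" and g: "Q.bounded_measurable g" and gap: "(\<lambda>k. Q.coupling_gap k g) \<longlonglongrightarrow> 0"
  shows "(\<lambda>k. \<integral>e. g e * h (rep u e) (rep v (shift_seq k e)) r \<partial>Q.S) \<longlonglongrightarrow> (\<integral>e. g e * mean_kernel r v (rep u e) \<partial>Q.S)"
proof -
  note hm = h_measurable2[OF r]
  have [measurable]: "g \<in> borel_measurable Q.S" by (rule Q.bounded_measurable_measurable[OF g])
  obtain D where D: "0 \<le> D" "\<And>x. \<bar>g x\<bar> \<le> D" using Q.bounded_measurableE[OF g] by metis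
  define G where "G k z = g (comb_seq k (fst z) (snd z)) * h (rep u (comb_seq k (fst z) (snd z))) (rep v (snd z)) r" for k and z :: "(nat \<Rightarrow> 'g) \<times> (nat \<Rightarrow> 'g)"
  define G' where "G' z = g (fst z) * h (rep u (fst z)) (rep v (snd z)) r" for z :: "(nat \<Rightarrow> 'g) \<times> (nat \<Rightarrow> 'g)"
  have hb: "\<bar>a * h x y r\<bar> \<le> D * C\<^sub>h" if "\<bar>a\<bar> \<le> D" for a x y
    unfolding abs_mult using that h_abs_le[OF r] D(1) by (intro mult_mono) auto
  have Gm: "G k \<in> borel_measurable (Q.S \<Otimes>\<^sub>M Q.S)" for k
  proof -
    have "(\<lambda>z. h (rep u (comb_seq k (fst z) (snd z))) (rep v (snd z)) r) \<in> borel_measurable (Q.S \<Otimes>\<^sub>M Q.S)" by (rule hm) measurable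
    then show ?thesis unfolding G_def[abs_def] by measurable
  qed
  have G'm: "G' \<in> borel_measurable (Q.S \<Otimes>\<^sub>M Q.S)"
  proof -
    have "(\<lambda>z. h (rep u (fst z)) (rep v (snd z)) r) \<in> borel_measurable (Q.S \<Otimes>\<^sub>M Q.S)" by (rule hm) measurable
    then show ?thesis unfolding G'_def[abs_def] by measurable
  qed
  have Gi: "integrable (Q.S \<Otimes>\<^sub>M Q.S) (G k)" for k
    by (rule Q.comb_integrable[OF Gm]) (unfold G_def, rule hb[OF D(2)])
  have G'i: "integrable (Q.S \<Otimes>\<^sub>M Q.S) G'"
    by (rule Q.comb_integrable[OF G'm]) (unfold G'_def, rule hb[OF D(2)])
  have lhs: "(\<integral>e. g e * h (rep u e) (rep v (shift_seq k e)) r \<partial>Q.S) = (\<integral>z. G k z \<partial>(Q.S \<Otimes>\<^sub>M Q.S))" for k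
  proof -
    have "(\<lambda>e. h (rep u e) (rep v (shift_seq k e)) r) \<in> borel_measurable Q.S"
      by (rule hm[OF rep_measurable measurable_compose[OF Q.measurable_shift_seq rep_measurable]])
    then have "(\<lambda>e. g e * h (rep u e) (rep v (shift_seq k e)) r) \<in> borel_measurable Q.S" by measurable
    from Q.integral_comb_seq[OF this, of k] show ?thesis by (simp add: G_def shift_comb_seq)
  qed
  have rhs: "(\<integral>e. g e * mean_kernel r v (rep u e) \<partial>Q.S) = (\<integral>z. G' z \<partial>(Q.S \<Otimes>\<^sub>M Q.S))"
  proof -
    have "(\<integral>z. G' z \<partial>(Q.S \<Otimes>\<^sub>M Q.S)) = (\<integral>e. (\<integral>x. G' (e, x) \<partial>Q.S) \<partial>Q.S)"
      by (rule Q.iterated_integral_fst[OF G'm]) (unfold G'_def, rule hb[OF D(2)])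
    then show ?thesis by (simp add: G'_def mean_kernel_def)
  qed
  have "(\<lambda>k. (\<integral>z. G k z \<partial>(Q.S \<Otimes>\<^sub>M Q.S)) - (\<integral>z. G' z \<partial>(Q.S \<Otimes>\<^sub>M Q.S))) \<longlonglongrightarrow> 0"
  proof (rule Lim_null_comparison[OF always_eventually[OF allI]])
    fix k
    let ?a = "\<lambda>z. \<bar>g (comb_seq k (fst z) (snd z)) - g (fst z)\<bar>"
    let ?b = "\<lambda>z. bdist (rep u (fst z)) (rep u (comb_seq k (fst z) (snd z)))"
    have ai: "integrable (Q.S \<Otimes>\<^sub>M Q.S) ?a" by (rule Q.coupling_gap_integrable[OF g])
    have bi: "integrable (Q.S \<Otimes>\<^sub>M Q.S) ?b" by (rule Q.comb_integrable[where C=1]) auto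
    have "(\<integral>z. G k z \<partial>(Q.S \<Otimes>\<^sub>M Q.S)) - (\<integral>z. G' z \<partial>(Q.S \<Otimes>\<^sub>M Q.S)) = (\<integral>z. G k z - G' z \<partial>(Q.S \<Otimes>\<^sub>M Q.S))"
      by (rule Bochner_Integration.integral_diff[symmetric, OF Gi G'i])
    also have "norm \<dots> \<le> (\<integral>z. norm (G k z - G' z) \<partial>(Q.S \<Otimes>\<^sub>M Q.S))" by (rule integral_norm_bound)
    also have "\<dots> \<le> (\<integral>z. C\<^sub>h * ?a z + (D * L\<^sub>h) * ?b z \<partial>(Q.S \<Otimes>\<^sub>M Q.S))"
    proof (rule integral_mono)
      show "integrable (Q.S \<Otimes>\<^sub>M Q.S) (\<lambda>z. norm (G k z - G' z))" by (intro integrable_norm Bochner_Integration.integrable_diff Gi G'i)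
      show "integrable (Q.S \<Otimes>\<^sub>M Q.S) (\<lambda>z. C\<^sub>h * ?a z + (D * L\<^sub>h) * ?b z)"
        by (intro Bochner_Integration.integrable_add integrable_mult_right ai bi)
      fix z :: "(nat \<Rightarrow> 'g) \<times> (nat \<Rightarrow> 'g)"
      let ?c = "comb_seq k (fst z) (snd z)"
      have "G k z - G' z = (g ?c - g (fst z)) * h (rep u ?c) (rep v (snd z)) r
          + g (fst z) * (h (rep u ?c) (rep v (snd z)) r - h (rep u (fst z)) (rep v (snd z)) r)"
        by (simp add: G_def G'_def algebra_simps)
      then have "norm (G k z - G' z) \<le> \<bar>g ?c - g (fst z)\<bar> * \<bar>h (rep u ?c) (rep v (snd z)) r\<bar>
          + \<bar>g (fst z)\<bar> * \<bar>h (rep u ?c) (rep v (snd z)) r - h (rep u (fst z)) (rep v (snd z)) r\<bar>"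
        by (simp only: real_norm_def abs_mult[symmetric] abs_triangle_ineq)
      also have "\<dots> \<le> \<bar>g ?c - g (fst z)\<bar> * C\<^sub>h + D * (L\<^sub>h * ?b z)"
      proof (intro add_mono mult_mono)
        show "\<bar>h (rep u ?c) (rep v (snd z)) r - h (rep u (fst z)) (rep v (snd z)) r\<bar> \<le> L\<^sub>h * ?b z"
          using h_bdist(1)[OF r, of "rep u (fst z)" "rep v (snd z)" "rep u ?c"] by (simp add: abs_minus_commute)
      qed (use h_abs_le[OF r] D in auto)
      finally show "norm (G k z - G' z) \<le> C\<^sub>h * ?a z + (D * L\<^sub>h) * ?b z" by (simp add: ac_simps)
    qed
    also have "\<dots> = C\<^sub>h * Q.coupling_gap k g + (D * L\<^sub>h) * rep_gap u k"
      using ai bi by (simp add: Q.coupling_gap_def rep_gap_def)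
    finally show "norm ((\<integral>z. G k z \<partial>(Q.S \<Otimes>\<^sub>M Q.S)) - (\<integral>z. G' z \<partial>(Q.S \<Otimes>\<^sub>M Q.S))) \<le> C\<^sub>h * Q.coupling_gap k g + (D * L\<^sub>h) * rep_gap u k" .
  next
    have "(\<lambda>k. C\<^sub>h * Q.coupling_gap k g + (D * L\<^sub>h) * rep_gap u k) \<longlonglongrightarrow> C\<^sub>h * 0 + (D * L\<^sub>h) * 0"
      by (intro tendsto_intros gap rep_gap_tendsto)
    then show "(\<lambda>k. C\<^sub>h * Q.coupling_gap k g + (D * L\<^sub>h) * rep_gap u k) \<longlonglongrightarrow> 0" by simp
  qed
  then show ?thesis unfolding lhs rhs by (simp add: LIM_zero_iff)
qed

end

lemma integral_Icc_swap:
  fixes G :: "'n \<times> real \<Rightarrow> real"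
  assumes "prob_space N" and G: "G \<in> borel_measurable (N \<Otimes>\<^sub>M borel)" and C: "\<And>z. \<bar>G z\<bar> \<le> C"
  shows "(\<integral>e. (LBINT w:{a..b}. G (e, w)) \<partial>N) = (LBINT w:{a..b}. (\<integral>e. G (e, w) \<partial>N))"
proof -
  interpret N: prob_space N by fact
  interpret P: pair_sigma_finite N lborel ..
  let ?f = "\<lambda>e w. indicator {a..b} w * G (e, w)"
  have G'[measurable]: "G \<in> borel_measurable (N \<Otimes>\<^sub>M lborel)" using G by (simp cong: measurable_cong_sets)
  have "integrable (N \<Otimes>\<^sub>M lborel) (case_prod ?f)"
  proof (rule Bochner_Integration.integrable_bound)
    have "emeasure (N \<Otimes>\<^sub>M lborel) (space N \<times> {a..b}) < \<infinity>"
      by (simp add: lborel.emeasure_pair_measure_Times N.emeasure_space_1 emeasure_lborel_Icc_eq)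
    then show "integrable (N \<Otimes>\<^sub>M lborel) (\<lambda>z. indicator (space N \<times> {a..b}) z * C)"
      by (intro integrable_mult_left integrable_real_indicator) auto
    show "case_prod ?f \<in> borel_measurable (N \<Otimes>\<^sub>M lborel)" by measurable
    show "AE z in N \<Otimes>\<^sub>M lborel. norm (case_prod ?f z) \<le> norm (indicator (space N \<times> {a..b}) z * C)"
    proof (rule AE_I2)
      fix z :: "'n \<times> real" assume z: "z \<in> space (N \<Otimes>\<^sub>M lborel)"
      then have "fst z \<in> space N" by (simp add: space_pair_measure mem_Times_iff)
      then have "norm (case_prod ?f z) = indicator (space N \<times> {a..b}) z * \<bar>G z\<bar>"
        by (cases z) (auto simp: abs_mult indicator_def)
      also have "\<dots> \<le> norm (indicator (space N \<times> {a..b}) z * C)"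
        using C[of z] by (auto simp: indicator_def)
      finally show "norm (case_prod ?f z) \<le> norm (indicator (space N \<times> {a..b}) z * C)" .
    qed
  qed
  from P.Fubini_integral[OF this] show ?thesis
    by (simp add: set_lebesgue_integral_def)
qed

context auxiliary_process
begin

lemma coupled_product_bounded:
  assumes u: "u \<in> {0..1}" and v: "v \<in> {0..1}" and r: "r \<in> {0..\<Lambda>}"
  shows "coupled_product m k u v r \<in> borel_measurable M" "\<bar>coupled_product m k u v r \<omega>\<bar> \<le> 2 * C\<^sub>h"
proof -
  let ?H = "\<lambda>\<omega>. h (coupled_aux \<epsilon> \<epsilon>' Fa m 0 u \<omega>) (coupled_aux \<epsilon> \<epsilon>' Fa m (0 - int k) v \<omega>) r"
  have m: "?H \<in> borel_measurable M" by (intro h_measurable2 r coupled_aux_measurable u v)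
  then show "coupled_product m k u v r \<in> borel_measurable M"
    unfolding coupled_product_def demeaned_def[abs_def] by (intro borel_measurable_diff borel_measurable_const)
  have "\<bar>\<integral>\<omega>. ?H \<omega> \<partial>M\<bar> \<le> (\<integral>\<omega>. \<bar>?H \<omega>\<bar> \<partial>M)" by simp
  also have "\<dots> \<le> (\<integral>\<omega>. C\<^sub>h \<partial>M)"
    by (intro integral_mono integrable_abs integrable_bounded[OF m h_abs_le[OF r]] h_abs_le r) simp_all
  finally have "\<bar>\<integral>\<omega>. ?H \<omega> \<partial>M\<bar> \<le> C\<^sub>h" by (simp add: prob_space)
  then show "\<bar>coupled_product m k u v r \<omega>\<bar> \<le> 2 * C\<^sub>h"
    using h_abs_le[OF r, of "coupled_aux \<epsilon> \<epsilon>' Fa m 0 u \<omega>" "coupled_aux \<epsilon> \<epsilon>' Fa m (0 - int k) v \<omega>"]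
    unfolding coupled_product_def demeaned_def by (simp only: abs_le_iff) linarith
qed

definition innovation_sd :: "real \<Rightarrow> real \<times> real \<Rightarrow> nat \<Rightarrow> real" where
  "innovation_sd u x j = sqrt (Q.innovation_cov j (obs u x) j (obs u x))"

lemma innovation_cov_nonneg: "0 \<le> Q.innovation_cov j f j f"
  unfolding Q.innovation_cov_def by (rule Bochner_Integration.integral_nonneg) simp

lemma innovation_sd_nonneg: "0 \<le> innovation_sd u x j"
  by (simp add: innovation_sd_def innovation_cov_nonneg)

lemma innovation_sd_sq: "(innovation_sd u x j)\<^sup>2 = Q.innovation_cov j (obs u x) j (obs u x)"
  by (simp add: innovation_sd_def innovation_cov_nonneg)

text \<open>By \<open>integral_innovation_le_projection\<close>, the inner product of the \<open>j\<close>-th innovation with a coupled product, divided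
by \<open>innovation_sd u x j\<close>, is at most the \<open>j\<close>-th term of the summability condition. The limits \<open>m \<longlonglongrightarrow> \<infinity>\<close>
(coupling) and \<open>k \<longlonglongrightarrow> \<infinity>\<close> (lag) are taken for a fixed number \<open>J\<close> of terms.\<close>

lemma innovation_mean_kernel_sum_le:
  assumes u: "u \<in> {0..1}" and v: "v \<in> {0..1}" and r: "r \<in> {0..\<Lambda>}" and x: "x \<in> Idx"
  shows "(\<Sum>j<J. (\<integral>e. Q.innovation_part j (obs u x) (shift_seq j e) * mean_kernel r v (rep u e) \<partial>Q.S) / innovation_sd u x j) \<le> nu_total"
proof -
  let ?f = "obs u x"
  let ?I = "\<lambda>j e. Q.innovation_part j ?f (shift_seq j e)"
  have f: "Q.bounded_measurable ?f" by (rule obs_bounded[OF x])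
  have step: "(\<Sum>j<J. (\<integral>e. ?I j e * h (rep u e) (rep v (shift_seq k e)) r \<partial>Q.S) / innovation_sd u x j) \<le> nu_total" for k
  proof (rule LIMSEQ_le_const2)
    show "(\<lambda>m. \<Sum>j<J. (\<integral>\<omega>. Q.innovation_part j ?f (past \<epsilon> (0 - int j) \<omega>) * coupled_product m k u v r \<omega> \<partial>M) / innovation_sd u x j)
      \<longlonglongrightarrow> (\<Sum>j<J. (\<integral>e. ?I j e * h (rep u e) (rep v (shift_seq k e)) r \<partial>Q.S) / innovation_sd u x j)"
      unfolding divide_inverse by (intro tendsto_sum tendsto_mult_right coupled_product_limit u v r f)
    have "(\<Sum>j<J. (\<integral>\<omega>. Q.innovation_part j ?f (past \<epsilon> (0 - int j) \<omega>) * coupled_product m k u v r \<omega> \<partial>M) / innovation_sd u x j) \<le> nu_total"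
      if m: "1 \<le> m" for m
    proof -
      have "(\<Sum>j<J. (\<integral>\<omega>. Q.innovation_part j ?f (past \<epsilon> (0 - int j) \<omega>) * coupled_product m k u v r \<omega> \<partial>M) / innovation_sd u x j)
        \<le> (\<Sum>j<J. Lp_norm M 2 (projection M E \<epsilon> (0 - int j) (coupled_product m k u v r)))"
      proof (rule sum_mono)
        fix j
        let ?a = "\<integral>\<omega>. Q.innovation_part j ?f (past \<epsilon> (0 - int j) \<omega>) * coupled_product m k u v r \<omega> \<partial>M"
        let ?n = "Lp_norm M 2 (projection M E \<epsilon> (0 - int j) (coupled_product m k u v r))"
        have a: "\<bar>?a\<bar> \<le> innovation_sd u x j * ?n"
          unfolding innovation_sd_def
          by (rule integral_innovation_le_projection[OF f coupled_product_bounded[OF u v r]])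
        have n: "0 \<le> ?n" by (simp add: Lp_norm_def)
        show "?a / innovation_sd u x j \<le> ?n"
        proof (cases "innovation_sd u x j = 0")
          case True then show ?thesis using n by simp
        next
          case False
          then have "0 < innovation_sd u x j" using innovation_sd_nonneg[of u x j] by linarith
          then have "?a / innovation_sd u x j \<le> ?n \<longleftrightarrow> ?a \<le> innovation_sd u x j * ?n"
            by (simp add: pos_divide_le_eq mult.commute)
          then show ?thesis using a by linarith
        qed
      qed
      also have "\<dots> \<le> nu_total" by (rule nu_partial_sum_le[OF u v r m])
      finally show ?thesis .
    qed
    then show "\<exists>N. \<forall>n\<ge>N. (\<Sum>j<J. (\<integral>\<omega>. Q.innovation_part j ?f (past \<epsilon> (0 - int j) \<omega>) * coupled_product n k u v r \<omega> \<partial>M) / innovation_sd u x j) \<le> nu_total"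
      by (intro exI[of _ 1] allI impI)
  qed
  show ?thesis
  proof (rule LIMSEQ_le_const2)
    have b: "Q.bounded_measurable (?I j)" for j
      by (rule Q.bounded_measurable_shift[OF Q.bounded_measurable_innovation[OF f]])
    have g: "(\<lambda>k. Q.coupling_gap k (?I j)) \<longlonglongrightarrow> 0" for j
    proof (rule Lim_null_comparison)
      have "norm (Q.coupling_gap k (?I j)) \<le> 2 * Q.coupling_gap k ?f" if "Suc j \<le> k" for k
        using Q.coupling_gap_innovation[OF f that] coupling_gap_nonneg[of k "?I j"] by simp
      then show "\<forall>\<^sub>F k in sequentially. norm (Q.coupling_gap k (?I j)) \<le> 2 * Q.coupling_gap k ?f"
        by (auto simp: eventually_sequentially)
      show "(\<lambda>k. 2 * Q.coupling_gap k ?f) \<longlonglongrightarrow> 0"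
        by (rule tendsto_mult_right_zero[OF obs_gap_tendsto[OF x]])
    qed
    show "(\<lambda>k. \<Sum>j<J. (\<integral>e. ?I j e * h (rep u e) (rep v (shift_seq k e)) r \<partial>Q.S) / innovation_sd u x j)
      \<longlonglongrightarrow> (\<Sum>j<J. (\<integral>e. ?I j e * mean_kernel r v (rep u e) \<partial>Q.S) / innovation_sd u x j)"
      unfolding divide_inverse by (intro tendsto_sum tendsto_mult_right lagged_product_limit r b g)
    show "\<exists>N. \<forall>k\<ge>N. (\<Sum>j<J. (\<integral>e. ?I j e * h (rep u e) (rep v (shift_seq k e)) r \<partial>Q.S) / innovation_sd u x j) \<le> nu_total"
      using step by (intro exI[of _ 0] allI impI)
  qed
qed

text \<open>The square of \<open>innovation_sd u x j\<close> is the inner product of the \<open>j\<close>-th innovation with the observable, which by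
Fubini's theorem is the integral over \<open>w\<close> of its inner products with \<open>mean_kernel r w\<close>. After division by
\<open>innovation_sd u x j\<close>, the sum over \<open>j\<close> can be estimated under the integral, separately for each \<open>w\<close>.\<close>

lemma innovation_sd_sum_le:
  assumes u: "u \<in> {0..1}" and x: "x \<in> Idx"
  shows "(\<Sum>j<J. innovation_sd u x j) \<le> nu_total"
proof -
  define z where "z = fst x"
  define r where "r = snd x"
  have z: "0 \<le> z" "z \<le> 1" and r: "r \<in> {0..\<Lambda>}" using x by (auto simp: z_def r_def mem_Times_iff)
  let ?f = "obs u x"
  let ?I = "\<lambda>j e. Q.innovation_part j ?f (shift_seq j e)"
  define A where "A j w = (\<integral>e. ?I j e * mean_kernel r w (rep u e) \<partial>Q.S)" for j w
  have f: "Q.bounded_measurable ?f" by (rule obs_bounded[OF x])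
  have b: "Q.bounded_measurable (?I j)" for j
    by (rule Q.bounded_measurable_shift[OF Q.bounded_measurable_innovation[OF f]])
  have ID: "\<bar>?I j e\<bar> \<le> 2 * C\<^sub>h" for j e by (rule Q.innovation_abs_le[OF obs_abs_le[OF x]])
  let ?G = "\<lambda>j p. ?I j (fst p) * mean_kernel r (snd p) (rep u (fst p))"
  have Gb: "\<bar>?G j p\<bar> \<le> 2 * C\<^sub>h * C\<^sub>h" for j p
    unfolding abs_mult using ID mean_kernel_bounds(3)[OF r] C_h_nonneg by (intro mult_mono) auto
  have Gm: "?G j \<in> borel_measurable (Q.S \<Otimes>\<^sub>M borel)" for j
    by (intro borel_measurable_times mean_kernel_measurable2 r
        measurable_compose[OF measurable_fst Q.bounded_measurable_measurable[OF b]]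
        measurable_compose[OF measurable_fst rep_measurable] measurable_snd)
  have Am: "A j \<in> borel_measurable borel" for j
  proof -
    have "(\<lambda>(w, e). ?G j (e, w)) \<in> borel_measurable (borel \<Otimes>\<^sub>M Q.S)"
      unfolding split_beta' fst_conv snd_conv
      by (intro borel_measurable_times mean_kernel_measurable2 r
        measurable_compose[OF measurable_snd Q.bounded_measurable_measurable[OF b]]
        measurable_compose[OF measurable_snd rep_measurable] measurable_fst)
    from Q.P.borel_measurable_lebesgue_integral[OF this] show ?thesis by (simp add: A_def[abs_def])
  qed
  have Ab: "\<bar>A j w\<bar> \<le> 2 * C\<^sub>h * C\<^sub>h" for j w
  proof -
    have m: "(\<lambda>e. ?I j e * mean_kernel r w (rep u e)) \<in> borel_measurable Q.S"
      by (intro borel_measurable_times mean_kernel_measurable2 r Q.bounded_measurable_measurable[OF b] rep_measurable borel_measurable_const)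
    have "\<bar>A j w\<bar> \<le> (\<integral>e. \<bar>?I j e * mean_kernel r w (rep u e)\<bar> \<partial>Q.S)" unfolding A_def by simp
    also have "\<dots> \<le> (\<integral>e. 2 * C\<^sub>h * C\<^sub>h \<partial>Q.S)"
      using Gb[of j "(_, w)"] by (intro integral_mono integrable_abs Q.P.integrable_bounded[OF m]) simp_all
    finally show ?thesis by (simp add: Q.P.prob_space)
  qed
  have sq: "(innovation_sd u x j)\<^sup>2 = (LBINT w:{0..z}. A j w)" for j
  proof -
    have "(innovation_sd u x j)\<^sup>2 = (\<integral>e. ?I j e * ?f e \<partial>Q.S)"
      unfolding innovation_sd_sq by (rule Q.innovation_cov_diag[OF f, symmetric])
    also have "\<dots> = (\<integral>e. (LBINT w:{0..z}. ?G j (e, w)) \<partial>Q.S)"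
      unfolding fst_conv snd_conv set_integral_mult_right obs_def cumulated_kernel_def z_def r_def ..
    also have "\<dots> = (LBINT w:{0..z}. A j w)"
      unfolding A_def using integral_Icc_swap[OF Q.P.prob_space_axioms Gm[of j] Gb[of j], of 0 z] by simp
    finally show ?thesis .
  qed
  have int: "set_integrable lborel {0..z} (\<lambda>w. A j w / innovation_sd u x j)" for j
    using set_integrable_bounded_Icc[OF Am Ab, of 0 z j] by (simp add: set_integrable_divide)
  have "innovation_sd u x j = (LBINT w:{0..z}. A j w / innovation_sd u x j)" for j
    by (cases "innovation_sd u x j = 0") (simp_all add: sq[symmetric] power2_eq_square)
  then have "(\<Sum>j<J. innovation_sd u x j) = (\<Sum>j<J. LBINT w:{0..z}. A j w / innovation_sd u x j)"
    by (rule sum.cong[OF refl])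
  also have "\<dots> = (LBINT w:{0..z}. \<Sum>j<J. A j w / innovation_sd u x j)"
    using int unfolding set_lebesgue_integral_def set_integrable_def scaleR_sum_right
    by (intro Bochner_Integration.integral_sum[symmetric])
  also have "\<dots> \<le> (LBINT w:{0..z}. nu_total)"
  proof (rule set_integral_mono)
    show "set_integrable lborel {0..z} (\<lambda>w. \<Sum>j<J. A j w / innovation_sd u x j)"
      using int unfolding set_integrable_def scaleR_sum_right by (intro Bochner_Integration.integrable_sum)
    show "set_integrable lborel {0..z} (\<lambda>w. nu_total)"
      by (rule set_integrable_bounded_Icc[where C="nu_total"]) (use nu_total_nonneg in auto)
    show "(\<Sum>j<J. A j w / innovation_sd u x j) \<le> nu_total" if "w \<in> {0..z}" for w
      unfolding A_def using that z by (intro innovation_mean_kernel_sum_le u r x) auto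
  qed
  also have "\<dots> = nu_total * z" using z by (simp add: set_lebesgue_integral_def)
  also have "\<dots> \<le> nu_total" using z nu_total_nonneg by (simp add: mult_left_le)
  finally show ?thesis .
qed

lemma innovation_sd_summable:
  assumes "u \<in> {0..1}" "x \<in> Idx"
  shows "summable (innovation_sd u x)" "(\<Sum>j. innovation_sd u x j) \<le> nu_total"
  using summableI_nonneg_bounded[OF innovation_sd_nonneg innovation_sd_sum_le[OF assms]]
    suminf_le_const[OF _ innovation_sd_sum_le[OF assms]] by auto

section \<open>Factorization of the Gram matrix of the innovations\<close>

lemma innovation_cov_lipschitz:
  assumes f: "Q.bounded_measurable f" "Q.bounded_measurable f'" and g: "Q.bounded_measurable g" "Q.bounded_measurable g'"
    and C: "\<And>x. \<bar>g x\<bar> \<le> C" "\<And>x. \<bar>f' x\<bar> \<le> C"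
  shows "\<bar>Q.innovation_cov i f l g - Q.innovation_cov i f' l g'\<bar>
    \<le> 4 * C * ((\<integral>x. \<bar>f x - f' x\<bar> \<partial>Q.S) + (\<integral>x. \<bar>g x - g' x\<bar> \<partial>Q.S))"
proof -
  let ?a = "Q.innovation_part i f" and ?a' = "Q.innovation_part i f'"
  let ?b = "Q.innovation_part l g" and ?b' = "Q.innovation_part l g'"
  let ?df = "Q.innovation_part i (\<lambda>x. f x - f' x)" and ?dg = "Q.innovation_part l (\<lambda>x. g x - g' x)"
  note bi = Q.bounded_measurable_innovation
  have C0: "0 \<le> C" using C(1)[of undefined] by simp
  have b: "Q.bounded_measurable ?a" "Q.bounded_measurable ?a'" "Q.bounded_measurable ?b" "Q.bounded_measurable ?b'"
    by (rule bi, rule f g)+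
  have bd: "Q.bounded_measurable ?df" "Q.bounded_measurable ?dg"
    by (rule bi[OF Q.bounded_measurable_diff[OF f]], rule bi[OF Q.bounded_measurable_diff[OF g]])
  have int: "integrable Q.S (\<lambda>x. \<bar>?df x\<bar>)" "integrable Q.S (\<lambda>x. \<bar>?dg x\<bar>)"
    using bd[THEN Q.bounded_measurable_abs, THEN Q.bounded_measurable_integrable] by auto
  have eq: "Q.innovation_cov i f l g - Q.innovation_cov i f' l g' = (\<integral>x. ?a x * ?b x - ?a' x * ?b' x \<partial>Q.S)"
    unfolding Q.innovation_cov_def
    by (intro Bochner_Integration.integral_diff[symmetric] Q.bounded_measurable_integrable Q.bounded_measurable_mult bi f g)
  have "\<bar>Q.innovation_cov i f l g - Q.innovation_cov i f' l g'\<bar> \<le> (\<integral>x. \<bar>?a x * ?b x - ?a' x * ?b' x\<bar> \<partial>Q.S)"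
    unfolding eq by simp
  also have "\<dots> \<le> (\<integral>x. 2 * C * \<bar>?df x\<bar> + 2 * C * \<bar>?dg x\<bar> \<partial>Q.S)"
  proof (rule integral_mono)
    show "integrable Q.S (\<lambda>x. \<bar>?a x * ?b x - ?a' x * ?b' x\<bar>)"
      by (rule Q.bounded_measurable_integrable[OF Q.bounded_measurable_abs[OF Q.bounded_measurable_diff[OF
            Q.bounded_measurable_mult[OF b(1,3)] Q.bounded_measurable_mult[OF b(2,4)]]]])
    show "integrable Q.S (\<lambda>x. 2 * C * \<bar>?df x\<bar> + 2 * C * \<bar>?dg x\<bar>)"
      by (rule Bochner_Integration.integrable_add[OF integrable_mult_right[OF int(1)] integrable_mult_right[OF int(2)]])
    fix x assume x: "x \<in> space Q.S"
    have "?a x * ?b x - ?a' x * ?b' x = ?df x * ?b x + ?a' x * ?dg x"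
      by (simp add: Q.innovation_diff[OF f x] Q.innovation_diff[OF g x] algebra_simps)
    then have "\<bar>?a x * ?b x - ?a' x * ?b' x\<bar> \<le> \<bar>?df x\<bar> * \<bar>?b x\<bar> + \<bar>?a' x\<bar> * \<bar>?dg x\<bar>"
      by (simp only: abs_mult[symmetric] abs_triangle_ineq)
    also have "\<dots> \<le> \<bar>?df x\<bar> * (2 * C) + (2 * C) * \<bar>?dg x\<bar>"
      by (intro add_mono mult_left_mono mult_right_mono Q.innovation_abs_le C) auto
    finally show "\<bar>?a x * ?b x - ?a' x * ?b' x\<bar> \<le> 2 * C * \<bar>?df x\<bar> + 2 * C * \<bar>?dg x\<bar>" by (simp add: ac_simps)
  qed
  also have "\<dots> = 2 * C * (\<integral>x. \<bar>?df x\<bar> \<partial>Q.S) + 2 * C * (\<integral>x. \<bar>?dg x\<bar> \<partial>Q.S)"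
    by (subst Bochner_Integration.integral_add[OF integrable_mult_right[OF int(1)] integrable_mult_right[OF int(2)]])
       (simp only: integral_mult_right_zero)
  also have "\<dots> \<le> 2 * C * (2 * (\<integral>x. \<bar>f x - f' x\<bar> \<partial>Q.S)) + 2 * C * (2 * (\<integral>x. \<bar>g x - g' x\<bar> \<partial>Q.S))"
    using C0 by (intro add_mono mult_left_mono Q.innovation_L1 Q.bounded_measurable_diff f g) auto
  finally show ?thesis by (simp add: algebra_simps)
qed

text \<open>The Gram matrix of the innovations, with the lag as part of the index.\<close>

definition innovation_kernel :: "real \<Rightarrow> nat \<times> real \<times> real \<Rightarrow> nat \<times> real \<times> real \<Rightarrow> real" where
  "innovation_kernel u p q = Q.innovation_cov (fst p) (obs u (snd p)) (fst q) (obs u (snd q))"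

abbreviation "Jdx \<equiv> (UNIV :: nat set) \<times> Idx"

lemma psd_innovation_kernel: "psd_kernel Jdx (innovation_kernel u)"
  unfolding psd_kernel_def
proof (intro conjI ballI allI impI)
  show "innovation_kernel u p q = innovation_kernel u q p" for p q
    by (simp add: innovation_kernel_def Q.innovation_cov_def mult.commute)
next
  fix n :: nat and p :: "nat \<Rightarrow> nat \<times> real \<times> real" and c :: "nat \<Rightarrow> real"
  assume p: "\<forall>i<n. p i \<in> Jdx"
  let ?f = "\<lambda>i. Q.innovation_part (fst (p i)) (obs u (snd (p i)))"
  have sq: "sq_integrable Q.S (?f i)" if "i \<in> {..<n}" for i
    using p that by (intro Q.bounded_measurable_sq Q.bounded_measurable_innovation obs_bounded) (auto simp: mem_Times_iff)
  have "0 \<le> (\<integral>x. (\<Sum>i<n. c i * ?f i x)\<^sup>2 \<partial>Q.S)" by (rule Bochner_Integration.integral_nonneg) simp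
  also have "\<dots> = (\<Sum>i<n. \<Sum>j<n. c i * c j * innovation_kernel u (p i) (p j))"
    unfolding innovation_kernel_def Q.innovation_cov_def by (rule integral_sq_sum[OF finite_lessThan sq])
  finally show "0 \<le> (\<Sum>i<n. \<Sum>j<n. c i * c j * innovation_kernel u (p i) (p j))" .
qed

lemma obs_lipschitz:
  assumes x: "x \<in> Idx"
  shows "(\<integral>e. \<bar>obs u x e - obs u' x e\<bar> \<partial>Q.S) \<le> L\<^sub>h * C\<^sub>u * \<bar>u - u'\<bar>"
proof -
  have "(\<integral>e. \<bar>obs u x e - obs u' x e\<bar> \<partial>Q.S) \<le> (\<integral>e. L\<^sub>h * bdist (rep u e) (rep u' e) \<partial>Q.S)"
    using x cumulated_kernel_bdist[of "fst x" "snd x"]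
    by (intro integral_mono Q.bounded_measurable_integrable Q.bounded_measurable_abs Q.bounded_measurable_diff
        obs_bounded Q.bounded_measurable_mult Q.bounded_measurable_const bdist_rep_bounded) (auto simp: obs_def)
  also have "\<dots> \<le> L\<^sub>h * (C\<^sub>u * \<bar>u - u'\<bar>)" by (simp add: mult_left_mono L_h_nonneg rep_lipschitz')
  finally show ?thesis by simp
qed

lemma innovation_kernel_measurable:
  assumes "p \<in> Jdx" "q \<in> Jdx"
  shows "(\<lambda>u. innovation_kernel u p q) \<in> borel_measurable borel"
proof (rule lipschitz_borel)
  fix u u' :: real
  let ?x = "snd p" and ?y = "snd q"
  have x: "?x \<in> Idx" "?y \<in> Idx" using assms by (auto simp: mem_Times_iff)
  have "\<bar>innovation_kernel u p q - innovation_kernel u' p q\<bar>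
      \<le> 4 * C\<^sub>h * ((\<integral>e. \<bar>obs u ?x e - obs u' ?x e\<bar> \<partial>Q.S) + (\<integral>e. \<bar>obs u ?y e - obs u' ?y e\<bar> \<partial>Q.S))"
    unfolding innovation_kernel_def by (intro innovation_cov_lipschitz obs_bounded obs_abs_le x)
  also have "\<dots> \<le> 4 * C\<^sub>h * (L\<^sub>h * C\<^sub>u * \<bar>u - u'\<bar> + L\<^sub>h * C\<^sub>u * \<bar>u - u'\<bar>)"
    using C_h_nonneg by (intro mult_left_mono add_mono obs_lipschitz x) auto
  finally show "\<bar>innovation_kernel u p q - innovation_kernel u' p q\<bar> \<le> (8 * C\<^sub>h * L\<^sub>h * C\<^sub>u) * dist u u'"
    by (simp add: dist_real_def algebra_simps)
qed

lemma mean_kernel_tendsto: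
  assumes r: "r \<in> {0..\<Lambda>}" "\<And>n. R n \<in> {0..\<Lambda>}" "R \<longlonglongrightarrow> r"
  shows "(\<lambda>n. mean_kernel (R n) w s) \<longlonglongrightarrow> mean_kernel r w s"
  unfolding mean_kernel_def
proof (rule integral_dominated_convergence[where w="\<lambda>_. C\<^sub>h"])
  show "AE e in Q.S. (\<lambda>n. h s (rep w e) (R n)) \<longlonglongrightarrow> h s (rep w e) r"
  proof (rule AE_I2)
    fix e
    have "(\<lambda>n. h s (rep w e) (R n) - h s (rep w e) r) \<longlonglongrightarrow> 0"
    proof (rule Lim_null_comparison)
      show "\<forall>\<^sub>F n in sequentially. norm (h s (rep w e) (R n) - h s (rep w e) r) \<le> L\<^sub>2 s (rep w e) * \<bar>R n - r\<bar>"
        using h_lipschitz_third[OF r(2) r(1)] by (intro always_eventually allI) simp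
      have "(\<lambda>n. \<bar>R n - r\<bar>) \<longlonglongrightarrow> 0" using r(3) by (simp add: LIM_zero_iff tendsto_rabs_zero_iff)
      then show "(\<lambda>n. L\<^sub>2 s (rep w e) * \<bar>R n - r\<bar>) \<longlonglongrightarrow> 0" by (rule tendsto_mult_right_zero)
    qed
    then show "(\<lambda>n. h s (rep w e) (R n)) \<longlonglongrightarrow> h s (rep w e) r" by (simp add: LIM_zero_iff)
  qed
  show "AE e in Q.S. norm (h s (rep w e) (R n)) \<le> C\<^sub>h" for n using h_abs_le[OF r(2)] by (intro AE_I2) simp
qed (use Q.bounded_measurable_measurable[OF h_rep_bounded] r in auto)

lemma cumulated_kernel_tendsto:
  assumes r: "r \<in> {0..\<Lambda>}" "\<And>n. R n \<in> {0..\<Lambda>}" "R \<longlonglongrightarrow> r"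
  shows "(\<lambda>n. cumulated_kernel z (R n) s) \<longlonglongrightarrow> cumulated_kernel z r s"
  unfolding cumulated_kernel_def set_lebesgue_integral_def
proof (rule integral_dominated_convergence[where w="\<lambda>w. indicator {0..z} w * C\<^sub>h"])
  show "integrable lborel (\<lambda>w. indicator {0..z} w * C\<^sub>h)"
    by (intro integrable_mult_left integrable_real_indicator) (auto simp: emeasure_lborel_Icc_eq)
  show "AE w in lborel. (\<lambda>n. indicator {0..z} w *\<^sub>R mean_kernel (R n) w s) \<longlonglongrightarrow> indicator {0..z} w *\<^sub>R mean_kernel r w s"
    by (intro AE_I2 tendsto_scaleR tendsto_const mean_kernel_tendsto r)
  show "AE w in lborel. norm (indicator {0..z} w *\<^sub>R mean_kernel (R n) w s) \<le> indicator {0..z} w * C\<^sub>h" for n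
    using mean_kernel_bounds(3)[OF r(2)] by (intro AE_I2) (auto simp: indicator_def)
qed (intro Icc_weight_measurable mean_kernel_measurable_time r)+

text \<open>The dependence on \<open>z\<close> is Lipschitz. In \<open>r\<close> the kernel is Lipschitz with a constant that varies with the other
arguments, so that dominated convergence is used.\<close>

lemma obs_tendsto:
  assumes x: "x \<in> Idx" and y: "\<And>n. y n \<in> Idx" and lim: "y \<longlonglongrightarrow> x"
  shows "(\<lambda>n. \<integral>e. \<bar>obs u x e - obs u (y n) e\<bar> \<partial>Q.S) \<longlonglongrightarrow> 0"
proof -
  have "(\<lambda>n. \<integral>e. \<bar>obs u x e - obs u (y n) e\<bar> \<partial>Q.S) \<longlonglongrightarrow> (\<integral>e. 0 \<partial>Q.S)"
  proof (rule integral_dominated_convergence[where w="\<lambda>_. 2 * C\<^sub>h"])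
    show "(\<lambda>e. \<bar>obs u x e - obs u (y n) e\<bar>) \<in> borel_measurable Q.S" for n
      by (intro Q.bounded_measurable_measurable Q.bounded_measurable_abs Q.bounded_measurable_diff obs_bounded x y)
    show "AE e in Q.S. norm \<bar>obs u x e - obs u (y n) e\<bar> \<le> 2 * C\<^sub>h" for n
    proof (rule AE_I2)
      show "norm \<bar>obs u x e - obs u (y n) e\<bar> \<le> 2 * C\<^sub>h" for e
        using obs_abs_le[OF x, of u e] obs_abs_le[OF y[of n], of u e] by (simp add: abs_le_iff)
    qed
    show "AE e in Q.S. (\<lambda>n. \<bar>obs u x e - obs u (y n) e\<bar>) \<longlonglongrightarrow> 0"
    proof (rule AE_I2)
      fix e
      let ?s = "rep u e"
      have z: "fst x \<in> {0..1}" "\<And>n. fst (y n) \<in> {0..1}" and r: "snd x \<in> {0..\<Lambda>}" "\<And>n. snd (y n) \<in> {0..\<Lambda>}"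
        using x y by (auto simp: mem_Times_iff)
      have "(\<lambda>n. C\<^sub>h * \<bar>fst x - fst (y n)\<bar> + \<bar>cumulated_kernel (fst x) (snd x) ?s - cumulated_kernel (fst x) (snd (y n)) ?s\<bar>)
        \<longlonglongrightarrow> C\<^sub>h * \<bar>fst x - fst x\<bar> + \<bar>cumulated_kernel (fst x) (snd x) ?s - cumulated_kernel (fst x) (snd x) ?s\<bar>"
        by (intro tendsto_intros cumulated_kernel_tendsto r tendsto_fst tendsto_snd lim)
      then have lim0: "(\<lambda>n. C\<^sub>h * \<bar>fst x - fst (y n)\<bar> + \<bar>cumulated_kernel (fst x) (snd x) ?s - cumulated_kernel (fst x) (snd (y n)) ?s\<bar>) \<longlonglongrightarrow> 0"
        by simp
      show "(\<lambda>n. \<bar>obs u x e - obs u (y n) e\<bar>) \<longlonglongrightarrow> 0"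
      proof (rule Lim_null_comparison[OF always_eventually[OF allI] lim0])
        fix n
        have "\<bar>cumulated_kernel (fst x) (snd (y n)) ?s - cumulated_kernel (fst (y n)) (snd (y n)) ?s\<bar> \<le> C\<^sub>h * \<bar>fst x - fst (y n)\<bar>"
          by (rule cumulated_kernel_lipschitz[OF z r(2)])
        then show "norm \<bar>obs u x e - obs u (y n) e\<bar>
          \<le> C\<^sub>h * \<bar>fst x - fst (y n)\<bar> + \<bar>cumulated_kernel (fst x) (snd x) ?s - cumulated_kernel (fst x) (snd (y n)) ?s\<bar>"
          unfolding obs_def by simp
      qed
    qed
  qed simp_all
  then show ?thesis by simp
qed

lemma innovation_kernel_quadratic_le:
  assumes x: "x \<in> Idx" and y: "y \<in> Idx"
  shows "innovation_kernel u (i, x) (i, x) - 2 * innovation_kernel u (i, x) (i, y) + innovation_kernel u (i, y) (i, y)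
    \<le> 8 * C\<^sub>h * (\<integral>e. \<bar>obs u x e - obs u y e\<bar> \<partial>Q.S)"
proof -
  let ?d = "\<integral>e. \<bar>obs u x e - obs u y e\<bar> \<partial>Q.S"
  have d: "(\<integral>e. \<bar>obs u y e - obs u x e\<bar> \<partial>Q.S) = ?d" by (simp add: abs_minus_commute)
  have "innovation_kernel u (i, x) (i, x) - innovation_kernel u (i, x) (i, y) \<le> 4 * C\<^sub>h * ?d"
    using innovation_cov_lipschitz[OF obs_bounded[OF x, of u] obs_bounded[OF x, of u] obs_bounded[OF x, of u] obs_bounded[OF y, of u]
        obs_abs_le[OF x] obs_abs_le[OF x], of i i] by (simp add: innovation_kernel_def)
  moreover have "innovation_kernel u (i, y) (i, y) - innovation_kernel u (i, x) (i, y) \<le> 4 * C\<^sub>h * ?d"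
    using innovation_cov_lipschitz[OF obs_bounded[OF y, of u] obs_bounded[OF x, of u] obs_bounded[OF y, of u] obs_bounded[OF y, of u]
        obs_abs_le[OF y] obs_abs_le[OF x], of i i] by (simp add: innovation_kernel_def d)
  ultimately show ?thesis by simp
qed

lemma innovation_kernel_dense:
  assumes d: "\<And>l. d l \<in> Idx" "\<And>x e. x \<in> Idx \<Longrightarrow> e > 0 \<Longrightarrow> \<exists>l. dist (d l) x < e"
    and x: "x \<in> Idx" and e: "e > 0"
  shows "\<exists>l. innovation_kernel u (i, x) (i, x) - 2 * innovation_kernel u (i, x) (i, d l) + innovation_kernel u (i, d l) (i, d l) < e"
proof -
  have "\<forall>n. \<exists>l. dist (d l) x < 1 / real (Suc n)" using d(2)[OF x] by simp
  then obtain l where l: "\<And>n. dist (d (l n)) x < 1 / real (Suc n)" by metis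
  have "(\<lambda>n. d (l n)) \<longlonglongrightarrow> x"
    by (rule metric_tendsto_imp_tendsto[OF lim_inverse_n'])
       (intro eventually_sequentiallyI[of 1], rule order_trans[OF less_imp_le[OF l]], simp add: frac_le)
  then have "(\<lambda>n. 8 * C\<^sub>h * (\<integral>e. \<bar>obs u x e - obs u (d (l n)) e\<bar> \<partial>Q.S)) \<longlonglongrightarrow> 0"
    by (intro tendsto_mult_right_zero obs_tendsto x d(1))
  then have "\<forall>\<^sub>F n in sequentially. 8 * C\<^sub>h * (\<integral>e. \<bar>obs u x e - obs u (d (l n)) e\<bar> \<partial>Q.S) < e"
    using e by (rule order_tendstoD(2))
  then obtain n where "8 * C\<^sub>h * (\<integral>e. \<bar>obs u x e - obs u (d (l n)) e\<bar> \<partial>Q.S) < e"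
    by (auto simp: eventually_sequentially)
  then show ?thesis using innovation_kernel_quadratic_le[OF x d(1), of u i "l n"] by (intro exI[of _ "l n"]) linarith
qed

lemma obs_clip: "obs (clip u) = obs u"
  by (simp add: fun_eq_iff obs_def rep_def clip_eq[OF clip_mem(1)])

lemma innovation_kernel_diag: "innovation_kernel u (i, x) (i, x) = (innovation_sd u x i)\<^sup>2"
  by (simp add: innovation_kernel_def innovation_sd_sq)

lemma innovation_sd_total:
  assumes "x \<in> Idx"
  shows "summable (innovation_sd u x)" "(\<Sum>j. innovation_sd u x j) \<le> nu_total" "(\<Sum>j<J. innovation_sd u x j) \<le> nu_total"
proof -
  have c: "innovation_sd u x = innovation_sd (clip u) x" by (simp add: fun_eq_iff innovation_sd_def obs_clip)
  show "summable (innovation_sd u x)" "(\<Sum>j. innovation_sd u x j) \<le> nu_total" "(\<Sum>j<J. innovation_sd u x j) \<le> nu_total"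
    unfolding c using innovation_sd_summable[OF clip_mem(1) assms] innovation_sd_sum_le[OF clip_mem(1) assms] by auto
qed

definition innovation_cov_sum :: "real \<Rightarrow> real \<times> real \<Rightarrow> real \<times> real \<Rightarrow> real" where
  "innovation_cov_sum u x y = (\<Sum>\<^sub>\<infinity>(i, l)\<in>UNIV. Q.innovation_cov i (obs u x) l (obs u y))"

lemma innovation_cov_abs_le:
  assumes x: "x \<in> Idx" and y: "y \<in> Idx"
  shows "\<bar>Q.innovation_cov i (obs u x) l (obs u y)\<bar> \<le> innovation_sd u x i * innovation_sd u y l"
proof -
  have "(innovation_kernel u (i, x) (l, y))\<^sup>2 \<le> (innovation_sd u x i)\<^sup>2 * (innovation_sd u y l)\<^sup>2"
    using psd_kernel_Cauchy_Schwarz[OF psd_innovation_kernel, of "(i, x)" "(l, y)" u] x y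
    by (simp add: innovation_kernel_diag)
  then have "(innovation_kernel u (i, x) (l, y))\<^sup>2 \<le> (innovation_sd u x i * innovation_sd u y l)\<^sup>2"
    by (simp add: power_mult_distrib)
  then show ?thesis
    using innovation_sd_nonneg[of u x i] innovation_sd_nonneg[of u y l]
    by (simp add: abs_le_square_iff[symmetric] innovation_kernel_def)
qed

lemma innovation_cov_sum_le:
  assumes x: "x \<in> Idx"
    and abs: "(\<lambda>(i, l). Q.innovation_cov i (obs u x) l (obs u x)) absolutely_summable_on UNIV"
  shows "innovation_cov_sum u x x \<le> nu_total\<^sup>2"
  unfolding innovation_cov_sum_def
proof (rule infsum_le_finite_sums)
  show "(\<lambda>(i, l). Q.innovation_cov i (obs u x) l (obs u x)) summable_on UNIV"
    using abs by (rule Infinite_Sum.abs_summable_summable)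
  fix F :: "(nat \<times> nat) set" assume "finite F"
  then have "finite (fst ` F \<union> snd ` F)" by simp
  from finite_nat_bounded[OF this] obtain n where n: "fst ` F \<union> snd ` F \<subseteq> {..<n}" ..
  let ?s = "innovation_sd u x"
  have "(\<Sum>(i, l)\<in>F. Q.innovation_cov i (obs u x) l (obs u x)) \<le> (\<Sum>(i, l)\<in>F. ?s i * ?s l)"
  proof (rule sum_mono, clarify)
    show "Q.innovation_cov i (obs u x) l (obs u x) \<le> ?s i * ?s l" for i l
      using innovation_cov_abs_le[OF x x, of i u l] by linarith
  qed
  also have "\<dots> \<le> (\<Sum>(i, l)\<in>{..<n} \<times> {..<n}. ?s i * ?s l)"
    using n by (intro sum_mono2) (auto intro!: mult_nonneg_nonneg innovation_sd_nonneg)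
  also have "\<dots> = (\<Sum>i<n. ?s i) * (\<Sum>l<n. ?s l)" by (simp add: sum_product sum.cartesian_product)
  also have "\<dots> \<le> nu_total * nu_total"
    by (intro mult_mono innovation_sd_total x nu_total_nonneg sum_nonneg innovation_sd_nonneg)
  finally show "(\<Sum>(i, l)\<in>F. Q.innovation_cov i (obs u x) l (obs u x)) \<le> nu_total\<^sup>2" by (simp add: power2_eq_square)
qed

text \<open>The Cholesky factors \<open>c\<^sub>q(i, x)\<close> of the Gram matrix are summed over the lag \<open>i\<close>. The bound
\<open>\<bar>c\<^sub>q(i, x)\<bar> \<le> innovation_sd u x i\<close> makes this legitimate, and it also gives the uniform bound for the sum.\<close>

theorem innovation_factorization:
  obtains g :: "nat \<Rightarrow> real \<Rightarrow> real \<times> real \<Rightarrow> real"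
  where "\<And>q x. x \<in> Idx \<Longrightarrow> (\<lambda>u. g q u x) \<in> borel_measurable borel"
    and "\<And>q u x. x \<in> Idx \<Longrightarrow> \<bar>g q u x\<bar> \<le> nu_total"
    and "\<And>u x y. x \<in> Idx \<Longrightarrow> y \<in> Idx \<Longrightarrow> (\<lambda>q. g q u x * g q u y) sums innovation_cov_sum u x y"
    and "\<And>u x y. x \<in> Idx \<Longrightarrow> y \<in> Idx \<Longrightarrow>
      (\<lambda>(i, l). Q.innovation_cov i (obs u x) l (obs u y)) absolutely_summable_on UNIV"
proof -
  have "Idx \<noteq> {}" using \<Lambda>_nonneg by auto
  then obtain d :: "nat \<Rightarrow> real \<times> real" where d: "\<And>l. d l \<in> Idx" "\<And>x e. x \<in> Idx \<Longrightarrow> e > 0 \<Longrightarrow> \<exists>l. dist (d l) x < e"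
    by (rule dense_sequence) blast
  (* All lags are combined with a dense sequence of index pairs. *)
  define D where "D n = (fst (prod_decode n), d (snd (prod_decode n)))" for n
  have D: "D n \<in> Jdx" for n using d(1) by (simp add: D_def)
  have dense: "\<exists>n. innovation_kernel u p p - 2 * innovation_kernel u p (D n) + innovation_kernel u (D n) (D n) < e"
    if "p \<in> Jdx" "e > 0" for u p e
  proof -
    obtain l where l: "innovation_kernel u (fst p, snd p) (fst p, snd p) - 2 * innovation_kernel u (fst p, snd p) (fst p, d l)
        + innovation_kernel u (fst p, d l) (fst p, d l) < e"
    proof -
      have "snd p \<in> Idx" using \<open>p \<in> Jdx\<close> by (simp only: mem_Times_iff)
      then have "\<exists>l. innovation_kernel u (fst p, snd p) (fst p, snd p) - 2 * innovation_kernel u (fst p, snd p) (fst p, d l)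
        + innovation_kernel u (fst p, d l) (fst p, d l) < e"
        using \<open>0 < e\<close> by (intro innovation_kernel_dense d)
      then show thesis by (elim exE) (rule that)
    qed
    have "D (prod_encode (fst p, l)) = (fst p, d l)" by (simp add: D_def)
    then show ?thesis using l by (intro exI[of _ "prod_encode (fst p, l)"]) simp
  qed
  define G where "G q u i x = cholesky (innovation_kernel u) D q (i, x)" for q u i x
  have G_sums: "(\<lambda>q. G q u i x * G q u l y) sums Q.innovation_cov i (obs u x) l (obs u y)" if "x \<in> Idx" "y \<in> Idx" for u i x l y
  proof -
    have "(\<lambda>q. cholesky (innovation_kernel u) D q (i, x) * cholesky (innovation_kernel u) D q (l, y)) sums innovation_kernel u (i, x) (l, y)"
      by (rule cholesky_sums[OF psd_innovation_kernel D dense]) (use that in auto)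
    then show ?thesis by (simp add: G_def innovation_kernel_def)
  qed
  have G_sq: "(\<lambda>q. (G q u i x)\<^sup>2) sums (innovation_sd u x i)\<^sup>2" if "x \<in> Idx" for u i x
    using G_sums[OF that that, of u i i] by (simp add: power2_eq_square[symmetric] innovation_sd_sq)
  have G_le: "\<bar>G q u i x\<bar> \<le> innovation_sd u x i" if x: "x \<in> Idx" for q u i x
  proof -
    have "(\<Sum>q'\<in>{q}. (G q' u i x)\<^sup>2) \<le> (\<Sum>q'. (G q' u i x)\<^sup>2)"
      using G_sq[OF x, of u i] by (intro sum_le_suminf) (auto simp: sums_iff)
    then have "(G q u i x)\<^sup>2 \<le> (innovation_sd u x i)\<^sup>2" using sums_unique[OF G_sq[OF x, of u i]] by simp
    then show ?thesis using innovation_sd_nonneg[of u x i] by (simp add: abs_le_square_iff[symmetric])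
  qed
  note products = sums_products_of_sums[OF innovation_sd_total(1) innovation_sd_nonneg G_sq innovation_sd_total(1) innovation_sd_nonneg G_sq G_sums]
  show thesis
  proof (rule that[of "\<lambda>q u x. \<Sum>i. G q u i x"])
    fix x assume x: "x \<in> Idx"
    show "(\<lambda>u. \<Sum>i. G q u i x) \<in> borel_measurable borel" for q
    proof (rule borel_measurable_suminf)
      show "(\<lambda>u. G q u i x) \<in> borel_measurable borel" for i
        unfolding G_def by (rule measurable_cholesky[OF innovation_kernel_measurable D]) (use x in auto)
    qed
    show "\<bar>\<Sum>i. G q u i x\<bar> \<le> nu_total" for q u
    proof -
      have s: "summable (\<lambda>i. \<bar>G q u i x\<bar>)"
        using innovation_sd_total(1)[OF x, of u] by (rule summable_comparison_test') (use G_le[OF x] in auto)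
      have "\<bar>\<Sum>i. G q u i x\<bar> \<le> (\<Sum>i. \<bar>G q u i x\<bar>)" by (rule summable_rabs[OF s])
      also have "\<dots> \<le> (\<Sum>i. innovation_sd u x i)" by (intro suminf_le G_le x s innovation_sd_total(1))
      also have "\<dots> \<le> nu_total" by (rule innovation_sd_total(2)[OF x])
      finally show ?thesis .
    qed
    fix u y assume y: "y \<in> Idx"
    show "(\<lambda>q. (\<Sum>i. G q u i x) * (\<Sum>i. G q u i y)) sums innovation_cov_sum u x y"
      unfolding innovation_cov_sum_def by (rule products(1)) (use x y in auto)
    show "(\<lambda>(i, l). Q.innovation_cov i (obs u x) l (obs u y)) absolutely_summable_on UNIV"
      by (rule products(2)) (use x y in auto)
  qed
qed

end

section \<open>The long-run covariance as a sum over innovations\<close>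

lemma (in prob_space) covariance_AE_shifted:
  assumes Y: "AE \<omega> in M. Y \<omega> = Y' \<omega> - K" "Y \<in> borel_measurable M" "Y' \<in> borel_measurable M" "\<And>\<omega>. \<bar>Y' \<omega>\<bar> \<le> C"
    and Z: "AE \<omega> in M. Z \<omega> = Z' \<omega> - K'" "Z \<in> borel_measurable M" "Z' \<in> borel_measurable M" "\<And>\<omega>. \<bar>Z' \<omega>\<bar> \<le> C"
  shows "covariance M Y Z = (\<integral>\<omega>. Y' \<omega> * Z' \<omega> \<partial>M) - (\<integral>\<omega>. Y' \<omega> \<partial>M) * (\<integral>\<omega>. Z' \<omega> \<partial>M)"
proof -
  note [measurable] = Y(2,3) Z(2,3)
  have int: "integrable M Y'" "integrable M Z'" using integrable_bounded Y(3,4) Z(3,4) by blast+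
  have C: "0 \<le> C" using Y(4)[of undefined] by simp
  have int2: "integrable M (\<lambda>\<omega>. Y' \<omega> * Z' \<omega>)"
  proof (rule integrable_bounded)
    show "\<bar>Y' \<omega> * Z' \<omega>\<bar> \<le> C * C" for \<omega> unfolding abs_mult by (intro mult_mono Y Z C) simp
  qed simp
  have eY: "integral\<^sup>L M Y = integral\<^sup>L M Y' - K"
    using integral_cong_AE[OF _ _ Y(1)] int by (simp add: prob_space)
  have eZ: "integral\<^sup>L M Z = integral\<^sup>L M Z' - K'"
    using integral_cong_AE[OF _ _ Z(1)] int by (simp add: prob_space)
  have "covariance M Y Z = (\<integral>\<omega>. (Y' \<omega> - integral\<^sup>L M Y') * (Z' \<omega> - integral\<^sup>L M Z') \<partial>M)"
    unfolding covariance_def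
  proof (rule integral_cong_AE)
    show "AE \<omega> in M. (Y \<omega> - integral\<^sup>L M Y) * (Z \<omega> - integral\<^sup>L M Z) = (Y' \<omega> - integral\<^sup>L M Y') * (Z' \<omega> - integral\<^sup>L M Z')"
      using Y(1) Z(1) by eventually_elim (simp add: eY eZ)
  qed measurable
  also have "\<dots> = (\<integral>\<omega>. Y' \<omega> * Z' \<omega> - integral\<^sup>L M Z' * Y' \<omega> - integral\<^sup>L M Y' * Z' \<omega> + integral\<^sup>L M Y' * integral\<^sup>L M Z' \<partial>M)"
    by (simp add: algebra_simps)
  also have "\<dots> = (\<integral>\<omega>. Y' \<omega> * Z' \<omega> \<partial>M) - integral\<^sup>L M Y' * integral\<^sup>L M Z'"
    using int int2 by (simp add: prob_space)
  finally show ?thesis .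
qed

context auxiliary_process
begin

lemma integral_h_copy:
  assumes w: "w \<in> {0..1}" and r: "r \<in> {0..\<Lambda>}"
  shows "(\<integral>\<omega>. h s (Xa 0 w \<omega>) r \<partial>M) = mean_kernel r w s"
proof -
  have "(\<integral>\<omega>. h s (Xa 0 w \<omega>) r \<partial>M) = (\<integral>\<omega>. h s (rep w (past \<epsilon> 0 \<omega>)) r \<partial>M)"
  proof (rule integral_cong_AE)
    show "AE \<omega> in M. h s (Xa 0 w \<omega>) r = h s (rep w (past \<epsilon> 0 \<omega>)) r"
      using representation[OF w, of 0] by eventually_elim (simp add: rep_def clip_eq[OF w])
  qed (auto intro!: h_measurable2 r Xa_measurable w measurable_compose[OF measurable_past rep_measurable])
  also have "\<dots> = mean_kernel r w s"
    unfolding mean_kernel_def by (rule integral_past) (rule Q.bounded_measurable_measurable[OF h_rep_bounded[OF r]])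
  finally show ?thesis .
qed

definition kernel_mean :: "int \<Rightarrow> real \<Rightarrow> real \<Rightarrow> real \<Rightarrow> real" where
  "kernel_mean k u r w = (\<integral>\<omega>. mean_kernel r w (Xa k u \<omega>) \<partial>M)"

lemma mean_kernel_Xa_integrable:
  assumes u: "u \<in> {0..1}" and r: "r \<in> {0..\<Lambda>}"
  shows "integrable M (\<lambda>\<omega>. mean_kernel r w (Xa k u \<omega>))"
  by (rule integrable_bounded[OF mean_kernel_measurable2[OF r borel_measurable_const Xa_measurable[OF u]] mean_kernel_bounds(3)[OF r]])

lemma kernel_mean_abs_le:
  assumes u: "u \<in> {0..1}" and r: "r \<in> {0..\<Lambda>}"
  shows "\<bar>kernel_mean k u r w\<bar> \<le> C\<^sub>h"
proof -
  have "\<bar>kernel_mean k u r w\<bar> \<le> (\<integral>\<omega>. \<bar>mean_kernel r w (Xa k u \<omega>)\<bar> \<partial>M)" unfolding kernel_mean_def by simp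
  also have "\<dots> \<le> (\<integral>\<omega>. C\<^sub>h \<partial>M)"
    by (intro integral_mono integrable_abs mean_kernel_Xa_integrable u r mean_kernel_bounds) simp
  finally show ?thesis by (simp add: prob_space)
qed

lemma kernel_mean_measurable:
  assumes u: "u \<in> {0..1}" and r: "r \<in> {0..\<Lambda>}"
  shows "kernel_mean k u r \<in> borel_measurable borel"
proof (rule lipschitz_borel)
  fix w w'
  have eq: "kernel_mean k u r w - kernel_mean k u r w' = (\<integral>\<omega>. mean_kernel r w (Xa k u \<omega>) - mean_kernel r w' (Xa k u \<omega>) \<partial>M)"
    unfolding kernel_mean_def by (intro Bochner_Integration.integral_diff[symmetric] mean_kernel_Xa_integrable u r)
  have "\<bar>kernel_mean k u r w - kernel_mean k u r w'\<bar> \<le> (\<integral>\<omega>. \<bar>mean_kernel r w (Xa k u \<omega>) - mean_kernel r w' (Xa k u \<omega>)\<bar> \<partial>M)"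
    unfolding eq by simp
  also have "\<dots> \<le> (\<integral>\<omega>. L\<^sub>h * (C\<^sub>u * \<bar>w - w'\<bar>) \<partial>M)"
    by (intro integral_mono integrable_abs Bochner_Integration.integrable_diff mean_kernel_Xa_integrable u r mean_kernel_lipschitz_time) simp
  finally show "\<bar>kernel_mean k u r w - kernel_mean k u r w'\<bar> \<le> L\<^sub>h * C\<^sub>u * dist w w'"
    by (simp add: prob_space dist_real_def)
qed

lemma partial_mean_eq:
  assumes u: "u \<in> {0..1}" and w: "w \<in> {0..1}" and r: "r \<in> {0..\<Lambda>}"
  shows "partial_mean M Xa h k u w r \<omega> = mean_kernel r w (Xa k u \<omega>) - kernel_mean k u r w"
proof -
  interpret MM: pair_sigma_finite M M ..
  let ?H = "\<lambda>\<omega> \<omega>'. h (Xa k u \<omega>) (Xa 0 w \<omega>') r"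
  have m: "(\<lambda>p. ?H (fst p) (snd p)) \<in> borel_measurable (M \<Otimes>\<^sub>M M)"
    by (intro h_measurable2 r measurable_compose[OF measurable_fst Xa_measurable[OF u]]
        measurable_compose[OF measurable_snd Xa_measurable[OF w]])
  have "integrable (M \<Otimes>\<^sub>M M) (\<lambda>p. ?H (fst p) (snd p))"
  proof -
    interpret MMp: pair_prob_space M M ..
    show ?thesis by (rule MMp.P.integrable_bounded[OF m h_abs_le[OF r]])
  qed
  then have "(\<integral>p. ?H (fst p) (snd p) \<partial>(M \<Otimes>\<^sub>M M)) = (\<integral>\<omega>. (\<integral>\<omega>'. ?H \<omega> \<omega>' \<partial>M) \<partial>M)"
    using MM.integral_fst[of ?H] by (simp add: split_beta')
  then have c: "(\<integral>p. ?H (fst p) (snd p) \<partial>(M \<Otimes>\<^sub>M M)) = kernel_mean k u r w"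
    by (simp add: integral_h_copy[OF w r] kernel_mean_def)
  have i: "integrable M (?H \<omega>)"
    by (rule integrable_bounded[OF h_measurable2[OF r borel_measurable_const Xa_measurable[OF w]] h_abs_le[OF r]])
  have "partial_mean M Xa h k u w r \<omega> = (\<integral>\<omega>'. ?H \<omega> \<omega>' - kernel_mean k u r w \<partial>M)"
    unfolding partial_mean_def demeaned_def by (simp add: c)
  also have "\<dots> = mean_kernel r w (Xa k u \<omega>) - kernel_mean k u r w"
    using i by (simp add: prob_space integral_h_copy[OF w r])
  finally show ?thesis .
qed

lemma integral_partial_mean:
  assumes u: "u \<in> {0..1}" and z: "z \<in> {0..1}" and r: "r \<in> {0..\<Lambda>}"
  shows "(LBINT w:{0..z}. partial_mean M Xa h k u w r \<omega>) = cumulated_kernel z r (Xa k u \<omega>) - (LBINT w:{0..z}. kernel_mean k u r w)"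
proof -
  have "(LBINT w:{0..z}. partial_mean M Xa h k u w r \<omega>) = (LBINT w:{0..z}. mean_kernel r w (Xa k u \<omega>) - kernel_mean k u r w)"
  proof (rule set_lebesgue_integral_cong)
    show "\<forall>w. w \<in> {0..z} \<longrightarrow> partial_mean M Xa h k u w r \<omega> = mean_kernel r w (Xa k u \<omega>) - kernel_mean k u r w"
    proof (intro allI impI)
      fix w assume "w \<in> {0..z}"
      then have "w \<in> {0..1}" using z by auto
      then show "partial_mean M Xa h k u w r \<omega> = mean_kernel r w (Xa k u \<omega>) - kernel_mean k u r w"
        by (rule partial_mean_eq[OF u _ r])
    qed
  qed simp
  also have "\<dots> = (LBINT w:{0..z}. mean_kernel r w (Xa k u \<omega>)) - (LBINT w:{0..z}. kernel_mean k u r w)"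
    by (rule set_integral_diff(2)[OF mean_kernel_set_integrable[OF r]
          set_integrable_bounded_Icc[OF kernel_mean_measurable[OF u r] kernel_mean_abs_le[OF u r]]])
  finally show ?thesis by (simp add: cumulated_kernel_def)
qed

text \<open>The earlier of the two pasts is a shift of the later one, and which of them is earlier depends on the sign of
\<open>k\<close>.\<close>

lemma integral_lagged_product:
  fixes k :: int
  assumes f: "Q.bounded_measurable f" and g: "Q.bounded_measurable g"
  shows "(\<integral>\<omega>. f (past \<epsilon> 0 \<omega>) * g (past \<epsilon> k \<omega>) \<partial>M) = (\<integral>e. Q.transfer (nat (- k)) f e * Q.transfer (nat k) g e \<partial>Q.S)"
proof (cases "k \<ge> 0")
  case True
  then have past0: "past \<epsilon> 0 \<omega> = shift_seq (nat k) (past \<epsilon> k \<omega>)" for \<omega>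
    using past_shift[of k "nat k" \<omega>] by simp
  have "(\<integral>\<omega>. f (past \<epsilon> 0 \<omega>) * g (past \<epsilon> k \<omega>) \<partial>M) = (\<integral>\<omega>. g (past \<epsilon> k \<omega>) * f (shift_seq (nat k) (past \<epsilon> k \<omega>)) \<partial>M)"
    unfolding past0 by (simp add: mult.commute)
  also have "\<dots> = (\<integral>e. g e * f (shift_seq (nat k) e) \<partial>Q.S)"
    by (rule integral_past[OF Q.bounded_measurable_measurable[OF Q.bounded_measurable_mult[OF g Q.bounded_measurable_shift[OF f]]]])
  also have "\<dots> = (\<integral>e. Q.transfer (nat k) g e * f e \<partial>Q.S)" by (rule Q.transfer_adjoint[OF g f])
  also have "\<dots> = (\<integral>e. Q.transfer (nat (- k)) f e * Q.transfer (nat k) g e \<partial>Q.S)"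
    using True by (simp add: Q.transfer_0 mult.commute)
  finally show ?thesis .
next
  case False
  then have pastk: "past \<epsilon> k \<omega> = shift_seq (nat (- k)) (past \<epsilon> 0 \<omega>)" for \<omega>
    using past_shift[of 0 "nat (- k)" \<omega>] by simp
  have "(\<integral>\<omega>. f (past \<epsilon> 0 \<omega>) * g (past \<epsilon> k \<omega>) \<partial>M) = (\<integral>e. f e * g (shift_seq (nat (- k)) e) \<partial>Q.S)"
    unfolding pastk
    by (rule integral_past[OF Q.bounded_measurable_measurable[OF Q.bounded_measurable_mult[OF f Q.bounded_measurable_shift[OF g]]]])
  also have "\<dots> = (\<integral>e. Q.transfer (nat (- k)) f e * g e \<partial>Q.S)" by (rule Q.transfer_adjoint[OF f g])
  also have "\<dots> = (\<integral>e. Q.transfer (nat (- k)) f e * Q.transfer (nat k) g e \<partial>Q.S)"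
    using False by (simp add: Q.transfer_0)
  finally show ?thesis .
qed

lemma covariance_partial_means:
  assumes u: "u \<in> {0..1}" and x: "x \<in> Idx" and y: "y \<in> Idx"
  shows "covariance M (\<lambda>\<omega>. LBINT w:{0..fst x}. partial_mean M Xa h 0 u w (snd x) \<omega>)
      (\<lambda>\<omega>. LBINT w:{0..fst y}. partial_mean M Xa h k u w (snd y) \<omega>)
    = (\<integral>e. Q.transfer (nat (- k)) (obs u x) e * Q.transfer (nat k) (obs u y) e \<partial>Q.S) - (\<integral>e. obs u x e \<partial>Q.S) * (\<integral>e. obs u y e \<partial>Q.S)"
proof -
  have *: "AE \<omega> in M. (LBINT w:{0..fst x}. partial_mean M Xa h k u w (snd x) \<omega>)
      = obs u x (past \<epsilon> k \<omega>) - (LBINT w:{0..fst x}. kernel_mean k u (snd x) w)"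
    "(\<lambda>\<omega>. LBINT w:{0..fst x}. partial_mean M Xa h k u w (snd x) \<omega>) \<in> borel_measurable M"
    "(\<lambda>\<omega>. obs u x (past \<epsilon> k \<omega>)) \<in> borel_measurable M" "\<And>\<omega>. \<bar>obs u x (past \<epsilon> k \<omega>)\<bar> \<le> C\<^sub>h"
    "(\<integral>\<omega>. obs u x (past \<epsilon> k \<omega>) \<partial>M) = (\<integral>e. obs u x e \<partial>Q.S)"
    if x: "x \<in> Idx" for x k
  proof -
    have zr: "fst x \<in> {0..1}" "snd x \<in> {0..\<Lambda>}" using x by (auto simp: mem_Times_iff)
    show "AE \<omega> in M. (LBINT w:{0..fst x}. partial_mean M Xa h k u w (snd x) \<omega>)
      = obs u x (past \<epsilon> k \<omega>) - (LBINT w:{0..fst x}. kernel_mean k u (snd x) w)"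
      using representation[OF u, of k]
      by eventually_elim (simp add: integral_partial_mean[OF u zr] obs_def rep_def clip_eq[OF u])
    have "(\<lambda>\<omega>. cumulated_kernel (fst x) (snd x) (Xa k u \<omega>)) \<in> borel_measurable M"
      by (rule measurable_compose[OF Xa_measurable[OF u] cumulated_kernel_measurable[OF zr]])
    then show "(\<lambda>\<omega>. LBINT w:{0..fst x}. partial_mean M Xa h k u w (snd x) \<omega>) \<in> borel_measurable M"
      unfolding integral_partial_mean[OF u zr] by (intro borel_measurable_diff borel_measurable_const)
    show "(\<lambda>\<omega>. obs u x (past \<epsilon> k \<omega>)) \<in> borel_measurable M"
      by (rule measurable_compose[OF measurable_past Q.bounded_measurable_measurable[OF obs_bounded[OF x]]])
    show "\<bar>obs u x (past \<epsilon> k \<omega>)\<bar> \<le> C\<^sub>h" for \<omega> by (rule obs_abs_le[OF x])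
    show "(\<integral>\<omega>. obs u x (past \<epsilon> k \<omega>) \<partial>M) = (\<integral>e. obs u x e \<partial>Q.S)"
      by (rule integral_past[OF Q.bounded_measurable_measurable[OF obs_bounded[OF x]]])
  qed
  show ?thesis
    unfolding covariance_AE_shifted[OF *(1-4)[OF x] *(1-4)[OF y]] *(5)[OF x] *(5)[OF y]
      integral_lagged_product[OF obs_bounded[OF x] obs_bounded[OF y]] ..
qed

theorem long_run_cov_eq_innovation_cov_sum:
  assumes u: "u \<in> {0..1}" and x: "x \<in> Idx" and y: "y \<in> Idx"
    and abs: "(\<lambda>(i, l). Q.innovation_cov i (obs u x) l (obs u y)) absolutely_summable_on UNIV"
  shows "long_run_cov M Xa h u (fst x) (snd x) (fst y) (snd y) = innovation_cov_sum u x y"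
  unfolding long_run_cov_def innovation_cov_sum_def covariance_partial_means[OF u x y]
  by (rule infsum_antidiagonals[OF abs])
     (rule Q.covariance_telescope[OF obs_bounded[OF x] obs_bounded[OF y] obs_gap_tendsto[OF x]])

end

section \<open>Series of Wiener integrals\<close>

lemma sum_diagonal_less:
  fixes J :: "nat \<Rightarrow> real"
  shows "(\<Sum>l<m. \<Sum>l'<n. if l = l' then J l else 0) = (\<Sum>l<min m n. J l)"
proof -
  have "(\<Sum>l<m. \<Sum>l'<n. if l = l' then J l else 0) = (\<Sum>l\<in>{..<m}. if l \<in> {..<n} then J l else 0)"
    by (simp add: sum.delta)
  also have "\<dots> = (\<Sum>l\<in>{..<m} \<inter> {..<n}. J l)" by (rule sum.inter_restrict[symmetric]) simp
  also have "{..<m} \<inter> {..<n} = {..<min m n}" by auto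
  finally show ?thesis .
qed

lemma sum_abs_mult_le_squares:
  fixes a b :: "nat \<Rightarrow> real"
  assumes "(\<lambda>l. (a l)\<^sup>2) sums A" "(\<lambda>l. (b l)\<^sup>2) sums B" "A \<le> D" "B \<le> D"
  shows "\<bar>\<Sum>l<n. a l * b l\<bar> \<le> D"
proof -
  have "\<bar>\<Sum>l<n. a l * b l\<bar> \<le> (\<Sum>l<n. \<bar>a l * b l\<bar>)" by (rule sum_abs)
  also have "\<dots> \<le> (\<Sum>l<n. ((a l)\<^sup>2 + (b l)\<^sup>2) / 2)"
  proof (rule sum_mono)
    fix l
    have "0 \<le> (\<bar>a l\<bar> - \<bar>b l\<bar>)\<^sup>2" by simp
    then show "\<bar>a l * b l\<bar> \<le> ((a l)\<^sup>2 + (b l)\<^sup>2) / 2" by (simp add: power2_diff abs_mult)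
  qed
  also have "\<dots> = ((\<Sum>l<n. (a l)\<^sup>2) + (\<Sum>l<n. (b l)\<^sup>2)) / 2"
    by (simp add: sum.distrib sum_divide_distrib[symmetric])
  also have "\<dots> \<le> (A + B) / 2"
    using sum_le_suminf[of "\<lambda>l. (a l)\<^sup>2" "{..<n}"] sum_le_suminf[of "\<lambda>l. (b l)\<^sup>2" "{..<n}"] assms(1,2)
    by (simp add: sums_iff)
  also have "\<dots> \<le> D" using assms(3,4) by simp
  finally show ?thesis .
qed

text \<open>By the isometry, the inner product of the partial sums with \<open>m\<close> and \<open>n\<close> terms is the integral of the first
\<open>min m n\<close> terms of the series for \<open>\<sigma>\<close>. These integrals converge by dominated convergence, the bound being \<open>D\<close>, and
since they depend on \<open>min m n\<close> only, the partial sums are Cauchy.\<close>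

theorem wiener_series_representation:
  fixes g :: "nat \<Rightarrow> real \<Rightarrow> 'b \<Rightarrow> real"
  assumes gm: "\<And>l x. x \<in> A \<Longrightarrow> (\<lambda>\<eta>. g l \<eta> x) \<in> borel_measurable borel"
    and gC: "\<And>l \<eta> x. x \<in> A \<Longrightarrow> \<bar>g l \<eta> x\<bar> \<le> C"
    and sums: "\<And>\<eta> x y. x \<in> A \<Longrightarrow> y \<in> A \<Longrightarrow> (\<lambda>l. g l \<eta> x * g l \<eta> y) sums \<sigma> \<eta> x y"
    and D: "\<And>\<eta> x. x \<in> A \<Longrightarrow> \<sigma> \<eta> x x \<le> D"
  obtains B :: "nat \<Rightarrow> real \<Rightarrow> (nat \<times> nat \<Rightarrow> real) \<Rightarrow> real" and I S
  where "independent_brownian_motions white_noise {0..1} B"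
    and "\<And>l a x. a \<in> {0..1} \<Longrightarrow> x \<in> A \<Longrightarrow> has_wiener_integral white_noise (B l) (\<lambda>\<eta>. g l \<eta> x) 0 a (I l a x)"
    and "\<And>a x. a \<in> {0..1} \<Longrightarrow> x \<in> A \<Longrightarrow> L2_tendsto white_noise (\<lambda>n \<omega>. \<Sum>l<n. I l a x \<omega>) (S a x)"
    and "\<And>a x. a \<in> {0..1} \<Longrightarrow> x \<in> A \<Longrightarrow> S a x \<in> gaussian_space"
    and "\<And>a x a' x'. a \<in> {0..1} \<Longrightarrow> x \<in> A \<Longrightarrow> a' \<in> {0..1} \<Longrightarrow> x' \<in> A \<Longrightarrow>
      (\<integral>\<omega>. S a x \<omega> * S a' x' \<omega> \<partial>white_noise) = (LBINT \<eta>:{0..min a a'}. \<sigma> \<eta> x x')"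
proof -
  (* Otherwise the measurability prover takes functions of a real variable for functions on a sequence space. *)
  note measurable_white_noise_coordinate [measurable del]
  interpret N: prob_space "white_noise :: (nat \<times> nat \<Rightarrow> real) measure" by (rule prob_space_white_noise)
  obtain B :: "nat \<Rightarrow> real \<Rightarrow> (nat \<times> nat \<Rightarrow> real) \<Rightarrow> real" where B: "independent_brownian_motions white_noise {0..1} B"
    and Bg: "\<And>l t. t \<in> {0..1} \<Longrightarrow> B l t \<in> gaussian_space"
    and Bc: "\<And>l m s t. s \<in> {0..1} \<Longrightarrow> t \<in> {0..1} \<Longrightarrow> (\<integral>\<omega>. B l s \<omega> * B m t \<omega> \<partial>white_noise) = (if l = m then min s t else 0)"
    using independent_brownian_motions_exist by blast
  define I where "I l a x = (SOME Y. has_wiener_integral white_noise (B l) (\<lambda>\<eta>. g l \<eta> x) 0 a Y \<and> Y \<in> gaussian_space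
      \<and> wiener_approx (B l) (\<lambda>\<eta>. g l \<eta> x) a Y)" for l a x
  have I: "has_wiener_integral white_noise (B l) (\<lambda>\<eta>. g l \<eta> x) 0 a (I l a x)" "I l a x \<in> gaussian_space"
    "wiener_approx (B l) (\<lambda>\<eta>. g l \<eta> x) a (I l a x)" if "a \<in> {0..1}" "x \<in> A" for l a x
  proof -
    have "\<exists>Y. has_wiener_integral white_noise (B l) (\<lambda>\<eta>. g l \<eta> x) 0 a Y \<and> Y \<in> gaussian_space \<and> wiener_approx (B l) (\<lambda>\<eta>. g l \<eta> x) a Y"
      by (rule wiener_integral_exists[OF Bg _ gm[OF that(2)] gC[OF that(2)]]) (use that Bc in auto)
    from someI_ex[OF this] show "has_wiener_integral white_noise (B l) (\<lambda>\<eta>. g l \<eta> x) 0 a (I l a x)" "I l a x \<in> gaussian_space"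
      "wiener_approx (B l) (\<lambda>\<eta>. g l \<eta> x) a (I l a x)" by (simp_all add: I_def)
  qed
  define J where "J a x a' x' l = (\<integral>y. indicator {0<..min a a'} y * (g l y x * g l y x') \<partial>lborel)" for a x a' x' l
  have II: "(\<integral>\<omega>. I l a x \<omega> * I m a' x' \<omega> \<partial>white_noise) = (if l = m then J a x a' x' l else 0)"
    if "a \<in> {0..1}" "x \<in> A" "a' \<in> {0..1}" "x' \<in> A" for l m a x a' x'
  proof -
    have "(\<integral>\<omega>. I l a x \<omega> * I m a' x' \<omega> \<partial>white_noise) = (if l = m then 1 else 0) *
      (\<integral>y. (indicator {0<..a} y * g l y x) * (indicator {0<..a'} y * g m y x') \<partial>lborel)"
      by (rule wiener_integral_isometry[OF Bg Bg _ I(3)[OF that(1,2)] I(3)[OF that(3,4)]]) (use that Bc in auto)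
    also have "(\<lambda>y. (indicator {0<..a} y * g l y x) * (indicator {0<..a'} y * g m y x'))
        = (\<lambda>y. indicator {0<..min a a'} y * (g l y x * g m y x'))" by (auto simp: indicator_def fun_eq_iff)
    finally show ?thesis by (simp add: J_def)
  qed
  define Z where "Z a x n \<omega> = (\<Sum>l<n. I l a x \<omega>)" for a x n \<omega>
  have Zg: "Z a x n \<in> gaussian_space" if "a \<in> {0..1}" "x \<in> A" for a x n
    using linear_closure_sum[OF white_noise_coordinate(3) I(2)[OF that], where c="\<lambda>_. 1" and A="{..<n}"] by (simp add: Z_def[abs_def])
  have ZZ: "(\<integral>\<omega>. Z a x m \<omega> * Z a' x' n \<omega> \<partial>white_noise) = (\<Sum>l<min m n. J a x a' x' l)"
    if "a \<in> {0..1}" "x \<in> A" "a' \<in> {0..1}" "x' \<in> A" for a x a' x' m n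
  proof -
    have "(\<integral>\<omega>. Z a x m \<omega> * Z a' x' n \<omega> \<partial>white_noise) = (\<Sum>l<m. \<Sum>l'<n. (\<integral>\<omega>. I l a x \<omega> * I l' a' x' \<omega> \<partial>white_noise))"
      using integral_mult_sum[where c="\<lambda>_. 1" and d="\<lambda>_. 1" and A="{..<m}" and B="{..<n}" and f="\<lambda>l. I l a x" and g="\<lambda>l. I l a' x'",
          OF gaussian_space_sq[OF I(2)[OF that(1,2)]] gaussian_space_sq[OF I(2)[OF that(3,4)]]]
      by (simp add: Z_def)
    then show ?thesis by (simp only: II[OF that] sum_diagonal_less)
  qed
  have J_sums: "(\<lambda>n. \<Sum>l<n. J a x a' x' l) \<longlonglongrightarrow> (LBINT \<eta>:{0..min a a'}. \<sigma> \<eta> x x')"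
    if "a \<in> {0..1}" "x \<in> A" "a' \<in> {0..1}" "x' \<in> A" for a x a' x'
  proof -
    let ?i = "\<lambda>y. indicator {0<..min a a'} y :: real"
    have gmx[measurable]: "(\<lambda>y. g l y x) \<in> borel_measurable borel" "(\<lambda>y. g l y x') \<in> borel_measurable borel" for l using gm that by auto
    have \<sigma>m[measurable]: "(\<lambda>y. \<sigma> y x x') \<in> borel_measurable borel"
      by (rule borel_measurable_LIMSEQ_real[where u="\<lambda>n y. \<Sum>l<n. g l y x * g l y x'"])
         (use sums[OF that(2,4)] in \<open>simp_all add: sums_def\<close>)
    have int: "integrable lborel (\<lambda>y. ?i y * (g l y x * g l y x'))" for l
    proof (rule Bochner_Integration.integrable_bound)
      show "integrable lborel (\<lambda>y. ?i y * (C * C))"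
        by (intro integrable_mult_left integrable_real_indicator) (use that in auto)
      have "\<bar>g l y x * g l y x'\<bar> \<le> C * C" for y
        unfolding abs_mult using gC that order_trans[OF abs_ge_zero gC[OF that(2)]] by (intro mult_mono) auto
      then show "AE y in lborel. norm (?i y * (g l y x * g l y x')) \<le> norm (?i y * (C * C))"
        by (intro AE_I2) (auto simp: indicator_def)
    qed measurable
    have "(\<lambda>n. \<integral>y. ?i y * (\<Sum>l<n. g l y x * g l y x') \<partial>lborel) \<longlonglongrightarrow> (\<integral>y. ?i y * \<sigma> y x x' \<partial>lborel)"
    proof (rule integral_dominated_convergence[where w="\<lambda>y. ?i y * D"])
      show "integrable lborel (\<lambda>y. ?i y * D)"
        by (intro integrable_mult_left integrable_real_indicator) (use that in auto)
      show "AE y in lborel. (\<lambda>n. ?i y * (\<Sum>l<n. g l y x * g l y x')) \<longlonglongrightarrow> ?i y * \<sigma> y x x'"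
        using sums[OF that(2,4)] by (intro AE_I2 tendsto_mult_left) (simp add: sums_def)
      show "AE y in lborel. norm (?i y * (\<Sum>l<n. g l y x * g l y x')) \<le> ?i y * D" for n
      proof (rule AE_I2)
        show "norm (?i y * (\<Sum>l<n. g l y x * g l y x')) \<le> ?i y * D" for y
          using sum_abs_mult_le_squares[OF sums[OF that(2,2), unfolded power2_eq_square[symmetric]]
              sums[OF that(4,4), unfolded power2_eq_square[symmetric]] D[OF that(2)] D[OF that(4)], of y y n]
          by (auto simp: indicator_def)
      qed
    qed measurable
    also have "(\<lambda>n. \<integral>y. ?i y * (\<Sum>l<n. g l y x * g l y x') \<partial>lborel) = (\<lambda>n. \<Sum>l<n. J a x a' x' l)"
      unfolding J_def sum_distrib_left by (intro ext Bochner_Integration.integral_sum int)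
    also have "(\<integral>y. ?i y * \<sigma> y x x' \<partial>lborel) = (LBINT \<eta>:{0..min a a'}. \<sigma> \<eta> x x')"
      unfolding set_lebesgue_integral_def
    proof (rule integral_cong_AE)
      have "AE y in lborel. y \<noteq> (0::real)" by (rule AE_lborel_singleton)
      then show "AE y in lborel. ?i y * \<sigma> y x x' = indicator {0..min a a'} y *\<^sub>R \<sigma> y x x'"
        by eventually_elim (auto simp: indicator_def)
    qed measurable
    finally show ?thesis .
  qed
  define S where "S a x = (SOME Y. L2_tendsto white_noise (Z a x) Y)" for a x
  have S: "L2_tendsto white_noise (Z a x) (S a x)" if "a \<in> {0..1}" "x \<in> A" for a x
  proof -
    let ?s = "\<lambda>n. \<Sum>l<n. J a x a x l"
    have "\<exists>Y. L2_tendsto white_noise (Z a x) Y"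
    proof (rule N.L2_Cauchy_converges)
      show sq: "sq_integrable white_noise (Z a x n)" for n by (rule gaussian_space_sq[OF Zg[OF that]])
      fix e :: real assume "e > 0"
      have "Cauchy ?s" using J_sums[OF that that] by (rule LIMSEQ_imp_Cauchy)
      then obtain K where K: "\<And>m n. m \<ge> K \<Longrightarrow> n \<ge> K \<Longrightarrow> \<bar>?s m - ?s n\<bar> < e / 2"
        using \<open>e > 0\<close> unfolding Cauchy_def dist_real_def by (meson half_gt_zero)
      show "\<exists>K. \<forall>m\<ge>K. \<forall>n\<ge>K. (\<integral>\<omega>. (Z a x m \<omega> - Z a x n \<omega>)\<^sup>2 \<partial>white_noise) \<le> e"
      proof (intro exI[of _ K] allI impI)
        fix m n assume mn: "K \<le> m" "K \<le> n"
        have "(\<integral>\<omega>. (Z a x m \<omega> - Z a x n \<omega>)\<^sup>2 \<partial>white_noise)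
          = (\<integral>\<omega>. Z a x m \<omega> * Z a x m \<omega> - 2 * (Z a x m \<omega> * Z a x n \<omega>) + Z a x n \<omega> * Z a x n \<omega> \<partial>white_noise)"
          by (simp add: power2_eq_square algebra_simps)
        also have "\<dots> = ?s m - 2 * ?s (min m n) + ?s n"
          using sq_integrable_mult[OF sq[of m] sq[of m]] sq_integrable_mult[OF sq[of m] sq[of n]] sq_integrable_mult[OF sq[of n] sq[of n]]
          by (simp add: ZZ[OF that that])
        also have "\<dots> \<le> e"
        proof -
          have "min m n \<ge> K" using mn by simp
          then show ?thesis using K[OF mn(1), of "min m n"] K[OF mn(2), of "min m n"] by linarith
        qed
        finally show "(\<integral>\<omega>. (Z a x m \<omega> - Z a x n \<omega>)\<^sup>2 \<partial>white_noise) \<le> e" .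
      qed
    qed
    then show ?thesis unfolding S_def by (rule someI_ex)
  qed
  show thesis
  proof (rule that[of B I S])
    show "independent_brownian_motions white_noise {0..1} B" by fact
    fix a :: real and x assume ax: "a \<in> {0..1}" "x \<in> A"
    show "has_wiener_integral white_noise (B l) (\<lambda>\<eta>. g l \<eta> x) 0 a (I l a x)" for l by (rule I(1)[OF ax])
    show "L2_tendsto white_noise (\<lambda>n \<omega>. \<Sum>l<n. I l a x \<omega>) (S a x)" using S[OF ax] by (simp add: Z_def[abs_def])
    show "S a x \<in> gaussian_space" by (rule linear_closure_limit[OF white_noise_coordinate(3) S[OF ax] Zg[OF ax]])
    fix a' :: real and x' assume ax': "a' \<in> {0..1}" "x' \<in> A"
    have "(\<lambda>n. \<integral>\<omega>. Z a x n \<omega> * Z a' x' n \<omega> \<partial>white_noise) \<longlonglongrightarrow> (\<integral>\<omega>. S a x \<omega> * S a' x' \<omega> \<partial>white_noise)"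
      by (rule L2_tendsto_inner[OF S[OF ax] S[OF ax'] gaussian_space_sq[OF Zg[OF ax]] gaussian_space_sq[OF Zg[OF ax']]])
    then have "(\<lambda>n. \<Sum>l<n. J a x a' x' l) \<longlonglongrightarrow> (\<integral>\<omega>. S a x \<omega> * S a' x' \<omega> \<partial>white_noise)"
      by (simp add: ZZ[OF ax ax'])
    then show "(\<integral>\<omega>. S a x \<omega> * S a' x' \<omega> \<partial>white_noise) = (LBINT \<eta>:{0..min a a'}. \<sigma> \<eta> x x')"
      by (rule LIMSEQ_unique[OF _ J_sums[OF ax ax']])
  qed
qed

section \<open>Representation of the limit process\<close>

text \<open>Linear combinations on both sides are centered Gaussian variables with equal variances.\<close>

theorem gaussian_process_law_eq:
  assumes "prob_space P" and G: "zero_mean_gaussian_process P I G K"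
    and Z: "\<And>i. i \<in> I \<Longrightarrow> Z i \<in> (gaussian_space :: (('a \<Rightarrow> real) \<Rightarrow> real) set)"
    and cov: "\<And>i j. i \<in> I \<Longrightarrow> j \<in> I \<Longrightarrow> (\<integral>\<omega>. Z i \<omega> * Z j \<omega> \<partial>white_noise) = K i j"
  shows "process_law P I borel G = process_law white_noise I borel Z"
  unfolding process_law_def
proof (rule Cramer_Wold)
  interpret P: prob_space P by fact
  have rv: "gaussian_rv P (\<lambda>\<omega>. \<Sum>i\<in>J. c i * G i \<omega>)" if "finite J" "J \<subseteq> I" for J c
    using G that by (auto simp: zero_mean_gaussian_process_def)
  have mean: "P.expectation (G i) = 0" if "i \<in> I" for i
    using G that by (auto simp: zero_mean_gaussian_process_def)
  have "centered_gaussian P (G i)" if "i \<in> I" for i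
    using rv[of "{i}" "\<lambda>_. 1"] that mean by (intro P.centered_gaussian_of_gaussian_rv) simp_all
  then have Gsq: "sq_integrable P (G i)" if "i \<in> I" for i using that by (simp add: centered_gaussian_def)
  show "prob_space P" "prob_space (white_noise :: ('a \<Rightarrow> real) measure)" by (fact, rule prob_space_white_noise)
  show "G i \<in> borel_measurable P" if "i \<in> I" for i using Gsq[OF that] by (rule sq_integrable_measurable)
  show "Z i \<in> borel_measurable white_noise" if "i \<in> I" for i
    by (rule sq_integrable_measurable[OF gaussian_space_sq[OF Z[OF that]]])
  fix J c assume J: "finite J" "J \<subseteq> I"
  have GK: "(\<integral>\<omega>. G i \<omega> * G j \<omega> \<partial>P) = K i j" if "i \<in> I" "j \<in> I" for i j
  proof -
    have "covariance P (G i) (G j) = K i j" using G that by (auto simp: zero_mean_gaussian_process_def)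
    then show ?thesis using mean that by (simp add: covariance_def)
  qed
  have "P.expectation (\<lambda>\<omega>. \<Sum>j\<in>J. c j * G j \<omega>) = 0"
    using J mean P.sq_integrable_integrable[OF Gsq]
    by (subst Bochner_Integration.integral_sum) (auto intro!: sum.neutral)
  then have gG: "centered_gaussian P (\<lambda>\<omega>. \<Sum>j\<in>J. c j * G j \<omega>)"
    by (rule P.centered_gaussian_of_gaussian_rv[OF rv[OF J]])
  have gZ: "centered_gaussian white_noise (\<lambda>\<omega>. \<Sum>j\<in>J. c j * Z j \<omega>)"
    using J Z by (intro gaussian_space_centered_gaussian linear_closure_sum[OF white_noise_coordinate(3)]) auto
  have "(\<integral>\<omega>. (\<Sum>j\<in>J. c j * G j \<omega>)\<^sup>2 \<partial>P) = (\<Sum>i\<in>J. \<Sum>j\<in>J. c i * c j * K i j)"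
    using J by (subst integral_sq_sum) (auto intro!: sum.cong Gsq simp: GK subset_iff)
  moreover have "(\<integral>\<omega>. (\<Sum>j\<in>J. c j * Z j \<omega>)\<^sup>2 \<partial>white_noise) = (\<Sum>i\<in>J. \<Sum>j\<in>J. c i * c j * K i j)"
    using J by (subst integral_sq_sum) (auto intro!: sum.cong gaussian_space_sq Z simp: cov subset_iff)
  ultimately show "char (distr P borel (\<lambda>x. \<Sum>j\<in>J. c j * G j x)) 1 = char (distr white_noise borel (\<lambda>x. \<Sum>j\<in>J. c j * Z j x)) 1"
    using gG gZ by (simp add: centered_gaussian_def)
qed

lemma integral_add_mult_add:
  assumes "sq_integrable M a" "sq_integrable M b" "sq_integrable M c" "sq_integrable M d"
  shows "(\<integral>x. (a x + b x) * (c x + d x) \<partial>M)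
    = (\<integral>x. a x * c x \<partial>M) + (\<integral>x. a x * d x \<partial>M) + (\<integral>x. b x * c x \<partial>M) + (\<integral>x. b x * d x \<partial>M)"
  using sq_integrable_mult[OF assms(1,3)] sq_integrable_mult[OF assms(1,4)]
    sq_integrable_mult[OF assms(2,3)] sq_integrable_mult[OF assms(2,4)]
  by (simp add: distrib_left distrib_right)

context auxiliary_process
begin

theorem limit_process_representation:
  assumes P: "prob_space P"
    and G: "zero_mean_gaussian_process P ({0..1} \<times> {0..1} \<times> {0..\<Lambda>}) G (limit_cov M Xa h)"
  obtains g and B :: "nat \<Rightarrow> real \<Rightarrow> (nat \<times> nat \<Rightarrow> real) \<Rightarrow> real" and I S
  where "\<And>\<eta> x y. \<eta> \<in> {0..1} \<Longrightarrow> x \<in> Idx \<Longrightarrow> y \<in> Idx \<Longrightarrow>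
      (\<lambda>l. g l \<eta> x * g l \<eta> y) sums long_run_cov M Xa h \<eta> (fst x) (snd x) (fst y) (snd y)"
    and "independent_brownian_motions white_noise {0..1} B"
    and "\<And>l a x. a \<in> {0..1} \<Longrightarrow> x \<in> Idx \<Longrightarrow> has_wiener_integral white_noise (B l) (\<lambda>\<eta>. g l \<eta> x) 0 a (I l a x)"
    and "\<And>a x. a \<in> {0..1} \<Longrightarrow> x \<in> Idx \<Longrightarrow> L2_tendsto white_noise (\<lambda>n \<omega>. \<Sum>l<n. I l a x \<omega>) (S a x)"
    and "process_law P ({0..1} \<times> {0..1} \<times> {0..\<Lambda>}) borel G
      = process_law white_noise ({0..1} \<times> {0..1} \<times> {0..\<Lambda>}) borel (\<lambda>(u, v, r) \<omega>. S u (v, r) \<omega> + S v (u, r) \<omega>)"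
proof -
  obtain g where gm: "\<And>q x. x \<in> Idx \<Longrightarrow> (\<lambda>u. g q u x) \<in> borel_measurable borel"
    and gC: "\<And>q u x. x \<in> Idx \<Longrightarrow> \<bar>g q u x\<bar> \<le> nu_total"
    and gs: "\<And>u x y. x \<in> Idx \<Longrightarrow> y \<in> Idx \<Longrightarrow> (\<lambda>q. g q u x * g q u y) sums innovation_cov_sum u x y"
    and abs: "\<And>u x y. x \<in> Idx \<Longrightarrow> y \<in> Idx \<Longrightarrow>
      (\<lambda>(i, l). Q.innovation_cov i (obs u x) l (obs u y)) absolutely_summable_on UNIV"
    by (rule innovation_factorization) (rule that)
  have D: "innovation_cov_sum u x x \<le> nu_total\<^sup>2" if "x \<in> Idx" for u x
    by (rule innovation_cov_sum_le[OF that abs[OF that that]])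
  note long_run = long_run_cov_eq_innovation_cov_sum[OF _ _ _ abs]
  obtain B :: "nat \<Rightarrow> real \<Rightarrow> (nat \<times> nat \<Rightarrow> real) \<Rightarrow> real" and I S
    where B: "independent_brownian_motions white_noise {0..1} B"
    and I: "\<And>l a x. a \<in> {0..1} \<Longrightarrow> x \<in> Idx \<Longrightarrow> has_wiener_integral white_noise (B l) (\<lambda>\<eta>. g l \<eta> x) 0 a (I l a x)"
    and S: "\<And>a x. a \<in> {0..1} \<Longrightarrow> x \<in> Idx \<Longrightarrow> L2_tendsto white_noise (\<lambda>n \<omega>. \<Sum>l<n. I l a x \<omega>) (S a x)"
    and Sg: "\<And>a x. a \<in> {0..1} \<Longrightarrow> x \<in> Idx \<Longrightarrow> S a x \<in> gaussian_space"
    and SS: "\<And>a x a' x'. a \<in> {0..1} \<Longrightarrow> x \<in> Idx \<Longrightarrow> a' \<in> {0..1} \<Longrightarrow> x' \<in> Idx \<Longrightarrow>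
      (\<integral>\<omega>. S a x \<omega> * S a' x' \<omega> \<partial>white_noise) = (LBINT \<eta>:{0..min a a'}. innovation_cov_sum \<eta> x x')"
    by (rule wiener_series_representation[where A=Idx and g=g and \<sigma>=innovation_cov_sum, OF gm gC gs D]) (assumption | rule that)+
  have SS': "(\<integral>\<omega>. S a (b, r) \<omega> * S a' (b', r') \<omega> \<partial>white_noise) = (LBINT \<eta>:{0..min a a'}. long_run_cov M Xa h \<eta> b r b' r')"
    if "a \<in> {0..1}" "b \<in> {0..1}" "r \<in> {0..\<Lambda>}" "a' \<in> {0..1}" "b' \<in> {0..1}" "r' \<in> {0..\<Lambda>}" for a b r a' b' r'
  proof -
    have x: "(b, r) \<in> Idx" "(b', r') \<in> Idx" using that by auto
    show ?thesis unfolding SS[OF that(1) x(1) that(4) x(2)]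
    proof (rule set_lebesgue_integral_cong)
      show "\<forall>\<eta>. \<eta> \<in> {0..min a a'} \<longrightarrow> innovation_cov_sum \<eta> (b, r) (b', r') = long_run_cov M Xa h \<eta> b r b' r'"
      proof (intro allI impI)
        fix \<eta> assume "\<eta> \<in> {0..min a a'}"
        then have "\<eta> \<in> {0..1}" using that(1) by auto
        from long_run[OF this x x] show "innovation_cov_sum \<eta> (b, r) (b', r') = long_run_cov M Xa h \<eta> b r b' r'" by simp
      qed
    qed simp
  qed
  show thesis
  proof (rule that[of g B I S])
    show "(\<lambda>l. g l \<eta> x * g l \<eta> y) sums long_run_cov M Xa h \<eta> (fst x) (snd x) (fst y) (snd y)"
      if "\<eta> \<in> {0..1}" "x \<in> Idx" "y \<in> Idx" for \<eta> x y
      unfolding long_run[OF that that(2,3)] by (rule gs[OF that(2,3)])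
    show "process_law P ({0..1} \<times> {0..1} \<times> {0..\<Lambda>}) borel G
      = process_law white_noise ({0..1} \<times> {0..1} \<times> {0..\<Lambda>}) borel (\<lambda>(u, v, r) \<omega>. S u (v, r) \<omega> + S v (u, r) \<omega>)"
    proof (rule gaussian_process_law_eq[OF P G])
      fix i :: "real \<times> real \<times> real" assume "i \<in> {0..1} \<times> {0..1} \<times> {0..\<Lambda>}"
      then obtain u v r where i: "i = (u, v, r)" "u \<in> {0..1}" "v \<in> {0..1}" "r \<in> {0..\<Lambda>}" by (elim SigmaE) simp
      have 1: "S u (v, r) \<in> gaussian_space" "S v (u, r) \<in> gaussian_space" using i(2-4) by (auto intro!: Sg)
      then show "(case i of (u, v, r) \<Rightarrow> \<lambda>\<omega>. S u (v, r) \<omega> + S v (u, r) \<omega>) \<in> gaussian_space"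
        unfolding i prod.case by (rule linear_closure_add[OF white_noise_coordinate(3)])
      fix j :: "real \<times> real \<times> real" assume "j \<in> {0..1} \<times> {0..1} \<times> {0..\<Lambda>}"
      then obtain u' v' r' where j: "j = (u', v', r')" "u' \<in> {0..1}" "v' \<in> {0..1}" "r' \<in> {0..\<Lambda>}" by (elim SigmaE) simp
      have 2: "S u' (v', r') \<in> gaussian_space" "S v' (u', r') \<in> gaussian_space" using j(2-4) by (auto intro!: Sg)
      show "(\<integral>\<omega>. (case i of (u, v, r) \<Rightarrow> \<lambda>\<omega>. S u (v, r) \<omega> + S v (u, r) \<omega>) \<omega> *
          (case j of (u, v, r) \<Rightarrow> \<lambda>\<omega>. S u (v, r) \<omega> + S v (u, r) \<omega>) \<omega> \<partial>white_noise) = limit_cov M Xa h i j"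
        unfolding i(1) j(1) prod.case limit_cov_def
          integral_add_mult_add[OF 1[THEN gaussian_space_sq] 2[THEN gaussian_space_sq]]
        using i(2-4) j(2-4) by (simp only: SS')
    qed
  qed (fact B I S)+
qed

end

theorem proposition3p17:
  fixes M :: "'w measure" and E :: "'g measure" and P :: "'p measure"
    and \<epsilon> \<epsilon>' :: "int \<Rightarrow> 'w \<Rightarrow> 'g"
    and F :: "int \<Rightarrow> nat \<Rightarrow> (nat \<Rightarrow> 'g) \<Rightarrow> 's::polish_space"
    and Fa :: "real \<Rightarrow> (nat \<Rightarrow> 'g) \<Rightarrow> 's"
    and X :: "int \<Rightarrow> nat \<Rightarrow> 'w \<Rightarrow> 's"
    and Xa :: "int \<Rightarrow> real \<Rightarrow> 'w \<Rightarrow> 's"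
    and h :: "'s \<Rightarrow> 's \<Rightarrow> real \<Rightarrow> real"
    and L\<^sub>1 :: real and L\<^sub>2 :: "'s \<Rightarrow> 's \<Rightarrow> real"
    and \<Lambda> :: real
    and G :: "real \<times> real \<times> real \<Rightarrow> 'p \<Rightarrow> real"
  assumes "\<Lambda> > 0"
    and "prob_space M"
    and "iid_sequence M E \<epsilon>"
    and "independent_copy M E \<epsilon> \<epsilon>'"
    and "locally_stationary M X Xa"
    and "has_representations M E \<epsilon> F Fa X Xa"
    and "(\<lambda>m. delta0_array M \<epsilon> \<epsilon>' F X m) \<longlonglongrightarrow> 0"
    and "(\<lambda>m. delta0_aux M \<epsilon> \<epsilon>' Fa Xa m) \<longlonglongrightarrow> 0"
    and summable_nu_array: "(SUP T\<in>{1..}. SUP r\<in>{0..\<Lambda>}. SUP k. \<Sum>j. SUP t\<in>{1..int T}.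
            nu_array M E \<epsilon> \<epsilon>' F h t k T j r) < \<infinity>"
    and summable_nu_aux: "(SUP u\<in>{0..1}. SUP v\<in>{0..1}. SUP r\<in>{0..\<Lambda>}. SUP k. \<Sum>j. SUP t.
            nu_aux M E \<epsilon> \<epsilon>' Fa h t k u v j r) < \<infinity>"
    and weighted_summable: "\<exists>e>0. \<forall>r\<in>{0..\<Lambda>}. (SUP T\<in>{1..}. SUP k. \<Sum>j. of_nat j * (SUP t\<in>{1..int T}.
            ennreal (Lp_norm M (6 + e) (projection M E \<epsilon> (t - int j)
              (demeaned M h (X t T) (X (t - int k) T) r))))) < \<infinity>"
    and h_nonneg: "\<And>x y r. r \<in> {0..\<Lambda>} \<Longrightarrow> 0 \<le> h x y r"
    and h_bounded: "\<exists>C. \<forall>x y. \<forall>r\<in>{0..\<Lambda>}. h x y r \<le> C"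
    and h_symmetric: "\<And>x y r. r \<in> {0..\<Lambda>} \<Longrightarrow> h x y r = h y x r"
    and h_monotone: "(\<forall>x y. mono_on {0..\<Lambda>} (h x y)) \<or> (\<forall>x y. antimono_on {0..\<Lambda>} (h x y))"
    and h_lipschitz: "\<And>x x' y r. r \<in> {0..\<Lambda>} \<Longrightarrow> \<bar>h x y r - h x' y r\<bar> \<le> L\<^sub>1 * dist x x'"
    and h_lipschitz_third: "\<And>x y r r'. r \<in> {0..\<Lambda>} \<Longrightarrow> r' \<in> {0..\<Lambda>} \<Longrightarrow> \<bar>h x y r - h x y r'\<bar> \<le> L\<^sub>2 x y * \<bar>r - r'\<bar>"
    and L2_measurable: "(\<lambda>(x, y). L\<^sub>2 x y) \<in> borel_measurable (borel \<Otimes>\<^sub>M borel)"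
    and L2_moment_array: "(SUP T\<in>{1..}. SUP t\<in>{1..int T}. SUP s\<in>{1..int T}.
            \<integral>\<^sup>+\<omega>. ennreal ((L\<^sub>2 (X t T \<omega>) (X s T \<omega>))\<^sup>2) \<partial>M) < \<infinity>"
    and L2_moment_aux: "(SUP u\<in>{0..1}. SUP v\<in>{0..1}. SUP t. SUP s.
            \<integral>\<^sup>+\<omega>. ennreal ((L\<^sub>2 (Xa t u \<omega>) (Xa s v \<omega>))\<^sup>2) \<partial>M) < \<infinity>"
    and "prob_space P"
    and "zero_mean_gaussian_process P ({0..1} \<times> {0..1} \<times> {0..\<Lambda>}) G (limit_cov M Xa h)"
  shows "\<exists>(g :: nat \<Rightarrow> real \<Rightarrow> real \<Rightarrow> real \<Rightarrow> real)
      (N :: (nat \<times> nat \<Rightarrow> real) measure)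
      (B :: nat \<Rightarrow> real \<Rightarrow> (nat \<times> nat \<Rightarrow> real) \<Rightarrow> real)
      (I :: nat \<Rightarrow> real \<Rightarrow> real \<Rightarrow> real \<Rightarrow> (nat \<times> nat \<Rightarrow> real) \<Rightarrow> real)
      (S :: real \<Rightarrow> real \<Rightarrow> real \<Rightarrow> (nat \<times> nat \<Rightarrow> real) \<Rightarrow> real).
    (\<forall>\<eta>\<in>{0..1}. \<forall>u\<^sub>1\<in>{0..1}. \<forall>u\<^sub>2\<in>{0..1}. \<forall>r\<^sub>1\<in>{0..\<Lambda>}. \<forall>r\<^sub>2\<in>{0..\<Lambda>}.
        (\<lambda>l. g l \<eta> u\<^sub>1 r\<^sub>1 * g l \<eta> u\<^sub>2 r\<^sub>2) sums long_run_cov M Xa h \<eta> u\<^sub>1 r\<^sub>1 u\<^sub>2 r\<^sub>2) \<and>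
    prob_space N \<and>
    independent_brownian_motions N {0..1} B \<and>
    \<comment> \<open>\<open>I l a b r = \<integral>\<^sub>0\<^sup>a g l \<eta> b r dB l \<eta>\<close> and \<open>S a b r = \<Sum>l. I l a b r\<close>\<close>
    (\<forall>l. \<forall>a\<in>{0..1}. \<forall>b\<in>{0..1}. \<forall>r\<in>{0..\<Lambda>}.
        has_wiener_integral N (B l) (\<lambda>\<eta>. g l \<eta> b r) 0 a (I l a b r)) \<and>
    (\<forall>a\<in>{0..1}. \<forall>b\<in>{0..1}. \<forall>r\<in>{0..\<Lambda>}.
        L2_tendsto N (\<lambda>n \<omega>. \<Sum>l<n. I l a b r \<omega>) (S a b r)) \<and>
    process_law P ({0..1} \<times> {0..1} \<times> {0..\<Lambda>}) borel G
      = process_law N ({0..1} \<times> {0..1} \<times> {0..\<Lambda>}) borel (\<lambda>(u, v, r) \<omega>. S u v r \<omega> + S v u r \<omega>)"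
proof -
  obtain C where C: "\<And>x y r. r \<in> {0..\<Lambda>} \<Longrightarrow> h x y r \<le> C" using h_bounded by blast
  have Xa: "Xa t u \<in> borel_measurable M" if "u \<in> {0..1}" for t u
    using \<open>locally_stationary M X Xa\<close> that by (simp add: locally_stationary_def)
  obtain C\<^sub>u where C\<^sub>u: "\<And>u v. u \<in> {0..1} \<Longrightarrow> v \<in> {0..1} \<Longrightarrow>
      (\<integral>\<omega>. min (dist (Xa 1 u \<omega>) (Xa 1 v \<omega>)) 1 \<partial>M) \<le> C\<^sub>u * \<bar>u - v\<bar>"
  proof -
    have "\<exists>C. \<forall>t\<ge>1. \<forall>u\<in>{0..1}. \<forall>v\<in>{0..1}. (\<integral>\<omega>. min (dist (Xa t u \<omega>) (Xa t v \<omega>)) 1 \<partial>M) \<le> C * \<bar>u - v\<bar>"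
      using \<open>locally_stationary M X Xa\<close> unfolding locally_stationary_def by (elim conjE)
    then obtain C where "\<forall>t\<ge>1. \<forall>u\<in>{0..1}. \<forall>v\<in>{0..1}. (\<integral>\<omega>. min (dist (Xa t u \<omega>) (Xa t v \<omega>)) 1 \<partial>M) \<le> C * \<bar>u - v\<bar>" ..
    then show thesis by (intro that[of C]) simp
  qed
  have Fa: "(\<lambda>(u, x). Fa u x) \<in> borel_measurable (restrict_space borel {0..1} \<Otimes>\<^sub>M (\<Pi>\<^sub>M i\<in>UNIV. E))"
    and Xa_Fa: "\<And>t u. u \<in> {0..1} \<Longrightarrow> AE \<omega> in M. Xa t u \<omega> = Fa u (past \<epsilon> t \<omega>)"
    using \<open>has_representations M E \<epsilon> F Fa X Xa\<close> unfolding has_representations_def by blast+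
  interpret prob_space M by fact
  interpret auxiliary_process M E \<epsilon> \<epsilon>' Fa Xa h \<Lambda> L\<^sub>1 C C\<^sub>u L\<^sub>2
    using \<open>\<Lambda> > 0\<close> \<open>iid_sequence M E \<epsilon>\<close> \<open>independent_copy M E \<epsilon> \<epsilon>'\<close> \<open>delta0_aux M \<epsilon> \<epsilon>' Fa Xa \<longlonglongrightarrow> 0\<close>
    by unfold_locales
      (assumption | rule Fa Xa Xa_Fa C C\<^sub>u summable_nu_aux h_nonneg h_symmetric h_lipschitz h_lipschitz_third | simp)+
  obtain g and B :: "nat \<Rightarrow> real \<Rightarrow> (nat \<times> nat \<Rightarrow> real) \<Rightarrow> real" and I S
    where g: "\<And>\<eta> x y. \<eta> \<in> {0..1} \<Longrightarrow> x \<in> Idx \<Longrightarrow> y \<in> Idx \<Longrightarrow>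
      (\<lambda>l. g l \<eta> x * g l \<eta> y) sums long_run_cov M Xa h \<eta> (fst x) (snd x) (fst y) (snd y)"
    and B: "independent_brownian_motions white_noise {0..1} B"
    and I: "\<And>l a x. a \<in> {0..1} \<Longrightarrow> x \<in> Idx \<Longrightarrow> has_wiener_integral white_noise (B l) (\<lambda>\<eta>. g l \<eta> x) 0 a (I l a x)"
    and S: "\<And>a x. a \<in> {0..1} \<Longrightarrow> x \<in> Idx \<Longrightarrow> L2_tendsto white_noise (\<lambda>n \<omega>. \<Sum>l<n. I l a x \<omega>) (S a x)"
    and law: "process_law P ({0..1} \<times> {0..1} \<times> {0..\<Lambda>}) borel G
      = process_law white_noise ({0..1} \<times> {0..1} \<times> {0..\<Lambda>}) borel (\<lambda>(u, v, r) \<omega>. S u (v, r) \<omega> + S v (u, r) \<omega>)"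
    using limit_process_representation[OF \<open>prob_space P\<close> \<open>zero_mean_gaussian_process P _ G _\<close>] by blast
  show ?thesis
  proof (rule exI[of _ "\<lambda>l \<eta> u r. g l \<eta> (u, r)"], rule exI[of _ white_noise], rule exI[of _ B],
      rule exI[of _ "\<lambda>l a b r. I l a (b, r)"], rule exI[of _ "\<lambda>a b r. S a (b, r)"], intro conjI ballI allI)
    show "(\<lambda>l. g l \<eta> (u\<^sub>1, r\<^sub>1) * g l \<eta> (u\<^sub>2, r\<^sub>2)) sums long_run_cov M Xa h \<eta> u\<^sub>1 r\<^sub>1 u\<^sub>2 r\<^sub>2"
      if "\<eta> \<in> {0..1}" "u\<^sub>1 \<in> {0..1}" "u\<^sub>2 \<in> {0..1}" "r\<^sub>1 \<in> {0..\<Lambda>}" "r\<^sub>2 \<in> {0..\<Lambda>}" for \<eta> u\<^sub>1 u\<^sub>2 r\<^sub>1 r\<^sub>2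
      using g[of \<eta> "(u\<^sub>1, r\<^sub>1)" "(u\<^sub>2, r\<^sub>2)"] that by simp
    show "prob_space white_noise" by (rule prob_space_white_noise)
    show "independent_brownian_motions white_noise {0..1} B" by (rule B)
    show "has_wiener_integral white_noise (B l) (\<lambda>\<eta>. g l \<eta> (b, r)) 0 a (I l a (b, r))"
      if "a \<in> {0..1}" "b \<in> {0..1}" "r \<in> {0..\<Lambda>}" for l a b r
      using I[of a "(b, r)" l] that by simp
    show "L2_tendsto white_noise (\<lambda>n \<omega>. \<Sum>l<n. I l a (b, r) \<omega>) (S a (b, r))"
      if "a \<in> {0..1}" "b \<in> {0..1}" "r \<in> {0..\<Lambda>}" for a b r
      using S[of a "(b, r)"] that by simp
    show "process_law P ({0..1} \<times> {0..1} \<times> {0..\<Lambda>}) borel G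
      = process_law white_noise ({0..1} \<times> {0..1} \<times> {0..\<Lambda>}) borel (\<lambda>(u, v, r) \<omega>. S u (v, r) \<omega> + S v (u, r) \<omega>)"
      by (rule law)
  qed
qed

end
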